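(* Let $f:[0,1]\to[0,\infty)$ be continuous and non-decreasing with $f(u)>0$ for $u\in(0,1]$, let $0<\delta<\alpha<1$, and fix a positive integer $r$. For $n$ with $k=\delta n$ and $m=\alpha n$ integers, let $w_i=f(i/n)$, let $\mathbf{A}\in\mathbb{R}^{m\times n}$ have i.i.d. $N(0,1)$ entries, and let $\mathbf{x}\in\mathbb{R}^n$ be any vector with $x_i>0$ for $i\le k$ and $x_i=0$ for $i>k$ (i.e. $\mathbf{x}/\|\mathbf{x}\|_{\mathbf{w},1}$ lies in the relative interior of the face $F_0^k$ of the weighted cross-polytope with vertices $\frac1{w_1}e_1,\dots,\frac1{w_k}e_k$). Let $\mathbf{P}(E\mid \mathbf{x}\in F_0^k)$ be the probability over $\mathbf{A}$ that $\mathbf{x}$ is not the unique solution of $\min\{\sum_i w_i|z_i|:\mathbf{A}\mathbf{z}=\mathbf{A}\mathbf{x}\}$. With $\bar\psi_{tot}(\delta)$ as defined in the context, for every $\epsilon>0$ there is $n(\epsilon)$ such that for all $n>n(\epsilon)$, $\frac1n\log\mathbf{P}(E\mid\mathbf{x}\in F_0^k)<\bar\psi_{tot}(\delta)+\epsilon$.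
   Context: Notation: $H(t)=-t\log t-(1-t)\log(1-t)$ (natural log); $\operatorname{erf}(x)=\frac2{\sqrt\pi}\int_0^xe^{-t^2}dt$; $\Phi$ the standard normal distribution function; $\lambda(u)=\frac{u^2}2+\log(2\Phi(u))$. Put $f_i=f\big(\delta+\frac{(i-1)(1-\delta)}{r}\big)$, $i=1,\dots,r$. For $\mathbf{h}\in[0,1-\delta]^r$, $x>0$, $y\in\mathbb{R}$ let $\psi_{com}(\mathbf{h})=\frac{1-\delta}{r}\sum_{i=1}^rH\big(\frac{h_i}{1-\delta}\big)+\big(r\sum_i h_i-\delta\big)\log2$; $c_1=\int_0^\delta f^2(u)du$, $\bar c_0=\frac1r\sum_if_ih_i$, $\bar\lambda_0(s)=\frac{1}{r\bar c_0}\sum_ih_i\lambda(sf_i)$, $\bar\lambda_0^*(y)=\sup_{s\in\mathbb{R}}(sy-\bar\lambda_0(s))$, with $\bar c_0\bar\lambda_0^*(y)$ understood as $\sup_s(\bar c_0sy-\frac1r\sum_ih_i\lambda(sf_i))$; $\psi_{int}(\mathbf{h},y)=-\big(r\sum_ih_i-\delta\big)\log2-\Big(\frac{\bar c_0^2}{2c_1}y^2+\bar c_0\bar\lambda_0^*(y)\Big)$; $\bar c_2=\int_0^\delta f^2(u)du+\frac1r\sum_if_i^2h_i$, $\bar G_0(x)=\int_\delta^1\log\operatorname{erf}(xf(u))du-\frac1r\sum_ih_i\log\operatorname{erf}(xf_i)$, $\psi_{ext}(\mathbf{h},x)=-(\bar c_2x^2-\bar G_0(x))$. Then $\bar\psi_{tot}(\delta)=\sup\{\psi_{com}(\mathbf{h})+\psi_{int}(\mathbf{h},y)+\psi_{ext}(\mathbf{h},x)\}$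 over $x>0$, $y\in\mathbb{R}$, $\mathbf{h}\in[0,1-\delta]^r$ with $\frac1r\sum_ih_i\ge\alpha-\delta$. *)

theory Defs
  imports "HOL-Probability.Probability"
begin

definition Hent :: "real \<Rightarrow> real" where
  "Hent t = - t * ln t - (1 - t) * ln (1 - t)"

definition erf :: "real \<Rightarrow> real" where
  "erf x = 2 / sqrt pi * (LBINT t=0..x. exp (- (t\<^sup>2)))"

definition std_normal_measure :: "real measure" where
  "std_normal_measure = density lborel std_normal_density"

definition Phi :: "real \<Rightarrow> real" where
  "Phi u = measure std_normal_measure {..u}"

definition lam :: "real \<Rightarrow> real" where
  "lam u = u\<^sup>2 / 2 + ln (2 * Phi u)"

section \<open>The exponent functional (indices i = 0..r-1 stand for i = 1..r)\<close>

definition fgrid :: "(real \<Rightarrow> real) \<Rightarrow> real \<Rightarrow> nat \<Rightarrow> nat \<Rightarrow> real" where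
  "fgrid f \<delta> r i = f (\<delta> + real i * (1 - \<delta>) / real r)"

definition psi_com :: "real \<Rightarrow> nat \<Rightarrow> (nat \<Rightarrow> real) \<Rightarrow> real" where
  "psi_com \<delta> r h = (1 - \<delta>) / real r * (\<Sum>i<r. Hent (h i / (1 - \<delta>)))
      + (real r * (\<Sum>i<r. h i) - \<delta>) * ln 2"

definition c1 :: "(real \<Rightarrow> real) \<Rightarrow> real \<Rightarrow> real" where
  "c1 f \<delta> = integral {0..\<delta>} (\<lambda>u. (f u)\<^sup>2)"

definition c0bar :: "(real \<Rightarrow> real) \<Rightarrow> real \<Rightarrow> nat \<Rightarrow> (nat \<Rightarrow> real) \<Rightarrow> real" where
  "c0bar f \<delta> r h = (1 / real r) * (\<Sum>i<r. fgrid f \<delta> r i * h i)"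

text \<open>c0bar * lambda0bar^*(y), as the (extended real) supremum over s.\<close>
definition c0_conj :: "(real \<Rightarrow> real) \<Rightarrow> real \<Rightarrow> nat \<Rightarrow> (nat \<Rightarrow> real) \<Rightarrow> real \<Rightarrow> ereal" where
  "c0_conj f \<delta> r h y = (SUP s\<in>UNIV. ereal (c0bar f \<delta> r h * s * y
        - (1 / real r) * (\<Sum>i<r. h i * lam (s * fgrid f \<delta> r i))))"

definition psi_int :: "(real \<Rightarrow> real) \<Rightarrow> real \<Rightarrow> nat \<Rightarrow> (nat \<Rightarrow> real) \<Rightarrow> real \<Rightarrow> ereal" where
  "psi_int f \<delta> r h y = ereal (- (real r * (\<Sum>i<r. h i) - \<delta>) * ln 2)
      - (ereal ((c0bar f \<delta> r h)\<^sup>2 / (2 * c1 f \<delta>) * y\<^sup>2) + c0_conj f \<delta> r h y)"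

definition c2bar :: "(real \<Rightarrow> real) \<Rightarrow> real \<Rightarrow> nat \<Rightarrow> (nat \<Rightarrow> real) \<Rightarrow> real" where
  "c2bar f \<delta> r h = integral {0..\<delta>} (\<lambda>u. (f u)\<^sup>2)
      + (1 / real r) * (\<Sum>i<r. (fgrid f \<delta> r i)\<^sup>2 * h i)"

definition G0bar :: "(real \<Rightarrow> real) \<Rightarrow> real \<Rightarrow> nat \<Rightarrow> (nat \<Rightarrow> real) \<Rightarrow> real \<Rightarrow> real" where
  "G0bar f \<delta> r h x = integral {\<delta>..1} (\<lambda>u. ln (erf (x * f u)))
      - (1 / real r) * (\<Sum>i<r. h i * ln (erf (x * fgrid f \<delta> r i)))"

definition psi_ext :: "(real \<Rightarrow> real) \<Rightarrow> real \<Rightarrow> nat \<Rightarrow> (nat \<Rightarrow> real) \<Rightarrow> real \<Rightarrow> real" where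
  "psi_ext f \<delta> r h x = - (c2bar f \<delta> r h * x\<^sup>2 - G0bar f \<delta> r h x)"

definition psi_tot :: "(real \<Rightarrow> real) \<Rightarrow> real \<Rightarrow> real \<Rightarrow> nat \<Rightarrow> ereal" where
  "psi_tot f \<delta> \<alpha> r = (SUP p \<in> {(h, x, y). 0 < x \<and> (\<forall>i<r. 0 \<le> h i \<and> h i \<le> 1 - \<delta>)
          \<and> (1 / real r) * (\<Sum>i<r. h i) \<ge> \<alpha> - \<delta>}.
      (case p of (h, x, y) \<Rightarrow>
        ereal (psi_com \<delta> r h) + psi_int f \<delta> r h y + ereal (psi_ext f \<delta> r h x)))"

section \<open>The random failure event (indices j = 0..n-1 stand for j = 1..n)\<close>

definition wts :: "(real \<Rightarrow> real) \<Rightarrow> nat \<Rightarrow> nat \<Rightarrow> real" where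
  "wts f n j = f (real (Suc j) / real n)"

definition wl1 :: "(nat \<Rightarrow> real) \<Rightarrow> nat \<Rightarrow> (nat \<Rightarrow> real) \<Rightarrow> real" where
  "wl1 w n z = (\<Sum>j<n. w j * \<bar>z j\<bar>)"

definition gauss_matrix :: "nat \<Rightarrow> nat \<Rightarrow> (nat \<times> nat \<Rightarrow> real) measure" where
  "gauss_matrix m n = PiM ({..<m} \<times> {..<n}) (\<lambda>_. std_normal_measure)"

definition fail_event :: "(real \<Rightarrow> real) \<Rightarrow> nat \<Rightarrow> nat \<Rightarrow> (nat \<Rightarrow> real) \<Rightarrow> (nat \<times> nat \<Rightarrow> real) set" where
  "fail_event f m n x = {A \<in> space (gauss_matrix m n).
     \<exists>z. (\<forall>j\<ge>n. z j = 0) \<and> z \<noteq> x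
       \<and> (\<forall>i<m. (\<Sum>j<n. A (i, j) * z j) = (\<Sum>j<n. A (i, j) * x j))
       \<and> wl1 (wts f n) n z \<le> wl1 (wts f n) n x}"

end

theory Submission
  imports Defs "HOL-Real_Asymp.Real_Asymp"
begin

text \<open>If the recovery fails, the kernel of \<open>A\<close> meets the descent cone of the weighted norm at \<open>x\<close>. Let \<open>g\<close> be
  an independent Gaussian vector, and project \<open>g\<close> onto the descent cone with the penalty \<open>|A d|\<^sup>2 / (2 e)\<close>.
  If a kernel vector \<open>d\<^sub>0\<close> of the cone has \<open>d\<^sub>0 \<bullet> g > 0\<close>, which has probability at least one half, then for
  small \<open>e\<close> the minimiser is a nonzero almost-kernel vector. Any \<open>m\<close> columns of \<open>A\<close> are almost surely independent,
  so the minimiser has more than \<open>m\<close> active coordinates: it lies in a face of the cone given by a set \<open>T\<close> of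
  coordinates beyond \<open>k\<close> with \<open>k + card T > m\<close> and a choice of signs.

  The probability of each face factorises. The minimiser depends only on the components of the rows along the
  hyperplane \<open>S\<close> spanned by the face, and the residual is, given these, Gaussian in the orthogonal directions; this
  yields the external factor. Given that it is nonzero, the direction of the minimiser is uniform on the sphere of
  \<open>S\<close> by rotation invariance, as is that of the projection of a Gaussian vector; this yields the internal factor,
  which is then estimated by a Chernoff bound with a parameter \<open>s \<le> 0\<close>. Thus internal and external angles of
  polytopes are not needed.

  Splitting the coordinates beyond \<open>k\<close> into \<open>r\<close> blocks of equal length, the choice \<open>s = saddle h\<close> turns the Chernoff
  exponent into \<open>psi_int\<close> at its saddle point, the external factor is a Laplace integral with exponent \<open>psi_ext\<close>, and
  the number of sets with given block fractions contributes the entropy in \<open>psi_com\<close>.\<close>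

section \<open>Gaussian vectors and rotations\<close>

text \<open>A kernel direction in the cone is picked by the matrix and has no law that factorises;
  this is the obstacle. The penalised minimiser on a fixed face solves linear equations that see the
  rows only along \<open>S\<close>, which restores independence. The admissible \<open>e\<close>
  depends on the matrix, so \<open>e\<close> runs through the values \<open>1 / (N + 1)\<close> and
  Fatou's lemma gives the limit; this works because the bound for a face does not involve
  \<open>e\<close>.

  \<open>psi_tot\<close> is only bounded from below: one \<open>y\<close> per \<open>h\<close>
  suffices, whereas \<open>x\<close> stays free, being up to scaling the integration variable of the
  external factor. The discretisation errors must be controlled over all faces and all
  \<open>x > 0\<close>, although \<open>ln (erf x)\<close> is unbounded near \<open>0\<close>. Three
  devices achieve this: monotonicity of \<open>f\<close>, which makes the values at left ends of
  blocks err in the favourable direction; concavity of \<open>erf\<close>, which bounds the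
  variation of \<open>ln (erf (x * v))\<close> uniformly in \<open>x\<close>; and block masses whose
  total is never below that of the face.\<close>

abbreviation "stdn \<equiv> std_normal_measure"

lemma prob_space_std_normal: "prob_space stdn"
  unfolding std_normal_measure_def by (rule prob_space_normal_density) simp

lemma sets_std_normal [simp, measurable_cong]: "sets stdn = sets borel"
  by (simp add: std_normal_measure_def)

lemma space_std_normal [simp]: "space stdn = UNIV"
  by (simp add: std_normal_measure_def)

interpretation stdn: prob_space stdn by (rule prob_space_std_normal)

definition gauss :: "'a set \<Rightarrow> ('a \<Rightarrow> real) measure" where
  "gauss I = PiM I (\<lambda>_. stdn)"

lemma sets_gauss [measurable_cong]: "sets (gauss I) = sets (PiM I (\<lambda>_. borel))"
  unfolding gauss_def by (rule sets_PiM_cong) auto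

lemma space_gauss: "space (gauss I) = (\<Pi>\<^sub>E i\<in>I. UNIV)"
  by (simp add: gauss_def space_PiM)

interpretation G: product_sigma_finite "\<lambda>_. stdn"
  by (simp add: product_sigma_finite_def stdn.sigma_finite_measure_axioms)

lemma prob_space_gauss: "prob_space (gauss I)"
  unfolding gauss_def by (rule prob_space_PiM) (rule prob_space_std_normal)

lemma measurable_gauss_coord [measurable]: "i \<in> I \<Longrightarrow> (\<lambda>z. z i) \<in> borel_measurable (gauss I)"
  by (simp add: measurable_cong_sets[OF sets_gauss refl])

lemma nn_integral_std_normal:
  "f \<in> borel_measurable borel \<Longrightarrow>
    (\<integral>\<^sup>+x. f x \<partial>stdn) = (\<integral>\<^sup>+x. ennreal (std_normal_density x) * f x \<partial>lborel)"
  unfolding std_normal_measure_def by (subst nn_integral_density) auto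

lemma std_normal_density_mult:
  "std_normal_density x * std_normal_density y = exp (- (x\<^sup>2 + y\<^sup>2) / 2) / (2 * pi)"
  unfolding std_normal_density_def
  by (simp add: field_simps flip: exp_add)

lemma nn_integral_std_normal2:
  assumes [measurable]: "h \<in> borel_measurable (borel \<Otimes>\<^sub>M borel)"
  shows "(\<integral>\<^sup>+y. \<integral>\<^sup>+x. h (x, y) \<partial>stdn \<partial>stdn)
       = (\<integral>\<^sup>+y. \<integral>\<^sup>+x. ennreal (exp (- (x\<^sup>2 + y\<^sup>2) / 2) / (2 * pi)) * h (x, y) \<partial>lborel \<partial>lborel)"
proof -
  have "(\<integral>\<^sup>+y. \<integral>\<^sup>+x. h (x, y) \<partial>stdn \<partial>stdn)
      = (\<integral>\<^sup>+y. ennreal (std_normal_density y) * (\<integral>\<^sup>+x. h (x, y) \<partial>stdn) \<partial>lborel)"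
    by (rule nn_integral_std_normal) measurable
  also have "\<dots> = (\<integral>\<^sup>+y. \<integral>\<^sup>+x. ennreal (std_normal_density x * std_normal_density y) * h (x, y) \<partial>lborel \<partial>lborel)"
  proof (rule nn_integral_cong)
    fix y
    have "(\<integral>\<^sup>+x. h (x, y) \<partial>stdn) = (\<integral>\<^sup>+x. ennreal (std_normal_density x) * h (x, y) \<partial>lborel)"
      by (rule nn_integral_std_normal) measurable
    then show "ennreal (std_normal_density y) * (\<integral>\<^sup>+x. h (x, y) \<partial>stdn)
      = (\<integral>\<^sup>+x. ennreal (std_normal_density x * std_normal_density y) * h (x, y) \<partial>lborel)"
      by (simp add: nn_integral_cmult[symmetric] ennreal_mult mult_ac)
  qed
  finally show ?thesis by (simp add: std_normal_density_mult)
qed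

text \<open>Two one-dimensional affine substitutions, with a change of the order of integration in
  between, replace a planar change of variables. Their Jacobians \<open>1 / c\<close> and
  \<open>c\<close> cancel in modulus, and the joint density depends on
  \<open>x\<^sup>2 + y\<^sup>2\<close> alone.\<close>

lemma nn_integral_std_normal_rotate:
  assumes cs: "c\<^sup>2 + s\<^sup>2 = 1" "c \<noteq> 0" and h[measurable]: "h \<in> borel_measurable (borel \<Otimes>\<^sub>M borel)"
  shows "(\<integral>\<^sup>+y. \<integral>\<^sup>+x. h (c * x + s * y, c * y - s * x) \<partial>stdn \<partial>stdn) = (\<integral>\<^sup>+y. \<integral>\<^sup>+x. h (x, y) \<partial>stdn \<partial>stdn)"
proof -
  define w where "w = (\<lambda>x y::real. ennreal (exp (- (x\<^sup>2 + y\<^sup>2) / 2) / (2 * pi)))"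
  have wm[measurable]: "(\<lambda>(x,y). w x y) \<in> borel_measurable (borel \<Otimes>\<^sub>M borel)"
    unfolding w_def by measurable
  have wm'[measurable]: "(\<lambda>x. w (f x) (g x)) \<in> borel_measurable M"
    if "f \<in> borel_measurable M" "g \<in> borel_measurable M" for f g and M :: "'z measure"
    unfolding w_def using that by measurable
  have w_rot: "w (c * x - s * y) (s * x + c * y) = w x y" for x y
  proof -
    have "(c * x - s * y)\<^sup>2 + (s * x + c * y)\<^sup>2 = (c\<^sup>2 + s\<^sup>2) * (x\<^sup>2 + y\<^sup>2)"
      by (simp add: power2_eq_square algebra_simps)
    then show ?thesis by (simp add: w_def cs)
  qed
  have "(\<integral>\<^sup>+y. \<integral>\<^sup>+x. h (c * x + s * y, c * y - s * x) \<partial>stdn \<partial>stdn)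
      = (\<integral>\<^sup>+y. \<integral>\<^sup>+x. w x y * h (c * x + s * y, c * y - s * x) \<partial>lborel \<partial>lborel)"
    using nn_integral_std_normal2[of "\<lambda>(x,y). h (c * x + s * y, c * y - s * x)"]
    by (simp add: w_def)
  also have "\<dots> = (\<integral>\<^sup>+y. ennreal \<bar>1/c\<bar> * (\<integral>\<^sup>+x. w ((x - s * y) / c) y * h (x, (y - s * x) / c) \<partial>lborel) \<partial>lborel)"
  proof (intro nn_integral_cong)
    fix y
    have 1: "c * (- s * y / c + 1 / c * x) + s * y = x" for x using cs(2) by (simp add: field_simps)
    have 2: "c * y - s * (- s * y / c + 1 / c * x) = (y - s * x) / c" for x
    proof -
      have "c * (c * y - s * (- s * y / c + 1 / c * x)) = (c\<^sup>2 + s\<^sup>2) * y - s * x"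
        using cs(2) by (simp add: power2_eq_square algebra_simps)
      also have "\<dots> = c * ((y - s * x) / c)" using cs by simp
      finally show ?thesis using cs(2) by (metis mult_left_cancel)
    qed
    have 3: "- s * y / c + 1 / c * x = (x - s * y) / c" for x by (simp add: diff_divide_distrib)
    show "(\<integral>\<^sup>+x. w x y * h (c * x + s * y, c * y - s * x) \<partial>lborel) =
       ennreal \<bar>1/c\<bar> * (\<integral>\<^sup>+x. w ((x - s * y) / c) y * h (x, (y - s * x) / c) \<partial>lborel)"
      using nn_integral_real_affine[of "\<lambda>x. w x y * h (c * x + s * y, c * y - s * x)" "1/c" "- s * y / c"] cs(2)
      unfolding 1 2 unfolding 3 by simp
  qed
  also have "\<dots> = ennreal \<bar>1/c\<bar> * (\<integral>\<^sup>+y. (\<integral>\<^sup>+x. w ((x - s * y) / c) y * h (x, (y - s * x) / c) \<partial>lborel) \<partial>lborel)"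
    by (rule nn_integral_cmult) measurable
  also have "\<dots> = ennreal \<bar>1/c\<bar> * (\<integral>\<^sup>+x. (\<integral>\<^sup>+y. w ((x - s * y) / c) y * h (x, (y - s * x) / c) \<partial>lborel) \<partial>lborel)"
    by (subst lborel_pair.Fubini') auto
  also have "(\<integral>\<^sup>+x. (\<integral>\<^sup>+y. w ((x - s * y) / c) y * h (x, (y - s * x) / c) \<partial>lborel) \<partial>lborel)
     = (\<integral>\<^sup>+x. ennreal \<bar>c\<bar> * (\<integral>\<^sup>+y. w x y * h (x, y) \<partial>lborel) \<partial>lborel)"
  proof (intro nn_integral_cong)
    fix x
    have 1: "(x - s * (s * x + c * y)) / c = c * x - s * y" for y
    proof -
      have "x - s * (s * x + c * y) = (c\<^sup>2 + s\<^sup>2) * x - s * (s * x + c * y)" using cs by simp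
      also have "\<dots> = c * (c * x - s * y)" by (simp add: power2_eq_square algebra_simps)
      finally show ?thesis using cs(2) by simp
    qed
    have 2: "(s * x + c * y - s * x) / c = y" for y using cs(2) by simp
    show "(\<integral>\<^sup>+y. w ((x - s * y) / c) y * h (x, (y - s * x) / c) \<partial>lborel) = ennreal \<bar>c\<bar> * (\<integral>\<^sup>+y. w x y * h (x, y) \<partial>lborel)"
      using nn_integral_real_affine[of "\<lambda>y. w ((x - s * y) / c) y * h (x, (y - s * x) / c)" c "s * x"] cs(2)
      unfolding 1 2 w_rot by simp
  qed
  also have "\<dots> = ennreal \<bar>c\<bar> * (\<integral>\<^sup>+x. (\<integral>\<^sup>+y. w x y * h (x, y) \<partial>lborel) \<partial>lborel)"
    by (rule nn_integral_cmult) measurable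
  also have "ennreal \<bar>1/c\<bar> * (ennreal \<bar>c\<bar> * (\<integral>\<^sup>+x. (\<integral>\<^sup>+y. w x y * h (x, y) \<partial>lborel) \<partial>lborel))
     = (\<integral>\<^sup>+x. (\<integral>\<^sup>+y. w x y * h (x, y) \<partial>lborel) \<partial>lborel)"
    using cs(2) by (simp add: mult.assoc[symmetric] ennreal_mult[symmetric] abs_mult[symmetric])
  also have "\<dots> = (\<integral>\<^sup>+y. (\<integral>\<^sup>+x. w x y * h (x, y) \<partial>lborel) \<partial>lborel)"
    by (subst lborel_pair.Fubini') auto
  also have "\<dots> = (\<integral>\<^sup>+y. \<integral>\<^sup>+x. h (x, y) \<partial>stdn \<partial>stdn)"
    by (subst nn_integral_std_normal2) (auto simp: w_def)
  finally show ?thesis .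
qed

lemma nn_integral_std_normal_minus:
  assumes [measurable]: "h \<in> borel_measurable borel"
  shows "(\<integral>\<^sup>+x. h (- x) \<partial>stdn) = (\<integral>\<^sup>+x. h x \<partial>stdn)"
proof -
  have "(\<integral>\<^sup>+x. h x \<partial>stdn) = (\<integral>\<^sup>+x. ennreal (std_normal_density x) * h x \<partial>lborel)"
    by (rule nn_integral_std_normal) simp
  also have "\<dots> = (\<integral>\<^sup>+x. ennreal (std_normal_density (-x)) * h (-x) \<partial>lborel)"
    by (subst nn_integral_real_affine[where c="-1" and t=0]) auto
  also have "\<dots> = (\<integral>\<^sup>+x. h (- x) \<partial>stdn)"
    by (subst nn_integral_std_normal) (auto simp: std_normal_density_def)
  finally show ?thesis ..
qed

lemma gauss_insert:
  assumes "finite I" "i \<notin> I" "f \<in> borel_measurable (gauss (insert i I))"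
  shows "(\<integral>\<^sup>+z. f z \<partial>gauss (insert i I)) = (\<integral>\<^sup>+z. \<integral>\<^sup>+x. f (z(i := x)) \<partial>stdn \<partial>gauss I)"
  using assms unfolding gauss_def by (rule G.product_nn_integral_insert)

lemma gauss_upd_measurable:
  assumes "f \<in> measurable N (gauss I)" "h \<in> borel_measurable N"
  shows "(\<lambda>x. (f x)(i := h x)) \<in> measurable N (gauss (insert i I))"
  using assms unfolding gauss_def
  by (intro measurable_fun_upd[where J=I]) (auto cong: measurable_cong_sets)

text \<open>Fubini isolates the coordinates \<open>a\<close> and \<open>b\<close>, on which the map
  is a plane rotation. Such Givens rotations are the building blocks of all orthonormal maps
  below.\<close>

lemma gauss_rotate2:
  assumes K: "finite K" "a \<in> K" "b \<in> K" "a \<noteq> b" and cs: "c\<^sup>2 + s\<^sup>2 = 1" "c \<noteq> 0"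
    and f: "f \<in> borel_measurable (gauss K)"
  shows "(\<integral>\<^sup>+z. f (z(a := c * z a + s * z b, b := c * z b - s * z a)) \<partial>gauss K) = (\<integral>\<^sup>+z. f z \<partial>gauss K)"
proof -
  define K' where "K' = K - {a, b}"
  have KK: "K = insert a (insert b K')" "finite K'" "a \<notin> insert b K'" "b \<notin> K'" "finite (insert b K')"
    using K by (auto simp: K'_def)
  have expand: "(\<integral>\<^sup>+z. g z \<partial>gauss K) = (\<integral>\<^sup>+z. \<integral>\<^sup>+y. \<integral>\<^sup>+x. g (z(b := y, a := x)) \<partial>stdn \<partial>stdn \<partial>gauss K')"
    if g: "g \<in> borel_measurable (gauss K)" for g
  proof -
    have [measurable]: "g \<in> borel_measurable (gauss (insert a (insert b K')))" using g KK by simp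
    have [measurable]: "(\<lambda>(z, x). z(a := x)) \<in> measurable (gauss (insert b K') \<Otimes>\<^sub>M borel) (gauss (insert a (insert b K')))"
      by (simp add: split_beta' gauss_upd_measurable)
    have "(\<lambda>z. \<integral>\<^sup>+x. g (z(a := x)) \<partial>stdn) \<in> borel_measurable (gauss (insert b K'))"
      by measurable
    then show ?thesis
      unfolding KK(1) using g KK by (simp add: gauss_insert)
  qed
  have R: "(\<lambda>z. f (z(a := c * z a + s * z b, b := c * z b - s * z a))) \<in> borel_measurable (gauss K)"
  proof -
    have "(\<lambda>z. z(a := c * z a + s * z b, b := c * z b - s * z a)) \<in> measurable (gauss K) (gauss (insert b (insert a K)))"
      using K by (intro gauss_upd_measurable) (measurable; auto)+
    moreover have "insert b (insert a K) = K" using K by auto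
    ultimately show ?thesis using f by (auto intro: measurable_compose)
  qed
  show ?thesis
    unfolding expand[OF f] expand[OF R]
  proof (rule nn_integral_cong)
    fix z assume z: "z \<in> space (gauss K')"
    have "(\<lambda>p. (z(b := snd p))(a := fst p)) \<in> measurable (borel \<Otimes>\<^sub>M borel) (gauss (insert a (insert b K')))"
      using z by (intro gauss_upd_measurable measurable_const) auto
    then have m: "(\<lambda>p. f (z(b := snd p, a := fst p))) \<in> borel_measurable (borel \<Otimes>\<^sub>M borel)"
      using f KK by (auto intro: measurable_compose)
    have "z(b := y, a := x, b := c * y - s * x) = z(b := c * y - s * x, a := x)" for x y
      using K by auto
    then show "(\<integral>\<^sup>+ y. \<integral>\<^sup>+ x. f ((z(b := y, a := x))
       (a := c * (z(b := y, a := x)) a + s * (z(b := y, a := x)) b,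
        b := c * (z(b := y, a := x)) b - s * (z(b := y, a := x)) a)) \<partial>stdn \<partial>stdn)
      = (\<integral>\<^sup>+ y. \<integral>\<^sup>+ x. f (z(b := y, a := x)) \<partial>stdn \<partial>stdn)"
      using nn_integral_std_normal_rotate[OF cs m] K by (simp add: fun_upd_twist)
  qed
qed

section \<open>Orthonormal images of Gaussian vectors\<close>

definition lin :: "('a \<Rightarrow> 'b \<Rightarrow> real) \<Rightarrow> 'b set \<Rightarrow> 'a set \<Rightarrow> ('b \<Rightarrow> real) \<Rightarrow> 'a \<Rightarrow> real" where
  "lin q K I z = (\<lambda>i\<in>I. \<Sum>k\<in>K. q i k * z k)"

text \<open>The rows are orthonormal but need not span: \<open>I\<close> may have fewer elements
  than \<open>K\<close>, so that marginals are covered along with rotations.\<close>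

definition orthonormal_on :: "('a \<Rightarrow> 'b \<Rightarrow> real) \<Rightarrow> 'b set \<Rightarrow> 'a set \<Rightarrow> bool" where
  "orthonormal_on q K I \<longleftrightarrow> (\<forall>i\<in>I. \<forall>j\<in>I. (\<Sum>k\<in>K. q i k * q j k) = (if i = j then 1 else 0))"

lemma lin_measurable [measurable]: "lin q K I \<in> measurable (gauss K) (gauss I)"
proof -
  have "(\<lambda>z. \<lambda>i\<in>I. \<Sum>k\<in>K. q i k * z k) \<in> measurable (gauss K) (PiM I (\<lambda>_. stdn))"
    by (intro measurable_restrict) (simp cong: measurable_cong_sets)
  then show ?thesis unfolding gauss_def lin_def[abs_def] .
qed

lemma sum_two: "finite K \<Longrightarrow> a \<in> K \<Longrightarrow> b \<in> K \<Longrightarrow> a \<noteq> b \<Longrightarrow>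
   (\<Sum>k\<in>K. g k) = g a + g b + (\<Sum>k\<in>K - {a, b}. (g k :: real))"
proof -
  assume "finite K" "a \<in> K" "b \<in> K" "a \<noteq> b"
  then have "K = insert a (insert b (K - {a, b}))" "finite (K - {a, b})" by auto
  then have "(\<Sum>k\<in>K. g k) = (\<Sum>k\<in>insert a (insert b (K - {a, b})). g k)" by simp
  also have "\<dots> = g a + g b + (\<Sum>k\<in>K - {a, b}. g k)"
    using \<open>finite K\<close> \<open>a \<noteq> b\<close> by (simp add: add.assoc)
  finally show ?thesis .
qed

text \<open>Givens rotations of the columns clear row \<open>i\<close> until a single entry, 1 or
  -1, is left. Orthogonality then clears the column of this entry in all other rows, one coordinate
  splits off, and the induction on \<open>I\<close> applies. The inner induction is on the number of
  nonzero entries of row \<open>i\<close>.\<close>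

theorem nn_integral_gauss_orthonormal:
  assumes "finite I" "finite K" "orthonormal_on q K I" "F \<in> borel_measurable (gauss I)"
  shows "(\<integral>\<^sup>+z. F (lin q K I z) \<partial>gauss K) = (\<integral>\<^sup>+z. F z \<partial>gauss I)"
  using assms
proof (induction I arbitrary: K q F rule: finite_induct)
  case empty
  have "emeasure (gauss K) (space (gauss K)) = 1"
    by (rule prob_space.emeasure_space_1[OF prob_space_gauss])
  moreover have "lin q K {} z = (\<lambda>_. undefined)" for z :: "'b \<Rightarrow> real"
    by (simp add: lin_def fun_eq_iff)
  ultimately show ?case
    by (simp add: gauss_def[of "{} :: 'a set"] PiM_empty nn_integral_count_space_finite)
next
  case (insert i I)
  define n where "n = card {k\<in>K. q i k \<noteq> 0}"
  from insert.prems n_def show ?case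
  proof (induction n arbitrary: q rule: less_induct)
    case (less n)
    note on = less.prems(2)[unfolded orthonormal_on_def]
    have K: "finite K" by fact
    show ?case
    proof (cases "\<exists>a\<in>K. \<exists>b\<in>K. a \<noteq> b \<and> q i a \<noteq> 0 \<and> q i b \<noteq> 0")
      case True
      then obtain a b where ab: "a \<in> K" "b \<in> K" "a \<noteq> b" "q i a \<noteq> 0" "q i b \<noteq> 0" by blast
      define t where "t = sqrt ((q i a)\<^sup>2 + (q i b)\<^sup>2)"
      have "(q i a)\<^sup>2 + (q i b)\<^sup>2 > 0" using ab by (simp add: sum_power2_gt_zero_iff)
      then have t: "t > 0" "t\<^sup>2 = (q i a)\<^sup>2 + (q i b)\<^sup>2" by (auto simp: t_def)
      define c s where "c = q i a / t" and "s = q i b / t"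
      have cs: "c\<^sup>2 + s\<^sup>2 = 1" "c \<noteq> 0"
        using t ab by (auto simp: c_def s_def power_divide add_divide_distrib[symmetric])
      \<comment> \<open>The same rotation acts on the columns of \<open>q\<close> and, as
        \<open>R\<close>, on the argument, so all inner products are unchanged; \<open>c\<close> and
        \<open>s\<close> are chosen to annihilate \<open>q' i b\<close>.\<close>
      define q' where "q' = (\<lambda>j. (q j)(a := c * q j a + s * q j b, b := c * q j b - s * q j a))"
      define R where "R = (\<lambda>z :: 'b \<Rightarrow> real. z(a := c * z a + s * z b, b := c * z b - s * z a))"
      have alg: "(c * x + s * y) * (c * x' + s * y') + (c * y - s * x) * (c * y' - s * x') = x * x' + y * y'" for x y x' y'
      proof -
        have "(c * x + s * y) * (c * x' + s * y') + (c * y - s * x) * (c * y' - s * x') = (c\<^sup>2 + s\<^sup>2) * (x * x' + y * y')"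
          by (simp add: algebra_simps power2_eq_square)
        then show ?thesis by (simp add: cs)
      qed
      have inv: "(\<Sum>k\<in>K. q' j k * R z k) = (\<Sum>k\<in>K. q j k * z k)" for j z
        using ab alg by (simp add: sum_two[OF K ab(1-3)] q'_def R_def)
      have "orthonormal_on q' K (insert i I)"
      proof -
        have "(\<Sum>k\<in>K. q' j k * q' j' k) = (\<Sum>k\<in>K. q j k * q j' k)" for j j'
          using inv[of j "q j'"] by (simp add: q'_def R_def)
        then show ?thesis using less.prems(2) by (simp add: orthonormal_on_def)
      qed
      moreover have "card {k\<in>K. q' i k \<noteq> 0} < n"
      proof -
        have "q' i b = 0" using ab by (simp add: q'_def c_def s_def)
        then have "{k\<in>K. q' i k \<noteq> 0} \<subseteq> {k\<in>K. q i k \<noteq> 0} - {b}"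
          using ab by (auto simp: q'_def split: if_splits)
        then have "{k\<in>K. q' i k \<noteq> 0} \<subset> {k\<in>K. q i k \<noteq> 0}" using ab by blast
        then show ?thesis unfolding less.prems(4) using K by (intro psubset_card_mono) auto
      qed
      ultimately have IH: "(\<integral>\<^sup>+z. F (lin q' K (insert i I) z) \<partial>gauss K) = (\<integral>\<^sup>+z. F z \<partial>gauss (insert i I))"
        using less.IH[OF _ K _ less.prems(3) refl] by blast
      have "lin q K (insert i I) z = lin q' K (insert i I) (R z)" for z
        by (simp add: lin_def inv)
      then have "(\<integral>\<^sup>+z. F (lin q K (insert i I) z) \<partial>gauss K) = (\<integral>\<^sup>+z. F (lin q' K (insert i I) (R z)) \<partial>gauss K)"
        by simp
      also have "\<dots> = (\<integral>\<^sup>+z. F (lin q' K (insert i I) z) \<partial>gauss K)"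
        unfolding R_def using ab less.prems(3) by (intro gauss_rotate2[OF K _ _ _ cs]) auto
      finally show ?thesis using IH by simp
    next
      case False
      have sq: "(\<Sum>k\<in>K. q i k * q i k) = 1" using on by simp
      then obtain k where k: "k \<in> K" "q i k \<noteq> 0" by (metis (no_types, lifting) mult_eq_0_iff sum.neutral zero_neq_one)
      then have z: "q i l = 0" if "l \<in> K" "l \<noteq> k" for l using False that by blast
      define K' where "K' = K - {k}"
      have K': "K = insert k K'" "k \<notin> K'" "finite K'" using k K by (auto simp: K'_def)
      have z': "q i l = 0" if "l \<in> K'" for l using z that K' by auto
      have "(\<Sum>l\<in>K'. q i l * g l) = 0" for g by (rule sum.neutral) (simp add: z')
      then have zs: "(\<Sum>l\<in>K. q i l * g l) = q i k * g k" for g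
        using K' by simp
      then have "q i k * q i k = 1" using sq by simp
      then have q1: "q i k = 1 \<or> q i k = - 1" by (simp add: square_eq_1_iff)
      \<comment> \<open>Orthogonality to row \<open>i\<close> clears column \<open>k\<close> in the
        other rows, so coordinate \<open>k\<close> feeds output \<open>i\<close> alone.\<close>
      have qj: "q j k = 0" if "j \<in> I" for j
      proof -
        have "(\<Sum>l\<in>K. q i l * q j l) = 0" using on that insert.hyps by (metis insertCI)
        then show ?thesis using zs k by simp
      qed
      have on': "orthonormal_on q K' I"
        using on qj K' unfolding orthonormal_on_def by simp
      have m: "F \<in> borel_measurable (gauss (insert i I))" by fact
      have lin_upd: "lin q K (insert i I) (z(k := x)) = (lin q K' I z)(i := q i k * x)" for z x
      proof
        fix j
        have "(\<Sum>l\<in>K'. g l * (z(k := x)) l) = (\<Sum>l\<in>K'. g l * z l)" for g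
          using K' by (intro sum.cong) auto
        moreover have "(\<Sum>l\<in>K. g l * (z(k := x)) l) = g k * x + (\<Sum>l\<in>K'. g l * (z(k := x)) l)" for g
          using K' by simp
        ultimately show "lin q K (insert i I) (z(k := x)) j = ((lin q K' I z)(i := q i k * x)) j"
          using zs[of "z(k := x)"] qj insert.hyps by (auto simp: lin_def)
      qed
      have Fm: "(\<lambda>v. \<integral>\<^sup>+x. F (v(i := x)) \<partial>stdn) \<in> borel_measurable (gauss I)"
      proof -
        have [measurable]: "(\<lambda>(z, x). z(i := x)) \<in> measurable (gauss I \<Otimes>\<^sub>M borel) (gauss (insert i I))"
          by (simp add: split_beta' gauss_upd_measurable)
        note m[measurable]
        show ?thesis by measurable
      qed
      have flip: "(\<integral>\<^sup>+x. F (v(i := q i k * x)) \<partial>stdn) = (\<integral>\<^sup>+x. F (v(i := x)) \<partial>stdn)"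
        if "v \<in> space (gauss I)" for v
      proof -
        have "(\<lambda>x. v(i := x)) \<in> measurable borel (gauss (insert i I))"
          using that by (intro gauss_upd_measurable) auto
        then have "(\<lambda>x. F (v(i := x))) \<in> borel_measurable borel" using m by (rule measurable_compose)
        from nn_integral_std_normal_minus[OF this] q1 show ?thesis by auto
      qed
      have "(\<integral>\<^sup>+z. F (lin q K (insert i I) z) \<partial>gauss K)
        = (\<integral>\<^sup>+z. \<integral>\<^sup>+x. F ((lin q K' I z)(i := q i k * x)) \<partial>stdn \<partial>gauss K')"
      proof -
        have "(\<lambda>z. F (lin q K (insert i I) z)) \<in> borel_measurable (gauss (insert k K'))"
          using m by (simp flip: K'(1))
        then show ?thesis
          using gauss_insert[OF K'(3,2)] by (simp flip: K'(1)) (simp add: lin_upd)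
      qed
      also have "\<dots> = (\<integral>\<^sup>+z. \<integral>\<^sup>+x. F ((lin q K' I z)(i := x)) \<partial>stdn \<partial>gauss K')"
        by (intro nn_integral_cong flip) (auto simp: space_gauss lin_def)
      also have "\<dots> = (\<integral>\<^sup>+z. \<integral>\<^sup>+x. F (z(i := x)) \<partial>stdn \<partial>gauss I)"
        using insert.IH[OF K'(3) on' Fm] .
      also have "\<dots> = (\<integral>\<^sup>+z. F z \<partial>gauss (insert i I))"
        using insert.hyps m by (simp add: gauss_insert)
      finally show ?thesis .
    qed
  qed
qed

section \<open>Penalised projection onto a cone\<close>

definition dot :: "nat \<Rightarrow> (nat \<Rightarrow> real) \<Rightarrow> (nat \<Rightarrow> real) \<Rightarrow> real" where
  "dot n x y = (\<Sum>j<n. x j * y j)"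

definition rowdot :: "(nat \<times> nat \<Rightarrow> real) \<Rightarrow> nat \<Rightarrow> nat \<Rightarrow> (nat \<Rightarrow> real) \<Rightarrow> real" where
  "rowdot W n i d = (\<Sum>j<n. W (i, j) * d j)"

text \<open>The rows of \<open>W\<close> below \<open>m\<close> form the random matrix \<open>A\<close>, row \<open>m\<close> is an auxiliary Gaussian vector \<open>g\<close>.
  The inner product \<open>ridge\<close> belongs to the penalised projection problem of minimising
  \<open>|d - g|\<^sup>2 / 2 + |A d|\<^sup>2 / (2 e)\<close>.\<close>

definition ridge :: "(nat \<times> nat \<Rightarrow> real) \<Rightarrow> nat \<Rightarrow> nat \<Rightarrow> real \<Rightarrow> (nat \<Rightarrow> real) \<Rightarrow> (nat \<Rightarrow> real) \<Rightarrow> real" where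
  "ridge W m n e x y = dot n x y + (\<Sum>i<m. rowdot W n i x * rowdot W n i y) / e"

text \<open>Vectors of dimension \<open>n\<close> are functions on all naturals that vanish from
  \<open>n\<close> on. Closedness refers to the product topology, in which boxes are compact by
  Tychonoff's theorem.\<close>

definition convex_cone_vecs :: "nat \<Rightarrow> (nat \<Rightarrow> real) set \<Rightarrow> bool" where
  "convex_cone_vecs n K \<longleftrightarrow> closed K \<and> (\<lambda>j. 0) \<in> K \<and> (\<forall>x\<in>K. \<forall>j\<ge>n. x j = 0) \<and>
     (\<forall>x\<in>K. \<forall>y\<in>K. \<forall>s\<ge>0. \<forall>t\<ge>0. (\<lambda>j. s * x j + t * y j) \<in> K)"

lemma dot_comb: "dot n (\<lambda>j. s * x j + t * y j) z = s * dot n x z + t * dot n y z"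
  by (simp add: dot_def sum.distrib sum_distrib_left algebra_simps)

lemma dot_commute: "dot n x y = dot n y x"
  by (simp add: dot_def mult.commute)

lemma rowdot_eq_dot: "rowdot W n i d = dot n (\<lambda>j. W (i, j)) d"
  by (simp add: dot_def rowdot_def)

lemma rowdot_comb: "rowdot W n i (\<lambda>j. s * x j + t * y j) = s * rowdot W n i x + t * rowdot W n i y"
  by (simp add: rowdot_eq_dot dot_commute[of _ "\<lambda>j. W (i, j)"] dot_comb)

lemma ridge_comb: "ridge W m n e (\<lambda>j. s * x j + t * y j) z = s * ridge W m n e x z + t * ridge W m n e y z"
proof -
  have "(\<Sum>i<m. (s * rowdot W n i x + t * rowdot W n i y) * rowdot W n i z)
      = s * (\<Sum>i<m. rowdot W n i x * rowdot W n i z) + t * (\<Sum>i<m. rowdot W n i y * rowdot W n i z)"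
    by (simp add: sum.distrib sum_distrib_left algebra_simps)
  then show ?thesis by (simp add: ridge_def dot_comb rowdot_comb add_divide_distrib algebra_simps)
qed

lemma ridge_commute: "ridge W m n e x y = ridge W m n e y x"
  by (simp add: ridge_def dot_commute mult.commute)

lemma dot_self_nonneg: "0 \<le> dot n x x"
  by (simp add: dot_def sum_nonneg)

lemma ridge_ge_dot: "e > 0 \<Longrightarrow> dot n x x \<le> ridge W m n e x x"
  by (simp add: ridge_def sum_nonneg)

lemma nonneg_if_quadratic_nonneg:
  fixes L Q b :: real
  assumes "b > 0" "\<And>t. 0 < t \<Longrightarrow> t \<le> b \<Longrightarrow> 0 \<le> 2 * t * L + t\<^sup>2 * Q"
  shows "0 \<le> L"
proof (rule ccontr)
  assume "\<not> 0 \<le> L"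
  then have L: "L < 0" by simp
  define t where "t = min b (- L / (1 + \<bar>Q\<bar>))"
  have t: "0 < t" "t \<le> b" "t \<le> - L / (1 + \<bar>Q\<bar>)" using L assms(1) by (auto simp: t_def field_simps)
  have "t * (1 + \<bar>Q\<bar>) \<le> - L" using t(3) pos_le_divide_eq[of "1 + \<bar>Q\<bar>" t "- L"] by simp
  moreover have "t * Q \<le> t * (1 + \<bar>Q\<bar>)" using t by (intro mult_left_mono) auto
  ultimately have "2 * L + t * Q < 0" using L by linarith
  then have "t * (2 * L + t * Q) < 0" using t by (simp add: mult_pos_neg)
  moreover have "0 \<le> t * (2 * L + t * Q)" using assms(2)[OF t(1,2)] by (simp add: power2_eq_square algebra_simps)
  ultimately show False by simp
qed

lemma compact_box_vecs: "compact {x :: nat \<Rightarrow> real. (\<forall>j<n. \<bar>x j\<bar> \<le> R) \<and> (\<forall>j\<ge>n. x j = 0)}"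
proof -
  have "compactin (product_topology (\<lambda>_. euclidean) UNIV) (PiE UNIV (\<lambda>j::nat. if j < n then {-R..R::real} else {0}))"
    by (subst compactin_PiE) auto
  moreover have "PiE UNIV (\<lambda>j::nat. if j < n then {-R..R::real} else {0}) = {x. (\<forall>j<n. \<bar>x j\<bar> \<le> R) \<and> (\<forall>j\<ge>n. x j = 0)}"
    by (auto simp: PiE_iff abs_le_iff split: if_splits) (metis leI minus_le_iff | force)+
  ultimately show ?thesis by (simp add: euclidean_product_topology)
qed

lemma continuous_on_rowdot [continuous_intros]: "continuous_on S (rowdot W n i)"
  unfolding rowdot_def by (intro continuous_intros continuous_on_product_coordinates[THEN continuous_on_subset]) auto

lemma continuous_on_dot_self: "continuous_on S (\<lambda>x. dot n x x)"
  unfolding dot_def by (intro continuous_intros continuous_on_product_coordinates[THEN continuous_on_subset]) auto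

text \<open>The two conclusions are the variational inequality and the complementarity that
  characterise a projection onto a convex cone. Moving from the minimiser in a direction of the cone
  gives the inequality; shrinking the minimiser towards \<open>0\<close> gives the opposite
  inequality for \<open>d' = d\<close>.\<close>

lemma ridge_min_exists:
  assumes K: "convex_cone_vecs n K" and e: "e > 0"
  shows "\<exists>d\<in>K. (\<forall>d'\<in>K. rowdot W n m d' \<le> ridge W m n e d d') \<and> ridge W m n e d d = rowdot W n m d"
proof -
  note K' = K[unfolded convex_cone_vecs_def]
  \<comment> \<open>Up to the constant |g|^2 this is twice the penalised objective, g being row
    \<open>m\<close>.\<close>
  define \<phi> where "\<phi> d = ridge W m n e d d - 2 * rowdot W n m d" for d
  \<comment> \<open>If \<open>\<phi> d \<le> 0\<close>, then |d|^2 is at most 2 (d . g), so |d - g|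
    is at most |g| and every coordinate of d is at most 2 |g| in modulus.\<close>
  define R where "R = 2 * sqrt (\<Sum>j<n. (W (m, j))\<^sup>2)"
  have bound: "\<bar>d j\<bar> \<le> R" if "\<phi> d \<le> 0" "j < n" for d j
  proof -
    have "dot n d d \<le> 2 * rowdot W n m d" using that ridge_ge_dot[OF e, of n d W m] by (simp add: \<phi>_def)
    then have "(\<Sum>j<n. (d j - W (m, j))\<^sup>2) \<le> (\<Sum>j<n. (W (m, j))\<^sup>2)"
      by (simp add: dot_def rowdot_def power2_diff sum.distrib sum_subtractf power2_eq_square[of "d _"] sum_distrib_left mult_ac)
    moreover have "(d j - W (m, j))\<^sup>2 \<le> (\<Sum>j<n. (d j - W (m, j))\<^sup>2)"
      using that by (intro member_le_sum) auto
    ultimately have "\<bar>d j - W (m, j)\<bar> \<le> sqrt (\<Sum>j<n. (W (m, j))\<^sup>2)"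
      by (intro real_le_rsqrt) (simp)
    moreover have "(W (m, j))\<^sup>2 \<le> (\<Sum>j<n. (W (m, j))\<^sup>2)"
      using that by (intro member_le_sum) auto
    then have "\<bar>W (m, j)\<bar> \<le> sqrt (\<Sum>j<n. (W (m, j))\<^sup>2)"
      by (intro real_le_rsqrt) (simp)
    ultimately show ?thesis unfolding R_def by linarith
  qed
  define B where "B = K \<inter> {x. (\<forall>j<n. \<bar>x j\<bar> \<le> R) \<and> (\<forall>j\<ge>n. x j = 0)}"
  have \<phi>0: "\<phi> (\<lambda>_. 0) = 0" by (simp add: \<phi>_def ridge_def dot_def rowdot_def)
  have "compact B" unfolding B_def using K' compact_box_vecs by (intro closed_Int_compact) auto
  moreover have B0: "(\<lambda>_. 0) \<in> B" using K' by (simp add: B_def R_def sum_nonneg)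
  then have "B \<noteq> {}" by blast
  moreover have "continuous_on B \<phi>"
    unfolding \<phi>_def ridge_def by (intro continuous_intros continuous_on_dot_self) (use e in auto)
  ultimately obtain d where d: "d \<in> B" "\<And>y. y \<in> B \<Longrightarrow> \<phi> d \<le> \<phi> y"
    using continuous_attains_inf[of B \<phi>] by metis
  have dK: "d \<in> K" using d by (simp add: B_def)
  have min: "\<phi> d \<le> \<phi> y" if "y \<in> K" for y
  proof (cases "\<phi> y \<le> 0")
    case True
    then have "y \<in> B" using bound that K' by (simp add: B_def)
    then show ?thesis by (rule d(2))
  next
    case False
    then show ?thesis using d(2)[OF B0] \<phi>0 by simp
  qed
  have expand: "\<phi> (\<lambda>j. 1 * d j + t * y j) = \<phi> d + (2 * t * (ridge W m n e d y - rowdot W n m y) + t\<^sup>2 * ridge W m n e y y)" for t y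
  proof -
    have "ridge W m n e (\<lambda>j. 1 * d j + t * y j) (\<lambda>j. 1 * d j + t * y j)
      = ridge W m n e d d + 2 * t * ridge W m n e d y + t\<^sup>2 * ridge W m n e y y"
      unfolding ridge_comb ridge_commute[of _ _ _ _ _ "\<lambda>j. 1 * d j + t * y j"] 
      by (simp add: ridge_commute[of _ _ _ _ y d] algebra_simps power2_eq_square)
    then show ?thesis by (simp add: \<phi>_def rowdot_comb[of _ _ _ 1, simplified] algebra_simps)
  qed
  have 1: "0 \<le> ridge W m n e d y - rowdot W n m y" if y: "y \<in> K" for y
  proof (rule nonneg_if_quadratic_nonneg[of 1])
    fix t :: real assume t: "0 < t"
    have "(\<lambda>j. 1 * d j + t * y j) \<in> K" using K' dK y t by (metis less_le zero_le_one)
    from min[OF this] show "0 \<le> 2 * t * (ridge W m n e d y - rowdot W n m y) + t\<^sup>2 * ridge W m n e y y"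
      unfolding expand by simp
  qed simp
  have 2: "0 \<le> - (ridge W m n e d d - rowdot W n m d)"
  proof (rule nonneg_if_quadratic_nonneg[of 1])
    fix t :: real assume t: "0 < t" "t \<le> 1"
    have "(\<lambda>j. (1 - t) * d j + 0 * d j) \<in> K" using K' dK t by (metis diff_ge_0_iff_ge order_refl)
    then have "(\<lambda>j. 1 * d j + (- t) * d j) \<in> K" by (simp add: algebra_simps)
    from min[OF this] show "0 \<le> 2 * t * (- (ridge W m n e d d - rowdot W n m d)) + t\<^sup>2 * ridge W m n e d d"
      unfolding expand by (simp add: algebra_simps)
  qed simp
  show ?thesis using dK 1 2 1[OF dK] by (intro bexI[of _ d]) force+
qed

section \<open>The descent cone and its polar\<close>

text \<open>The one-sided directional derivative of the weighted norm at a point that is positive in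
  the first \<open>k\<close> coordinates and zero in the others.\<close>

definition qf :: "(nat \<Rightarrow> real) \<Rightarrow> nat \<Rightarrow> nat \<Rightarrow> (nat \<Rightarrow> real) \<Rightarrow> real" where
  "qf w k n d = (\<Sum>j<k. w j * d j) + (\<Sum>j=k..<n. w j * \<bar>d j\<bar>)"

definition descent_cone :: "(nat \<Rightarrow> real) \<Rightarrow> nat \<Rightarrow> nat \<Rightarrow> (nat \<Rightarrow> real) set" where
  "descent_cone w k n = {d. (\<forall>j\<ge>n. d j = 0) \<and> qf w k n d \<le> 0}"

lemma continuous_on_qf: "continuous_on S (qf w k n)"
  unfolding qf_def by (intro continuous_intros continuous_on_product_coordinates[THEN continuous_on_subset]) auto

lemma closed_coord_zero: "closed {d :: nat \<Rightarrow> real. \<forall>j\<in>J. d j = 0}"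
proof -
  have "{d :: nat \<Rightarrow> real. \<forall>j\<in>J. d j = 0} = (\<Inter>j\<in>J. {d. d j = 0})" by auto
  moreover have "closed {d :: nat \<Rightarrow> real. d j = 0}" for j
    by (intro closed_Collect_eq continuous_intros continuous_on_product_coordinates)
  ultimately show ?thesis by auto
qed

lemma convex_cone_descent:
  assumes "\<And>j. j < n \<Longrightarrow> 0 \<le> w j"
  shows "convex_cone_vecs n (descent_cone w k n)"
proof -
  have "closed (descent_cone w k n)"
  proof -
    have "descent_cone w k n = {d. \<forall>j\<in>{n..}. d j = 0} \<inter> {d. qf w k n d \<le> 0}"
      by (auto simp: descent_cone_def)
    then show ?thesis by (auto intro!: closed_Int closed_coord_zero closed_Collect_le continuous_on_qf continuous_intros)
  qed
  moreover have "qf w k n (\<lambda>j. s * x j + t * y j) \<le> s * qf w k n x + t * qf w k n y" if "s \<ge> 0" "t \<ge> 0" for s t x y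
  proof -
    have "(\<Sum>j=k..<n. w j * \<bar>s * x j + t * y j\<bar>) \<le> (\<Sum>j=k..<n. s * (w j * \<bar>x j\<bar>) + t * (w j * \<bar>y j\<bar>))"
    proof (rule sum_mono)
      fix j assume "j \<in> {k..<n}"
      then have "0 \<le> w j" using assms by simp
      moreover have "\<bar>s * x j + t * y j\<bar> \<le> s * \<bar>x j\<bar> + t * \<bar>y j\<bar>"
        using that by (metis abs_mult abs_of_nonneg abs_triangle_ineq)
      ultimately have "w j * \<bar>s * x j + t * y j\<bar> \<le> w j * (s * \<bar>x j\<bar> + t * \<bar>y j\<bar>)" by (simp add: mult_left_mono)
      then show "w j * \<bar>s * x j + t * y j\<bar> \<le> s * (w j * \<bar>x j\<bar>) + t * (w j * \<bar>y j\<bar>)"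
        by (simp add: algebra_simps)
    qed
    then show ?thesis by (simp add: qf_def sum.distrib sum_distrib_left algebra_simps)
  qed
  moreover have "s * qf w k n x + t * qf w k n y \<le> 0" if "s \<ge> 0" "t \<ge> 0" "qf w k n x \<le> 0" "qf w k n y \<le> 0" for s t x y
    using that by (simp add: add_nonpos_nonpos mult_nonneg_nonpos)
  ultimately show ?thesis
    unfolding convex_cone_vecs_def
    by (auto simp: descent_cone_def) (simp add: qf_def, meson order_trans)
qed

lemma dot_delta: "a < n \<Longrightarrow> dot n r (\<lambda>j. if j = a then c else 0) = r a * c"
  by (simp add: dot_def if_distrib[of "\<lambda>x. _ * x"] cong: if_cong)

text \<open>The normal cone of a sublevel set of the sublinear \<open>qf\<close> consists of the
  multiples \<open>l\<close> of its subgradients, which are the first two clauses; the other two are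
  complementary slackness. The first two are read off from test directions with at most two nonzero
  coordinates.\<close>

lemma polar_descent_cone:
  assumes w: "\<And>j. j < n \<Longrightarrow> 0 < w j" and k: "0 < k" "k \<le> n"
    and pol: "\<And>d'. d' \<in> descent_cone w k n \<Longrightarrow> dot n r d' \<le> 0"
    and d: "d \<in> descent_cone w k n" "dot n r d = 0"
  shows "\<exists>l\<ge>0. (\<forall>j<k. r j = l * w j) \<and> (\<forall>j\<in>{k..<n}. \<bar>r j\<bar> \<le> l * w j) \<and>
     (\<forall>j\<in>{k..<n}. d j \<noteq> 0 \<longrightarrow> r j = l * w j * sgn (d j)) \<and> (0 < l \<longrightarrow> qf w k n d = 0)"
proof -
  have test: "x / w a * r a \<le> r b / w b" if "a < n" "b < k" "a \<noteq> b" "\<bar>x\<bar> \<le> 1" "a < k \<longrightarrow> x \<le> 1" for a b x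
  proof -
    \<comment> \<open>The entry \<open>- 1 / w b\<close> at \<open>b < k\<close> lowers
      \<open>qf\<close> by one, which pays for the entry \<open>x / w a\<close>.\<close>
    define d' :: "nat \<Rightarrow> real" where "d' = (\<lambda>j. 1 * (if j = a then x / w a else 0) + 1 * (if j = b then - 1 / w b else 0))"
    have b: "b < n" using that k by simp
    have "qf w k n d' \<le> 0"
    proof (cases "a < k")
      case True
      have "(\<Sum>j=k..<n. w j * \<bar>d' j\<bar>) = 0" using True that by (intro sum.neutral) (auto simp: d'_def)
      moreover have "(\<Sum>j<k. w j * d' j) = x - 1"
        using True that w[OF b] w[of a] k
        by (simp add: d'_def distrib_left sum.distrib if_distrib[of "\<lambda>x. _ * x"] cong: if_cong)
      ultimately show ?thesis using that by (simp add: qf_def)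
    next
      case False
      have "(\<Sum>j=k..<n. w j * \<bar>d' j\<bar>) = (\<Sum>j=k..<n. if j = a then \<bar>x\<bar> else 0)"
        using that False w[of a] by (intro sum.cong) (auto simp: d'_def abs_mult)
      also have "\<dots> = \<bar>x\<bar>" using False that by simp
      finally have "(\<Sum>j=k..<n. w j * \<bar>d' j\<bar>) = \<bar>x\<bar>" .
      moreover have "(\<Sum>j<k. w j * d' j) = (\<Sum>j<k. if j = b then - 1 else 0)"
        using that False w[OF b] by (intro sum.cong) (auto simp: d'_def)
      then have "(\<Sum>j<k. w j * d' j) = - 1" using that by simp
      ultimately show ?thesis using that by (simp add: qf_def)
    qed
    moreover have "\<forall>j\<ge>n. d' j = 0" using that b by (auto simp: d'_def)
    ultimately have "d' \<in> descent_cone w k n" by (simp add: descent_cone_def)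
    from pol[OF this] have "1 * (r a * (x / w a)) + 1 * (r b * (- 1 / w b)) \<le> 0"
      unfolding d'_def dot_commute[of n r] dot_comb using that b by (simp add: dot_commute[of n _ r] dot_delta)
    then show ?thesis by (simp add: mult_ac)
  qed
  define l where "l = r 0 / w 0"
  have w0: "w 0 > 0" using w k by simp
  have l0: "0 \<le> l"
  proof -
    define d' :: "nat \<Rightarrow> real" where "d' = (\<lambda>j. if j = 0 then - 1 / w 0 else (0::real))"
    have "(\<Sum>j=k..<n. w j * \<bar>d' j\<bar>) = 0" using k by (intro sum.neutral) (auto simp: d'_def)
    moreover have "(\<Sum>j<k. w j * d' j) = (\<Sum>j<k. if j = 0 then - 1 else 0)"
      using w0 by (intro sum.cong) (auto simp: d'_def)
    then have "(\<Sum>j<k. w j * d' j) = -1" using k by simp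
    ultimately have "d' \<in> descent_cone w k n" using k by (auto simp: descent_cone_def qf_def d'_def)
    from pol[OF this] have "r 0 * (- 1 / w 0) \<le> 0" unfolding d'_def using k by (subst (asm) dot_delta) auto
    then show ?thesis by (simp add: l_def)
  qed
  have F: "r j = l * w j" if "j < k" for j
  proof (cases "j = 0")
    case True then show ?thesis using w0 by (simp add: l_def)
  next
    case False
    have "1 / w j * r j \<le> r 0 / w 0" using False that k by (intro test) auto
    moreover have "1 / w 0 * r 0 \<le> r j / w j" using False that k by (intro test) auto
    ultimately have "r j / w j = l" by (simp add: l_def)
    then show ?thesis using w[of j] that k by (simp add: field_simps)
  qed
  have N: "\<bar>r j\<bar> \<le> l * w j" if "j \<in> {k..<n}" for j
  proof -
    have j: "j < n" "\<not> j < k" "w j > 0" using that w by auto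
    have "1 / w j * r j \<le> r 0 / w 0" using j k by (intro test) auto
    moreover have "(-1) / w j * r j \<le> r 0 / w 0" using j k by (intro test) auto
    ultimately have "\<bar>r j\<bar> / w j \<le> l" using j by (auto simp: l_def abs_if)
    then show ?thesis using j by (simp add: field_simps)
  qed
  have split: "dot n r d = (\<Sum>j<k. r j * d j) + (\<Sum>j=k..<n. r j * d j)"
    using k unfolding dot_def
    by (subst sum.union_disjoint[symmetric]) (auto intro!: sum.cong)
  have "(\<Sum>j<k. r j * d j) = l * (\<Sum>j<k. w j * d j)"
    using F by (simp add: sum_distrib_left mult.assoc)
  \<comment> \<open>Both sides must vanish: the left one is nonpositive on the cone, and on the
    right every summand is nonnegative because \<open>\<bar>r j\<bar> \<le> l * w j\<close>.\<close>
  then have id: "l * qf w k n d = (\<Sum>j=k..<n. l * w j * \<bar>d j\<bar> - r j * d j)"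
    using split d(2) by (simp add: qf_def sum_subtractf distrib_left sum_distrib_left mult.assoc)
  have nn: "0 \<le> l * w j * \<bar>d j\<bar> - r j * d j" if "j \<in> {k..<n}" for j
  proof -
    have "r j * d j \<le> \<bar>r j\<bar> * \<bar>d j\<bar>" by (metis abs_ge_self abs_mult)
    also have "\<dots> \<le> l * w j * \<bar>d j\<bar>" using N[OF that] by (simp add: mult_right_mono)
    finally show ?thesis by simp
  qed
  have "l * qf w k n d \<le> 0" using d l0 by (auto simp: descent_cone_def mult_nonneg_nonpos)
  moreover have "0 \<le> (\<Sum>j=k..<n. l * w j * \<bar>d j\<bar> - r j * d j)" by (rule sum_nonneg) (rule nn)
  ultimately have z: "(\<Sum>j=k..<n. l * w j * \<bar>d j\<bar> - r j * d j) = 0" "l * qf w k n d = 0"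
    using id by linarith+
  have "r j = l * w j * sgn (d j)" if "j \<in> {k..<n}" "d j \<noteq> 0" for j
  proof -
    have "l * w j * \<bar>d j\<bar> - r j * d j = 0"
      using z(1) nn sum_nonneg_eq_0_iff[of "{k..<n}" "\<lambda>j. l * w j * \<bar>d j\<bar> - r j * d j"] that by auto
    then have "(l * w j * sgn (d j) - r j) * d j = 0" by (simp add: algebra_simps abs_sgn)
    then show ?thesis using that by simp
  qed
  then show ?thesis using l0 F N z(2) by (intro exI[of _ l]) auto
qed

section \<open>Bilinearity and the Cauchy-Schwarz inequality\<close>

lemma dot_diff_left: "dot n (\<lambda>j. x j - y j) z = dot n x z - dot n y z"
  by (simp add: dot_def sum_subtractf algebra_simps)

lemma dot_smult_left: "dot n (\<lambda>j. c * x j) z = c * dot n x z"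
  by (simp add: dot_def sum_distrib_left mult.assoc)

lemma dot_add_left: "dot n (\<lambda>j. x j + y j) z = dot n x z + dot n y z"
  by (simp add: dot_def sum.distrib algebra_simps)

lemma dot_diff_right: "dot n z (\<lambda>j. x j - y j) = dot n z x - dot n z y"
  by (simp add: dot_commute[of n z] dot_diff_left)

lemma dot_smult_right: "dot n z (\<lambda>j. c * x j) = c * dot n z x"
  by (simp add: dot_commute[of n z] dot_smult_left)

lemma dot_add_right: "dot n z (\<lambda>j. x j + y j) = dot n z x + dot n z y"
  by (simp add: dot_commute[of n z] dot_add_left)

lemma dot_cong: "(\<And>j. j < n \<Longrightarrow> x j = x' j) \<Longrightarrow> (\<And>j. j < n \<Longrightarrow> y j = y' j) \<Longrightarrow> dot n x y = dot n x' y'"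
  by (simp add: dot_def)

lemma dot_eq_0D: "dot n x x = 0 \<Longrightarrow> j < n \<Longrightarrow> x j = 0"
  by (simp add: dot_def sum_nonneg_eq_0_iff)

definition nrm :: "nat \<Rightarrow> (nat \<Rightarrow> real) \<Rightarrow> real" where "nrm n x = sqrt (dot n x x)"

lemma nrm_nonneg [simp]: "0 \<le> nrm n x" by (simp add: nrm_def dot_self_nonneg)

lemma nrm_sq: "(nrm n x)\<^sup>2 = dot n x x" by (simp add: nrm_def dot_self_nonneg)

lemma nrm_L2: "nrm n x = L2_set x {..<n}"
  by (simp add: nrm_def dot_def L2_set_def power2_eq_square)

lemma dot_le_nrm: "\<bar>dot n x y\<bar> \<le> nrm n x * nrm n y"
proof -
  have "\<bar>dot n x y\<bar> \<le> (\<Sum>i<n. \<bar>x i\<bar> * \<bar>y i\<bar>)" unfolding dot_def by (rule order_trans[OF sum_abs]) (simp add: abs_mult)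
  also have "\<dots> \<le> nrm n x * nrm n y" unfolding nrm_L2 by (rule L2_set_mult_ineq)
  finally show ?thesis .
qed

lemma nrm_triangle: "nrm n (\<lambda>j. x j + y j) \<le> nrm n x + nrm n y"
  unfolding nrm_L2 by (rule L2_set_triangle_ineq)

lemma coord_le_nrm: "j < n \<Longrightarrow> \<bar>x j\<bar> \<le> nrm n x"
  using member_le_L2_set[of "{..<n}" j "\<lambda>i. \<bar>x i\<bar>"] by (simp add: nrm_L2 L2_set_def)

lemma nrm_pos_iff: "0 < nrm n x \<longleftrightarrow> (\<exists>j<n. x j \<noteq> 0)"
  by (auto simp: nrm_L2 L2_set_eq_0_iff order_less_le)

lemma rowdot_le: "\<bar>rowdot W n i x\<bar> \<le> nrm n (\<lambda>j. W (i, j)) * nrm n x"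
  unfolding rowdot_eq_dot by (rule dot_le_nrm)

lemma ridge_diff: "ridge W m n e (\<lambda>j. x j - y j) z = ridge W m n e x z - ridge W m n e y z"
  using ridge_comb[of W m n e 1 x "- 1" y z] by simp

lemma sum_diff_cmult: "(\<Sum>j\<in>J. (a j - c * b j) * y j) = (\<Sum>j\<in>J. a j * y j) - c * (\<Sum>j\<in>J. b j * (y j :: real))"
  by (simp add: left_diff_distrib sum_subtractf sum_distrib_left mult.assoc)

section \<open>Penalised projection onto a hyperplane\<close>

text \<open>For a face, \<open>J\<close> holds its active coordinates and \<open>u\<close> is the
  gradient of \<open>qf\<close> on it. The pair \<open>{..<n}\<close> and zero yields the whole
  space and serves the pattern with vanishing multiplier.\<close>

locale hyperplane =
  fixes n :: nat and J :: "nat set" and u :: "nat \<Rightarrow> real"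
  assumes J: "J \<subseteq> {..<n}" and u: "j \<notin> J \<Longrightarrow> u j = 0"
begin

text \<open>The case \<open>u = 0\<close> is allowed: as \<open>x / 0 = 0\<close>, \<open>proj\<close> is then the restriction to \<open>J\<close>.\<close>

definition S :: "(nat \<Rightarrow> real) set" where
  "S = {x. (\<forall>j. j \<notin> J \<longrightarrow> x j = 0) \<and> dot n u x = 0}"

definition proj :: "(nat \<Rightarrow> real) \<Rightarrow> nat \<Rightarrow> real" where
  "proj x = (\<lambda>j. if j \<in> J then x j - dot n u x / dot n u u * u j else 0)"

lemma S_out: "x \<in> S \<Longrightarrow> n \<le> j \<Longrightarrow> x j = 0"
  using J by (auto simp: S_def)

lemma S_comb: "x \<in> S \<Longrightarrow> y \<in> S \<Longrightarrow> (\<lambda>j. s * x j + t * y j) \<in> S"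
  by (simp add: S_def dot_commute[of n u] dot_comb)

lemma S_diff: "x \<in> S \<Longrightarrow> y \<in> S \<Longrightarrow> (\<lambda>j. x j - y j) \<in> S"
  using S_comb[of x y 1 "-1"] by simp

lemma S_smult: "x \<in> S \<Longrightarrow> (\<lambda>j. c * x j) \<in> S"
  using S_comb[of x x c 0] by simp

lemma S_zero: "(\<lambda>_. 0) \<in> S"
  by (simp add: S_def dot_def)

lemma convex_cone_S: "convex_cone_vecs n S"
proof -
  have "closed S"
  proof -
    have "S = {d. \<forall>j\<in>- J. d j = 0} \<inter> {d. dot n u d = 0}" by (auto simp: S_def)
    moreover have "closed {d. dot n u d = 0}" unfolding dot_def
      by (intro closed_Collect_eq continuous_intros continuous_on_product_coordinates)
    ultimately show ?thesis by (auto intro!: closed_Int closed_coord_zero)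
  qed
  then show ?thesis using S_comb S_zero S_out by (auto simp: convex_cone_vecs_def)
qed

lemma dot_restrict: "(\<And>j. j \<notin> J \<Longrightarrow> y j = 0) \<Longrightarrow> dot n x y = (\<Sum>j\<in>J. x j * y j)"
  unfolding dot_def using J by (intro sum.mono_neutral_right) auto

lemma dot_u_proj: "dot n u (proj x) = 0"
proof -
  have "dot n u (proj x) = (\<Sum>j\<in>J. (x j - dot n u x / dot n u u * u j) * u j)"
    by (subst dot_restrict) (auto simp: proj_def mult.commute intro!: sum.cong)
  also have "\<dots> = (\<Sum>j\<in>J. x j * u j) - dot n u x / dot n u u * (\<Sum>j\<in>J. u j * u j)"
    by (rule sum_diff_cmult)
  also have "\<dots> = dot n x u - dot n u x / dot n u u * dot n u u"
    using dot_restrict[of u x] dot_restrict[of u u] u by simp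
  also have "\<dots> = 0"
  proof (cases "dot n u u = 0")
    case True
    then have "dot n x u = 0" using dot_eq_0D[OF True] by (simp add: dot_def)
    then show ?thesis using True by simp
  qed (simp add: dot_commute)
  finally show ?thesis .
qed

lemma proj_in_S: "proj x \<in> S"
  using dot_u_proj by (simp add: S_def) (simp add: proj_def)

lemma dot_proj: "y \<in> S \<Longrightarrow> dot n (proj x) y = dot n x y"
proof -
  assume y: "y \<in> S"
  then have "dot n (proj x) y = (\<Sum>j\<in>J. (x j - dot n u x / dot n u u * u j) * y j)"
    by (subst dot_restrict) (auto simp: proj_def S_def intro!: sum.cong)
  also have "\<dots> = (\<Sum>j\<in>J. x j * y j) - dot n u x / dot n u u * (\<Sum>j\<in>J. u j * y j)"
    by (rule sum_diff_cmult)
  also have "\<dots> = dot n x y - dot n u x / dot n u u * dot n u y"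
    using dot_restrict[of y x] dot_restrict[of y u] y by (simp add: S_def)
  finally show ?thesis using y by (simp add: S_def)
qed

lemma proj_id: "x \<in> S \<Longrightarrow> proj x = x"
  by (auto simp: proj_def S_def fun_eq_iff)

lemma proj_comb: "proj (\<lambda>j. s * x j + t * y j) = (\<lambda>j. s * proj x j + t * proj y j)"
proof -
  have "dot n u (\<lambda>j. s * x j + t * y j) = s * dot n u x + t * dot n u y"
    by (simp add: dot_commute[of n u] dot_comb)
  then show ?thesis by (auto simp: proj_def fun_eq_iff add_divide_distrib algebra_simps)
qed

lemma nrm_proj_le: "nrm n (proj x) \<le> nrm n x"
proof -
  have "(nrm n (proj x))\<^sup>2 = dot n x (proj x)" by (simp add: nrm_sq dot_proj proj_in_S)
  also have "\<dots> \<le> nrm n x * nrm n (proj x)" using dot_le_nrm[of n x "proj x"] by simp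
  finally have "nrm n (proj x) * nrm n (proj x) \<le> nrm n x * nrm n (proj x)" by (simp add: power2_eq_square)
  then show ?thesis by (cases "nrm n (proj x) = 0") (auto simp: order_less_le)
qed

text \<open>On a subspace the variational inequality applies to \<open>x\<close> and to
  \<open>- x\<close> and becomes an equation: these are the normal equations of the penalised
  problem.\<close>

definition is_sol :: "nat \<Rightarrow> real \<Rightarrow> (nat \<times> nat \<Rightarrow> real) \<Rightarrow> (nat \<Rightarrow> real) \<Rightarrow> bool" where
  "is_sol m e W d \<longleftrightarrow> d \<in> S \<and> (\<forall>x\<in>S. ridge W m n e d x = rowdot W n m x)"

definition sol :: "nat \<Rightarrow> real \<Rightarrow> (nat \<times> nat \<Rightarrow> real) \<Rightarrow> nat \<Rightarrow> real" where
  "sol m e W = (THE d. is_sol m e W d)"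

lemma is_sol_exists: assumes "e > 0" shows "\<exists>d. is_sol m e W d"
proof -
  obtain d where d: "d \<in> S" "\<And>x. x \<in> S \<Longrightarrow> rowdot W n m x \<le> ridge W m n e d x"
    using ridge_min_exists[OF convex_cone_S assms] by blast
  have "rowdot W n m x = ridge W m n e d x" if x: "x \<in> S" for x
  proof (rule antisym[OF d(2)[OF x]])
    have m: "(\<lambda>j. (- 1) * x j + 0 * x j) \<in> S" by (intro S_comb x)
    have "ridge W m n e d (\<lambda>j. (- 1) * x j + 0 * x j) = - ridge W m n e d x"
      unfolding ridge_commute[of _ _ _ _ d] ridge_comb by simp
    moreover have "rowdot W n m (\<lambda>j. (- 1) * x j + 0 * x j) = - rowdot W n m x"
      unfolding rowdot_comb by simp
    ultimately show "ridge W m n e d x \<le> rowdot W n m x" using d(2)[OF m] by linarith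
  qed
  then show ?thesis using d(1) by (auto simp: is_sol_def)
qed

lemma is_sol_unique:
  assumes e: "e > 0" and d: "is_sol m e W d" "is_sol m e W d'"
  shows "d = d'"
proof
  define x where "x = (\<lambda>j. d j - d' j)"
  have xS: "x \<in> S" unfolding x_def using d by (intro S_diff) (auto simp: is_sol_def)
  have "ridge W m n e x x = ridge W m n e d x - ridge W m n e d' x"
    by (subst (1) x_def) (rule ridge_diff)
  also have "\<dots> = 0" using d xS by (simp add: is_sol_def)
  finally have "dot n x x = 0" using ridge_ge_dot[OF e, of n x W m] dot_self_nonneg[of n x] by linarith
  fix j
  show "d j = d' j"
  proof (cases "j < n")
    case True
    then have "x j = 0" using \<open>dot n x x = 0\<close> dot_eq_0D by blast
    then show ?thesis by (simp add: x_def)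
  next
    case False
    then show ?thesis using d S_out[of d j] S_out[of d' j] by (simp add: is_sol_def)
  qed
qed

lemma is_sol_sol: "e > 0 \<Longrightarrow> is_sol m e W (sol m e W)"
  unfolding sol_def by (rule theI'[of "is_sol m e W"]) (use is_sol_exists is_sol_unique in blast)

lemma sol_eqI: "e > 0 \<Longrightarrow> is_sol m e W d \<Longrightarrow> sol m e W = d"
  using is_sol_sol is_sol_unique by blast

lemma sol_in_S: "e > 0 \<Longrightarrow> sol m e W \<in> S"
  using is_sol_sol by (simp add: is_sol_def)

text \<open>Without penalty rows, row \<open>0\<close> plays the part of the auxiliary vector and
  the minimiser is its orthogonal projection. This is the reference law with which
  \<open>sol m\<close> is compared.\<close>

lemma sol_0: "e > 0 \<Longrightarrow> sol 0 e W = proj (\<lambda>j. W (0, j))"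
  by (intro sol_eqI) (auto simp: is_sol_def proj_in_S ridge_def dot_proj rowdot_eq_dot)

text \<open>The normal equations test the rows only against vectors of \<open>S\<close>; this is the
  source of the independence in the decoupling.\<close>

lemma sol_cong_S:
  assumes e: "e > 0" and eq: "\<And>i x. i \<le> m \<Longrightarrow> x \<in> S \<Longrightarrow> rowdot W n i x = rowdot W' n i x"
  shows "sol m e W = sol m e W'"
proof (rule sol_eqI[OF e])
  have s: "is_sol m e W' (sol m e W')" by (rule is_sol_sol[OF e])
  then have "sol m e W' \<in> S" by (simp add: is_sol_def)
  then have "ridge W m n e (sol m e W') x = ridge W' m n e (sol m e W') x" if "x \<in> S" for x
    using eq that by (simp add: ridge_def)
  then show "is_sol m e W (sol m e W')" using s eq by (simp add: is_sol_def)
qed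

section \<open>Measurability of the minimiser by gradient descent\<close>

definition grad :: "nat \<Rightarrow> real \<Rightarrow> (nat \<times> nat \<Rightarrow> real) \<Rightarrow> (nat \<Rightarrow> real) \<Rightarrow> nat \<Rightarrow> real" where
  "grad m e W x = (\<lambda>j. x j + (\<Sum>i<m. rowdot W n i x * W (i, j)) / e - W (m, j))"

lemma dot_grad: "dot n (grad m e W x) z = ridge W m n e x z - rowdot W n m z"
proof -
  have "(\<Sum>j<n. (\<Sum>i<m. rowdot W n i x * W (i, j)) / e * z j) = (\<Sum>i<m. rowdot W n i x * rowdot W n i z) / e"
    unfolding sum_divide_distrib sum_distrib_right
    by (subst sum.swap) (simp add: rowdot_def[of _ _ _ z] sum_distrib_left sum_divide_distrib mult_ac)
  then show ?thesis
    by (simp add: dot_def grad_def ridge_def rowdot_def[of _ _ m] sum.distrib sum_subtractf algebra_simps)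
qed

text \<open>An upper bound for the operator norm of the form \<open>ridge\<close>, with the
  Frobenius norm of A in place of the spectral norm.\<close>

definition lip :: "nat \<Rightarrow> real \<Rightarrow> (nat \<times> nat \<Rightarrow> real) \<Rightarrow> real" where
  "lip m e W = 1 + (\<Sum>i<m. \<Sum>j<n. W (i, j) * W (i, j)) / e"

lemma ridge_le_lip: "e > 0 \<Longrightarrow> \<bar>ridge W m n e x z\<bar> \<le> lip m e W * (nrm n x * nrm n z)"
proof -
  assume e: "e > 0"
  have "\<bar>\<Sum>i<m. rowdot W n i x * rowdot W n i z\<bar> \<le> (\<Sum>i<m. \<bar>rowdot W n i x\<bar> * \<bar>rowdot W n i z\<bar>)"
    by (rule order_trans[OF sum_abs]) (simp add: abs_mult)
  also have "\<dots> \<le> (\<Sum>i<m. (nrm n (\<lambda>j. W (i, j)) * nrm n x) * (nrm n (\<lambda>j. W (i, j)) * nrm n z))"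
    by (intro sum_mono mult_mono rowdot_le) auto
  also have "\<dots> = (\<Sum>i<m. (nrm n (\<lambda>j. W (i, j)))\<^sup>2 * (nrm n x * nrm n z))"
    by (simp add: power2_eq_square mult_ac)
  also have "\<dots> = (\<Sum>i<m. \<Sum>j<n. W (i, j) * W (i, j)) * (nrm n x * nrm n z)"
    unfolding nrm_sq by (simp only: dot_def sum_distrib_right[of _ "{..<m}"])
  finally have "\<bar>(\<Sum>i<m. rowdot W n i x * rowdot W n i z) / e\<bar> \<le> (\<Sum>i<m. \<Sum>j<n. W (i, j) * W (i, j)) / e * (nrm n x * nrm n z)"
    using e by (simp add: divide_right_mono)
  moreover have "\<bar>ridge W m n e x z\<bar> \<le> \<bar>dot n x z\<bar> + \<bar>(\<Sum>i<m. rowdot W n i x * rowdot W n i z) / e\<bar>"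
    unfolding ridge_def by (rule abs_triangle_ineq)
  moreover have "lip m e W * (nrm n x * nrm n z) = nrm n x * nrm n z + (\<Sum>i<m. \<Sum>j<n. W (i, j) * W (i, j)) / e * (nrm n x * nrm n z)"
    by (simp add: lip_def distrib_right)
  ultimately show ?thesis using dot_le_nrm[of n x z] by linarith
qed

text \<open>Projected gradient descent; it exhibits \<open>sol\<close> as a limit of measurable functions.\<close>

fun iter :: "nat \<Rightarrow> real \<Rightarrow> (nat \<times> nat \<Rightarrow> real) \<Rightarrow> nat \<Rightarrow> nat \<Rightarrow> real" where
  "iter m e W 0 = (\<lambda>_. 0)"
| "iter m e W (Suc t) = (\<lambda>j. iter m e W t j - 1 / (lip m e W)\<^sup>2 * proj (grad m e W (iter m e W t)) j)"

lemma iter_in_S: "iter m e W t \<in> S"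
proof (induction t)
  case (Suc t)
  then show ?case using S_comb[OF Suc proj_in_S, of 1 "- (1 / (lip m e W)\<^sup>2)"] by simp
qed (simp add: S_zero)

text \<open>The form \<open>ridge\<close> is bounded below by the identity and above by K =
  \<open>lip m e W\<close>. A gradient step of length h thus multiplies the squared error by at most
  1 - 2 h + h^2 K^2, which is 1 - h for h = 1 / K^2.\<close>

lemma iter_contract:
  assumes e: "e > 0"
  shows "dot n (\<lambda>j. iter m e W (Suc t) j - sol m e W j) (\<lambda>j. iter m e W (Suc t) j - sol m e W j)
     \<le> (1 - 1 / (lip m e W)\<^sup>2) * dot n (\<lambda>j. iter m e W t j - sol m e W j) (\<lambda>j. iter m e W t j - sol m e W j)"
proof -
  define d where "d = sol m e W"
  define x where "x = iter m e W t"
  define K where "K = lip m e W"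
  have K: "K \<ge> 1" unfolding K_def lip_def using e by (simp add: sum_nonneg)
  define y where "y = (\<lambda>j. x j - d j)"
  define g where "g = proj (grad m e W x)"
  have dS: "d \<in> S" unfolding d_def by (rule sol_in_S[OF e])
  have xS: "x \<in> S" unfolding x_def by (rule iter_in_S)
  have yS: "y \<in> S" unfolding y_def by (intro S_diff xS dS)
  have gS: "g \<in> S" unfolding g_def by (rule proj_in_S)
  have gz: "dot n g z = ridge W m n e y z" if "z \<in> S" for z
  proof -
    have "dot n g z = ridge W m n e x z - ridge W m n e d z"
      using that is_sol_sol[OF e, of m W] by (simp add: g_def dot_proj dot_grad d_def is_sol_def)
    also have "\<dots> = ridge W m n e (\<lambda>j. x j - d j) z" by (rule ridge_diff[symmetric])
    finally show ?thesis by (simp add: y_def)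
  qed
  have "nrm n g * nrm n g \<le> K * (nrm n y * nrm n g)"
    using gz[OF gS] ridge_le_lip[OF e, of W m y g] by (simp add: nrm_sq[symmetric] power2_eq_square K_def)
  then have "nrm n g \<le> K * nrm n y"
    using K by (cases "nrm n g = 0") (auto simp: order_less_le mult.assoc[symmetric])
  then have "(nrm n g)\<^sup>2 \<le> (K * nrm n y)\<^sup>2" by (intro power_mono) auto
  then have gg: "dot n g g \<le> K\<^sup>2 * dot n y y" by (simp add: nrm_sq power_mult_distrib)
  have gy: "dot n y y \<le> dot n g y" using gz[OF yS] ridge_ge_dot[OF e, of n y W m] by simp
  define h where "h = 1 / K\<^sup>2"
  have h: "h > 0" "h * K\<^sup>2 = 1" using K by (auto simp: h_def)
  have "dot n (\<lambda>j. y j - h * g j) (\<lambda>j. y j - h * g j) = dot n y y - 2 * h * dot n g y + h * (h * dot n g g)"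
    by (simp add: dot_diff_left dot_diff_right dot_smult_left dot_smult_right dot_commute[of n y g] algebra_simps)
  also have "\<dots> \<le> dot n y y - 2 * h * dot n y y + h * (h * (K\<^sup>2 * dot n y y))"
    using h gg gy by (intro add_mono diff_mono mult_left_mono) auto
  also have "\<dots> = (1 - h) * dot n y y" using h(2) by (simp add: mult.assoc[symmetric]) (simp add: algebra_simps)
  finally show ?thesis
    by (simp add: y_def h_def K_def g_def x_def d_def algebra_simps)
qed

lemma iter_tendsto:
  assumes e: "e > 0"
  shows "(\<lambda>t. iter m e W t j) \<longlonglongrightarrow> sol m e W j"
proof (cases "j < n")
  case False
  then show ?thesis using S_out[OF iter_in_S] S_out[OF sol_in_S[OF e]] by simp
next
  case True
  define \<kappa> where "\<kappa> = 1 - 1 / (lip m e W)\<^sup>2"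
  define q where "q t = dot n (\<lambda>j. iter m e W t j - sol m e W j) (\<lambda>j. iter m e W t j - sol m e W j)" for t
  have L: "lip m e W \<ge> 1" unfolding lip_def using e by (simp add: sum_nonneg)
  then have "(lip m e W)\<^sup>2 \<ge> 1" by (simp add: one_le_power)
  then have "1 / (lip m e W)\<^sup>2 \<le> 1" "0 < 1 / (lip m e W)\<^sup>2" using L by (auto simp: divide_le_eq)
  then have k: "0 \<le> \<kappa>" "\<kappa> < 1" by (auto simp: \<kappa>_def)
  have "q t \<le> \<kappa> ^ t * q 0" for t
  proof (induction t)
    case (Suc t)
    have "q (Suc t) \<le> \<kappa> * q t" unfolding q_def \<kappa>_def by (rule iter_contract[OF e])
    also have "\<dots> \<le> \<kappa> * (\<kappa> ^ t * q 0)" using Suc k by (intro mult_left_mono) auto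
    finally show ?case by simp
  qed simp
  moreover have "(\<lambda>t. \<kappa> ^ t * q 0) \<longlonglongrightarrow> 0 * q 0"
    using k by (intro tendsto_mult LIMSEQ_power_zero tendsto_const) auto
  ultimately have "q \<longlonglongrightarrow> 0"
    by (intro tendsto_sandwich[of "\<lambda>_. 0" q sequentially "\<lambda>t. \<kappa> ^ t * q 0"]) (auto simp: q_def dot_self_nonneg)
  then have "(\<lambda>t. sqrt (q t)) \<longlonglongrightarrow> sqrt 0" by (rule tendsto_real_sqrt)
  then have lim: "(\<lambda>t. sqrt (q t)) \<longlonglongrightarrow> 0" by (simp only: real_sqrt_zero)
  have "\<bar>iter m e W t j - sol m e W j\<bar> \<le> sqrt (q t)" for t
    using coord_le_nrm[OF True, of "\<lambda>j. iter m e W t j - sol m e W j"] by (simp only: nrm_def q_def)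
  then have "\<forall>\<^sub>F t in sequentially. norm (iter m e W t j - sol m e W j) \<le> sqrt (q t)"
    by (intro always_eventually allI) (simp only: real_norm_def)
  then have "(\<lambda>t. iter m e W t j - sol m e W j) \<longlonglongrightarrow> 0"
    by (rule Lim_null_comparison[OF _ lim])
  then show ?thesis by (rule LIM_zero_cancel)
qed

lemma sol_measurable [measurable]:
  assumes e: "e > 0"
  shows "(\<lambda>W. sol m e W j) \<in> borel_measurable (gauss ({..m} \<times> {..<n}))"
proof (rule borel_measurable_LIMSEQ_real[OF iter_tendsto[OF e]])
  have W: "(\<lambda>W. W (i, j)) \<in> borel_measurable (gauss ({..m} \<times> {..<n}))" if "i \<le> m" "j < n" for i j
    using that by (intro measurable_gauss_coord) auto
  have L: "(\<lambda>W. lip m e W) \<in> borel_measurable (gauss ({..m} \<times> {..<n}))"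
    unfolding lip_def by (intro borel_measurable_add borel_measurable_const borel_measurable_divide borel_measurable_sum borel_measurable_times W) auto
  fix t
  show "(\<lambda>W. iter m e W t j) \<in> borel_measurable (gauss ({..m} \<times> {..<n}))"
  proof (induction t arbitrary: j)
    case (Suc t)
    have R: "(\<lambda>W. rowdot W n i (iter m e W t)) \<in> borel_measurable (gauss ({..m} \<times> {..<n}))" if "i \<le> m" for i
      unfolding rowdot_def by (intro borel_measurable_sum borel_measurable_times W Suc that) auto
    have g: "(\<lambda>W. grad m e W (iter m e W t) j) \<in> borel_measurable (gauss ({..m} \<times> {..<n}))" if "j < n" for j
      unfolding grad_def using that by (intro borel_measurable_add borel_measurable_diff borel_measurable_divide borel_measurable_const borel_measurable_sum borel_measurable_times W Suc R) auto
    have du: "(\<lambda>W. dot n u (grad m e W (iter m e W t))) \<in> borel_measurable (gauss ({..m} \<times> {..<n}))"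
      unfolding dot_def by (intro borel_measurable_sum borel_measurable_times borel_measurable_const g) auto
    have p: "(\<lambda>W. proj (grad m e W (iter m e W t)) j) \<in> borel_measurable (gauss ({..m} \<times> {..<n}))"
    proof (cases "j \<in> J")
      case True
      then have "j < n" using J by auto
      then have "(\<lambda>W. grad m e W (iter m e W t) j - dot n u (grad m e W (iter m e W t)) / dot n u u * u j) \<in> borel_measurable (gauss ({..m} \<times> {..<n}))"
        by (intro borel_measurable_diff borel_measurable_times borel_measurable_divide borel_measurable_const du g)
      then show ?thesis using True by (simp only: proj_def if_True)
    qed (simp add: proj_def)
    show ?case unfolding iter.simps
      by (intro borel_measurable_diff borel_measurable_times borel_measurable_divide borel_measurable_const borel_measurable_power Suc L p)
  qed simp
qed

end

section \<open>The direction of the penalised projection\<close>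

lemma nn_integral_gauss_unit:
  assumes K: "finite K" and v: "(\<Sum>k\<in>K. v k * v k) = 1" and h: "h \<in> borel_measurable borel"
  shows "(\<integral>\<^sup>+z. h (\<Sum>k\<in>K. v k * z k) \<partial>gauss K) = (\<integral>\<^sup>+x. h x \<partial>stdn)"
proof -
  have m: "(\<lambda>z. h (z ())) \<in> borel_measurable (gauss {()})"
    using h by (auto intro: measurable_compose[OF measurable_gauss_coord])
  have "(\<integral>\<^sup>+z. h (lin (\<lambda>_. v) K {()} z ()) \<partial>gauss K) = (\<integral>\<^sup>+z. h (z ()) \<partial>gauss {()})"
    by (rule nn_integral_gauss_orthonormal[OF _ K _ m]) (auto simp: orthonormal_on_def v)
  also have "\<dots> = (\<integral>\<^sup>+x. h x \<partial>stdn)"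
    unfolding gauss_def by (rule G.product_nn_integral_singleton) (use h in \<open>simp cong: measurable_cong_sets\<close>)
  finally show ?thesis by (simp add: lin_def)
qed

lemma emeasure_std_normal_interval_pos:
  assumes "a < b" shows "0 < emeasure stdn {a<..<b}"
proof -
  have "emeasure stdn {a<..<b} = (\<integral>\<^sup>+x. ennreal (std_normal_density x) * indicator {a<..<b} x \<partial>lborel)"
    unfolding std_normal_measure_def by (rule emeasure_density) auto
  moreover have "\<dots> \<noteq> 0"
  proof
    assume "(\<integral>\<^sup>+x. ennreal (std_normal_density x) * indicator {a<..<b} x \<partial>lborel) = 0"
    then have "emeasure lborel {x. ennreal (std_normal_density x) * indicator {a<..<b} x \<noteq> 0} = 0"
      by (subst (asm) nn_integral_0_iff) auto
    moreover have "{x. ennreal (std_normal_density x) * indicator {a<..<b} x \<noteq> 0} = {a<..<b}"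
      using normal_density_pos[of 1 0] by (auto simp: indicator_def less_le)
    ultimately show False using assms by simp
  qed
  ultimately show ?thesis by (simp add: zero_less_iff_neq_zero)
qed

lemma emeasure_std_normal_singleton: "emeasure stdn {c} = 0"
proof -
  have "emeasure stdn {c} = (\<integral>\<^sup>+x. ennreal (std_normal_density x) * indicator {c} x \<partial>lborel)"
    unfolding std_normal_measure_def by (rule emeasure_density) auto
  then show ?thesis by (simp add: nn_integral_cmult_indicator)
qed

lemma of_bool_measurable [measurable (raw)]:
  "P \<in> measurable M (count_space UNIV) \<Longrightarrow> (\<lambda>x. of_bool (P x) :: ennreal) \<in> borel_measurable M"
  by (rule measurable_compose) auto

section \<open>Caps and reflections\<close>

text \<open>The direction of \<open>b\<close> lies in the open cap around \<open>a\<close> where the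
  cosine exceeds \<open>1 - r\<close>. The strict inequality excludes zero vectors.\<close>

definition near :: "nat \<Rightarrow> real \<Rightarrow> (nat \<Rightarrow> real) \<Rightarrow> (nat \<Rightarrow> real) \<Rightarrow> bool" where
  "near n r a b \<longleftrightarrow> (1 - r) * (nrm n a * nrm n b) < dot n a b"

text \<open>The Householder reflection in the hyperplane orthogonal to \<open>v\<close>.\<close>

definition reflect :: "nat \<Rightarrow> (nat \<Rightarrow> real) \<Rightarrow> (nat \<Rightarrow> real) \<Rightarrow> nat \<Rightarrow> real" where
  "reflect n v x = (\<lambda>j. x j - 2 * dot n v x / dot n v v * v j)"

lemma dot_reflect: "dot n (reflect n v x) y = dot n x (reflect n v y)"
  unfolding reflect_def dot_diff_left dot_diff_right dot_smult_left dot_smult_right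
  by (simp add: dot_commute[of n x v])

lemma reflect_reflect: assumes "dot n v v \<noteq> 0" shows "reflect n v (reflect n v x) = x"
proof -
  have "dot n v (reflect n v x) = - dot n v x"
    unfolding reflect_def dot_diff_right dot_smult_right using assms by simp
  then show ?thesis by (simp add: reflect_def[of n v "reflect n v x"]) (simp add: reflect_def fun_eq_iff)
qed

lemma nrm_reflect: "dot n v v \<noteq> 0 \<Longrightarrow> nrm n (reflect n v x) = nrm n x"
  by (simp add: nrm_def dot_reflect reflect_reflect)

lemma near_reflect: "dot n v v \<noteq> 0 \<Longrightarrow> near n r a (reflect n v b) \<longleftrightarrow> near n r (reflect n v a) b"
  by (simp add: near_def nrm_reflect dot_reflect)

lemma nrm_smult: "c \<ge> 0 \<Longrightarrow> nrm n (\<lambda>j. c * x j) = c * nrm n x"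
  by (simp add: nrm_def dot_smult_left dot_smult_right real_sqrt_mult)

lemma near_smult: "c > 0 \<Longrightarrow> near n r (\<lambda>j. c * a j) b \<longleftrightarrow> near n r a b"
  by (simp add: near_def nrm_smult dot_smult_left mult.left_commute[of _ c] mult.assoc)

lemma near_nrm_pos: "near n r a b \<Longrightarrow> r \<le> 1 \<Longrightarrow> 0 < nrm n a \<and> 0 < nrm n b"
proof -
  assume *: "near n r a b" "r \<le> 1"
  have "0 \<le> (1 - r) * (nrm n a * nrm n b)" using * by simp
  then have "0 < dot n a b" using *(1) unfolding near_def by linarith
  also have "dot n a b \<le> nrm n a * nrm n b" using dot_le_nrm[of n a b] by simp
  finally show ?thesis by (simp add: zero_less_mult_iff order_less_le)
qed

context hyperplane begin

text \<open>Written as \<open>lin\<close> with an explicit matrix so that the invariance theorem for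
  orthonormal maps applies; \<open>refl_rows_eq\<close> recovers the reflection of each row.\<close>

definition refl_rows :: "nat \<Rightarrow> (nat \<Rightarrow> real) \<Rightarrow> (nat \<times> nat \<Rightarrow> real) \<Rightarrow> nat \<times> nat \<Rightarrow> real" where
  "refl_rows m v = lin (\<lambda>(i, j) (i', j'). if i = i' then (if j = j' then 1 else 0) - 2 * v j * v j' / dot n v v else 0)
      ({..m} \<times> {..<n}) ({..m} \<times> {..<n})"

lemma refl_rows_eq:
  assumes "i \<le> m" "j < n"
  shows "refl_rows m v W (i, j) = reflect n v (\<lambda>j. W (i, j)) j"
proof -
  have "refl_rows m v W (i, j) = (\<Sum>i'\<le>m. \<Sum>j'<n. (if i = i' then (if j = j' then 1 else 0) - 2 * v j * v j' / dot n v v else 0) * W (i', j'))"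
    using assms by (auto simp: refl_rows_def lin_def sum.cartesian_product intro!: sum.cong)
  also have "\<dots> = (\<Sum>i'\<le>m. if i' = i then (\<Sum>j'<n. ((if j = j' then 1 else 0) - 2 * v j * v j' / dot n v v) * W (i, j')) else 0)"
    by (intro sum.cong refl) auto
  also have "\<dots> = (\<Sum>j'<n. ((if j = j' then 1 else 0) - 2 * v j * v j' / dot n v v) * W (i, j'))"
    using assms by simp
  also have "\<dots> = (\<Sum>j'<n. (if j = j' then W (i, j') else 0) - 2 * v j / dot n v v * (v j' * W (i, j')))"
    by (intro sum.cong refl) (simp add: left_diff_distrib)
  also have "\<dots> = reflect n v (\<lambda>j. W (i, j)) j"
  proof -
    have "(\<Sum>j'<n. (if j = j' then W (i, j') else 0) - 2 * v j / dot n v v * (v j' * W (i, j')))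
       = (\<Sum>j'<n. if j = j' then W (i, j') else 0) - 2 * v j / dot n v v * (\<Sum>j'<n. v j' * W (i, j'))"
      by (simp only: sum_subtractf sum_distrib_left)
    also have "\<dots> = W (i, j) - 2 * v j / dot n v v * dot n v (\<lambda>j. W (i, j))"
      using assms by (simp add: dot_def[of n v "\<lambda>j. W (i, j)"])
    finally show ?thesis by (simp add: reflect_def mult_ac)
  qed
  finally show ?thesis .
qed

lemma rowdot_refl_rows: "i \<le> m \<Longrightarrow> rowdot (refl_rows m v W) n i x = rowdot W n i (reflect n v x)"
  unfolding rowdot_eq_dot dot_reflect[symmetric] by (rule dot_cong) (auto simp: refl_rows_eq)

lemma reflect_S: "v \<in> S \<Longrightarrow> x \<in> S \<Longrightarrow> reflect n v x \<in> S"
  unfolding reflect_def by (intro S_diff S_smult)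

text \<open>A reflection along a vector of \<open>S\<close> is self-adjoint and preserves
  \<open>S\<close>, so it carries the normal equations for \<open>W\<close> into those for the
  reflected rows.\<close>

lemma sol_refl_rows:
  assumes e: "e > 0" and v: "v \<in> S" "dot n v v \<noteq> 0"
  shows "sol m e (refl_rows m v W) = reflect n v (sol m e W)"
proof (rule sol_eqI[OF e])
  have s: "is_sol m e W (sol m e W)" by (rule is_sol_sol[OF e])
  show "is_sol m e (refl_rows m v W) (reflect n v (sol m e W))"
    unfolding is_sol_def
  proof (intro conjI ballI)
    show "reflect n v (sol m e W) \<in> S" using s v by (simp add: is_sol_def reflect_S)
    fix x assume x: "x \<in> S"
    have "ridge (refl_rows m v W) m n e (reflect n v (sol m e W)) x = ridge W m n e (sol m e W) (reflect n v x)"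
      by (simp add: ridge_def rowdot_refl_rows dot_reflect reflect_reflect v)
    also have "\<dots> = rowdot W n m (reflect n v x)" using s x v by (simp add: is_sol_def reflect_S)
    finally show "ridge (refl_rows m v W) m n e (reflect n v (sol m e W)) x = rowdot (refl_rows m v W) n m x"
      by (simp add: rowdot_refl_rows)
  qed
qed

lemma nn_integral_refl_rows:
  assumes v: "dot n v v \<noteq> 0" and F: "F \<in> borel_measurable (gauss ({..m} \<times> {..<n}))"
  shows "(\<integral>\<^sup>+W. F (refl_rows m v W) \<partial>gauss ({..m} \<times> {..<n})) = (\<integral>\<^sup>+W. F W \<partial>gauss ({..m} \<times> {..<n}))"
proof -
  define E where "E = (\<lambda>a b. (if a = b then 1 else 0) - 2 * v a * v b / dot n v v)"
  define q where "q = (\<lambda>(i::nat, j) (i', j'). if i = i' then E j j' else 0)"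
  have refl: "refl_rows m v = lin q ({..m} \<times> {..<n}) ({..m} \<times> {..<n})"
    unfolding refl_rows_def q_def E_def ..
  have main: "(\<Sum>k\<in>{..m} \<times> {..<n}. q (i, j) k * q (i', j') k) = (if (i, j) = (i', j') then 1 else 0)"
    if ij: "(i, j) \<in> {..m} \<times> {..<n}" "(i', j') \<in> {..m} \<times> {..<n}" for i j i' j'
  proof -
    \<comment> \<open>The inner product of two rows of the reflection matrix is an entry of the
      reflection applied twice to a unit vector, so orthonormality is the involution
      property.\<close>
    have ref: "E j' = reflect n v (\<lambda>b. if b = j' then 1 else 0)"
      using ij by (auto simp: E_def reflect_def dot_delta fun_eq_iff)
    have "(\<Sum>k\<in>{..m} \<times> {..<n}. q (i, j) k * q (i', j') k) = refl_rows m v (q (i', j')) (i, j)"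
      using ij by (simp add: refl lin_def)
    also have "\<dots> = reflect n v (\<lambda>b. q (i', j') (i, b)) j" using ij by (simp add: refl_rows_eq)
    also have "\<dots> = (if i = i' then reflect n v (E j') j else 0)"
      by (simp add: q_def) (simp add: reflect_def dot_def)
    also have "\<dots> = (if (i, j) = (i', j') then 1 else 0)"
      unfolding ref reflect_reflect[OF v] by auto
    finally show ?thesis .
  qed
  have "orthonormal_on q ({..m} \<times> {..<n}) ({..m} \<times> {..<n})"
    unfolding orthonormal_on_def
  proof (intro ballI)
    fix x y :: "nat \<times> nat" assume xy: "x \<in> {..m} \<times> {..<n}" "y \<in> {..m} \<times> {..<n}"
    obtain i j i' j' where eq: "x = (i, j)" "y = (i', j')" by (cases x, cases y)
    show "(\<Sum>k\<in>{..m} \<times> {..<n}. q x k * q y k) = (if x = y then 1 else 0)"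
      using xy unfolding eq by (rule main)
  qed
  then show ?thesis
    unfolding refl by (intro nn_integral_gauss_orthonormal F) auto
qed

end

locale ridge_hyperplane = hyperplane +
  fixes e :: real
  assumes e: "e > 0"
begin

lemma sol_meas: "(\<lambda>W. sol m e W j) \<in> borel_measurable (gauss ({..m} \<times> {..<n}))"
  by (rule sol_measurable[OF e])

lemma dot_sol_meas:
  "(\<lambda>W. dot n (sol m e W) x) \<in> borel_measurable (gauss ({..m} \<times> {..<n}))"
  "(\<lambda>W. dot n x (sol m e W)) \<in> borel_measurable (gauss ({..m} \<times> {..<n}))"
  "(\<lambda>W. nrm n (sol m e W)) \<in> borel_measurable (gauss ({..m} \<times> {..<n}))"
  unfolding nrm_def dot_def
  by (intro borel_measurable_sum borel_measurable_times sol_meas borel_measurable_const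
    measurable_compose[OF _ borel_measurable_sqrt])+

lemma near_sol_meas: "(\<lambda>W. near n r a (sol m e W)) \<in> measurable (gauss ({..m} \<times> {..<n})) (count_space UNIV)"
  unfolding near_def
  by (intro borel_measurable_pred_less borel_measurable_times borel_measurable_const dot_sol_meas)

text \<open>Reflections in \<open>S\<close> act transitively on directions and preserve the law of \<open>W\<close>, so all caps of a given
  opening are equally likely. Integrating over the centre of the cap replaces the uniform law on the sphere of \<open>S\<close>.\<close>

definition cap :: "nat \<Rightarrow> real \<Rightarrow> (nat \<Rightarrow> real) \<Rightarrow> ennreal" where
  "cap m r a = (\<integral>\<^sup>+W. of_bool (near n r a (sol m e W)) \<partial>gauss ({..m} \<times> {..<n}))"

text \<open>After \<open>a'\<close> is rescaled to the length of \<open>a\<close>, the reflection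
  along the difference of the two vectors swaps them. The difference lies in \<open>S\<close>, so
  this reflection leaves the law of \<open>sol\<close> invariant.\<close>

lemma cap_const:
  assumes a: "a \<in> S" "0 < nrm n a" and a': "a' \<in> S" "0 < nrm n a'"
  shows "cap m r a = cap m r a'"
proof -
  define c where "c = nrm n a / nrm n a'"
  have c: "c > 0" using a a' by (simp add: c_def)
  define b where "b = (\<lambda>j. c * a' j)"
  have bS: "b \<in> S" unfolding b_def by (rule S_smult[OF a'(1)])
  have nb: "nrm n b = nrm n a" using c a' by (simp add: b_def nrm_smult) (simp add: c_def)
  have cap_b: "cap m r a' = cap m r b" unfolding cap_def b_def near_smult[OF c] ..
  define v where "v = (\<lambda>j. a j - b j)"
  have vS: "v \<in> S" unfolding v_def by (intro S_diff a bS)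
  have "cap m r a = cap m r b"
  proof (cases "dot n v v = 0")
    case True
    have "a j = b j" for j
      using dot_eq_0D[OF True, of j] S_out[OF a(1), of j] S_out[OF bS, of j] by (cases "j < n") (auto simp: v_def)
    then have "a = b" by auto
    then show ?thesis by simp
  next
    case False
    have ab: "dot n a a = dot n b b" using nb by (metis nrm_sq)
    have "2 * dot n v a = dot n v v"
      using ab by (simp add: v_def dot_diff_left dot_diff_right dot_commute[of n b a])
    then have "reflect n v a = b" using False by (simp add: reflect_def v_def fun_eq_iff)
    have m: "(\<lambda>W. of_bool (near n r a (sol m e W)) :: ennreal) \<in> borel_measurable (gauss ({..m} \<times> {..<n}))"
      by (intro of_bool_measurable near_sol_meas)
    have "cap m r a = (\<integral>\<^sup>+W. of_bool (near n r a (sol m e (refl_rows m v W))) \<partial>gauss ({..m} \<times> {..<n}))"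
      unfolding cap_def by (rule nn_integral_refl_rows[OF False m, symmetric])
    also have "\<dots> = cap m r b"
      unfolding sol_refl_rows[OF e vS False] near_reflect[OF False] \<open>reflect n v a = b\<close> cap_def ..
    finally show ?thesis .
  qed
  then show ?thesis using cap_b by simp
qed

lemma sol_0_row: "sol 0 e Z = proj (\<lambda>j. Z (0, j))"
  by (rule sol_0[OF e])

text \<open>Positivity allows the cap factor to be cancelled in \<open>cap_compare\<close>. A row in
  a small box around \<open>a\<close> projects close to \<open>a\<close>, and boxes have positive
  Gaussian mass.\<close>

lemma cap_0_pos:
  assumes a: "a \<in> S" "0 < nrm n a" and r: "0 < r" "r < 1"
  shows "0 < cap 0 r a"
proof -
  \<comment> \<open>Chosen so that \<open>(1 - r) * (nrm n a + t) < nrm n a - t\<close>: a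
    perturbation of norm \<open>t\<close> stays inside the cap.\<close>
  define t where "t = r * nrm n a / 3"
  have t: "t > 0" using a r by (simp add: t_def)
  define \<eta> where "\<eta> = t / (real n + 1)"
  have \<eta>: "\<eta> > 0" "real n * \<eta> \<le> t" using t by (auto simp: \<eta>_def field_simps)
  define B where "B = (\<lambda>(i::nat, j). {a j - \<eta><..<a j + \<eta>})"
  have "near n r a (sol 0 e Z)" if Z: "Z \<in> PiE ({..0} \<times> {..<n}) B" for Z
  proof -
    define z where "z = (\<lambda>j. Z (0, j))"
    have "\<bar>z j - a j\<bar> \<le> \<eta>" if "j < n" for j
      using PiE_mem[OF Z, of "(0, j)"] that by (auto simp: B_def z_def abs_le_iff)
    then have "(\<Sum>j<n. \<bar>z j - a j\<bar>) \<le> (\<Sum>j<n. \<eta>)" by (intro sum_mono) auto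
    then have "nrm n (\<lambda>j. z j - a j) \<le> t"
      using L2_set_le_sum_abs[of "\<lambda>j. z j - a j" "{..<n}"] \<eta> by (simp add: nrm_L2)
    moreover have "proj (\<lambda>j. z j - a j) = (\<lambda>j. proj z j - a j)"
      using proj_comb[of 1 z "- 1" a] a by (simp add: proj_id)
    ultimately have d: "nrm n (\<lambda>j. proj z j - a j) \<le> t" using nrm_proj_le[of "\<lambda>j. z j - a j"] by simp
    have "dot n a (proj z) = dot n a a + dot n a (\<lambda>j. proj z j - a j)" by (simp add: dot_diff_right)
    moreover have "\<bar>dot n a (\<lambda>j. proj z j - a j)\<bar> \<le> nrm n a * t"
      using dot_le_nrm d by (rule order_trans[OF _ mult_left_mono]) simp
    ultimately have 1: "dot n a (proj z) \<ge> nrm n a * (nrm n a - t)" by (simp add: nrm_sq[symmetric] power2_eq_square algebra_simps)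
    have "nrm n (proj z) \<le> nrm n a + t" using nrm_triangle[of n a "\<lambda>j. proj z j - a j"] d by simp
    then have "(1 - r) * (nrm n a * nrm n (proj z)) \<le> (1 - r) * (nrm n a * (nrm n a + t))"
      using r by (intro mult_left_mono) auto
    also have "\<dots> = nrm n a * ((1 - r) * (nrm n a + t))" by simp
    also have "\<dots> < nrm n a * (nrm n a - t)"
    proof (rule mult_strict_left_mono)
      have "r * t > 0" using r t by simp
      then show "(1 - r) * (nrm n a + t) < nrm n a - t" using t by (simp add: t_def algebra_simps)
    qed (use a in simp)
    finally show ?thesis using 1 by (simp add: near_def sol_0_row z_def)
  qed
  then have "(\<integral>\<^sup>+Z. indicator (PiE ({..0} \<times> {..<n}) B) Z \<partial>gauss ({..0} \<times> {..<n})) \<le> cap 0 r a"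
    unfolding cap_def by (intro nn_integral_mono) (auto simp: indicator_def)
  moreover have B: "PiE ({..0} \<times> {..<n}) B \<in> sets (gauss ({..0} \<times> {..<n}))"
    unfolding gauss_def by (intro sets_PiM_I_finite) (auto simp: B_def)
  moreover have "emeasure (gauss ({..0} \<times> {..<n})) (PiE ({..0} \<times> {..<n}) B) = (\<Prod>p\<in>{..0} \<times> {..<n}. emeasure stdn (B p))"
    unfolding gauss_def by (intro G.emeasure_PiM) (auto simp: B_def)
  moreover have "(\<Prod>p\<in>{..0} \<times> {..<n}. emeasure stdn (B p)) > 0"
  proof -
    have "emeasure stdn (B p) \<noteq> 0" for p
      using emeasure_std_normal_interval_pos[of "a (snd p) - \<eta>" "a (snd p) + \<eta>"] \<eta> by (auto simp: B_def split: prod.splits)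
    then show ?thesis by (simp add: zero_less_iff_neq_zero)
  qed
  ultimately show ?thesis by (metis nn_integral_indicator order_less_le_trans)
qed

text \<open>The inner product of the row with the unit vector along \<open>a\<close> is a standard
  normal variable, hence almost surely nonzero, and it agrees with that of the projection.\<close>

lemma sol_0_nonzero:
  assumes a: "a \<in> S" "0 < nrm n a"
  shows "(\<integral>\<^sup>+Z. of_bool (0 < nrm n (sol 0 e Z)) \<partial>gauss ({..0} \<times> {..<n})) = 1"
proof -
  interpret P: prob_space "gauss ({..0::nat} \<times> {..<n})" by (rule prob_space_gauss)
  define v where "v = (\<lambda>(i::nat, j). a j / nrm n a)"
  have dv: "(\<Sum>p\<in>{..0} \<times> {..<n}. v p * Z p) = dot n a (\<lambda>j. Z (0, j)) / nrm n a" for Z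
  proof -
    have "(\<Sum>p\<in>{..0} \<times> {..<n}. v p * Z p) = (\<Sum>i\<in>{..0}. \<Sum>j<n. v (i, j) * Z (i, j))"
      by (subst sum.cartesian_product) (auto intro!: sum.cong)
    then show ?thesis by (simp add: v_def dot_def sum_divide_distrib)
  qed
  have v1: "(\<Sum>p\<in>{..0} \<times> {..<n}. v p * v p) = 1"
  proof -
    have "(\<Sum>p\<in>{..0} \<times> {..<n}. v p * v p) = dot n a (\<lambda>j. 1 / nrm n a * a j) / nrm n a"
      unfolding dv by (simp add: v_def)
    also have "\<dots> = 1" using a by (simp only: dot_smult_right nrm_sq[symmetric]) (simp add: power2_eq_square)
    finally show ?thesis .
  qed
  have "(\<integral>\<^sup>+Z. of_bool ((\<Sum>p\<in>{..0} \<times> {..<n}. v p * Z p) \<noteq> 0) \<partial>gauss ({..0} \<times> {..<n})) = (\<integral>\<^sup>+x. of_bool (x \<noteq> 0) \<partial>stdn)"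
    by (rule nn_integral_gauss_unit[OF _ v1]) auto
  also have "\<dots> = (\<integral>\<^sup>+x. indicator (- {0}) x \<partial>stdn)" by (intro nn_integral_cong) (auto simp: indicator_def)
  also have "\<dots> = emeasure stdn (- {0})" by simp
  also have "\<dots> = 1"
    using stdn.prob_compl[of "{0}"] emeasure_std_normal_singleton[of 0]
    by (simp add: Compl_eq_Diff_UNIV stdn.emeasure_eq_measure)
  finally have "1 = (\<integral>\<^sup>+Z. of_bool ((\<Sum>p\<in>{..0} \<times> {..<n}. v p * Z p) \<noteq> 0) \<partial>gauss ({..0} \<times> {..<n}))" ..
  also have "\<dots> \<le> (\<integral>\<^sup>+Z. of_bool (0 < nrm n (sol 0 e Z)) \<partial>gauss ({..0} \<times> {..<n}))"
  proof (intro nn_integral_mono)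
    fix Z
    have "dot n a (\<lambda>j. Z (0, j)) = dot n a (sol 0 e Z)"
      using a by (simp add: sol_0_row dot_proj dot_commute[of n a])
    then show "(of_bool ((\<Sum>p\<in>{..0} \<times> {..<n}. v p * Z p) \<noteq> 0) :: ennreal) \<le> of_bool (0 < nrm n (sol 0 e Z))"
      unfolding dv using dot_le_nrm[of n a "sol 0 e Z"] by (auto simp: order_less_le)
  qed
  finally have "1 \<le> (\<integral>\<^sup>+Z. of_bool (0 < nrm n (sol 0 e Z)) \<partial>gauss ({..0} \<times> {..<n}))" .
  moreover have "(\<integral>\<^sup>+Z. of_bool (0 < nrm n (sol 0 e Z)) \<partial>gauss ({..0} \<times> {..<n})) \<le> (\<integral>\<^sup>+Z. 1 \<partial>gauss ({..0::nat} \<times> {..<n}))"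
    by (intro nn_integral_mono) auto
  moreover have "(\<integral>\<^sup>+Z. 1 \<partial>gauss ({..0::nat} \<times> {..<n})) = 1"
    unfolding nn_integral_const P.emeasure_space_1 by simp
  ultimately show ?thesis by (metis antisym)
qed

text \<open>Double counting with an independent copy. Given either of \<open>sol m e W\<close> and
  \<open>sol 0 e Z\<close>, if it is nonzero, the probability that the two are near each other does
  not depend on its direction. Integrating in both orders gives P(Gp) * cap <= P(Gq) * cap, and the
  positive finite cap factor cancels.\<close>

lemma cap_compare:
  fixes Gp Gq :: "(nat \<Rightarrow> real) \<Rightarrow> bool"
  assumes r: "0 < r" "r < 1"
    and Gp: "(\<lambda>W. Gp (sol m e W)) \<in> measurable (gauss ({..m} \<times> {..<n})) (count_space UNIV)"
    and Gq: "(\<lambda>W. Gq (sol 0 e W)) \<in> measurable (gauss ({..0} \<times> {..<n})) (count_space UNIV)"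
    and imp: "\<And>a b. a \<in> S \<Longrightarrow> b \<in> S \<Longrightarrow> Gp a \<Longrightarrow> near n r a b \<Longrightarrow> Gq b"
  shows "(\<integral>\<^sup>+W. of_bool (0 < nrm n (sol m e W) \<and> Gp (sol m e W)) \<partial>gauss ({..m} \<times> {..<n}))
     \<le> (\<integral>\<^sup>+W. of_bool (Gq (sol 0 e W)) \<partial>gauss ({..0} \<times> {..<n}))"
proof (cases "\<exists>a\<in>S. 0 < nrm n a")
  case False
  then have "\<not> 0 < nrm n (sol m e W)" for W using sol_in_S[OF e] by blast
  then show ?thesis by simp
next
  case True
  then obtain a where a: "a \<in> S" "0 < nrm n a" by blast
  let ?M = "gauss ({..m} \<times> {..<n})" and ?Z = "gauss ({..0::nat} \<times> {..<n})"
  interpret M: prob_space ?M by (rule prob_space_gauss)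
  interpret Z: prob_space ?Z by (rule prob_space_gauss)
  interpret MZ: pair_sigma_finite ?M ?Z ..
  define nr where "nr = (\<lambda>W Z. near n r (sol m e W) (sol 0 e Z))"
  have nr[measurable]: "(\<lambda>(W, Z). nr W Z) \<in> measurable (?M \<Otimes>\<^sub>M ?Z) (count_space UNIV)"
  proof -
    have 1: "(\<lambda>p. sol m e (fst p) j) \<in> borel_measurable (?M \<Otimes>\<^sub>M ?Z)" for j
      by (rule measurable_compose[OF measurable_fst sol_meas])
    have 2: "(\<lambda>p. sol 0 e (snd p) j) \<in> borel_measurable (?M \<Otimes>\<^sub>M ?Z)" for j
      by (rule measurable_compose[OF measurable_snd sol_meas])
    show ?thesis unfolding nr_def near_def nrm_def dot_def split_def
      by (intro borel_measurable_pred_less borel_measurable_times borel_measurable_const borel_measurable_sum 1 2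
         measurable_compose[OF _ borel_measurable_sqrt])
  qed
  have nr1: "nr W \<in> measurable ?Z (count_space UNIV)" for W
    unfolding nr_def by (rule near_sol_meas)
  have nr2: "(\<lambda>W. nr W Z) \<in> measurable ?M (count_space UNIV)" for Z
  proof -
    have "near n r x y = near n r y x" for x y by (simp add: near_def dot_commute mult.commute)
    then show ?thesis unfolding nr_def using near_sol_meas[of r "sol 0 e Z" m] by simp
  qed
  have pos1: "(\<lambda>W. 0 < nrm n (sol m e W)) \<in> measurable ?M (count_space UNIV)"
    and pos2: "(\<lambda>W. 0 < nrm n (sol 0 e W)) \<in> measurable ?Z (count_space UNIV)"
    by (intro borel_measurable_pred_less borel_measurable_const dot_sol_meas)+
  have nrb: "(\<lambda>(W, Z). of_bool (nr W Z) :: ennreal) \<in> borel_measurable (?M \<Otimes>\<^sub>M ?Z)"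
    using of_bool_measurable[OF nr] by (simp add: split_def)
  have in1: "(\<integral>\<^sup>+Z. of_bool (nr W Z) \<partial>?Z) = of_bool (0 < nrm n (sol m e W)) * cap 0 r a" for W
  proof (cases "0 < nrm n (sol m e W)")
    case True
    then have "cap 0 r (sol m e W) = cap 0 r a" by (intro cap_const sol_in_S e a)
    then show ?thesis using True by (simp add: nr_def cap_def)
  next
    case False
    then have "\<not> nr W Z" for Z using near_nrm_pos r by (auto simp: nr_def)
    then show ?thesis using False by simp
  qed
  have in2: "(\<integral>\<^sup>+W. of_bool (nr W Z) \<partial>?M) = of_bool (0 < nrm n (sol 0 e Z)) * cap m r a" for Z
  proof (cases "0 < nrm n (sol 0 e Z)")
    case True
    have "near n r x y = near n r y x" for x y by (simp add: near_def dot_commute mult.commute)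
    then have "(\<integral>\<^sup>+W. of_bool (nr W Z) \<partial>?M) = cap m r (sol 0 e Z)" by (simp add: nr_def cap_def)
    moreover have "cap m r (sol 0 e Z) = cap m r a" using True by (intro cap_const sol_in_S e a)
    ultimately show ?thesis using True by simp
  next
    case False
    then have "\<not> nr W Z" for W using near_nrm_pos r by (auto simp: nr_def)
    then show ?thesis using False by simp
  qed
  \<comment> \<open>The double integral without \<open>Gp\<close> and \<open>Gq\<close> compares the
    two cap factors; the indicator that \<open>sol m\<close> is nonzero is bounded by one.\<close>
  have "cap m r a = (\<integral>\<^sup>+Z. of_bool (0 < nrm n (sol 0 e Z)) * cap m r a \<partial>?Z)"
    unfolding nn_integral_multc[OF of_bool_measurable[OF pos2]] sol_0_nonzero[OF a] by simp
  also have "\<dots> = (\<integral>\<^sup>+Z. \<integral>\<^sup>+W. of_bool (nr W Z) \<partial>?M \<partial>?Z)" by (simp add: in2)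
  also have "\<dots> = (\<integral>\<^sup>+W. \<integral>\<^sup>+Z. of_bool (nr W Z) \<partial>?Z \<partial>?M)"
    by (rule MZ.Fubini'[OF nrb])
  also have "\<dots> \<le> (\<integral>\<^sup>+W. cap 0 r a \<partial>?M)" unfolding in1 by (intro nn_integral_mono) auto
  finally have cc: "cap m r a \<le> cap 0 r a" by (simp add: M.emeasure_space_1)
  have fin: "cap 0 r a \<noteq> \<top>"
  proof -
    have "cap 0 r a \<le> (\<integral>\<^sup>+Z. 1 \<partial>?Z)" unfolding cap_def by (intro nn_integral_mono) auto
    then have "cap 0 r a \<le> 1" unfolding nn_integral_const Z.emeasure_space_1 by simp
    then show ?thesis by (auto simp: top_unique)
  qed
  let ?L = "(\<integral>\<^sup>+W. of_bool (0 < nrm n (sol m e W) \<and> Gp (sol m e W)) \<partial>?M)" and ?R = "(\<integral>\<^sup>+W. of_bool (Gq (sol 0 e W)) \<partial>?Z)"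
  have "?L * cap 0 r a = (\<integral>\<^sup>+W. of_bool (0 < nrm n (sol m e W) \<and> Gp (sol m e W)) * cap 0 r a \<partial>?M)"
    by (rule nn_integral_multc[symmetric]) (intro of_bool_measurable pred_intros_logic pos1 Gp)
  also have "\<dots> = (\<integral>\<^sup>+W. \<integral>\<^sup>+Z. of_bool (Gp (sol m e W)) * of_bool (nr W Z) \<partial>?Z \<partial>?M)"
    unfolding nn_integral_cmult[OF of_bool_measurable[OF nr1]] in1 by (intro nn_integral_cong) auto
  also have "\<dots> \<le> (\<integral>\<^sup>+W. \<integral>\<^sup>+Z. of_bool (Gq (sol 0 e Z)) * of_bool (nr W Z) \<partial>?Z \<partial>?M)"
    using imp sol_in_S[OF e] by (intro nn_integral_mono) (auto simp: nr_def)
  also have "\<dots> = (\<integral>\<^sup>+Z. \<integral>\<^sup>+W. of_bool (Gq (sol 0 e Z)) * of_bool (nr W Z) \<partial>?M \<partial>?Z)"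
  proof (rule MZ.Fubini'[symmetric])
    have "(\<lambda>p. of_bool (Gq (sol 0 e (snd p))) :: ennreal) \<in> borel_measurable (?M \<Otimes>\<^sub>M ?Z)"
      by (rule measurable_compose[OF measurable_snd of_bool_measurable[OF Gq]])
    from borel_measurable_times_ennreal[OF this nrb]
    show "(\<lambda>(x, y). of_bool (Gq (sol 0 e y)) * of_bool (nr x y) :: ennreal) \<in> borel_measurable (?M \<Otimes>\<^sub>M ?Z)"
      by (simp add: split_def)
  qed
  also have "\<dots> = (\<integral>\<^sup>+Z. of_bool (Gq (sol 0 e Z)) * (of_bool (0 < nrm n (sol 0 e Z)) * cap m r a) \<partial>?Z)"
    unfolding nn_integral_cmult[OF of_bool_measurable[OF nr2]] in2 ..
  also have "\<dots> \<le> (\<integral>\<^sup>+Z. of_bool (Gq (sol 0 e Z)) * cap 0 r a \<partial>?Z)"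
    using cc by (intro nn_integral_mono mult_mono) auto
  also have "\<dots> = ?R * cap 0 r a" by (rule nn_integral_multc) (rule of_bool_measurable[OF Gq])
  finally have "?L * cap 0 r a \<le> ?R * cap 0 r a" .
  then show ?thesis using cap_0_pos[OF a r] fin
    by (simp add: ennreal_mult_le_mult_iff mult.commute[of _ "cap 0 r a"])
qed

section \<open>Decoupling the residual\<close>

definition pm :: "nat \<Rightarrow> nat \<Rightarrow> real" where
  "pm j j' = (if j \<in> J \<and> j' \<in> J then (if j = j' then 1 else 0) - u j * u j' / dot n u u else 0)"

lemma pm_sum: "j < n \<Longrightarrow> (\<Sum>j'<n. pm j j' * x j') = proj x j"
proof (cases "j \<in> J")
  case True
  assume j: "j < n"
  have "(\<Sum>j'<n. pm j j' * x j') = (\<Sum>j'<n. (if j' = j then x j' else 0) - u j / dot n u u * (u j' * x j'))"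
    using True u by (intro sum.cong refl) (auto simp: pm_def left_diff_distrib)
  also have "\<dots> = (\<Sum>j'<n. if j' = j then x j' else 0) - u j / dot n u u * (\<Sum>j'<n. u j' * x j')"
    by (simp only: sum_subtractf sum_distrib_left)
  also have "\<dots> = proj x j" using True j by (simp add: proj_def dot_def mult_ac)
  finally show ?thesis .
qed (simp add: pm_def proj_def)

lemma pm_proj: "l < n \<Longrightarrow> pm l = proj (\<lambda>j. if j = l then 1 else 0)"
  using u[of l] by (auto simp: pm_def proj_def fun_eq_iff dot_delta)

lemma pm_pm: "j < n \<Longrightarrow> l < n \<Longrightarrow> (\<Sum>j'<n. pm j j' * pm l j') = pm l j"
  by (subst pm_sum) (auto simp: pm_proj proj_id proj_in_S)

lemma pm_commute: "pm j l = pm l j"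
  by (auto simp: pm_def)

text \<open>\<open>mix\<close> keeps the \<open>S\<close>-component of the first \<open>m + 1\<close> rows and takes the orthogonal component from \<open>m + 1\<close>
  fresh rows. This preserves the law and does not change \<open>sol\<close>.\<close>

definition mixq :: "nat \<Rightarrow> nat \<times> nat \<Rightarrow> nat \<times> nat \<Rightarrow> real" where
  "mixq m = (\<lambda>(i, j) (i', j'). (if i' = i then pm j j' else 0) + (if i' = i + m + 1 then (if j' = j then 1 else 0) - pm j j' else 0))"

definition mix :: "nat \<Rightarrow> (nat \<times> nat \<Rightarrow> real) \<Rightarrow> nat \<times> nat \<Rightarrow> real" where
  "mix m = lin (mixq m) ({..2 * m + 1} \<times> {..<n}) ({..m} \<times> {..<n})"

lemma sum_mixq:
  assumes "i \<le> m"
  shows "(\<Sum>k\<in>{..2 * m + 1} \<times> {..<n}. mixq m (i, j) k * Z k)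
    = (\<Sum>j'<n. pm j j' * Z (i, j')) + (\<Sum>j'<n. ((if j' = j then 1 else 0) - pm j j') * Z (i + m + 1, j'))"
proof -
  have "(\<Sum>k\<in>{..2 * m + 1} \<times> {..<n}. mixq m (i, j) k * Z k) = (\<Sum>i'\<le>2 * m + 1. \<Sum>j'<n. mixq m (i, j) (i', j') * Z (i', j'))"
    by (subst sum.cartesian_product) (auto intro!: sum.cong)
  also have "\<dots> = (\<Sum>i'\<le>2 * m + 1. (if i' = i then (\<Sum>j'<n. pm j j' * Z (i, j')) else 0)
      + (if i' = i + m + 1 then (\<Sum>j'<n. ((if j' = j then 1 else 0) - pm j j') * Z (i + m + 1, j')) else 0))"
    by (intro sum.cong refl) (auto simp: mixq_def)
  also have "\<dots> = (\<Sum>j'<n. pm j j' * Z (i, j')) + (\<Sum>j'<n. ((if j' = j then 1 else 0) - pm j j') * Z (i + m + 1, j'))"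
    unfolding sum.distrib using assms by simp
  finally show ?thesis .
qed

lemma sum_id_minus_pm:
  "j < n \<Longrightarrow> (\<Sum>j'<n. ((if j' = j then 1 else 0) - pm j j') * x j') = x j - proj x j"
proof -
  assume j: "j < n"
  have "(\<Sum>j'<n. ((if j' = j then 1 else 0) - pm j j') * x j') = (\<Sum>j'<n. (if j' = j then x j' else 0) - pm j j' * x j')"
    by (intro sum.cong refl) (simp add: left_diff_distrib)
  also have "\<dots> = x j - proj x j" using j by (simp add: sum_subtractf pm_sum)
  finally show ?thesis .
qed

lemma mix_eq:
  assumes "i \<le> m" "j < n"
  shows "mix m Z (i, j) = proj (\<lambda>j. Z (i, j)) j + (Z (i + m + 1, j) - proj (\<lambda>j. Z (i + m + 1, j)) j)"
  unfolding mix_def using assms sum_mixq[OF assms(1), of j Z]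
    pm_sum[OF assms(2), of "\<lambda>j. Z (i, j)"] sum_id_minus_pm[OF assms(2), of "\<lambda>j. Z (i + m + 1, j)"]
  by (simp add: lin_def)

text \<open>With P the matrix \<open>pm\<close>, which is symmetric and idempotent, the two blocks P
  and 1 - P of a row give P P + (1 - P) (1 - P) = 1.\<close>

lemma orthonormal_mixq: "orthonormal_on (mixq m) ({..2 * m + 1} \<times> {..<n}) ({..m} \<times> {..<n})"
  unfolding orthonormal_on_def
proof (intro ballI)
  fix x y :: "nat \<times> nat" assume xy: "x \<in> {..m} \<times> {..<n}" "y \<in> {..m} \<times> {..<n}"
  obtain i j i' j' where eq: "x = (i, j)" "y = (i', j')" by (cases x, cases y)
  have ij: "i \<le> m" "j < n" "i' \<le> m" "j' < n" using xy eq by auto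
  have r1: "mixq m (i', j') (i, b) = (if i = i' then pm j' b else 0)" for b
    using ij by (auto simp: mixq_def)
  have r2: "mixq m (i', j') (i + m + 1, b) = (if i = i' then (if b = j' then 1 else 0) - pm j' b else 0)" for b
    using ij by (auto simp: mixq_def)
  have "(\<Sum>k\<in>{..2 * m + 1} \<times> {..<n}. mixq m (i, j) k * mixq m (i', j') k)
    = (\<Sum>b<n. pm j b * mixq m (i', j') (i, b)) + (\<Sum>b<n. ((if b = j then 1 else 0) - pm j b) * mixq m (i', j') (i + m + 1, b))"
    by (rule sum_mixq[OF ij(1)])
  also have "\<dots> = (if i = i' then (\<Sum>b<n. pm j b * pm j' b) + (\<Sum>b<n. ((if b = j then 1 else 0) - pm j b) * ((if b = j' then 1 else 0) - pm j' b)) else 0)"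
    by (simp only: r1 r2) simp
  also have "(\<Sum>b<n. pm j b * pm j' b) = pm j' j" using ij by (intro pm_pm)
  also have "(\<Sum>b<n. ((if b = j then 1 else 0) - pm j b) * ((if b = j' then 1 else 0) - pm j' b))
     = ((if j = j' then 1 else 0) - pm j' j) - ((if j' = j then pm j j' else pm j j') - pm j' j)"
    unfolding sum_id_minus_pm[OF ij(2), of "\<lambda>b. (if b = j' then 1 else 0) - pm j' b"]
    unfolding pm_sum[OF ij(2), symmetric] right_diff_distrib sum_subtractf pm_pm[OF ij(2,4)]
    using ij by (simp add: if_distrib[of "\<lambda>x. _ * x"] cong: if_cong)
  finally show "(\<Sum>k\<in>{..2 * m + 1} \<times> {..<n}. mixq m x k * mixq m y k) = (if x = y then 1 else 0)"
    by (simp add: eq pm_commute[of j j'])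
qed

lemma rowdot_mix: "i \<le> m \<Longrightarrow> x \<in> S \<Longrightarrow> rowdot (mix m Z) n i x = rowdot Z n i x"
proof -
  assume i: "i \<le> m" and x: "x \<in> S"
  have "rowdot (mix m Z) n i x = dot n (\<lambda>j. proj (\<lambda>j. Z (i, j)) j + (Z (i + m + 1, j) - proj (\<lambda>j. Z (i + m + 1, j)) j)) x"
    unfolding rowdot_eq_dot using i by (intro dot_cong) (auto simp: mix_eq)
  then show ?thesis using x by (simp add: dot_add_left dot_diff_left dot_proj rowdot_eq_dot)
qed

text \<open>The residual \<open>g - A\<^sup>T A d / e\<close> at \<open>d = sol m e W\<close>, as a linear combination of the rows.\<close>

definition coef :: "nat \<Rightarrow> (nat \<times> nat \<Rightarrow> real) \<Rightarrow> nat \<Rightarrow> real" where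
  "coef m W i = (if i = m then 1 else - (rowdot W n i (sol m e W) / e))"

definition pvec :: "nat \<Rightarrow> (nat \<times> nat \<Rightarrow> real) \<Rightarrow> nat \<Rightarrow> real" where
  "pvec m W = (\<lambda>j\<in>{..<n}. \<Sum>i\<le>m. coef m W i * W (i, j))"

lemma sol_mix: "sol m e (mix m Z) = sol m e Z"
  by (rule sol_cong_S[OF e]) (simp add: rowdot_mix)

lemma coef_mix: "i \<le> m \<Longrightarrow> coef m (mix m Z) i = coef m Z i"
  using sol_in_S[OF e] by (simp add: coef_def sol_mix rowdot_mix)

lemma coord_meas: "i \<le> m \<Longrightarrow> j < n \<Longrightarrow> (\<lambda>W. W (i, j)) \<in> borel_measurable (gauss ({..m} \<times> {..<n}))"
  by (intro measurable_gauss_coord) auto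

lemma rowdot_sol_meas: "i \<le> m \<Longrightarrow> (\<lambda>W. rowdot W n i (sol m e W)) \<in> borel_measurable (gauss ({..m} \<times> {..<n}))"
  unfolding rowdot_def
  by (rule borel_measurable_sum, rule borel_measurable_times, rule coord_meas, assumption, simp, rule sol_meas)

lemma coef_meas:
  assumes "i \<le> m"
  shows "(\<lambda>W. coef m W i) \<in> borel_measurable (gauss ({..m} \<times> {..<n}))"
proof (cases "i = m")
  case True
  then have "(\<lambda>W. coef m W i) = (\<lambda>W. 1)" by (simp add: coef_def fun_eq_iff)
  then show ?thesis by (simp only: borel_measurable_const)
next
  case False
  have "(\<lambda>W. - (rowdot W n i (sol m e W) / e)) \<in> borel_measurable (gauss ({..m} \<times> {..<n}))"
    by (rule borel_measurable_uminus, rule borel_measurable_divide, rule rowdot_sol_meas[OF assms], rule borel_measurable_const)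
  moreover have "(\<lambda>W. coef m W i) = (\<lambda>W. - (rowdot W n i (sol m e W) / e))"
    using False by (simp add: coef_def fun_eq_iff)
  ultimately show ?thesis by (simp only:)
qed

lemma pvec_meas: "pvec m \<in> measurable (gauss ({..m} \<times> {..<n})) (gauss {..<n})"
proof -
  have "(\<lambda>W. \<lambda>j\<in>{..<n}. \<Sum>i\<le>m. coef m W i * W (i, j)) \<in> measurable (gauss ({..m} \<times> {..<n})) (PiM {..<n} (\<lambda>_. borel))"
    by (rule measurable_restrict, rule borel_measurable_sum, rule borel_measurable_times, rule coef_meas, simp, rule coord_meas) simp_all
  then show ?thesis unfolding pvec_def[abs_def] by (simp only: measurable_cong_sets[OF refl sets_gauss])
qed

text \<open>After \<open>mix\<close>, \<open>sol\<close> and the coefficients depend on the first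
  \<open>m + 1\<close> rows \<open>y\<close> only, while \<open>h\<close> sees the residual through
  its component orthogonal to \<open>S\<close>, a combination of the fresh rows with coefficients
  \<open>coef m y i\<close>. For fixed \<open>y\<close> this is \<open>s\<close> times a standard
  Gaussian vector. Scale invariance of \<open>h\<close> removes \<open>s\<close>; for
  \<open>m = 0\<close> one has \<open>s = 1\<close>, which admits test functions that are not scale
  invariant.\<close>

lemma nn_integral_decouple:
  fixes Gp :: "(nat \<Rightarrow> real) \<Rightarrow> bool" and h :: "(nat \<Rightarrow> real) \<Rightarrow> ennreal"
  assumes Gp: "(\<lambda>W. Gp (sol m e W)) \<in> measurable (gauss ({..m} \<times> {..<n})) (count_space UNIV)"
    and h: "h \<in> borel_measurable (gauss {..<n})"
    and h_cong: "\<And>z z'. dot n u z = dot n u z' \<Longrightarrow> (\<And>j. j < n \<Longrightarrow> j \<notin> J \<Longrightarrow> z j = z' j) \<Longrightarrow> h z = h z'"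
    and h_scale: "\<And>t z. m > 0 \<Longrightarrow> 0 < t \<Longrightarrow> h (\<lambda>j. t * z j) = h z"
  shows "(\<integral>\<^sup>+W. of_bool (Gp (sol m e W)) * h (pvec m W) \<partial>gauss ({..m} \<times> {..<n}))
     = (\<integral>\<^sup>+W. of_bool (Gp (sol m e W)) \<partial>gauss ({..m} \<times> {..<n})) * (\<integral>\<^sup>+z. h z \<partial>gauss {..<n})"
proof -
  let ?I = "{..m} \<times> {..<n}" and ?X = "{m + 1..2 * m + 1} \<times> {..<n}" and ?K = "{..2 * m + 1} \<times> {..<n}"
  have K: "?K = ?I \<union> ?X" by auto
  define F where "F = (\<lambda>W. of_bool (Gp (sol m e W)) * h (pvec m W))"
  have Fm: "F \<in> borel_measurable (gauss ?I)"
    unfolding F_def by (intro borel_measurable_times_ennreal of_bool_measurable Gp measurable_compose[OF pvec_meas h])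
  have mixm: "mix m \<in> measurable (gauss ?K) (gauss ?I)" unfolding mix_def by (rule lin_measurable)
  \<comment> \<open>All projected parts are orthogonal to \<open>u\<close> and vanish outside
    \<open>J\<close>, so \<open>h\<close> sees the fresh rows alone.\<close>
  have xi: "h (pvec m (mix m Z)) = h (\<lambda>j\<in>{..<n}. \<Sum>i\<le>m. coef m Z i * Z (i + m + 1, j))" for Z
  proof (rule h_cong)
    have P: "pvec m (mix m Z) j = (\<Sum>i\<le>m. coef m Z i * (proj (\<lambda>j. Z (i, j)) j + (Z (i + m + 1, j) - proj (\<lambda>j. Z (i + m + 1, j)) j)))" if "j < n" for j
      using that by (simp add: pvec_def coef_mix mix_eq)
    show "pvec m (mix m Z) j = (\<lambda>j\<in>{..<n}. \<Sum>i\<le>m. coef m Z i * Z (i + m + 1, j)) j" if "j < n" "j \<notin> J" for j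
      using that by (simp add: P proj_def)
    have D: "dot n u (\<lambda>j\<in>{..<n}. \<Sum>i\<le>m. c i * Y i j) = (\<Sum>i\<le>m. c i * dot n u (Y i))" for c :: "nat \<Rightarrow> real" and Y
      unfolding dot_def by (simp add: sum_distrib_left mult.left_commute) (rule sum.swap)
    have "dot n u (pvec m (mix m Z)) = dot n u (\<lambda>j\<in>{..<n}. \<Sum>i\<le>m. coef m Z i * (proj (\<lambda>j. Z (i, j)) j + (Z (i + m + 1, j) - proj (\<lambda>j. Z (i + m + 1, j)) j)))"
      by (rule dot_cong) (simp_all add: P)
    also have "\<dots> = dot n u (\<lambda>j\<in>{..<n}. \<Sum>i\<le>m. coef m Z i * Z (i + m + 1, j))"
      unfolding D by (simp only: dot_add_right dot_diff_right dot_u_proj, simp)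
    finally show "dot n u (pvec m (mix m Z)) = dot n u (\<lambda>j\<in>{..<n}. \<Sum>i\<le>m. coef m Z i * Z (i + m + 1, j))" .
  qed
  have "(\<integral>\<^sup>+W. F W \<partial>gauss ?I) = (\<integral>\<^sup>+Z. F (mix m Z) \<partial>gauss ?K)"
    unfolding mix_def by (rule nn_integral_gauss_orthonormal[OF _ _ orthonormal_mixq Fm, symmetric]) auto
  also have "\<dots> = (\<integral>\<^sup>+y. \<integral>\<^sup>+x. F (mix m (merge ?I ?X (y, x))) \<partial>gauss ?X \<partial>gauss ?I)"
    unfolding gauss_def K
  proof (rule G.product_nn_integral_fold)
    show "(\<lambda>Z. F (mix m Z)) \<in> borel_measurable (PiM (?I \<union> ?X) (\<lambda>_. stdn))"
      unfolding gauss_def[symmetric] K[symmetric] by (rule measurable_compose[OF mixm Fm])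
  qed auto
  also have "\<dots> = (\<integral>\<^sup>+y. of_bool (Gp (sol m e y)) * (\<integral>\<^sup>+z. h z \<partial>gauss {..<n}) \<partial>gauss ?I)"
  proof (rule nn_integral_cong)
    fix y :: "nat \<times> nat \<Rightarrow> real"
    define c where "c = coef m y"
    \<comment> \<open>Positive because the auxiliary row \<open>m\<close> enters with coefficient
      \<open>1\<close>.\<close>
    define s where "s = sqrt (\<Sum>i=m + 1..2 * m + 1. (c (i - (m + 1)))\<^sup>2)"
    have "(c ((2 * m + 1) - (m + 1)))\<^sup>2 \<le> (\<Sum>i=m + 1..2 * m + 1. (c (i - (m + 1)))\<^sup>2)"
      by (rule member_le_sum) auto
    then have s2: "(\<Sum>i=m + 1..2 * m + 1. (c (i - (m + 1)))\<^sup>2) \<ge> 1" by (simp add: c_def coef_def)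
    then have s: "s > 0" "s * s = (\<Sum>i=m + 1..2 * m + 1. (c (i - (m + 1)))\<^sup>2)" by (auto simp: s_def)
    have s1: "s = 1" if "m = 0" using that by (simp add: s_def c_def coef_def)
    define v where "v = (\<lambda>(j::nat) (i, j'). if j' = j then c (i - (m + 1)) / s else (0::real))"
    have on: "orthonormal_on v ?X {..<n}"
      unfolding orthonormal_on_def
    proof (intro ballI)
      fix j l assume jl: "j \<in> {..<n}" "l \<in> {..<n}"
      have "(\<Sum>k\<in>?X. v j k * v l k) = (\<Sum>i\<in>{m + 1..2 * m + 1}. \<Sum>j'<n. v j (i, j') * v l (i, j'))"
        by (subst sum.cartesian_product) (auto intro!: sum.cong)
      also have "\<dots> = (\<Sum>i\<in>{m + 1..2 * m + 1}. \<Sum>j'<n. if j' = j then (if j = l then (c (i - (m + 1)))\<^sup>2 / (s * s) else 0) else 0)"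
        by (intro sum.cong refl) (auto simp: v_def power2_eq_square)
      also have "\<dots> = (if j = l then (\<Sum>i\<in>{m + 1..2 * m + 1}. (c (i - (m + 1)))\<^sup>2) / (s * s) else 0)"
        using jl by (simp add: sum_divide_distrib add_divide_distrib)
      also have "\<dots> = (if j = l then 1 else 0)" using s(1) by (simp only: s(2)[symmetric]) simp
      finally show "(\<Sum>k\<in>?X. v j k * v l k) = (if j = l then 1 else 0)" .
    qed
    have cf: "coef m (merge ?I ?X (y, x)) i = c i" if "i \<le> m" for x i
    proof -
      have r: "rowdot (merge ?I ?X (y, x)) n i = rowdot y n i" if "i \<le> m" for i
        using that by (auto simp: rowdot_def fun_eq_iff merge_def intro!: sum.cong)
      then have "sol m e (merge ?I ?X (y, x)) = sol m e y" by (intro sol_cong_S[OF e]) simp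
      then show ?thesis using that by (simp only: coef_def r c_def)
    qed
    have so: "sol m e (mix m (merge ?I ?X (y, x))) = sol m e y" for x
      unfolding sol_mix by (intro sol_cong_S[OF e]) (auto simp: rowdot_def merge_def intro!: sum.cong)
    have hx: "h (pvec m (mix m (merge ?I ?X (y, x)))) = h (lin v ?X {..<n} x)" for x
    proof -
      have "(\<Sum>i\<le>m. c i * x (i + m + 1, j)) = s * (\<Sum>k\<in>?X. v j k * x k)" if "j < n" for j
      proof -
        have "(\<Sum>k\<in>?X. v j k * x k) = (\<Sum>i\<in>{m + 1..2 * m + 1}. \<Sum>j'<n. v j (i, j') * x (i, j'))"
          by (subst sum.cartesian_product) (auto intro!: sum.cong)
        also have "\<dots> = (\<Sum>i\<in>{m + 1..2 * m + 1}. \<Sum>j'<n. if j' = j then c (i - (m + 1)) * x (i, j) / s else 0)"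
          by (intro sum.cong refl) (auto simp: v_def)
        also have "\<dots> = (\<Sum>i\<in>{m + 1..2 * m + 1}. c (i - (m + 1)) * x (i, j)) / s"
          using that by (simp add: sum_divide_distrib add_divide_distrib)
        also have "(\<Sum>i\<in>{m + 1..2 * m + 1}. c (i - (m + 1)) * x (i, j)) = (\<Sum>i\<le>m. c i * x (i + m + 1, j))"
          by (rule sum.reindex_bij_witness[of _ "\<lambda>i. i + m + 1" "\<lambda>i. i - (m + 1)"]) auto
        finally show ?thesis using s by simp
      qed
      then have "h (\<lambda>j\<in>{..<n}. \<Sum>i\<le>m. c i * x (i + m + 1, j)) = h (\<lambda>j. s * lin v ?X {..<n} x j)"
        by (intro h_cong dot_cong) (auto simp: lin_def)
      also have "\<dots> = h (lin v ?X {..<n} x)"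
        using h_scale[of s] s s1 by (cases "m = 0") auto
      also have "h (\<lambda>j\<in>{..<n}. \<Sum>i\<le>m. c i * x (i + m + 1, j)) = h (pvec m (mix m (merge ?I ?X (y, x))))"
      proof -
        have mx: "merge ?I ?X (y, x) (i + m + 1, j) = x (i + m + 1, j)" if "i \<le> m" "j < n" for i j
          using that by (simp add: merge_def)
        have "coef m (merge ?I ?X (y, x)) i * merge ?I ?X (y, x) (i + m + 1, j) = c i * x (i + m + 1, j)"
          if "j \<in> {..<n}" "i \<in> {..m}" for i j
          using cf[of i x] mx[of i j] that by (simp only: atMost_iff lessThan_iff)
        then show ?thesis unfolding xi
          by (intro arg_cong[of _ _ h] restrict_ext sum.cong refl) metis
      qed
      finally show ?thesis .
    qed
    have hm: "(\<lambda>x. h (lin v ?X {..<n} x)) \<in> borel_measurable (gauss ?X)"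
      by (rule measurable_compose[OF lin_measurable h])
    show "(\<integral>\<^sup>+x. F (mix m (merge ?I ?X (y, x))) \<partial>gauss ?X) = of_bool (Gp (sol m e y)) * (\<integral>\<^sup>+z. h z \<partial>gauss {..<n})"
      unfolding F_def so hx nn_integral_cmult[OF hm]
      by (subst nn_integral_gauss_orthonormal[OF _ _ on h]) auto
  qed
  also have "\<dots> = (\<integral>\<^sup>+W. of_bool (Gp (sol m e W)) \<partial>gauss ?I) * (\<integral>\<^sup>+z. h z \<partial>gauss {..<n})"
    by (rule nn_integral_multc) (rule of_bool_measurable[OF Gp])
  finally show ?thesis unfolding F_def .
qed

lemma pvec_0: "j < n \<Longrightarrow> pvec 0 W j = W (0, j)"
  by (simp add: pvec_def coef_def)

end

section \<open>One-dimensional Gaussian integrals\<close>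

text \<open>Exponential tilting: completing the square shifts the Gaussian by
  \<open>a\<close>.\<close>

lemma nn_integral_std_normal_exp:
  assumes [measurable]: "f \<in> borel_measurable borel"
  shows "(\<integral>\<^sup>+x. f x * ennreal (exp (a * x)) \<partial>stdn) = ennreal (exp (a\<^sup>2 / 2)) * (\<integral>\<^sup>+x. f (x + a) \<partial>stdn)"
proof -
  have d: "std_normal_density (x + a) * exp (a * (x + a)) = exp (a\<^sup>2 / 2) * std_normal_density x" for x
  proof -
    have "- (x + a)\<^sup>2 / 2 + a * (x + a) = a\<^sup>2 / 2 + - x\<^sup>2 / 2"
      by (simp add: power2_eq_square field_simps)
    then have "exp (- (x + a)\<^sup>2 / 2) * exp (a * (x + a)) = exp (a\<^sup>2 / 2) * exp (- x\<^sup>2 / 2)"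
      by (simp only: exp_add[symmetric])
    then show ?thesis by (simp add: std_normal_density_def)
  qed
  have "(\<integral>\<^sup>+x. f x * ennreal (exp (a * x)) \<partial>stdn) = (\<integral>\<^sup>+x. ennreal (std_normal_density x * exp (a * x)) * f x \<partial>lborel)"
    by (subst nn_integral_std_normal) (auto simp: ennreal_mult mult_ac)
  also have "\<dots> = (\<integral>\<^sup>+x. ennreal (std_normal_density (a + 1 * x) * exp (a * (a + 1 * x))) * f (a + 1 * x) \<partial>lborel)"
    by (subst nn_integral_real_affine[where c=1 and t=a]) auto
  also have "\<dots> = (\<integral>\<^sup>+x. ennreal (exp (a\<^sup>2 / 2)) * (ennreal (std_normal_density x) * f (x + a)) \<partial>lborel)"
    using d by (intro nn_integral_cong) (simp add: add.commute[of a] ennreal_mult mult.assoc)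
  also have "\<dots> = ennreal (exp (a\<^sup>2 / 2)) * (\<integral>\<^sup>+x. f (x + a) \<partial>stdn)"
    by (subst nn_integral_cmult) (auto simp: nn_integral_std_normal)
  finally show ?thesis .
qed

lemma nn_integral_std_normal_mgf: "(\<integral>\<^sup>+x. ennreal (exp (a * x)) \<partial>stdn) = ennreal (exp (a\<^sup>2 / 2))"
  using nn_integral_std_normal_exp[of "\<lambda>_. 1" a] stdn.emeasure_space_1 by simp

section \<open>The normal distribution function and \<open>lam\<close>\<close>

lemma Phi_pos: "0 < Phi u"
proof -
  have "0 < emeasure stdn {u - 1<..<u}"
  proof -
    have "emeasure stdn {u - 1<..<u} = (\<integral>\<^sup>+x. ennreal (std_normal_density x) * indicator {u - 1<..<u} x \<partial>lborel)"
      unfolding std_normal_measure_def by (rule emeasure_density) auto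
    moreover have "\<dots> \<noteq> 0"
    proof
      assume "(\<integral>\<^sup>+x. ennreal (std_normal_density x) * indicator {u - 1<..<u} x \<partial>lborel) = 0"
      then have "emeasure lborel {x. ennreal (std_normal_density x) * indicator {u - 1<..<u} x \<noteq> 0} = 0"
        by (subst (asm) nn_integral_0_iff) auto
      moreover have "{x. ennreal (std_normal_density x) * indicator {u - 1<..<u} x \<noteq> 0} = {u - 1<..<u}"
        using normal_density_pos[of 1 0] by (auto simp: indicator_def less_le)
      ultimately show False by simp
    qed
    ultimately show ?thesis by (simp add: zero_less_iff_neq_zero)
  qed
  also have "\<dots> \<le> emeasure stdn {..u}" by (intro emeasure_mono) auto
  finally show ?thesis by (simp add: Phi_def stdn.emeasure_eq_measure)
qed

lemma emeasure_Phi: "emeasure stdn {..u} = ennreal (Phi u)"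
  by (simp add: Phi_def stdn.emeasure_eq_measure)

lemma emeasure_std_normal_atLeast: "emeasure stdn {- u..} = ennreal (Phi u)"
proof -
  have "emeasure stdn {- u..} = (\<integral>\<^sup>+x. indicator {- u..} x \<partial>stdn)" by simp
  also have "\<dots> = (\<integral>\<^sup>+x. indicator {- u..} (- x) \<partial>stdn)"
    by (rule nn_integral_std_normal_minus[symmetric]) simp
  also have "\<dots> = (\<integral>\<^sup>+x. indicator {..u} x \<partial>stdn)"
    by (intro nn_integral_cong) (auto simp: indicator_def)
  finally show ?thesis by (simp add: emeasure_Phi)
qed

lemma exp_lam: "exp (lam u) = 2 * (exp (u\<^sup>2 / 2) * Phi u)"
  using Phi_pos[of u] by (simp add: lam_def exp_add)

text \<open>Identifies \<open>lam\<close> as the cumulant generating function of the modulus of a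
  standard normal variable; the factor one half comes from the restriction to a half-line.
  Monotonicity, convexity and growth of \<open>lam\<close> are all derived from this
  integral.\<close>

lemma half_normal_mgf: "(\<integral>\<^sup>+x. of_bool (0 \<le> x) * ennreal (exp (a * x)) \<partial>stdn) = ennreal (exp (lam a) / 2)"
proof -
  have "(\<integral>\<^sup>+x. of_bool (0 \<le> x) * ennreal (exp (a * x)) \<partial>stdn) = ennreal (exp (a\<^sup>2 / 2)) * (\<integral>\<^sup>+x. of_bool (0 \<le> x + a) \<partial>stdn)"
    by (rule nn_integral_std_normal_exp) auto
  also have "(\<integral>\<^sup>+x. of_bool (0 \<le> x + a) \<partial>stdn) = (\<integral>\<^sup>+x. indicator {- a..} x \<partial>stdn)"
    by (intro nn_integral_cong) (auto simp: indicator_def)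
  finally show ?thesis
    by (simp add: emeasure_std_normal_atLeast exp_lam ennreal_mult less_imp_le[OF Phi_pos])
qed

lemma half_normal_mgf_sign:
  assumes "s = 1 \<or> s = - 1"
  shows "(\<integral>\<^sup>+x. of_bool (0 \<le> s * x) * ennreal (exp (a * (s * x))) \<partial>stdn) = ennreal (exp (lam a) / 2)"
proof (cases "s = 1")
  case True
  then show ?thesis using half_normal_mgf[of a] by simp
next
  case False
  then have "s = - 1" using assms by simp
  then show ?thesis
    using nn_integral_std_normal_minus[of "\<lambda>x. of_bool (0 \<le> x) * ennreal (exp (a * x))"] half_normal_mgf[of a] by simp
qed

lemma lam_mono: "a \<le> b \<Longrightarrow> lam a \<le> lam b"
proof -
  assume ab: "a \<le> b"
  have "(\<integral>\<^sup>+x. of_bool (0 \<le> x) * ennreal (exp (a * x)) \<partial>stdn) \<le> (\<integral>\<^sup>+x. of_bool (0 \<le> x) * ennreal (exp (b * x)) \<partial>stdn)"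
    using ab by (intro nn_integral_mono) (auto intro!: ennreal_leI mult_right_mono)
  then show ?thesis unfolding half_normal_mgf by simp
qed

lemma lam_0: "lam 0 = 0"
proof -
  have "emeasure stdn {0} = (\<integral>\<^sup>+x. ennreal (std_normal_density x) * indicator {0} x \<partial>lborel)"
    unfolding std_normal_measure_def by (rule emeasure_density) auto
  then have z: "emeasure stdn {0::real} = 0" by (simp add: nn_integral_cmult_indicator)
  have "1 = measure stdn ({..0} \<union> {0<..})"
  proof -
    have "{..0} \<union> {0<..} = (UNIV :: real set)" by auto
    then show ?thesis using stdn.prob_space by simp
  qed
  also have "\<dots> = Phi 0 + measure stdn {0<..}"
    unfolding Phi_def by (rule stdn.finite_measure_Union) auto
  also have "measure stdn {0<..} = measure stdn {0..}"
  proof -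
    have "{0::real..} = {0} \<union> {0<..}" by auto
    then have "measure stdn {0..} = measure stdn {0} + measure stdn {0<..}"
      by (simp only:) (rule stdn.finite_measure_Union, auto)
    then show ?thesis using z by (simp add: measure_def)
  qed
  also have "measure stdn {0..} = Phi 0"
    using emeasure_std_normal_atLeast[of 0] Phi_pos[of 0] by (simp add: measure_def)
  finally show ?thesis by (simp add: lam_def)
qed

text \<open>Hoelder's inequality for the exponential integrals, by way of the convexity of
  \<open>exp\<close>: the integrands are first normalised by \<open>lam a\<close> and
  \<open>lam b\<close>, so that the pointwise inequality integrates to the claim.\<close>

lemma lam_convex: "convex_on UNIV lam"
proof (rule convex_onI)
  fix t a b :: real assume t: "0 < t" "t < 1"
  define c where "c = (1 - t) * lam a + t * lam b"
  have pw: "exp (((1 - t) * a + t * b) * x) \<le> (exp c * (1 - t) * exp (- lam a)) * exp (a * x) + (exp c * t * exp (- lam b)) * exp (b * x)" for x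
  proof -
    have "exp ((1 - t) * (a * x - lam a) + t * (b * x - lam b)) \<le> (1 - t) * exp (a * x - lam a) + t * exp (b * x - lam b)"
      using convex_onD[OF exp_convex, of t "a * x - lam a" "b * x - lam b"] t by simp
    moreover have "exp (((1 - t) * a + t * b) * x) = exp c * exp ((1 - t) * (a * x - lam a) + t * (b * x - lam b))"
      unfolding c_def exp_add[symmetric] by (simp add: algebra_simps)
    ultimately have "exp (((1 - t) * a + t * b) * x) \<le> exp c * ((1 - t) * exp (a * x - lam a) + t * exp (b * x - lam b))"
      by simp
    then show ?thesis by (simp add: exp_diff exp_minus field_simps)
  qed
  have "ennreal (exp (lam ((1 - t) * a + t * b)) / 2) = (\<integral>\<^sup>+x. of_bool (0 \<le> x) * ennreal (exp (((1 - t) * a + t * b) * x)) \<partial>stdn)"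
    by (rule half_normal_mgf[symmetric])
  also have "\<dots> \<le> (\<integral>\<^sup>+x. ennreal (exp c * (1 - t) * exp (- lam a)) * (of_bool (0 \<le> x) * ennreal (exp (a * x)))
       + ennreal (exp c * t * exp (- lam b)) * (of_bool (0 \<le> x) * ennreal (exp (b * x))) \<partial>stdn)"
    using pw t by (intro nn_integral_mono) (auto simp: ennreal_mult[symmetric] ennreal_plus[symmetric] intro!: ennreal_leI simp del: ennreal_plus)
  also have "\<dots> = ennreal (exp c * (1 - t) * exp (- lam a)) * ennreal (exp (lam a) / 2) + ennreal (exp c * t * exp (- lam b)) * ennreal (exp (lam b) / 2)"
  proof -
    have m: "(\<lambda>x. of_bool (0 \<le> x) * ennreal (exp (a * x))) \<in> borel_measurable stdn" for a
      by (simp cong: measurable_cong_sets)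
    have "(\<integral>\<^sup>+x. A * (of_bool (0 \<le> x) * ennreal (exp (a * x))) + B * (of_bool (0 \<le> x) * ennreal (exp (b * x))) \<partial>stdn)
      = A * (\<integral>\<^sup>+x. of_bool (0 \<le> x) * ennreal (exp (a * x)) \<partial>stdn) + B * (\<integral>\<^sup>+x. of_bool (0 \<le> x) * ennreal (exp (b * x)) \<partial>stdn)" for A B
      by (subst nn_integral_add) (simp_all only: nn_integral_cmult[OF m] m borel_measurable_times_ennreal borel_measurable_const)
    then show ?thesis unfolding half_normal_mgf .
  qed
  also have "\<dots> = ennreal (exp c / 2)"
  proof -
    have p: "ennreal (exp c * q * exp (- lam d)) * ennreal (exp (lam d) / 2) = ennreal (exp c * q / 2)" if "0 \<le> q" for q d
    proof -
      have "a * q * x * (y / 2) = a * q / 2" if "x * y = 1" for a q x y :: real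
        using that by (simp add: mult.assoc)
      from this[of "exp (- lam d)" "exp (lam d)" "exp c" q]
      have "exp c * q * exp (- lam d) * (exp (lam d) / 2) = exp c * q / 2"
        by (simp only: exp_add[symmetric], simp)
      moreover have "ennreal (exp c * q * exp (- lam d)) * ennreal (exp (lam d) / 2) = ennreal (exp c * q * exp (- lam d) * (exp (lam d) / 2))"
        using that by (intro ennreal_mult[symmetric]) auto
      ultimately show ?thesis by (simp only:)
    qed
    have "exp c * (1 - t) / 2 + exp c * t / 2 = exp c / 2" by (simp add: algebra_simps add_divide_distrib[symmetric])
    moreover have "ennreal (exp c * (1 - t) / 2 + exp c * t / 2) = ennreal (exp c * (1 - t) / 2) + ennreal (exp c * t / 2)"
      using t by (intro ennreal_plus) auto
    moreover have "0 \<le> 1 - t" "0 \<le> t" using t by auto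
    ultimately show ?thesis by (simp only: p)
  qed
  finally show "lam ((1 - t) *\<^sub>R a + t *\<^sub>R b) \<le> (1 - t) * lam a + t * lam b" by (simp add: c_def)
qed auto

definition p01 :: real where "p01 = measure stdn {0..1}"

lemma p01_pos: "0 < p01"
proof -
  have "0 < emeasure stdn {0..1}"
  proof -
    have "emeasure stdn {0..1} = (\<integral>\<^sup>+x. ennreal (std_normal_density x) * indicator {0..1} x \<partial>lborel)"
      unfolding std_normal_measure_def by (rule emeasure_density) auto
    moreover have "\<dots> \<noteq> 0"
    proof
      assume "(\<integral>\<^sup>+x. ennreal (std_normal_density x) * indicator {0..1} x \<partial>lborel) = 0"
      then have "emeasure lborel {x. ennreal (std_normal_density x) * indicator {0..1} x \<noteq> 0} = 0"
        by (subst (asm) nn_integral_0_iff) auto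
      moreover have "{x. ennreal (std_normal_density x) * indicator {0..1} x \<noteq> 0} = {0..1::real}"
        using normal_density_pos[of 1 0] by (auto simp: indicator_def less_le)
      ultimately show False by simp
    qed
    ultimately show ?thesis by (simp add: zero_less_iff_neq_zero)
  qed
  then show ?thesis by (simp add: p01_def stdn.emeasure_eq_measure)
qed

lemma emeasure_p01: "emeasure stdn {0..1} = ennreal p01"
  by (simp add: p01_def stdn.emeasure_eq_measure)

lemma p01_le_1: "p01 \<le> 1"
  by (simp add: p01_def stdn.prob_le_1)

text \<open>Only the part of the integral over \<open>{0..1}\<close> is kept. The point is that
  \<open>lam\<close> falls at most linearly, so that a quadratic term dominates it.\<close>

lemma lam_lower: "s \<le> 0 \<Longrightarrow> s + ln (2 * p01) \<le> lam s"
proof -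
  assume s: "s \<le> 0"
  have "(\<integral>\<^sup>+x. ennreal (exp s) * indicator {0..1} x \<partial>stdn) \<le> (\<integral>\<^sup>+x. of_bool (0 \<le> x) * ennreal (exp (s * x)) \<partial>stdn)"
  proof (rule nn_integral_mono)
    fix x :: real
    have "s \<le> s * x" if "x \<le> 1" using mult_left_mono_neg[OF that s] by simp
    then show "ennreal (exp s) * indicator {0..1} x \<le> of_bool (0 \<le> x) * ennreal (exp (s * x))"
      by (auto simp: indicator_def intro!: ennreal_leI)
  qed
  then have "ennreal (exp s * p01) \<le> ennreal (exp (lam s) / 2)"
    unfolding half_normal_mgf using p01_pos by (simp add: nn_integral_cmult_indicator emeasure_p01 ennreal_mult)
  then have "exp s * (2 * p01) \<le> exp (lam s)" using p01_pos by simp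
  then have "ln (exp s * (2 * p01)) \<le> ln (exp (lam s))" using p01_pos by (subst ln_le_cancel_iff) auto
  then show ?thesis using p01_pos by (simp add: ln_mult)
qed

section \<open>The error function\<close>

lemma erf_has_derivative: "(erf has_real_derivative 2 / sqrt pi * exp (- x\<^sup>2)) (at x)"
proof -
  define a where "a = min x 0 - 1"
  define b where "b = max x 0 + 1"
  have ab: "a \<le> 0" "0 \<le> b" "a < x" "x < b" by (auto simp: a_def b_def)
  have "((\<lambda>u. LBINT y=ereal 0..ereal u. exp (- y\<^sup>2)) has_vector_derivative exp (- x\<^sup>2)) (at x within {a..b})"
    using ab by (intro interval_integral_FTC2 continuous_intros) auto
  then have "((\<lambda>u. LBINT y=ereal 0..ereal u. exp (- y\<^sup>2)) has_vector_derivative exp (- x\<^sup>2)) (at x)"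
    using ab by (simp add: at_within_Icc_at)
  then have "((\<lambda>u. LBINT y=0..ereal u. exp (- y\<^sup>2)) has_real_derivative exp (- x\<^sup>2)) (at x)"
    by (simp add: has_real_derivative_iff_has_vector_derivative zero_ereal_def)
  from DERIV_cmult[OF this, of "2 / sqrt pi"] show ?thesis by (simp add: erf_def[abs_def])
qed

lemma erf_0: "erf 0 = 0"
  by (simp add: erf_def zero_ereal_def[symmetric])

lemma erf_minus: "erf (- x) = - erf x"
proof -
  have d: "((\<lambda>x. erf x + erf (- x)) has_real_derivative 0) (at x)" for x
    by (rule derivative_eq_intros erf_has_derivative DERIV_chain2[OF erf_has_derivative] | simp)+
  then have "erf x + erf (- x) = erf 0 + erf (- 0)"
    by (rule DERIV_isconst_all[rule_format])
  then show ?thesis by (simp add: erf_0)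
qed

lemma emeasure_std_normal_erf:
  assumes "0 \<le> a"
  shows "emeasure stdn {t. \<bar>t\<bar> \<le> a} = ennreal (erf (a / sqrt 2))"
proof -
  have D: "((\<lambda>t. erf (t / sqrt 2) / 2) has_real_derivative std_normal_density t) (at t)" for t
  proof -
    have "((\<lambda>t. erf (t / sqrt 2)) has_real_derivative 2 / sqrt pi * exp (- (t / sqrt 2)\<^sup>2) * (1 / sqrt 2)) (at t)"
      by (rule DERIV_chain2[OF erf_has_derivative DERIV_cdivide[OF DERIV_ident]])
    from DERIV_cdivide[OF this, of 2]
    have "((\<lambda>t. erf (t / sqrt 2) / 2) has_real_derivative (2 / sqrt pi * exp (- (t / sqrt 2)\<^sup>2) * (1 / sqrt 2)) / 2) (at t)" .
    moreover have "(2 / sqrt pi * exp (- (t / sqrt 2)\<^sup>2) * (1 / sqrt 2)) / 2 = std_normal_density t"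
      by (simp add: std_normal_density_def power_divide real_sqrt_mult)
    ultimately show ?thesis by (simp only:)
  qed
  have set: "{t. \<bar>t\<bar> \<le> a} = {- a..a}" by auto
  have "emeasure stdn {t. \<bar>t\<bar> \<le> a} = (\<integral>\<^sup>+x. ennreal (std_normal_density x) * indicator {- a..a} x \<partial>lborel)"
    unfolding std_normal_measure_def set by (rule emeasure_density) auto
  also have "(\<integral>\<^sup>+x. ennreal (std_normal_density x) * indicator {- a..a} x \<partial>lborel) = ennreal (erf (a / sqrt 2) / 2 - erf (- a / sqrt 2) / 2)"
    using assms D by (intro nn_integral_FTC_Icc) (auto intro: has_field_derivative_at_within)
  also have "erf (a / sqrt 2) / 2 - erf (- a / sqrt 2) / 2 = erf (a / sqrt 2)"
    using erf_minus[of "a / sqrt 2"] by simp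
  finally show ?thesis .
qed

lemma erf_strict_mono: "x < y \<Longrightarrow> erf x < erf y"
  by (rule DERIV_pos_imp_increasing) (auto intro!: exI[of _ "2 / sqrt pi * exp (- _\<^sup>2)"] erf_has_derivative)

lemma erf_pos: "0 < x \<Longrightarrow> 0 < erf x"
  using erf_strict_mono[of 0 x] by (simp add: erf_0)

lemma erf_le_1: "erf x \<le> 1"
proof (cases "0 \<le> x")
  case True
  have "ennreal (erf x) = emeasure stdn {t. \<bar>t\<bar> \<le> x * sqrt 2}"
    using emeasure_std_normal_erf[of "x * sqrt 2"] True by simp
  also have "\<dots> \<le> 1" by (rule stdn.emeasure_le_1)
  finally show ?thesis by simp
next
  case False
  then show ?thesis using erf_strict_mono[of x 0] by (simp add: erf_0)
qed

text \<open>Concavity of \<open>erf\<close> on the nonnegative reals together with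
  \<open>erf 0 = 0\<close>: the slope \<open>g\<close> at \<open>a\<close> is at most the mean slope
  on \<open>{0..a}\<close> and at least the one on \<open>{a..b}\<close>.\<close>

lemma erf_ratio:
  assumes "0 < a" "a \<le> b"
  shows "erf b \<le> b / a * erf a"
proof -
  have c: "continuous_on S erf" for S
    using erf_has_derivative by (intro DERIV_continuous_on[where D="\<lambda>x. 2 / sqrt pi * exp (- x\<^sup>2)"]) (auto intro: has_field_derivative_at_within)
  define g where "g = 2 / sqrt pi * exp (- a\<^sup>2)"
  have 1: "g * a \<le> erf a"
  proof -
    obtain z where z: "0 < z" "z < a" "erf a - erf 0 = (a - 0) * (2 / sqrt pi * exp (- z\<^sup>2))"
      using MVT2[of 0 a erf "\<lambda>x. 2 / sqrt pi * exp (- x\<^sup>2)"] assms erf_has_derivative by blast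
    have "z\<^sup>2 \<le> a\<^sup>2" using z by (intro power_mono) auto
    then have "g \<le> 2 / sqrt pi * exp (- z\<^sup>2)" unfolding g_def by (intro mult_left_mono) auto
    then have "a * g \<le> a * (2 / sqrt pi * exp (- z\<^sup>2))" using assms by (intro mult_left_mono) auto
    then show ?thesis using z(3) by (simp only: erf_0 diff_zero mult.commute[of g])
  qed
  have 2: "erf b - erf a \<le> (b - a) * g"
  proof (cases "a = b")
    case False
    then obtain z where z: "a < z" "z < b" "erf b - erf a = (b - a) * (2 / sqrt pi * exp (- z\<^sup>2))"
      using MVT2[of a b erf "\<lambda>x. 2 / sqrt pi * exp (- x\<^sup>2)"] assms erf_has_derivative by force
    have "a\<^sup>2 \<le> z\<^sup>2" using z assms by (intro power_mono) auto
    then have "2 / sqrt pi * exp (- z\<^sup>2) \<le> g" unfolding g_def by (intro mult_left_mono) auto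
    then have "(b - a) * (2 / sqrt pi * exp (- z\<^sup>2)) \<le> (b - a) * g" using assms by (intro mult_left_mono) auto
    then show ?thesis using z(3) by (simp only:)
  qed simp
  have "(b - a) * (g * a) \<le> (b - a) * erf a" using 1 assms by (intro mult_left_mono) auto
  then have "a * erf b \<le> b * erf a"
    using mult_left_mono[OF 2, of a] assms by (simp add: algebra_simps)
  then show ?thesis using assms by (simp add: field_simps)
qed

lemma continuous_on_erf: "continuous_on A erf"
  using erf_has_derivative
  by (intro DERIV_continuous_on[where D = "\<lambda>x. 2 / sqrt pi * exp (- x\<^sup>2)"]) (auto intro: has_field_derivative_at_within)

lemma ln_erf_mono: "0 < a \<Longrightarrow> a \<le> b \<Longrightarrow> ln (erf a) \<le> ln (erf b)"
  using erf_strict_mono[of a b] erf_pos[of a] by (cases "a = b") auto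

lemma ln_erf_nonpos: "0 < a \<Longrightarrow> ln (erf a) \<le> 0"
  using erf_le_1[of a] erf_pos[of a] by simp

text \<open>The error depends on the quotient \<open>b / a\<close> only. Hence
  \<open>ln (erf (x * v))\<close> varies by a bounded amount over a compact range of positive
  \<open>v\<close>, uniformly in \<open>x\<close>, although it is unbounded as \<open>x\<close>
  tends to \<open>0\<close>.\<close>

lemma ln_erf_ratio: "0 < a \<Longrightarrow> a \<le> b \<Longrightarrow> ln (erf b) \<le> ln (erf a) + ln (b / a)"
proof -
  assume ab: "0 < a" "a \<le> b"
  have "ln (erf b) \<le> ln (b / a * erf a)"
    using ab erf_ratio[OF ab] erf_pos[of a] erf_pos[of b] by (subst ln_le_cancel_iff) auto
  also have "\<dots> = ln (b / a) + ln (erf a)" using ab erf_pos[of a] by (simp add: ln_mult ln_div)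
  finally show ?thesis by simp
qed

section \<open>Probabilities of the optimality patterns\<close>

text \<open>Continuity of the measure from above along decreasing events.\<close>

lemma le_of_bool_limit:
  fixes P :: "nat \<Rightarrow> 'a \<Rightarrow> bool"
  assumes M: "prob_space M" and P: "\<And>i. P i \<in> measurable M (count_space UNIV)"
    and dec: "\<And>i x. P (Suc i) x \<Longrightarrow> P i x"
    and le: "\<And>i. a \<le> (\<integral>\<^sup>+x. of_bool (P i x) \<partial>M)" and lim: "\<And>x. (\<And>i. P i x) \<Longrightarrow> Q x"
  shows "a \<le> (\<integral>\<^sup>+x. of_bool (Q x) \<partial>M)"
proof -
  interpret prob_space M by (rule M)
  have "(\<integral>\<^sup>+x. (INF i. of_bool (P i x)) \<partial>M) = (INF i. \<integral>\<^sup>+x. of_bool (P i x) \<partial>M)"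
  proof (rule nn_integral_monotone_convergence_INF_decseq)
    show "decseq (\<lambda>i x. of_bool (P i x) :: ennreal)"
      using dec by (intro decseq_SucI) (auto simp: le_fun_def)
    show "(\<lambda>x. of_bool (P i x) :: ennreal) \<in> borel_measurable M" for i
      by (rule of_bool_measurable[OF P])
    have "(\<integral>\<^sup>+x. of_bool (P 0 x) \<partial>M) \<le> (\<integral>\<^sup>+x. 1 \<partial>M)" by (intro nn_integral_mono) auto
    then have "(\<integral>\<^sup>+x. of_bool (P 0 x) \<partial>M) \<le> 1" unfolding nn_integral_const emeasure_space_1 by simp
    then show "(\<integral>\<^sup>+x. of_bool (P 0 x) \<partial>M) < \<infinity>"
      by (metis ennreal_one_less_top infinity_ennreal_def le_less_trans)
  qed
  moreover have "(INF i. of_bool (P i x) :: ennreal) \<le> of_bool (Q x)" for x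
  proof (cases "Q x")
    case True
    then show ?thesis by (auto intro!: INF_lower2[of 0])
  next
    case False
    then obtain i where "\<not> P i x" using lim by blast
    then show ?thesis by (intro INF_lower2[of i]) auto
  qed
  then have "(\<integral>\<^sup>+x. (INF i. of_bool (P i x)) \<partial>M) \<le> (\<integral>\<^sup>+x. of_bool (Q x) \<partial>M)"
    by (intro nn_integral_mono)
  moreover have "a \<le> (INF i. \<integral>\<^sup>+x. of_bool (P i x) \<partial>M)" by (rule INF_greatest) (rule le)
  ultimately show ?thesis by simp
qed

text \<open>Unit vectors with inner product above \<open>1 - r\<close> have distance below
  \<open>sqrt (2 * r)\<close>, so the inner product with \<open>c\<close> changes by at most that
  distance times \<open>nrm n c\<close>.\<close>

lemma near_dot_lower:
  assumes nr: "near n r a b" and r: "0 < r" "r \<le> 1" and c: "0 \<le> dot n c a"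
  shows "- sqrt (2 * r) * (nrm n c * nrm n b) \<le> dot n c b"
proof -
  have ab: "0 < nrm n a" "0 < nrm n b" using near_nrm_pos[OF nr] r by auto
  define x where "x = (\<lambda>j. nrm n a * b j - nrm n b * a j)"
  have "dot n x x = (nrm n a)\<^sup>2 * dot n b b + (nrm n b)\<^sup>2 * dot n a a - 2 * (nrm n a * nrm n b) * dot n a b"
    unfolding x_def dot_diff_left dot_diff_right dot_smult_left dot_smult_right
    by (simp add: dot_commute[of n b a] power2_eq_square algebra_simps)
  also have "\<dots> = 2 * (nrm n a * nrm n b) * (nrm n a * nrm n b - dot n a b)"
    unfolding nrm_sq[symmetric] by (simp add: power2_eq_square algebra_simps)
  also have "\<dots> \<le> 2 * (nrm n a * nrm n b) * (r * (nrm n a * nrm n b))"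
    using nr ab by (intro mult_left_mono) (auto simp: near_def algebra_simps)
  also have "\<dots> = (sqrt (2 * r) * (nrm n a * nrm n b))\<^sup>2"
    using r by (simp add: power_mult_distrib) (simp add: power2_eq_square)
  finally have "nrm n x \<le> sqrt (2 * r) * (nrm n a * nrm n b)"
    unfolding nrm_sq[symmetric] by (rule power2_le_imp_le) (use r in simp)
  then have "\<bar>dot n c x\<bar> \<le> nrm n c * (sqrt (2 * r) * (nrm n a * nrm n b))"
    using dot_le_nrm[of n c x] by (meson mult_left_mono nrm_nonneg order_trans)
  moreover have "dot n c x = nrm n a * dot n c b - nrm n b * dot n c a"
    unfolding x_def dot_diff_right dot_smult_right ..
  moreover have "0 \<le> nrm n b * dot n c a" using c by simp
  ultimately have "nrm n a * (- sqrt (2 * r) * (nrm n c * nrm n b)) \<le> nrm n a * dot n c b"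
    by (simp add: mult_ac)
  then show ?thesis using ab by (metis mult_le_cancel_left_pos)
qed

context ridge_hyperplane begin

lemma dots_meas:
  assumes "finite L"
  shows "(\<lambda>W. \<forall>l\<in>L. - t * (nrm n (c l) * nrm n (sol m e W)) \<le> dot n (c l) (sol m e W)) \<in> measurable (gauss ({..m} \<times> {..<n})) (count_space UNIV)"
  using assms
proof (induction L)
  case empty
  then show ?case by simp
next
  case (insert l L)
  have "(\<lambda>W. - t * (nrm n (c l) * nrm n (sol m e W)) \<le> dot n (c l) (sol m e W)) \<in> measurable (gauss ({..m} \<times> {..<n})) (count_space UNIV)"
    unfolding pred_def by (intro borel_measurable_le borel_measurable_times borel_measurable_const dot_sol_meas)
  from pred_intros_logic(3)[OF this insert.IH]
  have "(\<lambda>W. - t * (nrm n (c l) * nrm n (sol m e W)) \<le> dot n (c l) (sol m e W) \<and>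
      (\<forall>l\<in>L. - t * (nrm n (c l) * nrm n (sol m e W)) \<le> dot n (c l) (sol m e W))) \<in> measurable (gauss ({..m} \<times> {..<n})) (count_space UNIV)" .
  moreover have "(\<forall>l\<in>insert l L. Q l) \<longleftrightarrow> Q l \<and> (\<forall>l\<in>L. Q l)" for Q by blast
  ultimately show ?case by presburger
qed

text \<open>Caps transfer the cone constraints only up to an error \<open>sqrt (2 * r)\<close>. As
  the constraints are closed, the relaxed events decrease to the exact one when \<open>r\<close>
  tends to \<open>0\<close>.\<close>

lemma cone_compare:
  assumes L: "finite L"
  shows "(\<integral>\<^sup>+W. of_bool (0 < nrm n (sol m e W) \<and> (\<forall>l\<in>L. 0 \<le> dot n (c l) (sol m e W))) \<partial>gauss ({..m} \<times> {..<n}))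
     \<le> (\<integral>\<^sup>+W. of_bool (\<forall>l\<in>L. 0 \<le> dot n (c l) (sol 0 e W)) \<partial>gauss ({..0} \<times> {..<n}))"
proof -
  define t where "t = (\<lambda>i::nat. sqrt (2 * (1 / (real i + 2))))"
  have t_dec: "t (Suc i) \<le> t i" for i by (simp add: t_def frac_le)
  have t_lim: "t \<longlonglongrightarrow> 0"
  proof -
    have "(\<lambda>i. 2 * (1 / (real i + 2))) \<longlonglongrightarrow> 0"
      using LIMSEQ_ignore_initial_segment[OF lim_const_over_n[of "2::real"], of 2] by (simp add: add.commute)
    from tendsto_real_sqrt[OF this] show ?thesis by (simp add: t_def[abs_def])
  qed
  define P where "P = (\<lambda>i W. \<forall>l\<in>L. - t i * (nrm n (c l) * nrm n (sol 0 e W)) \<le> dot n (c l) (sol 0 e W))"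
  show ?thesis
  proof (rule le_of_bool_limit[OF prob_space_gauss, where P = P])
    show "P i \<in> measurable (gauss ({..0} \<times> {..<n})) (count_space UNIV)" for i
      unfolding P_def by (rule dots_meas[OF L])
    show "P i W" if "P (Suc i) W" for i W
    proof -
      have "- t i * (nrm n (c l) * nrm n (sol 0 e W)) \<le> - t (Suc i) * (nrm n (c l) * nrm n (sol 0 e W))" for l
        using t_dec[of i] by (intro mult_right_mono) auto
      then show ?thesis using that unfolding P_def by (meson order_trans)
    qed
    show "\<forall>l\<in>L. 0 \<le> dot n (c l) (sol 0 e W)" if "\<And>i. P i W" for W
    proof
      fix l assume l: "l \<in> L"
      have "(\<lambda>i. - t i * (nrm n (c l) * nrm n (sol 0 e W))) \<longlonglongrightarrow> - 0 * (nrm n (c l) * nrm n (sol 0 e W))"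
        by (intro tendsto_intros t_lim)
      then have "- 0 * (nrm n (c l) * nrm n (sol 0 e W)) \<le> dot n (c l) (sol 0 e W)"
        by (rule LIMSEQ_le_const2) (use that l in \<open>auto simp: P_def\<close>)
      then show "0 \<le> dot n (c l) (sol 0 e W)" by simp
    qed
    show "(\<integral>\<^sup>+W. of_bool (0 < nrm n (sol m e W) \<and> (\<forall>l\<in>L. 0 \<le> dot n (c l) (sol m e W))) \<partial>gauss ({..m} \<times> {..<n}))
       \<le> (\<integral>\<^sup>+W. of_bool (P i W) \<partial>gauss ({..0} \<times> {..<n}))" for i
      unfolding P_def
    proof (rule cap_compare[of "1 / (real i + 2)" "\<lambda>d. \<forall>l\<in>L. 0 \<le> dot n (c l) d" m "\<lambda>d. \<forall>l\<in>L. - t i * (nrm n (c l) * nrm n d) \<le> dot n (c l) d"])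
      show "(\<lambda>W. \<forall>l\<in>L. 0 \<le> dot n (c l) (sol m e W)) \<in> measurable (gauss ({..m} \<times> {..<n})) (count_space UNIV)"
        using dots_meas[OF L, of 0 c m] by simp
      show "(\<lambda>W. \<forall>l\<in>L. - t i * (nrm n (c l) * nrm n (sol 0 e W)) \<le> dot n (c l) (sol 0 e W)) \<in> measurable (gauss ({..0} \<times> {..<n})) (count_space UNIV)"
        by (rule dots_meas[OF L])
      show "\<forall>l\<in>L. - t i * (nrm n (c l) * nrm n b) \<le> dot n (c l) b"
        if "\<forall>l\<in>L. 0 \<le> dot n (c l) a" "near n (1 / (real i + 2)) a b" for a b
        using near_dot_lower[OF that(2)] that(1) by (auto simp: t_def)
    qed auto
  qed
qed

end

section \<open>The two factors of a face probability\<close>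

lemma nn_integral_gauss_prod_row:
  fixes n :: nat
  assumes g: "\<And>j. j < n \<Longrightarrow> g j \<in> borel_measurable borel"
  shows "(\<integral>\<^sup>+W. (\<Prod>j<n. g j (W (0::nat, j))) \<partial>gauss ({..0} \<times> {..<n})) = (\<Prod>j<n. \<integral>\<^sup>+x. g j x \<partial>stdn)"
proof -
  have c: "(\<Prod>p\<in>{..0::nat} \<times> {..<n}. f (snd p)) = (\<Prod>j<n. f j)" for f :: "nat \<Rightarrow> ennreal"
    by (rule prod.reindex_bij_witness[of _ "\<lambda>j. (0, j)" snd]) auto
  have c': "(\<Prod>p\<in>{..0::nat} \<times> {..<n}. g (snd p) (W p)) = (\<Prod>j<n. g j (W (0, j)))" for W
    by (rule prod.reindex_bij_witness[of _ "\<lambda>j. (0, j)" snd]) auto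
  have "(\<integral>\<^sup>+W. (\<Prod>p\<in>{..0::nat} \<times> {..<n}. g (snd p) (W p)) \<partial>gauss ({..0} \<times> {..<n})) = (\<Prod>p\<in>{..0::nat} \<times> {..<n}. \<integral>\<^sup>+x. g (snd p) x \<partial>stdn)"
    unfolding gauss_def using g by (intro G.product_nn_integral_prod) (auto cong: measurable_cong_sets)
  then show ?thesis unfolding c' using c[of "\<lambda>j. \<integral>\<^sup>+x. g j x \<partial>stdn"] by simp
qed

text \<open>The linear functional that agrees with \<open>qf\<close> on vectors supported on
  \<open>{..<k}\<close> and \<open>T\<close> with signs \<open>s\<close> on
  \<open>T\<close>.\<close>

definition facevec :: "(nat \<Rightarrow> real) \<Rightarrow> nat \<Rightarrow> nat set \<Rightarrow> (nat \<Rightarrow> real) \<Rightarrow> nat \<Rightarrow> real" where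
  "facevec w k T s = (\<lambda>j. if j < k then w j else if j \<in> T then s j * w j else 0)"

text \<open>The logarithm of the exponential integral in \<open>chernoff_row\<close>, without its
  factor \<open>1 / 2 ^ card T\<close>: Gaussian cumulants for the first \<open>k\<close>
  coordinates, half-normal ones for \<open>T\<close>.\<close>

definition int_exp :: "(nat \<Rightarrow> real) \<Rightarrow> nat \<Rightarrow> nat set \<Rightarrow> real \<Rightarrow> real" where
  "int_exp w k T \<sigma> = \<sigma>\<^sup>2 / 2 * (\<Sum>j<k. (w j)\<^sup>2) + (\<Sum>j\<in>T. lam (\<sigma> * w j))"

lemma chernoff_row:
  assumes T: "T \<subseteq> {k..<n}" "k \<le> n" and s: "\<And>j. s j = 1 \<or> s j = - 1"
  shows "(\<integral>\<^sup>+W. of_bool (\<forall>j\<in>T. 0 \<le> s j * W (0::nat, j)) * ennreal (exp (\<sigma> * dot n (facevec w k T s) (\<lambda>j. W (0, j)))) \<partial>gauss ({..0} \<times> {..<n}))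
    = ennreal (exp (int_exp w k T \<sigma>) / 2 ^ card T)"
proof -
  have fT: "finite T" using T finite_subset by blast
  define g where "g = (\<lambda>j x. of_bool (j \<in> T \<longrightarrow> 0 \<le> s j * x) * ennreal (exp (\<sigma> * (facevec w k T s j * x))))"
  have gm: "g j \<in> borel_measurable borel" for j
    unfolding g_def by (cases "j \<in> T") auto
  have eq: "of_bool (\<forall>j\<in>T. 0 \<le> s j * W (0::nat, j)) * ennreal (exp (\<sigma> * dot n (facevec w k T s) (\<lambda>j. W (0, j)))) = (\<Prod>j<n. g j (W (0, j)))" for W
  proof -
    have "(\<Prod>j<n. g j (W (0, j))) = (\<Prod>j<n. of_bool (j \<in> T \<longrightarrow> 0 \<le> s j * W (0, j))) * (\<Prod>j<n. ennreal (exp (\<sigma> * (facevec w k T s j * W (0, j)))))"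
      unfolding g_def by (rule prod.distrib)
    also have "(\<Prod>j<n. ennreal (exp (\<sigma> * (facevec w k T s j * W (0, j))))) = ennreal (exp (\<sigma> * dot n (facevec w k T s) (\<lambda>j. W (0, j))))"
      by (subst prod_ennreal) (auto simp: dot_def sum_distrib_left exp_sum)
    also have "(\<Prod>j<n. of_bool (j \<in> T \<longrightarrow> 0 \<le> s j * W (0, j)) :: ennreal) = of_bool (\<forall>j\<in>T. 0 \<le> s j * W (0, j))"
    proof (cases "\<forall>j\<in>T. 0 \<le> s j * W (0, j)")
      case False
      then obtain j where "j \<in> T" "\<not> 0 \<le> s j * W (0, j)" by blast
      then show ?thesis using T by (subst prod_zero) (auto intro!: bexI[of _ j])
    qed auto
    finally show ?thesis by simp
  qed
  define v where "v = (\<lambda>j. if j < k then exp ((\<sigma> * w j)\<^sup>2 / 2) else if j \<in> T then exp (lam (\<sigma> * w j)) / 2 else 1)"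
  have val: "(\<integral>\<^sup>+x. g j x \<partial>stdn) = ennreal (v j)" for j
  proof -
    consider "j < k" | "\<not> j < k" "j \<in> T" | "\<not> j < k" "j \<notin> T" by blast
    then show ?thesis
    proof cases
      case 1
      then have "j \<notin> T" using T by auto
      then show ?thesis using 1 nn_integral_std_normal_mgf[of "\<sigma> * w j"] by (simp add: g_def v_def facevec_def mult.assoc)
    next
      case 2
      then show ?thesis using half_normal_mgf_sign[OF s[of j], of "\<sigma> * w j"] by (simp add: g_def v_def facevec_def mult_ac)
    next
      case 3
      then show ?thesis using stdn.emeasure_space_1 by (simp add: g_def v_def facevec_def)
    qed
  qed
  have "(\<Prod>j<n. v j) = exp (int_exp w k T \<sigma>) / 2 ^ card T"
  proof -
    have "{..<n} = {..<k} \<union> ({k..<n} - T) \<union> T" using T by auto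
    then have "(\<Prod>j<n. v j) = (\<Prod>j\<in>{..<k} \<union> ({k..<n} - T). v j) * (\<Prod>j\<in>T. v j)"
      using T fT by (simp only:) (subst prod.union_disjoint, auto)
    also have "(\<Prod>j\<in>{..<k} \<union> ({k..<n} - T). v j) = (\<Prod>j<k. v j) * (\<Prod>j\<in>{k..<n} - T. v j)"
      by (rule prod.union_disjoint) auto
    also have "(\<Prod>j\<in>{k..<n} - T. v j) = 1" by (rule prod.neutral) (auto simp: v_def)
    also have "(\<Prod>j<k. v j) = exp (\<sigma>\<^sup>2 / 2 * (\<Sum>j<k. (w j)\<^sup>2))"
      by (simp add: v_def exp_sum[symmetric] sum_distrib_left power_mult_distrib)
    also have "(\<Prod>j\<in>T. v j) = (\<Prod>j\<in>T. exp (lam (\<sigma> * w j)) / 2)"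
      using T by (intro prod.cong) (auto simp: v_def)
    also have "\<dots> = exp (\<Sum>j\<in>T. lam (\<sigma> * w j)) / 2 ^ card T"
      using fT by (simp add: prod_dividef exp_sum)
    finally show ?thesis by (simp add: int_exp_def exp_add)
  qed
  moreover have "(\<Prod>j<n. ennreal (v j)) = ennreal (\<Prod>j<n. v j)"
    by (rule prod_ennreal) (auto simp: v_def)
  ultimately show ?thesis
    unfolding eq by (subst nn_integral_gauss_prod_row[OF gm]) (simp add: val)
qed

text \<open>The norm of \<open>facevec\<close>, which does not depend on the signs.\<close>

definition fnrm :: "(nat \<Rightarrow> real) \<Rightarrow> nat \<Rightarrow> nat set \<Rightarrow> real" where
  "fnrm w k T = sqrt ((\<Sum>j<k. (w j)\<^sup>2) + (\<Sum>j\<in>T. (w j)\<^sup>2))"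

text \<open>The Gaussian measure of the normal cone of the face, taken in the orthogonal complement
  of \<open>S\<close>. Here \<open>x\<close> is the coordinate along the unit normal, and the error
  functions are the probabilities of the constraints on the inactive coordinates.\<close>

definition ext_int :: "(nat \<Rightarrow> real) \<Rightarrow> nat \<Rightarrow> nat \<Rightarrow> nat set \<Rightarrow> ennreal" where
  "ext_int w n k T = (\<integral>\<^sup>+x. of_bool (0 < x) * (\<Prod>j\<in>{k..<n} - T. ennreal (erf (x / fnrm w k T * w j / sqrt 2))) \<partial>stdn)"

text \<open>The first-order conditions of the penalised projection onto the descent cone: the minimiser lies in the face with
  active coordinates \<open>T\<close> and signs \<open>s\<close>, and the residual lies in its normal cone. In \<open>cone_pattern\<close> the multiplier
  of the descent constraint vanishes.\<close>

definition face_pattern :: "(nat \<Rightarrow> real) \<Rightarrow> nat \<Rightarrow> nat \<Rightarrow> real \<Rightarrow> nat \<Rightarrow> nat set \<Rightarrow> (nat \<Rightarrow> real) \<Rightarrow> (nat \<times> nat \<Rightarrow> real) \<Rightarrow> bool" where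
  "face_pattern w n m e k T s W \<longleftrightarrow>
    (let u = facevec w k T s; d = hyperplane.sol n ({..<k} \<union> T) u m e W; p = ridge_hyperplane.pvec n ({..<k} \<union> T) u e m W in
      0 < nrm n d \<and> (\<forall>j\<in>T. 0 \<le> s j * d j) \<and> 0 < dot n u p \<and> (\<forall>j\<in>{k..<n} - T. \<bar>p j\<bar> \<le> dot n u p / dot n u u * w j))"

definition cone_pattern :: "(nat \<Rightarrow> real) \<Rightarrow> nat \<Rightarrow> nat \<Rightarrow> real \<Rightarrow> nat \<Rightarrow> (nat \<Rightarrow> real) \<Rightarrow> (nat \<times> nat \<Rightarrow> real) \<Rightarrow> bool" where
  "cone_pattern w n m e k s W \<longleftrightarrow>
    (let d = hyperplane.sol n {..<n} (\<lambda>_. 0) m e W in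
      0 < nrm n d \<and> (\<forall>j\<in>{k..<n}. 0 \<le> s j * d j) \<and> dot n (facevec w k {k..<n} s) d \<le> 0)"

lemma dot_facevec_self:
  assumes T: "T \<subseteq> {k..<n}" "k \<le> n" and s: "\<And>j. s j = 1 \<or> s j = - 1"
  shows "nrm n (facevec w k T s) = fnrm w k T"
proof -
  have fT: "finite T" using T finite_subset by blast
  have s2: "s j * s j = 1" for j using s[of j] by auto
  have "dot n (facevec w k T s) (facevec w k T s) = (\<Sum>j\<in>{..<k} \<union> T. facevec w k T s j * facevec w k T s j)"
    unfolding dot_def using T by (intro sum.mono_neutral_right) (auto simp: facevec_def)
  also have "\<dots> = (\<Sum>j<k. facevec w k T s j * facevec w k T s j) + (\<Sum>j\<in>T. facevec w k T s j * facevec w k T s j)"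
    using T fT by (intro sum.union_disjoint) auto
  also have "(\<Sum>j<k. facevec w k T s j * facevec w k T s j) = (\<Sum>j<k. (w j)\<^sup>2)"
    by (simp add: facevec_def power2_eq_square)
  also have "(\<Sum>j\<in>T. facevec w k T s j * facevec w k T s j) = (\<Sum>j\<in>T. (w j)\<^sup>2)"
  proof (intro sum.cong refl)
    fix j assume "j \<in> T"
    then have "facevec w k T s j = s j * w j" using T by (auto simp: facevec_def)
    then have "facevec w k T s j * facevec w k T s j = (s j * s j) * (w j * w j)" by simp
    then show "facevec w k T s j * facevec w k T s j = (w j)\<^sup>2" by (simp only: s2 power2_eq_square mult_1)
  qed
  finally show ?thesis by (simp add: nrm_def fnrm_def)
qed

lemma fnrm_pos: "0 < k \<Longrightarrow> 0 < w 0 \<Longrightarrow> finite T \<Longrightarrow> 0 < fnrm w k T"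
proof -
  assume "0 < k" "0 < w 0" "finite T"
  then have "0 < (\<Sum>j<k. (w j)\<^sup>2)" by (intro sum_pos2[of _ 0]) auto
  moreover have "0 \<le> (\<Sum>j\<in>T. (w j)\<^sup>2)" by (intro sum_nonneg) auto
  ultimately show ?thesis by (simp add: fnrm_def)
qed

lemma ext_int_full: "ext_int w n k {k..<n} = emeasure stdn {0<..}"
proof -
  have "ext_int w n k {k..<n} = (\<integral>\<^sup>+x. indicator {0<..} x \<partial>stdn)"
    unfolding ext_int_def by (intro nn_integral_cong) (auto simp: indicator_def)
  also have "\<dots> = emeasure stdn {0<..}" by (intro nn_integral_indicator) (simp add: std_normal_measure_def)
  finally show ?thesis .
qed

lemma normal_cone_meas:
  fixes u :: "nat \<Rightarrow> real"
  assumes "B \<subseteq> {..<n}"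
  shows "(\<lambda>z. 0 < dot n u z \<and> (\<forall>j\<in>B. \<bar>z j\<bar> \<le> dot n u z / c * w j)) \<in> measurable (gauss {..<n}) (count_space UNIV)"
proof (rule pred_intros_logic(3))
  have d: "(\<lambda>z. dot n u z) \<in> borel_measurable (gauss {..<n})"
    unfolding dot_def by (rule borel_measurable_sum, rule borel_measurable_times, rule borel_measurable_const, rule measurable_gauss_coord)
  show "(\<lambda>z. 0 < dot n u z) \<in> measurable (gauss {..<n}) (count_space UNIV)"
    by (rule borel_measurable_pred_less, rule borel_measurable_const, rule d)
  have B: "finite B" using assms finite_subset by blast
  show "(\<lambda>z. \<forall>j\<in>B. \<bar>z j\<bar> \<le> dot n u z / c * w j) \<in> measurable (gauss {..<n}) (count_space UNIV)"
  proof (rule pred_intros_finite(3)[OF B])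
    fix j assume "j \<in> B"
    then have "(\<lambda>z. z j) \<in> borel_measurable (gauss {..<n})" using assms by (intro measurable_gauss_coord) auto
    then show "(\<lambda>z. \<bar>z j\<bar> \<le> dot n u z / c * w j) \<in> measurable (gauss {..<n}) (count_space UNIV)"
      unfolding pred_def
      by (intro borel_measurable_le borel_measurable_abs borel_measurable_times borel_measurable_divide borel_measurable_const d)
  qed
qed

text \<open>The unit normal and the inactive unit vectors are orthonormal, so the corresponding
  coordinates are independent standard normal variables. Given the first, each inactive coordinate
  contributes an error function.\<close>

lemma normal_cone_prob:
  assumes T: "T \<subseteq> {k..<n}" "k \<le> n" "0 < k" and s: "\<And>j. s j = 1 \<or> s j = - 1" and w: "\<And>j. j < n \<Longrightarrow> 0 < w j"
  defines "u \<equiv> facevec w k T s"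
  shows "(\<integral>\<^sup>+z. of_bool (0 < dot n u z \<and> (\<forall>j\<in>{k..<n} - T. \<bar>z j\<bar> \<le> dot n u z / dot n u u * w j)) \<partial>gauss {..<n})
     = ext_int w n k T"
proof -
  define B where "B = {k..<n} - T"
  have fT: "finite T" using T finite_subset by blast
  define R where "R = fnrm w k T"
  have R: "R > 0" unfolding R_def using T w fT by (intro fnrm_pos) auto
  have uR: "nrm n u = R" unfolding u_def R_def by (rule dot_facevec_self[OF T(1,2) s])
  then have uu: "dot n u u = R * R" using nrm_sq[of n u] by (simp add: power2_eq_square)
  have uB: "u j = 0" if "j \<in> B" for j using that by (auto simp: u_def facevec_def B_def)
  \<comment> \<open>The index \<open>n\<close>, which lies outside \<open>{..<n}\<close>, names the
    coordinate along the unit normal.\<close>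
  define q where "q = (\<lambda>i j. if i = n then u j / R else if i = j then 1 else (0::real))"
  have nB: "n \<notin> B" "finite B" "B \<subseteq> {..<n}" by (auto simp: B_def)
  have on: "orthonormal_on q {..<n} (insert n B)"
    unfolding orthonormal_on_def
  proof (intro ballI)
    fix i j assume ij: "i \<in> insert n B" "j \<in> insert n B"
    have nn: "(\<Sum>l<n. q n l * q n l) = 1"
    proof -
      have "(\<Sum>l<n. q n l * q n l) = dot n u u / (R * R)"
        by (simp add: q_def dot_def sum_divide_distrib)
      then show ?thesis using uu R by simp
    qed
    have nb: "(\<Sum>l<n. q n l * q i l) = 0" if "i \<in> B" for i
    proof -
      have "i \<noteq> n" using that nB by auto
      then have "(\<Sum>l<n. q n l * q i l) = (\<Sum>l<n. if l = i then u l / R else 0)"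
        by (intro sum.cong refl) (auto simp: q_def)
      then show ?thesis using that uB nB by auto
    qed
    have bb: "(\<Sum>l<n. q i l * q j l) = (if i = j then 1 else 0)" if "i \<in> B" "j \<in> B" for i j
    proof -
      have "i \<noteq> n" "j \<noteq> n" "i < n" using that nB by auto
      then have "(\<Sum>l<n. q i l * q j l) = (\<Sum>l<n. if l = i then (if i = j then 1 else 0) else 0)"
        by (intro sum.cong refl) (auto simp: q_def)
      then show ?thesis using \<open>i < n\<close> by simp
    qed
    show "(\<Sum>l<n. q i l * q j l) = (if i = j then 1 else 0)"
    proof (cases "i = n")
      case True
      then show ?thesis using nn nb ij by auto
    next
      case False
      then have iB: "i \<in> B" using ij by simp
      show ?thesis
      proof (cases "j = n")
        case True
        then show ?thesis using nb[OF iB] False by (simp add: mult.commute)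
      next
        case False
        then show ?thesis using bb iB ij by simp
      qed
    qed
  qed
  define F where "F = (\<lambda>v. of_bool (0 < v n \<and> (\<forall>j\<in>B. \<bar>v j\<bar> \<le> v n / R * w j)) :: ennreal)"
  have Fm: "F \<in> borel_measurable (gauss (insert n B))"
    unfolding F_def
  proof (intro of_bool_measurable pred_intros_logic(3))
    have c: "(\<lambda>z. z j) \<in> borel_measurable (gauss (insert n B))" if "j \<in> insert n B" for j
      using that by (rule measurable_gauss_coord)
    show "(\<lambda>v. 0 < v n) \<in> measurable (gauss (insert n B)) (count_space UNIV)"
      by (intro borel_measurable_pred_less borel_measurable_const c) simp
    show "(\<lambda>v. \<forall>j\<in>B. \<bar>v j\<bar> \<le> v n / R * w j) \<in> measurable (gauss (insert n B)) (count_space UNIV)"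
    proof (rule pred_intros_finite(3)[OF nB(2)])
      fix j assume j: "j \<in> B"
      show "(\<lambda>v. \<bar>v j\<bar> \<le> v n / R * w j) \<in> measurable (gauss (insert n B)) (count_space UNIV)"
        unfolding pred_def using j
        by (intro borel_measurable_le borel_measurable_abs borel_measurable_times borel_measurable_divide borel_measurable_const c) auto
    qed
  qed
  have hF: "of_bool (0 < dot n u z \<and> (\<forall>j\<in>B. \<bar>z j\<bar> \<le> dot n u z / dot n u u * w j)) = F (lin q {..<n} (insert n B) z)" for z
  proof -
    have 1: "lin q {..<n} (insert n B) z n = dot n u z / R"
      by (simp add: lin_def q_def dot_def sum_divide_distrib)
    have 2: "lin q {..<n} (insert n B) z j = z j" if "j \<in> B" for j
    proof -
      have "j \<noteq> n" "j < n" using that nB by auto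
      then have "(\<Sum>l<n. q j l * z l) = (\<Sum>l<n. if l = j then z l else 0)"
        by (intro sum.cong refl) (auto simp: q_def)
      then show ?thesis using that \<open>j < n\<close> by (simp add: lin_def)
    qed
    show ?thesis unfolding F_def uu using R by (simp add: 1 2 zero_less_divide_iff)
  qed
  have "(\<integral>\<^sup>+z. of_bool (0 < dot n u z \<and> (\<forall>j\<in>B. \<bar>z j\<bar> \<le> dot n u z / dot n u u * w j)) \<partial>gauss {..<n}) = (\<integral>\<^sup>+v. F v \<partial>gauss (insert n B))"
    unfolding hF using nB by (intro nn_integral_gauss_orthonormal on Fm) auto
  also have "\<dots> = (\<integral>\<^sup>+x. \<integral>\<^sup>+z. F (z(n := x)) \<partial>gauss B \<partial>stdn)"
    using G.product_nn_integral_insert_rev[OF nB(2,1), of F] Fm by (simp add: gauss_def)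
  also have "\<dots> = (\<integral>\<^sup>+x. of_bool (0 < x) * (\<Prod>j\<in>B. ennreal (erf (x / R * w j / sqrt 2))) \<partial>stdn)"
  proof (rule nn_integral_cong)
    fix x :: real
    have "F (z(n := x)) = of_bool (0 < x) * (\<Prod>j\<in>B. of_bool (\<bar>z j\<bar> \<le> x / R * w j))" for z
    proof -
      have nj: "(z(n := x)) j = z j" if "j \<in> B" for j using that nB by auto
      have "(\<Prod>j\<in>B. of_bool (\<bar>z j\<bar> \<le> x / R * w j) :: ennreal) = of_bool (\<forall>j\<in>B. \<bar>z j\<bar> \<le> x / R * w j)"
      proof (cases "\<forall>j\<in>B. \<bar>z j\<bar> \<le> x / R * w j")
        case False
        then obtain j where "j \<in> B" "\<not> \<bar>z j\<bar> \<le> x / R * w j" by blast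
        then show ?thesis using nB by (subst prod_zero) (auto intro!: bexI[of _ j])
      qed auto
      then show ?thesis using nj by (auto simp: F_def)
    qed
    then have "(\<integral>\<^sup>+z. F (z(n := x)) \<partial>gauss B) = (\<integral>\<^sup>+z. of_bool (0 < x) * (\<Prod>j\<in>B. of_bool (\<bar>z j\<bar> \<le> x / R * w j)) \<partial>gauss B)"
      by simp
    also have "\<dots> = of_bool (0 < x) * (\<integral>\<^sup>+z. (\<Prod>j\<in>B. of_bool (\<bar>z j\<bar> \<le> x / R * w j)) \<partial>gauss B)"
      by (cases "0 < x") auto
    also have "(\<integral>\<^sup>+z. (\<Prod>j\<in>B. of_bool (\<bar>z j\<bar> \<le> x / R * w j)) \<partial>gauss B) = (\<Prod>j\<in>B. \<integral>\<^sup>+t. of_bool (\<bar>t\<bar> \<le> x / R * w j) \<partial>stdn)"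
      unfolding gauss_def by (rule G.product_nn_integral_prod[OF nB(2)]) (simp cong: measurable_cong_sets)
    also have "of_bool (0 < x) * \<dots> = of_bool (0 < x) * (\<Prod>j\<in>B. ennreal (erf (x / R * w j / sqrt 2)))"
    proof (cases "0 < x")
      case True
      have "(\<integral>\<^sup>+t. of_bool (\<bar>t\<bar> \<le> x / R * w j) \<partial>stdn) = ennreal (erf (x / R * w j / sqrt 2))" if "j \<in> B" for j
      proof -
        have "0 < w j" using that w nB by auto
        then have "0 \<le> x / R * w j" using True R by simp
        from emeasure_std_normal_erf[OF this]
        have "(\<integral>\<^sup>+t. indicator {t. \<bar>t\<bar> \<le> x / R * w j} t \<partial>stdn) = ennreal (erf (x / R * w j / sqrt 2))"
          by (subst nn_integral_indicator) auto
        moreover have "(\<integral>\<^sup>+t. indicator {t. \<bar>t\<bar> \<le> x / R * w j} t \<partial>stdn) = (\<integral>\<^sup>+t. of_bool (\<bar>t\<bar> \<le> x / R * w j) \<partial>stdn)"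
          by (intro nn_integral_cong) (simp add: indicator_def)
        ultimately show ?thesis by simp
      qed
      then show ?thesis by simp
    qed simp
    finally show "(\<integral>\<^sup>+z. F (z(n := x)) \<partial>gauss B) = of_bool (0 < x) * (\<Prod>j\<in>B. ennreal (erf (x / R * w j / sqrt 2)))" .
  qed
  finally show ?thesis by (simp add: ext_int_def B_def R_def)
qed

text \<open>Decoupling splits off the external factor, and \<open>cone_compare\<close> reduces the
  rest to the projection of a Gaussian vector z. For the Chernoff bound the component along
  \<open>u\<close> is put back: it is independent of the projection and satisfies 0 <= u . z <= R
  with probability \<open>p01\<close>. On this event z itself has the signs \<open>s\<close> on
  \<open>T\<close>, and exp (\<sigma> (u . z - R)) is at least one. The price
  \<open>exp (- \<sigma> * R) / p01\<close> is subexponential for bounded \<sigma> because R is of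
  order sqrt n.\<close>

lemma face_pattern_prob:
  assumes T: "T \<subseteq> {k..<n}" "k \<le> n" "0 < k" and s: "\<And>j. s j = 1 \<or> s j = - 1" and w: "\<And>j. j < n \<Longrightarrow> 0 < w j"
    and e: "0 < e" and \<sigma>: "\<sigma> \<le> 0"
  shows "(\<integral>\<^sup>+W. of_bool (face_pattern w n m e k T s W) \<partial>gauss ({..m} \<times> {..<n}))
     \<le> ennreal (exp (- \<sigma> * fnrm w k T) / p01 * (exp (int_exp w k T \<sigma>) / 2 ^ card T)) * ext_int w n k T"
    and "(\<lambda>W. face_pattern w n m e k T s W) \<in> measurable (gauss ({..m} \<times> {..<n})) (count_space UNIV)"
proof -
  define u where "u = facevec w k T s"
  define J where "J = {..<k} \<union> T"
  interpret ridge_hyperplane n J u e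
    using T e by unfold_locales (auto simp: J_def u_def facevec_def)
  have fT: "finite T" using T finite_subset by blast
  define R where "R = fnrm w k T"
  have R: "R > 0" unfolding R_def using T w fT by (intro fnrm_pos) auto
  have uR: "nrm n u = R" unfolding u_def R_def by (rule dot_facevec_self[OF T(1,2) s])
  then have uu: "dot n u u = R * R" using nrm_sq[of n u] by (simp add: power2_eq_square)
  define c where "c = (\<lambda>l j. if j = l then s l else (0::real))"
  have cs: "dot n (c l) d = s l * d l" if "l \<in> T" for l d
    using that T unfolding c_def dot_commute[of n _ d] by (subst dot_delta) auto
  define h where "h = (\<lambda>z. of_bool (0 < dot n u z \<and> (\<forall>j\<in>{k..<n} - T. \<bar>z j\<bar> \<le> dot n u z / dot n u u * w j)) :: ennreal)"
  define Gp where "Gp = (\<lambda>d. 0 < nrm n d \<and> (\<forall>l\<in>T. 0 \<le> dot n (c l) d))"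
  have Gm0: "(\<lambda>W. \<forall>l\<in>T. 0 \<le> dot n (c l) (sol m e W)) \<in> measurable (gauss ({..m} \<times> {..<n})) (count_space UNIV)" for m
    using dots_meas[OF fT, of 0 c m] by (simp only: minus_zero mult_zero_left)
  have Gm: "(\<lambda>W. Gp (sol m e W)) \<in> measurable (gauss ({..m} \<times> {..<n})) (count_space UNIV)"
    unfolding Gp_def
    by (intro pred_intros_logic(3) Gm0 borel_measurable_pred_less borel_measurable_const dot_sol_meas)
  have hp: "(\<lambda>z. 0 < dot n u z \<and> (\<forall>j\<in>{k..<n} - T. \<bar>z j\<bar> \<le> dot n u z / dot n u u * w j)) \<in> measurable (gauss {..<n}) (count_space UNIV)"
    by (rule normal_cone_meas) auto
  have fp: "face_pattern w n m e k T s W \<longleftrightarrow> Gp (sol m e W) \<and> (0 < dot n u (pvec m W) \<and> (\<forall>j\<in>{k..<n} - T. \<bar>pvec m W j\<bar> \<le> dot n u (pvec m W) / dot n u u * w j))" for W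
    by (auto simp: face_pattern_def Let_def Gp_def u_def[symmetric] J_def[symmetric] cs)
  show "(\<lambda>W. face_pattern w n m e k T s W) \<in> measurable (gauss ({..m} \<times> {..<n})) (count_space UNIV)"
    unfolding fp by (intro pred_intros_logic(3)[OF Gm] measurable_compose[OF pvec_meas hp])
  have "(\<integral>\<^sup>+W. of_bool (face_pattern w n m e k T s W) \<partial>gauss ({..m} \<times> {..<n}))
      = (\<integral>\<^sup>+W. of_bool (Gp (sol m e W)) * h (pvec m W) \<partial>gauss ({..m} \<times> {..<n}))"
    unfolding fp h_def by (intro nn_integral_cong) auto
  also have "\<dots> = (\<integral>\<^sup>+W. of_bool (Gp (sol m e W)) \<partial>gauss ({..m} \<times> {..<n})) * (\<integral>\<^sup>+z. h z \<partial>gauss {..<n})"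
  proof (rule nn_integral_decouple[OF Gm])
    show "h \<in> borel_measurable (gauss {..<n})" unfolding h_def by (rule of_bool_measurable[OF hp])
    show "h z = h z'" if "dot n u z = dot n u z'" "\<And>j. j < n \<Longrightarrow> j \<notin> J \<Longrightarrow> z j = z' j" for z z'
      using that by (auto simp: h_def J_def)
    show "h (\<lambda>j. t * z j) = h z" if "0 < t" for t z
    proof -
      have "\<bar>t * z j\<bar> \<le> t * dot n u z / dot n u u * w j \<longleftrightarrow> \<bar>z j\<bar> \<le> dot n u z / dot n u u * w j" for j
      proof -
        have "\<bar>t * z j\<bar> \<le> t * dot n u z / dot n u u * w j \<longleftrightarrow> t * \<bar>z j\<bar> \<le> t * (dot n u z / dot n u u * w j)"
          using that by (simp add: abs_mult mult.assoc)
        then show ?thesis using that by (simp only: mult_le_cancel_left_pos)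
      qed
      then show ?thesis unfolding h_def dot_smult_right using that by (simp add: zero_less_mult_iff)
    qed
  qed
  also have "(\<integral>\<^sup>+z. h z \<partial>gauss {..<n}) = ext_int w n k T"
    unfolding h_def u_def by (rule normal_cone_prob[OF T s w])
  also have "(\<integral>\<^sup>+W. of_bool (Gp (sol m e W)) \<partial>gauss ({..m} \<times> {..<n})) \<le> (\<integral>\<^sup>+W. of_bool (\<forall>l\<in>T. 0 \<le> dot n (c l) (sol 0 e W)) \<partial>gauss ({..0} \<times> {..<n}))"
    unfolding Gp_def by (rule cone_compare[OF fT])
  also have "\<dots> \<le> ennreal (exp (- \<sigma> * fnrm w k T) / p01 * (exp (int_exp w k T \<sigma>) / 2 ^ card T))"
  proof -
    define h0 where "h0 = (\<lambda>z. indicator {0..1} (dot n u z / R) :: ennreal)"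
    have hm: "h0 \<in> borel_measurable (gauss {..<n})"
    proof -
      have "(\<lambda>z. dot n u z / R) \<in> borel_measurable (gauss {..<n})"
        unfolding dot_def by (rule borel_measurable_divide, rule borel_measurable_sum, rule borel_measurable_times,
            rule borel_measurable_const, rule measurable_gauss_coord, assumption, rule borel_measurable_const)
      then show ?thesis unfolding h0_def by (rule measurable_compose) simp
    qed
    have i0: "(\<integral>\<^sup>+z. h0 z \<partial>gauss {..<n}) = ennreal p01"
    proof -
      have v: "(\<Sum>j<n. u j / R * (u j / R)) = 1"
      proof -
        have "(\<Sum>j<n. u j / R * (u j / R)) = dot n u u / (R * R)" by (simp add: dot_def sum_divide_distrib)
        then show ?thesis using uu R by simp
      qed
      have "(\<integral>\<^sup>+z. indicator {0..1} (\<Sum>j<n. u j / R * z j) \<partial>gauss {..<n}) = (\<integral>\<^sup>+x. indicator {0..1} x \<partial>stdn)"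
        by (rule nn_integral_gauss_unit[OF _ v]) auto
      then show ?thesis by (simp add: h0_def dot_def sum_divide_distrib emeasure_p01)
    qed
    let ?P = "(\<integral>\<^sup>+W. of_bool (\<forall>l\<in>T. 0 \<le> dot n (c l) (sol 0 e W)) \<partial>gauss ({..0} \<times> {..<n}))"
    have "?P * ennreal p01 = (\<integral>\<^sup>+W. of_bool (\<forall>l\<in>T. 0 \<le> dot n (c l) (sol 0 e W)) * h0 (pvec 0 W) \<partial>gauss ({..0} \<times> {..<n}))"
      unfolding i0[symmetric]
      by (rule nn_integral_decouple[OF Gm0 hm, symmetric]) (simp_all add: h0_def)
    also have "\<dots> \<le> (\<integral>\<^sup>+W. ennreal (exp (- \<sigma> * R)) * (of_bool (\<forall>j\<in>T. 0 \<le> s j * W (0::nat, j)) * ennreal (exp (\<sigma> * dot n u (\<lambda>j. W (0, j))))) \<partial>gauss ({..0} \<times> {..<n}))"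
    proof (rule nn_integral_mono)
      fix W :: "nat \<times> nat \<Rightarrow> real"
      define z where "z = (\<lambda>j. W (0, j))"
      have du: "dot n u (pvec 0 W) = dot n u z"
        by (rule dot_cong) (simp_all add: pvec_0 z_def)
      show "of_bool (\<forall>l\<in>T. 0 \<le> dot n (c l) (sol 0 e W)) * h0 (pvec 0 W)
        \<le> ennreal (exp (- \<sigma> * R)) * (of_bool (\<forall>j\<in>T. 0 \<le> s j * W (0::nat, j)) * ennreal (exp (\<sigma> * dot n u (\<lambda>j. W (0, j)))))"
      proof (cases "(\<forall>l\<in>T. 0 \<le> dot n (c l) (sol 0 e W)) \<and> dot n u z / R \<in> {0..1}")
        case False
        then have "of_bool (\<forall>l\<in>T. 0 \<le> dot n (c l) (sol 0 e W)) * h0 (pvec 0 W) = 0"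
          unfolding h0_def du by (auto simp: indicator_def)
        then show ?thesis by (simp only: zero_le)
      next
        case True
        have z0: "0 \<le> dot n u z" "dot n u z \<le> R" using True R by (auto simp: zero_le_divide_iff divide_le_eq)
        have "0 \<le> s j * z j" if j: "j \<in> T" for j
        proof -
          have "0 \<le> dot n (c j) (sol 0 e W)" using True j by blast
          then have "0 \<le> s j * proj z j" unfolding cs[OF j] sol_0_row z_def .
          \<comment> \<open>The multiple of \<open>u\<close> that was projected away has sign
            \<open>s j\<close> at \<open>j\<close>, so restoring it keeps the sign
            condition.\<close>
          moreover have "proj z j = z j - dot n u z / dot n u u * u j"
          proof -
            have "j \<in> J" using j by (simp add: J_def)
            then show ?thesis by (simp add: proj_def)
          qed
          moreover have "u j = s j * w j" "0 < w j" using j T w by (auto simp: u_def facevec_def)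
          then have "s j * u j = w j" using s[of j] by auto
          ultimately have "0 \<le> s j * z j - dot n u z / dot n u u * w j"
            by (simp add: right_diff_distrib mult.left_commute[of "s j"])
          moreover have "0 \<le> dot n u z / dot n u u * w j" using z0 uu R \<open>0 < w j\<close> by simp
          ultimately show ?thesis by linarith
        qed
        moreover have "0 \<le> - \<sigma> * R + \<sigma> * dot n u z"
          using mult_left_mono_neg[OF z0(2) \<sigma>] by simp
        then have "1 \<le> exp (- \<sigma> * R) * exp (\<sigma> * dot n u z)" unfolding exp_add[symmetric] by simp
        then have "1 \<le> ennreal (exp (- \<sigma> * R)) * ennreal (exp (\<sigma> * dot n u z))"
          by (simp add: ennreal_mult[symmetric])
        ultimately show ?thesis using True unfolding h0_def du z_def by (simp add: z_def[symmetric])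
      qed
    qed
    also have "\<dots> = ennreal (exp (- \<sigma> * R)) * ennreal (exp (int_exp w k T \<sigma>) / 2 ^ card T)"
    proof (subst nn_integral_cmult)
      show "(\<lambda>W. of_bool (\<forall>j\<in>T. 0 \<le> s j * W (0::nat, j)) * ennreal (exp (\<sigma> * dot n u (\<lambda>j. W (0, j))))) \<in> borel_measurable (gauss ({..0} \<times> {..<n}))"
      proof (rule borel_measurable_times_ennreal)
        have W0: "(\<lambda>W. W (0::nat, j)) \<in> borel_measurable (gauss ({..0} \<times> {..<n}))" if "j < n" for j
          using that by (intro measurable_gauss_coord) auto
        show "(\<lambda>W. of_bool (\<forall>j\<in>T. 0 \<le> s j * W (0::nat, j)) :: ennreal) \<in> borel_measurable (gauss ({..0} \<times> {..<n}))"
        proof (intro of_bool_measurable pred_intros_finite(3)[OF fT])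
          fix j assume "j \<in> T"
          then have "j < n" using T by auto
          then show "(\<lambda>W. 0 \<le> s j * W (0::nat, j)) \<in> measurable (gauss ({..0} \<times> {..<n})) (count_space UNIV)"
            unfolding pred_def by (intro borel_measurable_le borel_measurable_const borel_measurable_times W0)
        qed
        have "(\<lambda>W. \<sigma> * dot n u (\<lambda>j. W (0::nat, j))) \<in> borel_measurable (gauss ({..0} \<times> {..<n}))"
          unfolding dot_def by (rule borel_measurable_times, rule borel_measurable_const, rule borel_measurable_sum,
              rule borel_measurable_times, rule borel_measurable_const, rule W0) simp
        then show "(\<lambda>W. ennreal (exp (\<sigma> * dot n u (\<lambda>j. W (0::nat, j))))) \<in> borel_measurable (gauss ({..0} \<times> {..<n}))"
          by (rule measurable_compose) simp
      qed
      show "ennreal (exp (- \<sigma> * R)) * (\<integral>\<^sup>+W. of_bool (\<forall>j\<in>T. 0 \<le> s j * W (0::nat, j)) * ennreal (exp (\<sigma> * dot n u (\<lambda>j. W (0, j)))) \<partial>gauss ({..0} \<times> {..<n}))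
        = ennreal (exp (- \<sigma> * R)) * ennreal (exp (int_exp w k T \<sigma>) / 2 ^ card T)"
        unfolding u_def by (subst chernoff_row[OF T(1,2) s]) (rule refl)
    qed
    also have "\<dots> = ennreal (exp (- \<sigma> * R) * (exp (int_exp w k T \<sigma>) / 2 ^ card T))"
      by (rule ennreal_mult[symmetric]) auto
    finally have P: "?P * ennreal p01 \<le> ennreal (exp (- \<sigma> * R) * (exp (int_exp w k T \<sigma>) / 2 ^ card T))" .
    have "?P = ?P * ennreal p01 * ennreal (1 / p01)"
      using p01_pos by (simp add: mult.assoc ennreal_mult[symmetric])
    also have "\<dots> \<le> ennreal (exp (- \<sigma> * R) * (exp (int_exp w k T \<sigma>) / 2 ^ card T)) * ennreal (1 / p01)"
      by (rule mult_right_mono[OF P]) simp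
    also have "\<dots> = ennreal (exp (- \<sigma> * R) / p01 * (exp (int_exp w k T \<sigma>) / 2 ^ card T))"
      using p01_pos by (subst ennreal_mult[symmetric]) auto
    finally show ?thesis by (simp only: R_def)
  qed
  finally show "(\<integral>\<^sup>+W. of_bool (face_pattern w n m e k T s W) \<partial>gauss ({..m} \<times> {..<n}))
     \<le> ennreal (exp (- \<sigma> * fnrm w k T) / p01 * (exp (int_exp w k T \<sigma>) / 2 ^ card T)) * ext_int w n k T"
    by (simp add: mult_right_mono)
qed

text \<open>Here \<open>S\<close> is the whole space, so \<open>sol 0\<close> is the Gaussian row
  itself, and the descent constraint makes the exponential factor at least one for
  \<open>\<sigma> \<le> 0\<close>.\<close>

lemma cone_pattern_prob:
  assumes k: "k \<le> n" and s: "\<And>j. s j = 1 \<or> s j = - 1" and e: "0 < e" and \<sigma>: "\<sigma> \<le> 0"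
  shows "(\<integral>\<^sup>+W. of_bool (cone_pattern w n m e k s W) \<partial>gauss ({..m} \<times> {..<n}))
     \<le> ennreal (exp (int_exp w k {k..<n} \<sigma>) / 2 ^ card {k..<n})"
    and "(\<lambda>W. cone_pattern w n m e k s W) \<in> measurable (gauss ({..m} \<times> {..<n})) (count_space UNIV)"
proof -
  define v where "v = facevec w k {k..<n} s"
  interpret ridge_hyperplane n "{..<n}" "\<lambda>_. 0" e
    using e by unfold_locales auto
  \<comment> \<open>\<open>None\<close> encodes the descent constraint and \<open>Some l\<close> the
    sign of coordinate \<open>l\<close>, which puts both into the form required by
    \<open>cone_compare\<close>.\<close>
  define c where "c = (\<lambda>l. case l of None \<Rightarrow> (\<lambda>j. (-1) * v j) | Some l \<Rightarrow> (\<lambda>j. if j = l then s l else (0::real)))"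
  define L where "L = insert None (Some ` {k..<n})"
  have fL: "finite L" by (simp add: L_def)
  have cs: "(\<forall>l\<in>L. 0 \<le> dot n (c l) d) \<longleftrightarrow> (\<forall>j\<in>{k..<n}. 0 \<le> s j * d j) \<and> dot n v d \<le> 0" for d
  proof -
    have "dot n (c (Some l)) d = s l * d l" if "l \<in> {k..<n}" for l
      using that unfolding c_def dot_commute[of n _ d] option.case by (subst dot_delta) auto
    moreover have "dot n (c None) d = - dot n v d" unfolding c_def option.case dot_smult_left by simp
    ultimately show ?thesis by (auto simp: L_def)
  qed
  have cp: "cone_pattern w n m e k s W \<longleftrightarrow> 0 < nrm n (sol m e W) \<and> (\<forall>l\<in>L. 0 \<le> dot n (c l) (sol m e W))" for W
    unfolding cs cone_pattern_def Let_def v_def ..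
  have Gm0: "(\<lambda>W. \<forall>l\<in>L. 0 \<le> dot n (c l) (sol m e W)) \<in> measurable (gauss ({..m} \<times> {..<n})) (count_space UNIV)" for m
    using dots_meas[OF fL, of 0 c m] by (simp only: minus_zero mult_zero_left)
  show "(\<lambda>W. cone_pattern w n m e k s W) \<in> measurable (gauss ({..m} \<times> {..<n})) (count_space UNIV)"
    unfolding cp by (intro pred_intros_logic(3) Gm0 borel_measurable_pred_less borel_measurable_const dot_sol_meas)
  have "(\<integral>\<^sup>+W. of_bool (cone_pattern w n m e k s W) \<partial>gauss ({..m} \<times> {..<n}))
      \<le> (\<integral>\<^sup>+W. of_bool (\<forall>l\<in>L. 0 \<le> dot n (c l) (sol 0 e W)) \<partial>gauss ({..0} \<times> {..<n}))"
    unfolding cp by (rule cone_compare[OF fL])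
  also have "\<dots> \<le> (\<integral>\<^sup>+W. of_bool (\<forall>j\<in>{k..<n}. 0 \<le> s j * W (0::nat, j)) * ennreal (exp (\<sigma> * dot n v (\<lambda>j. W (0, j)))) \<partial>gauss ({..0} \<times> {..<n}))"
  proof (rule nn_integral_mono)
    fix W :: "nat \<times> nat \<Rightarrow> real"
    have so: "sol 0 e W j = W (0, j)" if "j < n" for j
      using that by (simp add: sol_0_row proj_def)
    have dv: "dot n v (sol 0 e W) = dot n v (\<lambda>j. W (0, j))"
      by (rule dot_cong) (simp_all add: so)
    show "of_bool (\<forall>l\<in>L. 0 \<le> dot n (c l) (sol 0 e W)) \<le> of_bool (\<forall>j\<in>{k..<n}. 0 \<le> s j * W (0::nat, j)) * ennreal (exp (\<sigma> * dot n v (\<lambda>j. W (0, j))))"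
      unfolding cs dv using so \<sigma> by (auto simp: mult_nonpos_nonpos)
  qed
  also have "\<dots> = ennreal (exp (int_exp w k {k..<n} \<sigma>) / 2 ^ card {k..<n})"
    unfolding v_def by (rule chernoff_row[OF _ k s]) auto
  finally show "(\<integral>\<^sup>+W. of_bool (cone_pattern w n m e k s W) \<partial>gauss ({..m} \<times> {..<n}))
     \<le> ennreal (exp (int_exp w k {k..<n} \<sigma>) / 2 ^ card {k..<n})" .
qed

section \<open>Nondegenerate Gaussian matrices\<close>

text \<open>Any \<open>m\<close> columns are linearly independent, in quantitative form.\<close>

definition nondeg :: "nat \<Rightarrow> nat \<Rightarrow> (nat \<times> nat \<Rightarrow> real) \<Rightarrow> bool" where
  "nondeg m n W \<longleftrightarrow> (\<forall>J. J \<subseteq> {..<n} \<longrightarrow> card J \<le> m \<longrightarrow>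
     (\<exists>C. \<forall>d. (\<forall>j. j \<notin> J \<longrightarrow> d j = 0) \<longrightarrow> dot n d d \<le> C * (\<Sum>i<m. (rowdot W n i d)\<^sup>2)))"

lemma nondeg_const:
  assumes "nondeg m n W"
  obtains C where "C > 0" "\<And>J d. J \<subseteq> {..<n} \<Longrightarrow> card J \<le> m \<Longrightarrow> (\<And>j. j \<notin> J \<Longrightarrow> d j = 0) \<Longrightarrow>
     dot n d d \<le> C * (\<Sum>i<m. (rowdot W n i d)\<^sup>2)"
proof -
  from assms have "\<forall>J. \<exists>C. J \<subseteq> {..<n} \<longrightarrow> card J \<le> m \<longrightarrow>
     (\<forall>d. (\<forall>j. j \<notin> J \<longrightarrow> d j = 0) \<longrightarrow> dot n d d \<le> C * (\<Sum>i<m. (rowdot W n i d)\<^sup>2))"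
    unfolding nondeg_def by blast
  then obtain c where c: "\<And>J d. J \<subseteq> {..<n} \<Longrightarrow> card J \<le> m \<Longrightarrow> (\<forall>j. j \<notin> J \<longrightarrow> d j = 0) \<Longrightarrow>
     dot n d d \<le> c J * (\<Sum>i<m. (rowdot W n i d)\<^sup>2)" by metis
  define C where "C = 1 + (\<Sum>J\<in>Pow {..<n}. \<bar>c J\<bar>)"
  have "0 \<le> (\<Sum>J\<in>Pow {..<n}. \<bar>c J\<bar>)" by (intro sum_nonneg) auto
  then have "C > 0" unfolding C_def by linarith
  moreover have "dot n d d \<le> C * (\<Sum>i<m. (rowdot W n i d)\<^sup>2)"
    if "J \<subseteq> {..<n}" "card J \<le> m" "\<And>j. j \<notin> J \<Longrightarrow> d j = 0" for J d
  proof -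
    have "\<bar>c J\<bar> \<le> (\<Sum>J\<in>Pow {..<n}. \<bar>c J\<bar>)" using that by (intro member_le_sum) auto
    then have "c J \<le> C" by (simp add: C_def)
    then have "c J * (\<Sum>i<m. (rowdot W n i d)\<^sup>2) \<le> C * (\<Sum>i<m. (rowdot W n i d)\<^sup>2)"
      by (intro mult_right_mono sum_nonneg) auto
    then show ?thesis using c[of J d] that by force
  qed
  ultimately show thesis by (rule that)
qed

definition sgn_of :: "nat set \<Rightarrow> nat \<Rightarrow> real" where
  "sgn_of R j = (if j \<in> R then - 1 else 1)"

lemma sgn_of_cases: "sgn_of R j = 1 \<or> sgn_of R j = - 1"
  by (simp add: sgn_of_def)

lemma dot_split_at: "k \<le> n \<Longrightarrow> dot n x y = (\<Sum>j<k. x j * y j) + (\<Sum>j=k..<n. x j * y j)"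
  unfolding dot_def by (subst sum.union_disjoint[symmetric]) (auto intro!: sum.cong)

text \<open>The minimiser \<open>d\<close> is nonzero because \<open>d0\<close> lies in the cone,
  carries no penalty and has positive inner product with g. If the multiplier \<open>l\<close>
  vanishes, \<open>d\<close> is the unconstrained minimiser; otherwise it solves the problem on the
  span of the face given by its support. In the latter case a support contained in at most
  \<open>m\<close> active coordinates would give |d|^2 <= C |A d|^2 <= C e |g|^2, contradicting |d|
  |d0| >= d0 . g for small \<open>e\<close>.\<close>

lemma pattern_exists:
  assumes w: "\<And>j. j < n \<Longrightarrow> 0 < w j" and k: "0 < k" "k \<le> n" and e: "0 < e"
    and d0: "d0 \<in> descent_cone w k n" "\<And>i. i < m \<Longrightarrow> rowdot W n i d0 = 0" "0 < rowdot W n m d0"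
    and C: "C > 0" "\<And>J d. J \<subseteq> {..<n} \<Longrightarrow> card J \<le> m \<Longrightarrow> (\<And>j. j \<notin> J \<Longrightarrow> d j = 0) \<Longrightarrow>
       dot n d d \<le> C * (\<Sum>i<m. (rowdot W n i d)\<^sup>2)"
    and small: "e * (C * (dot n (\<lambda>j. W (m, j)) (\<lambda>j. W (m, j)) * dot n d0 d0)) < (rowdot W n m d0)\<^sup>2"
  shows "(\<exists>T. T \<subseteq> {k..<n} \<and> m < k + card T \<and> (\<exists>R\<in>Pow T. face_pattern w n m e k T (sgn_of R) W))
     \<or> (\<exists>R\<in>Pow {k..<n}. cone_pattern w n m e k (sgn_of R) W)"
proof -
  obtain d where dC: "d \<in> descent_cone w k n"
    and opt: "\<And>d'. d' \<in> descent_cone w k n \<Longrightarrow> rowdot W n m d' \<le> ridge W m n e d d'"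
    and opt0: "ridge W m n e d d = rowdot W n m d"
    using ridge_min_exists[OF convex_cone_descent[of n w k] e, where m = m and W = W] w by (auto intro: less_imp_le)
  have dout: "d j = 0" if "n \<le> j" for j using dC that by (simp add: descent_cone_def)
  define p where "p = (\<lambda>j. W (m, j) - (\<Sum>i<m. rowdot W n i d / e * W (i, j)))"
  define r where "r = (\<lambda>j. p j - d j)"
  have dp: "dot n p x = rowdot W n m x - (\<Sum>i<m. rowdot W n i d * rowdot W n i x) / e" for x
  proof -
    have "(\<Sum>j<n. (\<Sum>i<m. rowdot W n i d / e * W (i, j)) * x j) = (\<Sum>i<m. rowdot W n i d * rowdot W n i x) / e"
      unfolding sum_divide_distrib sum_distrib_right
      by (subst sum.swap) (simp add: rowdot_def[of _ _ _ x] sum_distrib_left sum_divide_distrib mult_ac)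
    then show ?thesis by (simp add: p_def dot_def rowdot_def[of _ _ m] left_diff_distrib sum_subtractf)
  qed
  have dr: "dot n r x = rowdot W n m x - ridge W m n e d x" for x
    by (simp add: r_def dot_diff_left dp ridge_def)
  have "\<exists>l\<ge>0. (\<forall>j<k. r j = l * w j) \<and> (\<forall>j\<in>{k..<n}. \<bar>r j\<bar> \<le> l * w j) \<and>
     (\<forall>j\<in>{k..<n}. d j \<noteq> 0 \<longrightarrow> r j = l * w j * sgn (d j)) \<and> (0 < l \<longrightarrow> qf w k n d = 0)"
  proof (rule polar_descent_cone)
    show "0 < w j" if "j < n" for j using w that .
    show "dot n r d' \<le> 0" if "d' \<in> descent_cone w k n" for d' using opt[OF that] by (simp add: dr)
    show "dot n r d = 0" using opt0 by (simp add: dr)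
  qed (use k dC in auto)
  then obtain l where l: "l \<ge> 0" "\<And>j. j < k \<Longrightarrow> r j = l * w j" "\<And>j. j \<in> {k..<n} \<Longrightarrow> \<bar>r j\<bar> \<le> l * w j"
    "\<And>j. j \<in> {k..<n} \<Longrightarrow> d j \<noteq> 0 \<Longrightarrow> r j = l * w j * sgn (d j)" "0 < l \<Longrightarrow> qf w k n d = 0"
    by blast
  have "ridge W m n e d d0 = dot n d d0" by (simp add: ridge_def d0)
  then have dd0: "rowdot W n m d0 \<le> dot n d d0" using opt[OF d0(1)] by simp
  then have "0 < dot n d d0" using d0 by simp
  then have dpos: "0 < nrm n d" using dot_le_nrm[of n d d0] by (auto simp: order_less_le)
  define T where "T = {j\<in>{k..<n}. d j \<noteq> 0}"
  define R where "R = {j\<in>T. d j < 0}"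
  have T: "T \<subseteq> {k..<n}" "finite T" by (auto simp: T_def)
  have RT: "R \<in> Pow T" by (auto simp: R_def)
  have sd: "sgn_of R j * d j = \<bar>d j\<bar>" if "j \<in> {k..<n}" for j
    using that by (auto simp: sgn_of_def R_def T_def)
  have sT: "sgn_of R j = sgn (d j)" if "j \<in> T" for j
    using that by (auto simp: sgn_of_def R_def T_def sgn_if)
  have fd: "dot n (facevec w k T' (sgn_of R)) d = qf w k n d" if "T \<subseteq> T'" "T' \<subseteq> {k..<n}" for T'
  proof -
    have "(\<Sum>j=k..<n. facevec w k T' (sgn_of R) j * d j) = (\<Sum>j=k..<n. w j * \<bar>d j\<bar>)"
    proof (intro sum.cong refl)
      fix j assume j: "j \<in> {k..<n}"
      show "facevec w k T' (sgn_of R) j * d j = w j * \<bar>d j\<bar>"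
      proof (cases "j \<in> T'")
        case True
        then show ?thesis using j sd[OF j] by (simp add: facevec_def mult_ac)
      next
        case False
        then have "d j = 0" using j that by (auto simp: T_def)
        then show ?thesis by simp
      qed
    qed
    then show ?thesis using k by (simp add: dot_split_at qf_def facevec_def)
  qed
  show ?thesis
  proof (cases "l = 0")
    case True
    \<comment> \<open>With \<open>l = 0\<close> the residual vanishes in all coordinates, so
      \<open>d\<close> satisfies the normal equations on the whole space.\<close>
    have r0: "r j = 0" if "j < n" for j
      using l(2)[of j] l(3)[of j] that True by (cases "j < k") auto
    interpret H: ridge_hyperplane n "{..<n}" "\<lambda>_. 0" e using e by unfold_locales auto
    have "H.is_sol m e W d"
    proof -
      have "d \<in> H.S" using dout by (auto simp: H.S_def dot_def)
      moreover have "ridge W m n e d x = rowdot W n m x" for x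
      proof -
        have "dot n r x = 0" using r0 by (simp add: dot_def)
        then show ?thesis using dr[of x] by simp
      qed
      ultimately show ?thesis by (simp add: H.is_sol_def)
    qed
    then have "H.sol m e W = d" by (rule H.sol_eqI[OF e])
    then have "cone_pattern w n m e k (sgn_of R) W"
      using dpos sd fd[of "{k..<n}"] T dC by (simp add: cone_pattern_def Let_def descent_cone_def)
    moreover have "R \<in> Pow {k..<n}" using RT T by auto
    ultimately show ?thesis by blast
  next
    case False
    then have lp: "0 < l" using l by simp
    define J where "J = {..<k} \<union> T"
    define u where "u = facevec w k T (sgn_of R)"
    interpret H: ridge_hyperplane n J u e
      using T e k by unfold_locales (auto simp: J_def u_def facevec_def)
    have rJ: "r j = l * u j" if "j \<in> J" for j
    proof (cases "j < k")
      case True then show ?thesis using l(2) by (simp add: u_def facevec_def)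
    next
      case False
      then have "j \<in> T" using that by (simp add: J_def)
      then show ?thesis using l(4)[of j] T False sT[of j] by (auto simp: u_def facevec_def T_def)
    qed
    have uout: "u j = 0" if "j \<notin> J" for j using that by (simp add: u_def facevec_def J_def)
    have djout: "d j = 0" if "j \<notin> J" for j using that dout[of j] by (cases "j < n") (auto simp: J_def T_def)
    have ud: "dot n u d = 0" using fd[of T] T l(5)[OF lp] by (simp add: u_def)
    have dS: "d \<in> H.S" using djout ud by (simp add: H.S_def)
    have rx: "dot n r x = l * dot n u x" if "\<And>j. j \<notin> J \<Longrightarrow> x j = 0" for x
      using that rJ by (subst (1 2) H.dot_restrict) (auto simp: sum_distrib_left mult.assoc intro!: sum.cong)
    have "H.is_sol m e W d"
    proof -
      have "ridge W m n e d x = rowdot W n m x" if "x \<in> H.S" for x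
        using rx[of x] that dr[of x] by (simp add: H.S_def)
      then show ?thesis using dS by (simp add: H.is_sol_def)
    qed
    then have sol: "H.sol m e W = d" by (rule H.sol_eqI[OF e])
    have pv: "H.pvec m W j = p j" if "j < n" for j
    proof -
      have "(\<Sum>i\<le>m. H.coef m W i * W (i, j)) = (\<Sum>i<m. H.coef m W i * W (i, j)) + H.coef m W m * W (m, j)"
        by (simp add: lessThan_Suc_atMost[symmetric])
      also have "(\<Sum>i<m. H.coef m W i * W (i, j)) = (\<Sum>i<m. - (rowdot W n i d / e * W (i, j)))"
        by (intro sum.cong refl) (simp add: H.coef_def sol)
      finally show ?thesis using that by (simp add: H.pvec_def p_def H.coef_def sum_negf)
    qed
    have up: "dot n u (H.pvec m W) = l * dot n u u"
    proof -
      have "dot n u (H.pvec m W) = dot n u (\<lambda>j. d j + r j)" by (rule dot_cong) (simp_all add: pv r_def)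
      also have "\<dots> = dot n r u" using ud by (simp add: dot_add_right dot_commute)
      also have "\<dots> = l * dot n u u" by (rule rx) (rule uout)
      finally show ?thesis .
    qed
    have "0 < nrm n u" unfolding u_def using T k w
      by (subst dot_facevec_self) (auto simp: sgn_of_cases intro!: fnrm_pos)
    then have uu: "0 < dot n u u" using nrm_sq[of n u] by (metis zero_less_power)
    have off: "\<bar>H.pvec m W j\<bar> \<le> dot n u (H.pvec m W) / dot n u u * w j" if "j \<in> {k..<n} - T" for j
    proof -
      have "d j = 0" "j < n" using that by (auto simp: T_def)
      then have "H.pvec m W j = r j" by (simp add: pv r_def)
      then show ?thesis using l(3)[of j] that uu by (simp add: up)
    qed
    have fp: "face_pattern w n m e k T (sgn_of R) W"
      unfolding face_pattern_def Let_def u_def[symmetric] J_def[symmetric] sol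
      using dpos sd T off up lp uu by auto
    have "m < k + card T"
    proof (rule ccontr)
      assume "\<not> m < k + card T"
      moreover have "card J = k + card T" unfolding J_def using T by (subst card_Un_disjoint) auto
      ultimately have "card J \<le> m" by simp
      then have dd: "dot n d d \<le> C * (\<Sum>i<m. (rowdot W n i d)\<^sup>2)" using H.J djout by (intro C(2)) auto
      define g where "g = nrm n (\<lambda>j. W (m, j))"
      have gd: "rowdot W n m d \<le> g * nrm n d" using rowdot_le[of W n m d] by (simp add: g_def)
      \<comment> \<open>This is \<open>opt0\<close> rearranged: the penalty sum at the minimiser is
        of order \<open>e\<close>.\<close>
      have id: "(\<Sum>i<m. (rowdot W n i d)\<^sup>2) = e * (rowdot W n m d - dot n d d)"
        using opt0 e by (simp add: ridge_def power2_eq_square field_simps)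
      have "0 \<le> (\<Sum>i<m. (rowdot W n i d)\<^sup>2)" by (intro sum_nonneg) auto
      then have "dot n d d \<le> rowdot W n m d" using id e by (simp add: zero_le_mult_iff)
      then have "nrm n d * nrm n d \<le> g * nrm n d" using gd by (simp add: nrm_sq[symmetric] power2_eq_square)
      then have ng: "nrm n d \<le> g" using dpos by simp
      have "(\<Sum>i<m. (rowdot W n i d)\<^sup>2) \<le> e * (g * g)"
      proof -
        have "rowdot W n m d - dot n d d \<le> g * nrm n d" using gd dot_self_nonneg[of n d] by simp
        also have "\<dots> \<le> g * g" using ng by (intro mult_left_mono) (auto simp: g_def)
        finally show ?thesis unfolding id using e by (intro mult_left_mono) auto
      qed
      then have "dot n d d \<le> C * (e * (g * g))" using dd C(1) by (meson mult_left_mono less_imp_le order_trans)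
      then have "dot n d d * dot n d0 d0 \<le> C * (e * (g * g)) * dot n d0 d0"
        by (intro mult_right_mono dot_self_nonneg)
      also have "\<dots> = e * (C * (dot n (\<lambda>j. W (m, j)) (\<lambda>j. W (m, j)) * dot n d0 d0))"
        unfolding g_def nrm_sq[symmetric] by (simp add: power2_eq_square)
      also have "\<dots> < (rowdot W n m d0)\<^sup>2" by (rule small)
      also have "\<dots> \<le> (dot n d d0)\<^sup>2" using dd0 d0 by (intro power_mono) auto
      also have "\<dots> \<le> (nrm n d * nrm n d0)\<^sup>2" using dot_le_nrm[of n d d0] by (intro abs_le_square_iff[THEN iffD1]) auto
      also have "\<dots> = dot n d d * dot n d0 d0" by (simp add: power_mult_distrib nrm_sq)
      finally show False by simp
    qed
    then show ?thesis using fp T RT by blast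
  qed
qed

section \<open>Gaussian elimination with almost surely nonzero pivots\<close>

text \<open>Elimination without row exchanges. After \<open>t\<close> steps only the entries with
  both indices at least \<open>t\<close> are of interest, and the next pivot is the entry
  \<open>(t, t)\<close>.\<close>

fun gauss_elim :: "(nat \<Rightarrow> nat \<Rightarrow> real) \<Rightarrow> nat \<Rightarrow> nat \<Rightarrow> nat \<Rightarrow> real" where
  "gauss_elim B 0 i j = B i j"
| "gauss_elim B (Suc t) i j = gauss_elim B t i j - gauss_elim B t i t * gauss_elim B t t j / gauss_elim B t t t"

text \<open>Up to step \<open>a\<close> the entry \<open>(a, a)\<close> is neither a pivot nor part
  of a product, so it enters its own pivot additively with coefficient one. For given other entries
  that pivot vanishes for a single value of it.\<close>

lemma gauss_elim_upd:
  assumes "t \<le> a" "t \<le> i" "t \<le> j"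
    and "\<And>i j. (i, j) \<noteq> (a, a) \<Longrightarrow> B' i j = B i j"
  shows "gauss_elim B' t i j = gauss_elim B t i j + (if (i, j) = (a, a) then B' a a - B a a else 0)"
  using assms(1-3)
proof (induction t arbitrary: i j)
  case 0
  then show ?case using assms(4) by auto
next
  case (Suc t)
  then show ?case by simp
qed

lemma gauss_elim_meas:
  assumes "\<And>i j. (\<lambda>A. B A i j) \<in> borel_measurable M"
  shows "(\<lambda>A. gauss_elim (B A) t i j) \<in> borel_measurable M"
proof (induction t arbitrary: i j)
  case 0
  show ?case unfolding gauss_elim.simps by (rule assms)
next
  case (Suc t)
  show ?case unfolding gauss_elim.simps
    by (intro borel_measurable_diff borel_measurable_divide borel_measurable_times Suc)
qed

text \<open>Each step replaces an equation by a combination of two, so residuals grow by a bounded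
  factor. The constant precedes \<open>x\<close> and \<open>\<rho>\<close> because
  \<open>nondeg\<close> asks for uniformity over all vectors.\<close>

lemma gauss_elim_residual_bound:
  fixes B :: "nat \<Rightarrow> nat \<Rightarrow> real"
  shows "t \<le> p \<Longrightarrow> (\<And>s. s < t \<Longrightarrow> gauss_elim B s s s \<noteq> 0) \<Longrightarrow> \<exists>K\<ge>0. \<forall>x \<rho>. (\<forall>i<p. \<bar>\<Sum>j<p. B i j * x j\<bar> \<le> \<rho>) \<longrightarrow>
     (\<forall>i\<in>{t..<p}. \<bar>\<Sum>j=t..<p. gauss_elim B t i j * x j\<bar> \<le> K * \<rho>)"
proof (induction t)
  case 0
  then show ?case by (intro exI[of _ 1]) (simp add: lessThan_atLeast0)
next
  case (Suc t)
  then obtain K where K: "K \<ge> 0" "\<And>x \<rho> i. (\<forall>i<p. \<bar>\<Sum>j<p. B i j * x j\<bar> \<le> \<rho>) \<Longrightarrow> i \<in> {t..<p} \<Longrightarrow> \<bar>\<Sum>j=t..<p. gauss_elim B t i j * x j\<bar> \<le> K * \<rho>"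
    by fastforce
  have piv: "gauss_elim B t t t \<noteq> 0" using Suc.prems by blast
  define K' where "K' = K + (\<Sum>i<p. \<bar>gauss_elim B t i t / gauss_elim B t t t\<bar>) * K"
  have "0 \<le> (\<Sum>i<p. \<bar>gauss_elim B t i t / gauss_elim B t t t\<bar>)" by (intro sum_nonneg) auto
  then have K'0: "K' \<ge> 0" using K(1) by (simp add: K'_def)
  have "\<bar>\<Sum>j=Suc t..<p. gauss_elim B (Suc t) i j * x j\<bar> \<le> K' * \<rho>"
    if x: "\<forall>i<p. \<bar>\<Sum>j<p. B i j * x j\<bar> \<le> \<rho>" and i: "i \<in> {Suc t..<p}" for x \<rho> i
  proof -
    define q where "q = gauss_elim B t i t / gauss_elim B t t t"
    have tp: "t < p" using i by auto
    have "0 \<le> \<rho>" using x tp by fastforce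
    have sp: "(\<Sum>j=t..<p. gauss_elim B t l j * x j) = gauss_elim B t l t * x t + (\<Sum>j=Suc t..<p. gauss_elim B t l j * x j)" for l
      using tp by (simp add: sum.atLeast_Suc_lessThan)
    have "(\<Sum>j=Suc t..<p. gauss_elim B (Suc t) i j * x j) = (\<Sum>j=Suc t..<p. gauss_elim B t i j * x j) - q * (\<Sum>j=Suc t..<p. gauss_elim B t t j * x j)"
      by (simp add: sum_subtractf sum_distrib_left left_diff_distrib q_def mult.assoc)
    also have "\<dots> = (\<Sum>j=t..<p. gauss_elim B t i j * x j) - q * (\<Sum>j=t..<p. gauss_elim B t t j * x j)"
      unfolding sp using piv by (simp add: q_def distrib_left)
    finally have "\<bar>\<Sum>j=Suc t..<p. gauss_elim B (Suc t) i j * x j\<bar> \<le> \<bar>\<Sum>j=t..<p. gauss_elim B t i j * x j\<bar> + \<bar>q\<bar> * \<bar>\<Sum>j=t..<p. gauss_elim B t t j * x j\<bar>"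
      by (metis abs_mult abs_triangle_ineq4)
    also have "\<dots> \<le> K * \<rho> + (\<Sum>i<p. \<bar>gauss_elim B t i t / gauss_elim B t t t\<bar>) * (K * \<rho>)"
    proof (intro add_mono mult_mono)
      show "\<bar>\<Sum>j=t..<p. gauss_elim B t i j * x j\<bar> \<le> K * \<rho>" using i by (intro K(2)[OF x]) auto
      show "\<bar>\<Sum>j=t..<p. gauss_elim B t t j * x j\<bar> \<le> K * \<rho>" using tp by (intro K(2)[OF x]) auto
      show "\<bar>q\<bar> \<le> (\<Sum>i<p. \<bar>gauss_elim B t i t / gauss_elim B t t t\<bar>)"
        unfolding q_def using i by (intro member_le_sum[of i "{..<p}" "\<lambda>i. \<bar>gauss_elim B t i t / gauss_elim B t t t\<bar>"]) auto
    qed (auto intro: sum_nonneg)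
    also have "\<dots> = K' * \<rho>" by (simp add: K'_def distrib_right)
    finally show ?thesis .
  qed
  then show ?case using K'0 by blast
qed

text \<open>Back substitution, by induction on the number \<open>t\<close> of last unknowns that are
  already bounded.\<close>

lemma gauss_elim_solution_bound:
  fixes B :: "nat \<Rightarrow> nat \<Rightarrow> real"
  assumes piv: "\<And>t. t < p \<Longrightarrow> gauss_elim B t t t \<noteq> 0"
  shows "\<exists>K\<ge>0. \<forall>x \<rho>. (\<forall>i<p. \<bar>\<Sum>j<p. B i j * x j\<bar> \<le> \<rho>) \<longrightarrow> (\<forall>j<p. \<bar>x j\<bar> \<le> K * \<rho>)"
proof -
  have "t \<le> p \<Longrightarrow> \<exists>K\<ge>0. \<forall>x \<rho>. (\<forall>i<p. \<bar>\<Sum>j<p. B i j * x j\<bar> \<le> \<rho>) \<longrightarrow> (\<forall>j\<in>{p - t..<p}. \<bar>x j\<bar> \<le> K * \<rho>)" for t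
  proof (induction t)
    case 0
    then show ?case by auto
  next
    case (Suc t)
    then obtain K where K: "K \<ge> 0" "\<And>x \<rho> j. (\<forall>i<p. \<bar>\<Sum>j<p. B i j * x j\<bar> \<le> \<rho>) \<Longrightarrow> j \<in> {p - t..<p} \<Longrightarrow> \<bar>x j\<bar> \<le> K * \<rho>"
      by fastforce
    define s where "s = p - Suc t"
    have s: "s < p" "Suc s = p - t" using Suc.prems by (auto simp: s_def)
    obtain L where L: "L \<ge> 0" "\<And>x \<rho> i. (\<forall>i<p. \<bar>\<Sum>j<p. B i j * x j\<bar> \<le> \<rho>) \<Longrightarrow> i \<in> {s..<p} \<Longrightarrow> \<bar>\<Sum>j=s..<p. gauss_elim B s i j * x j\<bar> \<le> L * \<rho>"
      using gauss_elim_residual_bound[of s p B] s piv by fastforce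
    define c where "c = \<bar>1 / gauss_elim B s s s\<bar>"
    define H where "H = (\<Sum>j=Suc s..<p. \<bar>gauss_elim B s s j\<bar>)"
    have cH: "c \<ge> 0" "H \<ge> 0" by (auto simp: c_def H_def intro: sum_nonneg)
    have "\<bar>x j\<bar> \<le> (K + c * (L + H * K)) * \<rho>"
      if x: "\<forall>i<p. \<bar>\<Sum>j<p. B i j * x j\<bar> \<le> \<rho>" and j: "j \<in> {s..<p}" for x \<rho> j
    proof -
      have "0 \<le> \<rho>" using x s by fastforce
      show ?thesis
      proof (cases "j = s")
        case False
        then have "\<bar>x j\<bar> \<le> K * \<rho>" using j s by (intro K(2)[OF x]) auto
        also have "\<dots> \<le> (K + c * (L + H * K)) * \<rho>" using cH K L \<open>0 \<le> \<rho>\<close> by (intro mult_right_mono) auto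
        finally show ?thesis .
      next
        case True
        have "(\<Sum>j=s..<p. gauss_elim B s s j * x j) = gauss_elim B s s s * x s + (\<Sum>j=Suc s..<p. gauss_elim B s s j * x j)"
          using s by (simp add: sum.atLeast_Suc_lessThan)
        then have "gauss_elim B s s s * x s = (\<Sum>j=s..<p. gauss_elim B s s j * x j) - (\<Sum>j=Suc s..<p. gauss_elim B s s j * x j)" by simp
        then have "\<bar>gauss_elim B s s s * x s\<bar> \<le> \<bar>\<Sum>j=s..<p. gauss_elim B s s j * x j\<bar> + \<bar>\<Sum>j=Suc s..<p. gauss_elim B s s j * x j\<bar>"
          by (metis abs_triangle_ineq4)
        also have "\<dots> \<le> L * \<rho> + H * (K * \<rho>)"
        proof (rule add_mono)
          show "\<bar>\<Sum>j=s..<p. gauss_elim B s s j * x j\<bar> \<le> L * \<rho>" using s by (intro L(2)[OF x]) auto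
          have "\<bar>\<Sum>j=Suc s..<p. gauss_elim B s s j * x j\<bar> \<le> (\<Sum>j=Suc s..<p. \<bar>gauss_elim B s s j\<bar> * \<bar>x j\<bar>)"
            by (rule order_trans[OF sum_abs]) (simp add: abs_mult)
          also have "\<dots> \<le> (\<Sum>j=Suc s..<p. \<bar>gauss_elim B s s j\<bar> * (K * \<rho>))"
            using s by (intro sum_mono mult_left_mono K(2)[OF x]) auto
          finally show "\<bar>\<Sum>j=Suc s..<p. gauss_elim B s s j * x j\<bar> \<le> H * (K * \<rho>)" by (simp add: H_def sum_distrib_right)
        qed
        finally have "c * \<bar>gauss_elim B s s s * x s\<bar> \<le> c * (L * \<rho> + H * (K * \<rho>))" using cH by (intro mult_left_mono)
        moreover have "c * \<bar>gauss_elim B s s s * x s\<bar> = \<bar>x s\<bar>" using piv[OF s(1)] by (simp add: c_def abs_mult)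
        ultimately have "\<bar>x s\<bar> \<le> c * (L + H * K) * \<rho>" by (simp add: algebra_simps)
        moreover have "0 \<le> K * \<rho>" using K \<open>0 \<le> \<rho>\<close> by simp
        ultimately show ?thesis using True by (simp add: algebra_simps)
      qed
    qed
    moreover have "0 \<le> K + c * (L + H * K)" using cH K L by simp
    ultimately show ?case unfolding s_def by blast
  qed
  from this[of p] show ?thesis by (simp add: Ball_def)
qed

definition subcols :: "(nat \<times> nat \<Rightarrow> real) \<Rightarrow> nat set \<Rightarrow> nat \<Rightarrow> nat \<Rightarrow> real" where
  "subcols A J i j = A (i, sorted_list_of_set J ! j)"

lemma nondegI:
  assumes piv: "\<And>J t. J \<subseteq> {..<n} \<Longrightarrow> card J \<le> m \<Longrightarrow> t < card J \<Longrightarrow> gauss_elim (subcols A J) t t t \<noteq> 0"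
  shows "nondeg m n A"
  unfolding nondeg_def
proof (intro allI impI)
  fix J assume J: "J \<subseteq> {..<n}" "card J \<le> m"
  have fJ: "finite J" using J finite_subset by blast
  define p where "p = card J"
  define c where "c = (\<lambda>j. sorted_list_of_set J ! j)"
  have len: "length (sorted_list_of_set J) = p" by (simp add: p_def)
  have bij: "bij_betw c {..<p} J"
    unfolding c_def using fJ bij_betw_nth[of "sorted_list_of_set J" "{..<p}" J] len by simp
  obtain K where K: "K \<ge> 0" "\<And>x \<rho>. (\<forall>i<p. \<bar>\<Sum>j<p. subcols A J i j * x j\<bar> \<le> \<rho>) \<Longrightarrow> \<forall>j<p. \<bar>x j\<bar> \<le> K * \<rho>"
    using gauss_elim_solution_bound[of p "subcols A J"] piv[OF J] unfolding p_def by blast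
  show "\<exists>C. \<forall>d. (\<forall>j. j \<notin> J \<longrightarrow> d j = 0) \<longrightarrow> dot n d d \<le> C * (\<Sum>i<m. (rowdot A n i d)\<^sup>2)"
  proof (intro exI allI impI)
    fix d :: "nat \<Rightarrow> real" assume d: "\<forall>j. j \<notin> J \<longrightarrow> d j = 0"
    have rd: "rowdot A n i d = (\<Sum>j<p. subcols A J i j * d (c j))" for i
    proof -
      have "rowdot A n i d = (\<Sum>j\<in>J. A (i, j) * d j)"
        unfolding rowdot_def using J d by (intro sum.mono_neutral_right) auto
      also have "\<dots> = (\<Sum>j<p. A (i, c j) * d (c j))" by (rule sum.reindex_bij_betw[OF bij, symmetric])
      finally show ?thesis by (simp add: subcols_def c_def)
    qed
    define \<rho> where "\<rho> = sqrt (\<Sum>i<m. (rowdot A n i d)\<^sup>2)"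
    have "\<bar>\<Sum>j<p. subcols A J i j * d (c j)\<bar> \<le> \<rho>" if "i < p" for i
    proof -
      have "(rowdot A n i d)\<^sup>2 \<le> (\<Sum>i<m. (rowdot A n i d)\<^sup>2)"
        using that J by (intro member_le_sum) (auto simp: p_def)
      then show ?thesis unfolding rd[symmetric] \<rho>_def by (intro real_le_rsqrt) simp
    qed
    then have x: "\<bar>d (c j)\<bar> \<le> K * \<rho>" if "j < p" for j using K(2)[of "\<lambda>j. d (c j)" \<rho>] that by blast
    have "dot n d d = (\<Sum>j\<in>J. d j * d j)"
      unfolding dot_def using J d by (intro sum.mono_neutral_right) auto
    also have "\<dots> = (\<Sum>j<p. d (c j) * d (c j))" by (rule sum.reindex_bij_betw[OF bij, symmetric])
    also have "\<dots> \<le> (\<Sum>j<p. (K * \<rho>) * (K * \<rho>))"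
    proof (rule sum_mono)
      fix j assume "j \<in> {..<p}"
      then have "\<bar>d (c j)\<bar> * \<bar>d (c j)\<bar> \<le> (K * \<rho>) * (K * \<rho>)" using x by (intro mult_mono') auto
      then show "d (c j) * d (c j) \<le> (K * \<rho>) * (K * \<rho>)" by simp
    qed
    also have "\<dots> = (real p * K * K) * (\<rho> * \<rho>)" by simp
    also have "\<rho> * \<rho> = (\<Sum>i<m. (rowdot A n i d)\<^sup>2)" by (simp add: \<rho>_def sum_nonneg)
    finally show "dot n d d \<le> (real p * K * K) * (\<Sum>i<m. (rowdot A n i d)\<^sup>2)" .
  qed
qed

text \<open>Finitely many pairs of a column set and a pivot index have to be excluded. Each is a
  null set by \<open>gauss_elim_upd\<close> and Fubini in a single matrix entry.\<close>

lemma gauss_nondeg: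
  "\<exists>N\<in>null_sets (gauss ({..<m} \<times> {..<n})). \<forall>A\<in>space (gauss ({..<m} \<times> {..<n})) - N. nondeg m n A"
proof -
  let ?I = "{..<m} \<times> {..<n}"
  define Z where "Z = (\<lambda>(J, t). {A \<in> space (gauss ?I). gauss_elim (subcols A J) t t t = 0})"
  define P where "P = Sigma {J. J \<subseteq> {..<n} \<and> card J \<le> m} (\<lambda>J. {..<card J})"
  have fP: "finite P" unfolding P_def by (intro finite_SigmaI) auto
  have null: "Z (J, a) \<in> null_sets (gauss ?I)" if JP: "(J, a) \<in> P" for J a
  proof -
    have J: "J \<subseteq> {..<n}" "card J \<le> m" "a < card J" using JP by (auto simp: P_def)
    have fJ: "finite J" using J finite_subset by blast
    define c where "c = (\<lambda>j. sorted_list_of_set J ! j)"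
    have cJ: "c j \<in> J" if "j < card J" for j
      using that fJ by (metis c_def length_sorted_list_of_set nth_mem set_sorted_list_of_set)
    have cinj: "c j = c a \<longleftrightarrow> j = a" if "j < card J" for j
      using that J(3) unfolding c_def by (subst nth_eq_iff_index_eq) auto
    have can: "(a, c a) \<in> ?I" using J cJ by auto
    \<comment> \<open>Outside the square block the entries are replaced by \<open>0\<close>, since
      \<open>subcols\<close> refers there to positions outside the list or outside the index set;
      \<open>trunc\<close> shows that the relevant entries agree.\<close>
    have meas: "(\<lambda>A. gauss_elim (\<lambda>i j. if i < card J \<and> j < card J then subcols A J i j else 0) t i j) \<in> borel_measurable (gauss ?I)" for t i j
    proof (rule gauss_elim_meas)
      fix i j
      show "(\<lambda>A. if i < card J \<and> j < card J then subcols A J i j else 0) \<in> borel_measurable (gauss ?I)"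
      proof (cases "i < card J \<and> j < card J")
        case True
        then have "(i, c j) \<in> ?I" using J cJ[of j] by auto
        then have "(\<lambda>A. A (i, c j)) \<in> borel_measurable (gauss ?I)" by (rule measurable_gauss_coord)
        moreover have "(\<lambda>A. if i < card J \<and> j < card J then subcols A J i j else 0) = (\<lambda>A. A (i, c j))"
          using True by (simp add: subcols_def c_def fun_eq_iff)
        ultimately show ?thesis by (simp only:)
      next
        case False
        then show ?thesis by (simp only: if_False borel_measurable_const)
      qed
    qed
    have trunc: "gauss_elim (\<lambda>i j. if i < card J \<and> j < card J then subcols A J i j else 0) t i j = gauss_elim (subcols A J) t i j"
      if "i < card J" "j < card J" "t \<le> card J" for A t i j
      using that by (induction t arbitrary: i j) auto
    have aa: "(\<lambda>A. gauss_elim (subcols A J) a a a) \<in> borel_measurable (gauss ?I)"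
      using meas[of a a a] J(3) by (simp only: trunc less_imp_le)
    then have sZ: "Z (J, a) \<in> sets (gauss ?I)"
      unfolding Z_def split by (rule borel_measurable_eq) simp
    define I' where "I' = ?I - {(a, c a)}"
    have I': "?I = insert (a, c a) I'" "(a, c a) \<notin> I'" "finite I'" using can by (auto simp: I'_def)
    have "emeasure (gauss ?I) (Z (J, a)) = (\<integral>\<^sup>+A. indicator (Z (J, a)) A \<partial>gauss (insert (a, c a) I'))"
      using sZ by (simp flip: I'(1))
    also have "\<dots> = (\<integral>\<^sup>+A. \<integral>\<^sup>+x. indicator (Z (J, a)) (A((a, c a) := x)) \<partial>stdn \<partial>gauss I')"
      using sZ by (intro gauss_insert I') (simp flip: I'(1))
    also have "\<dots> = (\<integral>\<^sup>+A. 0 \<partial>gauss I')"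
    proof (rule nn_integral_cong)
      fix A
      \<comment> \<open>The pivot with the entry \<open>(a, c a)\<close> set to \<open>0\<close>;
        for the value \<open>x\<close> of that entry it is \<open>y + x\<close>, hence zero only for
        \<open>x = - y\<close>.\<close>
      define y where "y = gauss_elim (subcols (A((a, c a) := 0)) J) a a a"
      have "gauss_elim (subcols (A((a, c a) := x)) J) a a a = y + x" for x
      proof -
        define B where "B = (\<lambda>A i j. if i < card J \<and> j < card J then subcols A J i j else 0)"
        have "gauss_elim (B (A((a, c a) := x))) a a a = gauss_elim (B (A((a, c a) := 0))) a a a + (if (a, a) = (a, a) then B (A((a, c a) := x)) a a - B (A((a, c a) := 0)) a a else 0)"
        proof (rule gauss_elim_upd)
          fix i j assume "(i, j) \<noteq> (a, a)"
          then show "B (A((a, c a) := x)) i j = B (A((a, c a) := 0)) i j"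
            using cinj[of j] by (auto simp: B_def subcols_def c_def)
        qed auto
        then show ?thesis using J(3) trunc[of a a a] by (simp add: B_def y_def subcols_def c_def)
      qed
      then have "indicator (Z (J, a)) (A((a, c a) := x)) \<le> (indicator {- y} x :: ennreal)" for x
        by (auto simp: Z_def indicator_def split: if_splits)
      then have "(\<integral>\<^sup>+x. indicator (Z (J, a)) (A((a, c a) := x)) \<partial>stdn) \<le> (\<integral>\<^sup>+x. indicator {- y} x \<partial>stdn)"
        by (intro nn_integral_mono)
      also have "\<dots> = 0" by (simp add: emeasure_std_normal_singleton)
      finally show "(\<integral>\<^sup>+x. indicator (Z (J, a)) (A((a, c a) := x)) \<partial>stdn) = 0" by simp
    qed
    finally show ?thesis using sZ by (simp add: null_sets_def)
  qed
  have "(\<Union>p\<in>P. Z p) \<in> null_sets (gauss ?I)"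
    using fP null by (intro null_sets.finite_UN) auto
  moreover have "nondeg m n A" if "A \<in> space (gauss ?I) - (\<Union>p\<in>P. Z p)" for A
  proof (rule nondegI)
    fix J t assume "J \<subseteq> {..<n}" "card J \<le> m" "t < card J"
    then have "(J, t) \<in> P" by (simp add: P_def)
    then show "gauss_elim (subcols A J) t t t \<noteq> 0" using that by (force simp: Z_def)
  qed
  ultimately show ?thesis by blast
qed

section \<open>The union bound\<close>

definition big_faces :: "nat \<Rightarrow> nat \<Rightarrow> nat \<Rightarrow> nat set set" where
  "big_faces k m n = {T. T \<subseteq> {k..<n} \<and> m < k + card T}"

lemma finite_big_faces: "finite (big_faces k m n)"
  by (rule finite_subset[of _ "Pow {k..<n}"]) (auto simp: big_faces_def)

definition some_pattern :: "(nat \<Rightarrow> real) \<Rightarrow> nat \<Rightarrow> nat \<Rightarrow> nat \<Rightarrow> real \<Rightarrow> (nat \<times> nat \<Rightarrow> real) \<Rightarrow> bool" where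
  "some_pattern w k m n e W \<longleftrightarrow> (\<exists>T\<in>big_faces k m n. \<exists>R\<in>Pow T. face_pattern w n m e k T (sgn_of R) W)
     \<or> (\<exists>R\<in>Pow {k..<n}. cone_pattern w n m e k (sgn_of R) W)"

text \<open>The sum over the signs is already carried out: \<open>2 ^ card T\<close> choices cancel
  \<open>1 / 2 ^ card T\<close>. The Chernoff parameter may depend on the face, and \<open>e\<close>
  has disappeared.\<close>

definition fail_bound :: "(nat \<Rightarrow> real) \<Rightarrow> nat \<Rightarrow> nat \<Rightarrow> nat \<Rightarrow> (nat set \<Rightarrow> real) \<Rightarrow> ennreal" where
  "fail_bound w k m n \<sigma> =
    (\<Sum>T\<in>big_faces k m n. ennreal (exp (- \<sigma> T * fnrm w k T) / p01 * exp (int_exp w k T (\<sigma> T))) * ext_int w n k T)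
     + ennreal (exp (int_exp w k {k..<n} (\<sigma> {k..<n})))"

lemma some_pattern_prob:
  assumes w: "\<And>j. j < n \<Longrightarrow> 0 < w j" and k: "0 < k" "k \<le> n" and e: "0 < e" and \<sigma>: "\<And>T. \<sigma> T \<le> 0"
  shows "(\<integral>\<^sup>+W. of_bool (some_pattern w k m n e W) \<partial>gauss ({..m} \<times> {..<n})) \<le> fail_bound w k m n \<sigma>"
    and "some_pattern w k m n e \<in> measurable (gauss ({..m} \<times> {..<n})) (count_space UNIV)"
proof -
  let ?M = "gauss ({..m} \<times> {..<n})"
  have T: "T \<subseteq> {k..<n}" "finite T" if "T \<in> big_faces k m n" for T
    using that finite_subset by (auto simp: big_faces_def)
  have fm: "(\<lambda>W. face_pattern w n m e k T (sgn_of R) W) \<in> measurable ?M (count_space UNIV)" if "T \<in> big_faces k m n" for T R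
    by (rule face_pattern_prob(2)[OF T(1)[OF that] k(2,1) sgn_of_cases w e order_refl])
  have cm: "(\<lambda>W. cone_pattern w n m e k (sgn_of R) W) \<in> measurable ?M (count_space UNIV)" for R
    by (rule cone_pattern_prob(2)[OF k(2) sgn_of_cases e order_refl])
  have "(\<lambda>W. (\<exists>T\<in>big_faces k m n. \<exists>R\<in>Pow T. face_pattern w n m e k T (sgn_of R) W)
     \<or> (\<exists>R\<in>Pow {k..<n}. cone_pattern w n m e k (sgn_of R) W)) \<in> measurable ?M (count_space UNIV)"
    using T by (intro pred_intros_logic(5) pred_intros_finite(4) finite_big_faces fm cm) auto
  then show "some_pattern w k m n e \<in> measurable ?M (count_space UNIV)"
    by (simp only: some_pattern_def[abs_def])
  have fi: "(\<integral>\<^sup>+W. (\<Sum>R\<in>Pow T. of_bool (face_pattern w n m e k T (sgn_of R) W)) \<partial>?M)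
     \<le> ennreal (exp (- \<sigma> T * fnrm w k T) / p01 * exp (int_exp w k T (\<sigma> T))) * ext_int w n k T" if "T \<in> big_faces k m n" for T
  proof -
    define a where "a = exp (- \<sigma> T * fnrm w k T) / p01"
    have a: "a \<ge> 0" using p01_pos by (simp add: a_def)
    have "(\<integral>\<^sup>+W. (\<Sum>R\<in>Pow T. of_bool (face_pattern w n m e k T (sgn_of R) W)) \<partial>?M)
       = (\<Sum>R\<in>Pow T. \<integral>\<^sup>+W. of_bool (face_pattern w n m e k T (sgn_of R) W) \<partial>?M)"
      by (rule nn_integral_sum) (rule of_bool_measurable[OF fm[OF that]])
    also have "\<dots> \<le> (\<Sum>R\<in>Pow T. ennreal (a * (exp (int_exp w k T (\<sigma> T)) / 2 ^ card T)) * ext_int w n k T)"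
      unfolding a_def using T[OF that] k w by (intro sum_mono face_pattern_prob(1) sgn_of_cases e \<sigma>) auto
    also have "\<dots> = ennreal (\<Sum>R\<in>Pow T. a * (exp (int_exp w k T (\<sigma> T)) / 2 ^ card T)) * ext_int w n k T"
    proof -
      have "(\<Sum>R\<in>Pow T. ennreal (a * (exp (int_exp w k T (\<sigma> T)) / 2 ^ card T))) = ennreal (\<Sum>R\<in>Pow T. a * (exp (int_exp w k T (\<sigma> T)) / 2 ^ card T))"
        by (rule sum_ennreal) (use a in simp)
      then show ?thesis by (simp only: sum_distrib_right[symmetric])
    qed
    also have "(\<Sum>R\<in>Pow T. a * (exp (int_exp w k T (\<sigma> T)) / 2 ^ card T)) = a * exp (int_exp w k T (\<sigma> T))"
      using T[OF that] by (simp add: card_Pow)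
    finally show ?thesis by (simp only: a_def)
  qed
  have ci: "(\<integral>\<^sup>+W. (\<Sum>R\<in>Pow {k..<n}. of_bool (cone_pattern w n m e k (sgn_of R) W)) \<partial>?M)
     \<le> ennreal (exp (int_exp w k {k..<n} (\<sigma> {k..<n})))"
  proof -
    define b where "b = exp (int_exp w k {k..<n} (\<sigma> {k..<n}))"
    have "(\<integral>\<^sup>+W. (\<Sum>R\<in>Pow {k..<n}. of_bool (cone_pattern w n m e k (sgn_of R) W)) \<partial>?M)
       = (\<Sum>R\<in>Pow {k..<n}. \<integral>\<^sup>+W. of_bool (cone_pattern w n m e k (sgn_of R) W) \<partial>?M)"
      by (rule nn_integral_sum) (rule of_bool_measurable[OF cm])
    also have "\<dots> \<le> (\<Sum>R\<in>Pow {k..<n}. ennreal (b / 2 ^ card {k..<n}))"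
      unfolding b_def by (intro sum_mono cone_pattern_prob(1) sgn_of_cases e \<sigma> k)
    also have "\<dots> = ennreal (\<Sum>R\<in>Pow {k..<n}. b / 2 ^ card {k..<n})"
      by (rule sum_ennreal) (simp add: b_def)
    also have "(\<Sum>R\<in>Pow {k..<n}. b / 2 ^ card {k..<n}) = b" by (simp add: card_Pow)
    finally show ?thesis by (simp only: b_def)
  qed
  have "(\<integral>\<^sup>+W. of_bool (some_pattern w k m n e W) \<partial>?M)
     \<le> (\<integral>\<^sup>+W. (\<Sum>T\<in>big_faces k m n. \<Sum>R\<in>Pow T. of_bool (face_pattern w n m e k T (sgn_of R) W))
        + (\<Sum>R\<in>Pow {k..<n}. of_bool (cone_pattern w n m e k (sgn_of R) W)) \<partial>?M)"
  proof (rule nn_integral_mono)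
    fix W
    show "of_bool (some_pattern w k m n e W) \<le> (\<Sum>T\<in>big_faces k m n. \<Sum>R\<in>Pow T. of_bool (face_pattern w n m e k T (sgn_of R) W))
        + (\<Sum>R\<in>Pow {k..<n}. of_bool (cone_pattern w n m e k (sgn_of R) W) :: ennreal)"
    proof (cases "some_pattern w k m n e W")
      case True
      then consider (f) T R where "T \<in> big_faces k m n" "R \<in> Pow T" "face_pattern w n m e k T (sgn_of R) W"
        | (c) R where "R \<in> Pow {k..<n}" "cone_pattern w n m e k (sgn_of R) W"
        unfolding some_pattern_def by blast
      then show ?thesis
      proof cases
        case f
        have "1 = (of_bool (face_pattern w n m e k T (sgn_of R) W) :: ennreal)" using f by simp
        also have "\<dots> \<le> (\<Sum>R\<in>Pow T. of_bool (face_pattern w n m e k T (sgn_of R) W))"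
          using f T by (intro member_le_sum) auto
        also have "\<dots> \<le> (\<Sum>T\<in>big_faces k m n. \<Sum>R\<in>Pow T. of_bool (face_pattern w n m e k T (sgn_of R) W))"
          using f finite_big_faces by (intro member_le_sum[of T _ "\<lambda>T. \<Sum>R\<in>Pow T. of_bool (face_pattern w n m e k T (sgn_of R) W)"]) auto
        finally show ?thesis using True by (simp add: add_increasing2)
      next
        case c
        have "1 = (of_bool (cone_pattern w n m e k (sgn_of R) W) :: ennreal)" using c by simp
        also have "\<dots> \<le> (\<Sum>R\<in>Pow {k..<n}. of_bool (cone_pattern w n m e k (sgn_of R) W))"
          using c by (intro member_le_sum) auto
        finally show ?thesis using True by (simp add: add_increasing)
      qed
    qed simp
  qed
  also have "\<dots> = (\<integral>\<^sup>+W. (\<Sum>T\<in>big_faces k m n. \<Sum>R\<in>Pow T. of_bool (face_pattern w n m e k T (sgn_of R) W)) \<partial>?M)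
      + (\<integral>\<^sup>+W. (\<Sum>R\<in>Pow {k..<n}. of_bool (cone_pattern w n m e k (sgn_of R) W)) \<partial>?M)"
    by (intro nn_integral_add borel_measurable_sum of_bool_measurable fm cm)
  also have "(\<integral>\<^sup>+W. (\<Sum>T\<in>big_faces k m n. \<Sum>R\<in>Pow T. of_bool (face_pattern w n m e k T (sgn_of R) W)) \<partial>?M)
     = (\<Sum>T\<in>big_faces k m n. \<integral>\<^sup>+W. (\<Sum>R\<in>Pow T. of_bool (face_pattern w n m e k T (sgn_of R) W)) \<partial>?M)"
    by (intro nn_integral_sum borel_measurable_sum of_bool_measurable fm)
  also have "\<dots> + (\<integral>\<^sup>+W. (\<Sum>R\<in>Pow {k..<n}. of_bool (cone_pattern w n m e k (sgn_of R) W)) \<partial>?M) \<le> fail_bound w k m n \<sigma>"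
    unfolding fail_bound_def by (intro add_mono sum_mono fi ci)
  finally show "(\<integral>\<^sup>+W. of_bool (some_pattern w k m n e W) \<partial>?M) \<le> fail_bound w k m n \<sigma>" .
qed

lemma nondeg_cong:
  assumes "\<And>i d. i < m \<Longrightarrow> rowdot W n i d = rowdot A n i d" "nondeg m n A"
  shows "nondeg m n W"
  using assms(2) unfolding nondeg_def by (simp add: assms(1))

text \<open>For fixed \<open>A\<close> with a kernel vector \<open>d\<close> in the cone, the
  auxiliary row has positive inner product with \<open>d\<close> with probability
  \<open>emeasure stdn {0<..}\<close>. Then a pattern occurs for all small \<open>e\<close>, with a
  threshold depending on \<open>A\<close> and the row; Fatou's lemma along
  \<open>e = 1 / (N + 1)\<close> turns this into a bound without threshold.\<close>

theorem fail_prob_bound: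
  assumes w: "\<And>j. j < n \<Longrightarrow> 0 < w j" and k: "0 < k" "k \<le> n" and \<sigma>: "\<And>T. \<sigma> T \<le> 0"
    and F: "F \<in> sets (gauss ({..<m} \<times> {..<n}))"
    and bad: "\<And>A. A \<in> F \<Longrightarrow> \<exists>d\<in>descent_cone w k n. 0 < nrm n d \<and> (\<forall>i<m. rowdot A n i d = 0)"
  shows "emeasure (gauss ({..<m} \<times> {..<n})) F * emeasure stdn {0<..} \<le> fail_bound w k m n \<sigma>"
proof -
  let ?A = "{..<m} \<times> {..<n}" and ?g = "{m} \<times> {..<n}" and ?I = "{..m} \<times> {..<n}"
  have I: "?I = ?A \<union> ?g" by (auto simp: le_less)
  define Q where "Q = (\<lambda>N::nat. some_pattern w k m n (1 / (real N + 1)))"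
  have Qm: "Q N \<in> measurable (gauss ?I) (count_space UNIV)" for N
    unfolding Q_def using w by (intro some_pattern_prob(2)[where \<sigma> = \<sigma>] k \<sigma>) auto
  have Qi: "(\<integral>\<^sup>+W. of_bool (Q N W) \<partial>gauss ?I) \<le> fail_bound w k m n \<sigma>" for N
    unfolding Q_def using w by (intro some_pattern_prob(1) k \<sigma>) auto
  define L where "L = (\<lambda>W. liminf (\<lambda>N. of_bool (Q N W) :: ennreal))"
  have Lm: "L \<in> borel_measurable (gauss ?I)"
    unfolding L_def by (intro borel_measurable_liminf of_bool_measurable Qm)
  have "(\<integral>\<^sup>+W. L W \<partial>gauss ?I) \<le> liminf (\<lambda>N. \<integral>\<^sup>+W. of_bool (Q N W) \<partial>gauss ?I)"
    unfolding L_def by (intro nn_integral_liminf of_bool_measurable Qm)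
  also have "\<dots> \<le> liminf (\<lambda>N::nat. fail_bound w k m n \<sigma>)"
    by (intro Liminf_mono always_eventually allI Qi)
  also have "\<dots> = fail_bound w k m n \<sigma>" by (rule Liminf_const) simp
  finally have LU: "(\<integral>\<^sup>+W. L W \<partial>gauss ?I) \<le> fail_bound w k m n \<sigma>" .
  have Lfold: "(\<integral>\<^sup>+W. L W \<partial>gauss ?I) = (\<integral>\<^sup>+A. \<integral>\<^sup>+g. L (merge ?A ?g (A, g)) \<partial>gauss ?g \<partial>gauss ?A)"
  proof -
    have "?A \<inter> ?g = {}" "finite ?A" "finite ?g" by auto
    moreover have "L \<in> borel_measurable (PiM (?A \<union> ?g) (\<lambda>_. stdn))"
      using Lm unfolding gauss_def I .
    ultimately show ?thesis unfolding gauss_def I by (rule G.product_nn_integral_fold)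
  qed
  from gauss_nondeg[of m n] obtain N0 where N0: "N0 \<in> null_sets (gauss ?A)"
    and N0': "\<forall>A\<in>space (gauss ?A) - N0. nondeg m n A" by (elim bexE)
  have inner: "emeasure stdn {0<..} \<le> (\<integral>\<^sup>+g. L (merge ?A ?g (A, g)) \<partial>gauss ?g)" if A: "A \<in> F" "nondeg m n A" for A
  proof -
    obtain d where d: "d \<in> descent_cone w k n" "0 < nrm n d" "\<And>i. i < m \<Longrightarrow> rowdot A n i d = 0"
      using bad[OF A(1)] by blast
    define v where "v = (\<lambda>(i::nat, j). d j / nrm n d)"
    have sv: "(\<Sum>p\<in>?g. v p * g p) = rowdot g n m d / nrm n d" for g
    proof -
      have "(\<Sum>p\<in>?g. v p * g p) = (\<Sum>i\<in>{m}. \<Sum>j<n. v (i, j) * g (i, j))"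
        by (subst sum.cartesian_product) (auto intro!: sum.cong)
      then show ?thesis by (simp add: v_def rowdot_def sum_divide_distrib mult.commute)
    qed
    have v1: "(\<Sum>p\<in>?g. v p * v p) = 1"
    proof -
      have "(\<Sum>p\<in>?g. v p * v p) = rowdot v n m d / nrm n d" by (rule sv)
      also have "rowdot v n m d = dot n d d / nrm n d" by (simp add: rowdot_def v_def dot_def sum_divide_distrib)
      finally show ?thesis using d(2) by (simp add: nrm_sq[symmetric] power2_eq_square)
    qed
    have "emeasure stdn {0<..} = (\<integral>\<^sup>+x. indicator {0<..} x \<partial>stdn)" by simp
    also have "\<dots> = (\<integral>\<^sup>+g. indicator {0<..} (\<Sum>p\<in>?g. v p * g p) \<partial>gauss ?g)"
      by (rule nn_integral_gauss_unit[OF _ v1, symmetric]) auto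
    also have "\<dots> \<le> (\<integral>\<^sup>+g. L (merge ?A ?g (A, g)) \<partial>gauss ?g)"
    proof (rule nn_integral_mono)
      fix g :: "nat \<times> nat \<Rightarrow> real"
      define W where "W = merge ?A ?g (A, g)"
      have rW: "rowdot W n i x = rowdot A n i x" if "i < m" for i x
        using that by (auto simp: rowdot_def W_def merge_def intro!: sum.cong)
      have rg: "rowdot W n m x = rowdot g n m x" for x
        by (auto simp: rowdot_def W_def merge_def intro!: sum.cong)
      show "indicator {0<..} (\<Sum>p\<in>?g. v p * g p) \<le> L (merge ?A ?g (A, g))"
      proof (cases "0 < rowdot g n m d")
        case False
        then have "\<not> 0 < (\<Sum>p\<in>?g. v p * g p)" unfolding sv using d(2) by (simp add: zero_less_divide_iff)
        then show ?thesis by (simp add: indicator_def)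
      next
        case True
        have "nondeg m n W" by (rule nondeg_cong[OF rW A(2)])
        then obtain C where C: "C > 0" "\<And>J d. J \<subseteq> {..<n} \<Longrightarrow> card J \<le> m \<Longrightarrow> (\<And>j. j \<notin> J \<Longrightarrow> d j = 0) \<Longrightarrow>
           dot n d d \<le> C * (\<Sum>i<m. (rowdot W n i d)\<^sup>2)" by (rule nondeg_const) blast
        define b where "b = C * (dot n (\<lambda>j. W (m, j)) (\<lambda>j. W (m, j)) * dot n d d)"
        have "(\<lambda>N. 1 / (real N + 1) * b) \<longlonglongrightarrow> 0 * b"
          using LIMSEQ_inverse_real_of_nat by (intro tendsto_mult tendsto_const) (simp add: inverse_eq_divide add.commute)
        then have "\<forall>\<^sub>F N in sequentially. 1 / (real N + 1) * b < (rowdot W n m d)\<^sup>2"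
          using True rg by (intro order_tendstoD(2)[where y = "0 * b"]) auto
        then have "\<forall>\<^sub>F N in sequentially. Q N W"
        proof eventually_elim
          case (elim N)
          have "(\<exists>T. T \<subseteq> {k..<n} \<and> m < k + card T \<and> (\<exists>R\<in>Pow T. face_pattern w n m (1 / (real N + 1)) k T (sgn_of R) W))
            \<or> (\<exists>R\<in>Pow {k..<n}. cone_pattern w n m (1 / (real N + 1)) k (sgn_of R) W)"
          proof (rule pattern_exists[OF w k _ d(1) _ _ C])
            show "rowdot W n i d = 0" if "i < m" for i using that d(3) rW by simp
            show "0 < rowdot W n m d" using True rg by simp
            show "1 / (real N + 1) * (C * (dot n (\<lambda>j. W (m, j)) (\<lambda>j. W (m, j)) * dot n d d)) < (rowdot W n m d)\<^sup>2"
              using elim by (simp only: b_def)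
          qed auto
          then show ?case unfolding Q_def some_pattern_def big_faces_def by blast
        qed
        then have "(\<lambda>N. of_bool (Q N W) :: ennreal) \<longlonglongrightarrow> 1"
          by (intro tendsto_eventually) (auto elim: eventually_mono)
        then have "L W = 1" unfolding L_def by (intro lim_imp_Liminf) auto
        then show ?thesis by (simp add: W_def indicator_def)
      qed
    qed
    finally show ?thesis .
  qed
  have "emeasure (gauss ?A) F * emeasure stdn {0<..} = (\<integral>\<^sup>+A. indicator F A * emeasure stdn {0<..} \<partial>gauss ?A)"
    using F by (simp add: nn_integral_multc)
  also have "\<dots> \<le> (\<integral>\<^sup>+A. \<integral>\<^sup>+g. L (merge ?A ?g (A, g)) \<partial>gauss ?g \<partial>gauss ?A)"
  proof (rule nn_integral_mono_AE)
    have "AE A in gauss ?A. A \<notin> N0" by (rule AE_not_in[OF N0])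
    then show "AE A in gauss ?A. indicator F A * emeasure stdn {0<..} \<le> (\<integral>\<^sup>+g. L (merge ?A ?g (A, g)) \<partial>gauss ?g)"
    proof (rule AE_mp, intro AE_I2 impI)
      fix A assume "A \<in> space (gauss ?A)" "A \<notin> N0"
      then show "indicator F A * emeasure stdn {0<..} \<le> (\<integral>\<^sup>+g. L (merge ?A ?g (A, g)) \<partial>gauss ?g)"
        using inner[of A] N0'[rule_format, of A] by (cases "A \<in> F") auto
    qed
  qed
  also have "\<dots> \<le> fail_bound w k m n \<sigma>" using LU unfolding Lfold .
  finally show ?thesis .
qed

section \<open>Riemann sums and entropy\<close>

text \<open>For a monotone integrand the difference of right and left sums telescopes, so the error
  is controlled by the end values alone. This matters for integrands that vary with
  \<open>x\<close>.\<close>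

lemma riemann_mono_bounds:
  fixes g :: "real \<Rightarrow> real" and p q n :: nat
  assumes n: "n > 0" and pq: "p \<le> q"
    and cont: "continuous_on {real p / n..real q / n} g" and mono: "mono_on {real p / n..real q / n} g"
  shows "integral {real p / n..real q / n} g \<le> (\<Sum>j=p..<q. g (real (Suc j) / n)) / n"
    and "(\<Sum>j=p..<q. g (real (Suc j) / n)) / n \<le> integral {real p / n..real q / n} g + (g (real q / n) - g (real p / n)) / n"
proof -
  have le: "real a / n \<le> real b / n" if "a \<le> b" for a b :: nat
    using that n by (simp add: divide_right_mono)
  have step: "g (real j / n) / n \<le> integral {real j / n..real (Suc j) / n} g \<and> integral {real j / n..real (Suc j) / n} g \<le> g (real (Suc j) / n) / n"
    if j: "p \<le> j" "j < q" for j
  proof -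
    let ?I = "{real j / n..real (Suc j) / n}"
    have sub: "?I \<subseteq> {real p / n..real q / n}"
      using le[of p j] le[of "Suc j" q] j by auto
    then have int: "g integrable_on ?I"
      using cont by (intro integrable_continuous_interval) (rule continuous_on_subset)
    have len: "real (Suc j) / n - real j / n = 1 / n" by (simp add: diff_divide_distrib[symmetric])
    have c: "integral ?I (\<lambda>_. c) = c / n" for c :: real
      using le[of j "Suc j"] len by (simp add: content_real)
    have b: "g (real j / n) \<le> g u" "g u \<le> g (real (Suc j) / n)" if "u \<in> ?I" for u
      using that sub le[of j "Suc j"] by (auto intro!: mono_onD[OF mono])
    have "integral ?I (\<lambda>_. g (real j / n)) \<le> integral ?I g"
      by (rule integral_le) (use int b in auto)
    moreover have "integral ?I g \<le> integral ?I (\<lambda>_. g (real (Suc j) / n))"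
      by (rule integral_le) (use int b in auto)
    ultimately show ?thesis by (simp only: c)
  qed
  have comb: "integral {real p / n..real q' / n} g = (\<Sum>j=p..<q'. integral {real j / n..real (Suc j) / n} g)" if "p \<le> q'" "q' \<le> q" for q'
    using that
  proof (induction q' rule: dec_induct)
    case base
    then show ?case by simp
  next
    case (step q')
    have "g integrable_on {real p / n..real (Suc q') / n}"
      using cont step le[of "Suc q'" q] by (intro integrable_continuous_interval) (auto intro: continuous_on_subset)
    then have "integral {real p / n..real q' / n} g + integral {real q' / n..real (Suc q') / n} g = integral {real p / n..real (Suc q') / n} g"
      by (intro Henstock_Kurzweil_Integration.integral_combine le step) auto
    then show ?case using step by simp
  qed
  show "integral {real p / n..real q / n} g \<le> (\<Sum>j=p..<q. g (real (Suc j) / n)) / n"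
    unfolding comb[OF pq order_refl] sum_divide_distrib using step by (intro sum_mono) auto
  have "(\<Sum>j=p..<q. g (real j / n) / n) \<le> integral {real p / n..real q / n} g"
    unfolding comb[OF pq order_refl] using step by (intro sum_mono) auto
  moreover have "(\<Sum>j=p..<q. g (real (Suc j) / n) / n) - (\<Sum>j=p..<q. g (real j / n) / n) = (g (real q / n) - g (real p / n)) / n"
    unfolding sum_subtractf[symmetric] diff_divide_distrib[symmetric] sum_divide_distrib[symmetric]
    using sum_Suc_diff'[OF pq, of "\<lambda>j. g (real j / n)"] by simp
  ultimately show "(\<Sum>j=p..<q. g (real (Suc j) / n)) / n \<le> integral {real p / n..real q / n} g + (g (real q / n) - g (real p / n)) / n"
    unfolding sum_divide_distrib by simp
qed

section \<open>The binary entropy\<close>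

lemma xlnx_mix:
  fixes t s :: real
  assumes t: "0 \<le> t" "t \<le> 1" and s: "0 \<le> s" "s \<le> 1"
  defines "t' \<equiv> (1 - s) * t + s"
  shows "t' * ln t' \<le> (1 - s) * (t * ln t)"
proof (cases "t' = 0")
  case True
  have "(1 - s) * t \<ge> 0" using assms by simp
  then have "s = 0" "(1 - s) * t = 0" using True s unfolding t'_def by linarith+
  then show ?thesis using True by simp
next
  case False
  have "(1 - s) * t \<ge> 0" using assms by simp
  then have t': "t' > 0" using False s unfolding t'_def by linarith
  have "(1 - s) * (t * ln t') - (1 - s) * (t * ln t) \<le> (1 - s) * (t' - t)"
  proof (cases "t = 0")
    case False
    then have "t > 0" using t by simp
    have "ln t' - ln t = ln (t' / t)" using t' \<open>t > 0\<close> by (simp add: ln_div)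
    also have "\<dots> \<le> t' / t - 1" using t' \<open>t > 0\<close> by (intro ln_le_minus_one) simp
    finally have "t * (ln t' - ln t) \<le> t * (t' / t - 1)" using \<open>t > 0\<close> by (intro mult_left_mono) auto
    also have "\<dots> = t' - t" using \<open>t > 0\<close> by (simp add: right_diff_distrib)
    finally have "(1 - s) * (t * (ln t' - ln t)) \<le> (1 - s) * (t' - t)" using s by (intro mult_left_mono) auto
    then show ?thesis by (simp add: algebra_simps)
  qed (use t' s in simp)
  moreover have "s * ln t' \<le> s * (t' - 1)" using s t' ln_le_minus_one[OF t'] by (intro mult_left_mono) auto
  moreover have "t' * ln t' = (1 - s) * (t * ln t') + s * ln t'"
    by (subst (1) t'_def) (simp add: algebra_simps)
  moreover have "(1 - s) * (t' - t) + s * (t' - 1) = 0" by (simp add: t'_def algebra_simps)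
  ultimately show ?thesis by linarith
qed

text \<open>Concavity on the segment from \<open>t\<close> to \<open>1\<close>, where the entropy is
  zero. It bounds the entropy lost when a density is pushed towards the full block; the end points
  rely on \<open>0 * ln 0 = 0\<close>.\<close>

lemma Hent_mix:
  fixes t s :: real
  assumes t: "0 \<le> t" "t \<le> 1" and s: "0 \<le> s" "s \<le> 1"
  shows "(1 - s) * Hent t \<le> Hent ((1 - s) * t + s)"
proof -
  define t' where "t' = (1 - s) * t + s"
  have 1: "t' * ln t' \<le> (1 - s) * (t * ln t)" unfolding t'_def by (rule xlnx_mix[OF assms])
  have e: "1 - t' = (1 - s) * (1 - t)" by (simp add: t'_def algebra_simps)
  have "(1 - t') * ln (1 - t') \<le> (1 - s) * ((1 - t) * ln (1 - t))"
  proof (cases "s = 1 \<or> t = 1")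
    case False
    then have p: "0 < 1 - s" "0 < 1 - t" using t s by auto
    have "ln (1 - t') = ln (1 - s) + ln (1 - t)" unfolding e using p by (simp add: ln_mult)
    moreover have "ln (1 - s) \<le> 0" using p s by simp
    ultimately have "ln (1 - t') \<le> ln (1 - t)" by simp
    then have "(1 - s) * (1 - t) * ln (1 - t') \<le> (1 - s) * (1 - t) * ln (1 - t)" using p by (intro mult_left_mono) auto
    then show ?thesis by (simp add: e mult.assoc)
  qed (use e in auto)
  then show ?thesis using 1 unfolding Hent_def t'_def[symmetric] by (simp add: algebra_simps)
qed

lemma Hent_nonneg: "0 \<le> t \<Longrightarrow> t \<le> 1 \<Longrightarrow> 0 \<le> Hent t"
proof -
  assume t: "0 \<le> t" "t \<le> 1"
  have a: "x * ln x \<le> 0" if "0 \<le> x" "x \<le> 1" for x :: real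
    using that by (cases "x = 0") (auto intro!: mult_nonneg_nonpos)
  show ?thesis using a[of t] a[of "1 - t"] t by (simp add: Hent_def)
qed

lemma Hent_le_1: "0 \<le> t \<Longrightarrow> t \<le> 1 \<Longrightarrow> Hent t \<le> 1"
proof -
  assume t: "0 \<le> t" "t \<le> 1"
  have a: "- (x * ln x) \<le> 1 - x" if "0 \<le> x" for x :: real
  proof (cases "x = 0")
    case False
    then have x: "x > 0" using that by simp
    have "- ln x = ln (1 / x)" using x by (simp add: ln_div)
    also have "\<dots> \<le> 1 / x - 1" using x by (intro ln_le_minus_one) simp
    finally have "x * (- ln x) \<le> x * (1 / x - 1)" using x by (intro mult_left_mono) auto
    then show ?thesis using x by (simp add: right_diff_distrib)
  qed simp
  show ?thesis using a[of t] a[of "1 - t"] t by (simp add: Hent_def)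
qed

text \<open>The right-hand side is the probability of a given sequence with \<open>l\<close>
  successes in \<open>b\<close> trials, at the empirical success rate.\<close>

lemma exp_Hent:
  fixes l b :: nat
  assumes "l \<le> b"
  shows "exp (- (real b * Hent (real l / real b))) = (real l / real b) ^ l * (1 - real l / real b) ^ (b - l)"
proof (cases "l = 0 \<or> l = b")
  case True
  then show ?thesis by (cases "b = 0") (auto simp: Hent_def)
next
  case False
  define t where "t = real l / real b"
  have b: "b > 0" using False assms by auto
  have t: "0 < t" "t < 1" using False assms b by (auto simp: t_def)
  have bt: "real b * t = real l" "real b * (1 - t) = real (b - l)" using b assms by (auto simp: t_def right_diff_distrib of_nat_diff)
  have "- (real b * Hent t) = real b * t * ln t + real b * (1 - t) * ln (1 - t)"
    by (simp add: Hent_def algebra_simps)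
  also have "\<dots> = real l * ln t + real (b - l) * ln (1 - t)" by (simp only: bt)
  finally have "exp (- (real b * Hent t)) = exp (real l * ln t) * exp (real (b - l) * ln (1 - t))" by (simp add: exp_add)
  also have "\<dots> = t ^ l * (1 - t) ^ (b - l)" using t by (simp add: exp_of_nat_mult)
  finally show ?thesis by (simp add: t_def)
qed

text \<open>Each subset is charged to the product measure whose block densities are its own; there are at
  most \<open>(n + 1) ^ r\<close> such measures, each of total mass one.\<close>

lemma sum_exp_entropy_le:
  fixes X :: "nat set" and blk :: "nat \<Rightarrow> nat"
  assumes X: "finite X" "card X \<le> n" and blk: "\<And>j. j \<in> X \<Longrightarrow> blk j < r"
  defines "B \<equiv> \<lambda>i. {j \<in> X. blk j = i}"
  shows "(\<Sum>T\<in>Pow X. exp (- (\<Sum>i<r. real (card (B i)) * Hent (real (card (T \<inter> B i)) / real (card (B i)))))) \<le> (real n + 1) ^ r"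
proof -
  \<comment> \<open>Truncated at \<open>1\<close> because \<open>q\<close> is arbitrary here; for
    the counts of an actual subset the minimum is the quotient.\<close>
  define pr where "pr = (\<lambda>(q::nat \<Rightarrow> nat) i. min 1 (real (q i) / real (card (B i))))"
  define mu where "mu = (\<lambda>q T. (\<Prod>j\<in>T. pr q (blk j)) * (\<Prod>j\<in>X - T. 1 - pr q (blk j)))"
  define cnt where "cnt = (\<lambda>T. \<lambda>i\<in>{..<r}. card (T \<inter> B i))"
  define Q where "Q = PiE {..<r} (\<lambda>_. {..n})"
  have fB: "finite (B i)" "B i \<subseteq> X" for i using X by (auto simp: B_def)
  have pr01: "0 \<le> pr q i" "pr q i \<le> 1" for q i by (auto simp: pr_def)
  have mu0: "0 \<le> mu q T" for q T unfolding mu_def using pr01 by (intro mult_nonneg_nonneg prod_nonneg) auto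
  \<comment> \<open>Expansion of the product over \<open>X\<close> of the sums
    \<open>pr + (1 - pr)\<close>.\<close>
  have total: "(\<Sum>T\<in>Pow X. mu q T) = 1" for q
    unfolding mu_def using prod_add[OF X(1), of "\<lambda>j. pr q (blk j)" "\<lambda>j. 1 - pr q (blk j)"] by simp
  have fib: "(\<Prod>j\<in>Y. g (blk j)) = (\<Prod>i<r. g i ^ card (Y \<inter> B i))" if "Y \<subseteq> X" for Y and g :: "nat \<Rightarrow> real"
  proof -
    have "(\<Prod>j\<in>Y. g (blk j)) = (\<Prod>i<r. \<Prod>j\<in>{j\<in>Y. blk j = i}. g (blk j))"
      using that X blk by (intro prod.group[symmetric]) (auto intro: finite_subset)
    also have "\<dots> = (\<Prod>i<r. g i ^ card (Y \<inter> B i))"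
    proof (intro prod.cong refl)
      fix i
      have "{j\<in>Y. blk j = i} = Y \<inter> B i" using that by (auto simp: B_def)
      then show "(\<Prod>j\<in>{j\<in>Y. blk j = i}. g (blk j)) = g i ^ card (Y \<inter> B i)"
        by (subst prod.cong[OF refl, of _ _ "\<lambda>_. g i"]) (auto simp: B_def)
    qed
    finally show ?thesis .
  qed
  have own: "exp (- (\<Sum>i<r. real (card (B i)) * Hent (real (card (T \<inter> B i)) / real (card (B i))))) = mu (cnt T) T"
    if T: "T \<subseteq> X" for T
  proof -
    have le: "card (T \<inter> B i) \<le> card (B i)" for i using fB by (intro card_mono) auto
    have pc: "pr (cnt T) i = real (card (T \<inter> B i)) / real (card (B i))" if "i < r" for i
    proof -
      have "real (card (T \<inter> B i)) / real (card (B i)) \<le> 1" using le[of i] by (cases "card (B i) = 0") auto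
      then show ?thesis using that by (simp add: pr_def cnt_def)
    qed
    have cc: "card ((X - T) \<inter> B i) = card (B i) - card (T \<inter> B i)" for i
    proof -
      have "(X - T) \<inter> B i = B i - (T \<inter> B i)" using fB by auto
      then show ?thesis using fB by (simp add: card_Diff_subset)
    qed
    have "mu (cnt T) T = (\<Prod>i<r. pr (cnt T) i ^ card (T \<inter> B i)) * (\<Prod>i<r. (1 - pr (cnt T) i) ^ card ((X - T) \<inter> B i))"
      unfolding mu_def using T by (subst (1 2) fib[of _ "\<lambda>i. _ i"]) auto
    also have "\<dots> = (\<Prod>i<r. exp (- (real (card (B i)) * Hent (real (card (T \<inter> B i)) / real (card (B i))))))"
      unfolding prod.distrib[symmetric] using exp_Hent[OF le] by (intro prod.cong refl) (simp add: pc cc)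
    finally show ?thesis by (simp add: exp_sum[symmetric] sum_negf)
  qed
  have cQ: "cnt T \<in> Q" if "T \<subseteq> X" for T
  proof -
    have "T \<inter> B i \<subseteq> X" for i using that by auto
    then have "card (T \<inter> B i) \<le> n" for i using card_mono[OF X(1)] X(2) order_trans by blast
    then show ?thesis by (simp add: cnt_def Q_def)
  qed
  have fQ: "finite Q" unfolding Q_def by (intro finite_PiE) auto
  have "(\<Sum>T\<in>Pow X. exp (- (\<Sum>i<r. real (card (B i)) * Hent (real (card (T \<inter> B i)) / real (card (B i)))))) = (\<Sum>T\<in>Pow X. mu (cnt T) T)"
    by (intro sum.cong refl own) auto
  also have "\<dots> \<le> (\<Sum>T\<in>Pow X. \<Sum>q\<in>Q. mu q T)"
    using cQ mu0 fQ by (intro sum_mono member_le_sum[of "cnt _" Q "\<lambda>q. mu q _"]) auto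
  also have "\<dots> = (\<Sum>q\<in>Q. \<Sum>T\<in>Pow X. mu q T)" by (rule sum.swap)
  also have "\<dots> = real (card Q)" by (simp add: total)
  also have "card Q = (n + 1) ^ r" by (simp add: Q_def card_PiE)
  finally show ?thesis by (simp add: add.commute)
qed

text \<open>The shift by one reflects that index \<open>j\<close> stands for the point
  \<open>j + 1\<close>; the interval is open on the left and closed on the right, as the blocks
  are.\<close>

lemma card_nat_interval:
  fixes a b :: real
  assumes "0 \<le> a" "a \<le> b"
  shows "b - a - 1 < real (card {j::nat. a < real j + 1 \<and> real j + 1 \<le> b})"
    and "real (card {j::nat. a < real j + 1 \<and> real j + 1 \<le> b}) < b - a + 1"
proof -
  have "{j::nat. a < real j + 1 \<and> real j + 1 \<le> b} = {nat \<lfloor>a\<rfloor>..<nat \<lfloor>b\<rfloor>}"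
  proof (intro set_eqI)
    fix j :: nat
    have "a < real j + 1 \<longleftrightarrow> \<lfloor>a\<rfloor> < int j + 1" using floor_less_iff[of a "int j + 1"] by simp
    moreover have "real j + 1 \<le> b \<longleftrightarrow> int j + 1 \<le> \<lfloor>b\<rfloor>" using le_floor_iff[of "int j + 1" b] by simp
    moreover have "0 \<le> \<lfloor>a\<rfloor>" "0 \<le> \<lfloor>b\<rfloor>" using assms by auto
    ultimately show "j \<in> {j::nat. a < real j + 1 \<and> real j + 1 \<le> b} \<longleftrightarrow> j \<in> {nat \<lfloor>a\<rfloor>..<nat \<lfloor>b\<rfloor>}" by auto
  qed
  moreover have "\<lfloor>a\<rfloor> \<le> \<lfloor>b\<rfloor>" "0 \<le> \<lfloor>a\<rfloor>" "0 \<le> \<lfloor>b\<rfloor>" using assms by (auto intro: floor_mono)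
  ultimately have "real (card {j::nat. a < real j + 1 \<and> real j + 1 \<le> b}) = real_of_int \<lfloor>b\<rfloor> - real_of_int \<lfloor>a\<rfloor>"
    by (simp add: of_nat_diff)
  then show "b - a - 1 < real (card {j::nat. a < real j + 1 \<and> real j + 1 \<le> b})"
    "real (card {j::nat. a < real j + 1 \<and> real j + 1 \<le> b}) < b - a + 1" by linarith+
qed

lemma ev_le_real_mult: "0 < d \<Longrightarrow> \<forall>\<^sub>F n in sequentially. c \<le> real n * d"
  by real_asymp

lemma error_tendsto: "(\<lambda>n. (a + b * sqrt (real n) + ln (real n) / 2 + c * ln (real n + 1)) / real n) \<longlonglongrightarrow> 0"
proof -
  have l: "(\<lambda>n. 1 / real n) \<longlonglongrightarrow> 0" "(\<lambda>n. sqrt (real n) / real n) \<longlonglongrightarrow> 0"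
    "(\<lambda>n. ln (real n) / real n) \<longlonglongrightarrow> 0" "(\<lambda>n. ln (real n + 1) / real n) \<longlonglongrightarrow> 0"
    by real_asymp+
  have "(\<lambda>n. a * (1 / real n) + b * (sqrt (real n) / real n) + 1 / 2 * (ln (real n) / real n) + c * (ln (real n + 1) / real n))
      \<longlonglongrightarrow> a * 0 + b * 0 + 1 / 2 * 0 + c * 0"
    by (intro tendsto_intros l)
  then show ?thesis by (simp add: add_divide_distrib)
qed

section \<open>The exponent functional\<close>

locale weight_setup =
  fixes f :: "real \<Rightarrow> real" and \<delta> \<alpha> :: real and r :: nat
  assumes f_cont: "continuous_on {0..1} f" and f_mono: "mono_on {0..1} f"
    and f_nonneg: "\<forall>u\<in>{0..1}. 0 \<le> f u" and f_pos: "\<forall>u\<in>{0<..1}. 0 < f u"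
    and \<delta>: "0 < \<delta>" "\<delta> < \<alpha>" and \<alpha>: "\<alpha> < 1" and r: "0 < r"
begin

abbreviation "fg \<equiv> fgrid f \<delta> r"

lemma \<delta>1: "\<delta> < 1" using \<delta> \<alpha> by simp

lemma f_le: "0 \<le> u \<Longrightarrow> u \<le> v \<Longrightarrow> v \<le> 1 \<Longrightarrow> f u \<le> f v"
  using f_mono by (auto simp: mono_on_def)

lemma grid_pt: "i < r \<Longrightarrow> \<delta> \<le> \<delta> + real i * (1 - \<delta>) / r \<and> \<delta> + real i * (1 - \<delta>) / r \<le> 1"
proof -
  assume i: "i < r"
  have "real i * (1 - \<delta>) / r \<ge> 0" using \<delta>1 r by simp
  moreover have "real i * (1 - \<delta>) \<le> real r * (1 - \<delta>)" using i \<delta>1 by (intro mult_right_mono) auto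
  then have "real i * (1 - \<delta>) / r \<le> 1 - \<delta>" using r by (simp add: field_simps)
  ultimately show ?thesis by simp
qed

lemma fg_bounds: "i < r \<Longrightarrow> f \<delta> \<le> fg i" "i < r \<Longrightarrow> fg i \<le> f 1"
  using grid_pt[of i] \<delta> by (auto simp: fgrid_def intro!: f_le)

lemma f\<delta>_pos: "0 < f \<delta>" using f_pos \<delta> \<delta>1 by auto

lemma fg_pos: "i < r \<Longrightarrow> 0 < fg i" using fg_bounds(1)[of i] f\<delta>_pos by linarith

lemma f\<delta>1: "f \<delta> \<le> f 1" using \<delta> \<delta>1 by (intro f_le) auto

lemma f1_pos: "0 < f 1" using f\<delta>_pos f\<delta>1 by linarith

text \<open>As \<open>f\<close> may vanish at \<open>0\<close>, the integral is bounded below on the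
  right half of the interval, where \<open>f\<close> is at least
  \<open>f (\<delta> / 2)\<close>.\<close>

lemma c1_pos: "0 < c1 f \<delta>"
proof -
  have c: "continuous_on {\<delta> / 2..\<delta>} (\<lambda>u. (f u)\<^sup>2)" "continuous_on {0..\<delta> / 2} (\<lambda>u. (f u)\<^sup>2)" "continuous_on {0..\<delta>} (\<lambda>u. (f u)\<^sup>2)"
    using \<delta> \<delta>1 by (auto intro!: continuous_intros continuous_on_subset[OF f_cont])
  have "f (\<delta> / 2) > 0" using f_pos \<delta> \<delta>1 by auto
  have "integral {\<delta> / 2..\<delta>} (\<lambda>_. (f (\<delta> / 2))\<^sup>2) \<le> integral {\<delta> / 2..\<delta>} (\<lambda>u. (f u)\<^sup>2)"
  proof (rule integral_le)
    fix u assume "u \<in> {\<delta> / 2..\<delta>}"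
    then have "f (\<delta> / 2) \<le> f u" using \<delta> \<delta>1 by (intro f_le) auto
    then show "(f (\<delta> / 2))\<^sup>2 \<le> (f u)\<^sup>2" using \<open>f (\<delta> / 2) > 0\<close> by (intro power_mono) auto
  qed (use c in \<open>auto intro: integrable_continuous_interval\<close>)
  moreover have "integral {\<delta> / 2..\<delta>} (\<lambda>_. (f (\<delta> / 2))\<^sup>2) > 0" using \<delta> \<open>f (\<delta> / 2) > 0\<close> by simp
  moreover have "integral {0..\<delta> / 2} (\<lambda>u. (f u)\<^sup>2) \<ge> 0" using c by (intro integral_nonneg integrable_continuous_interval) auto
  moreover have "integral {0..\<delta> / 2} (\<lambda>u. (f u)\<^sup>2) + integral {\<delta> / 2..\<delta>} (\<lambda>u. (f u)\<^sup>2) = c1 f \<delta>"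
    unfolding c1_def using \<delta> c by (intro Henstock_Kurzweil_Integration.integral_combine integrable_continuous_interval) auto
  ultimately show ?thesis by linarith
qed

definition feasible :: "(nat \<Rightarrow> real) \<Rightarrow> bool" where
  "feasible h \<longleftrightarrow> (\<forall>i<r. 0 \<le> h i \<and> h i \<le> 1 - \<delta>) \<and> (1 / real r) * (\<Sum>i<r. h i) \<ge> \<alpha> - \<delta>"

lemma avg_le: "(\<And>i. i < r \<Longrightarrow> a i \<le> c) \<Longrightarrow> 1 / real r * (\<Sum>i<r. a i) \<le> c"
proof -
  assume "\<And>i. i < r \<Longrightarrow> a i \<le> c"
  then have "(\<Sum>i<r. a i) \<le> (\<Sum>i<r. c)" by (intro sum_mono) auto
  then show ?thesis using r by (simp add: field_simps)
qed

section \<open>The saddle point of the internal exponent\<close>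

definition mean_lam :: "(nat \<Rightarrow> real) \<Rightarrow> real \<Rightarrow> real" where
  "mean_lam h s = (1 / real r) * (\<Sum>i<r. h i * lam (s * fg i))"

text \<open>For \<open>s\<close> below minus this value,
  \<open>c1 f \<delta> * s\<^sup>2 / 2\<close> exceeds the loss
  \<open>f 1 * \<bar>s\<bar> + \<bar>ln (2 * p01)\<bar>\<close> allowed by
  \<open>mean_lam_lower\<close>. The summand \<open>1\<close> ensures
  \<open>\<bar>s\<bar> > 1\<close>, so that the constant part of the loss is also covered by a
  multiple of \<open>\<bar>s\<bar>\<close>.\<close>

definition saddle_radius :: real where
  "saddle_radius = 1 + 2 * (f 1 + \<bar>ln (2 * p01)\<bar>) / c1 f \<delta>"

lemma saddle_radius_ge_1: "1 \<le> saddle_radius" using c1_pos f1_pos by (simp add: saddle_radius_def)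

lemma mean_lam_convex: "feasible h \<Longrightarrow> convex_on UNIV (mean_lam h)"
proof (rule convex_onI)
  fix t a b :: real assume h: "feasible h" and t: "0 < t" "t < 1"
  have "h i * lam (((1 - t) * a + t * b) * fg i) \<le> (1 - t) * (h i * lam (a * fg i)) + t * (h i * lam (b * fg i))" if "i < r" for i
  proof -
    have "lam ((1 - t) * (a * fg i) + t * (b * fg i)) \<le> (1 - t) * lam (a * fg i) + t * lam (b * fg i)"
      using convex_onD[OF lam_convex, of t "a * fg i" "b * fg i"] t by simp
    then have "h i * lam ((1 - t) * (a * fg i) + t * (b * fg i)) \<le> h i * ((1 - t) * lam (a * fg i) + t * lam (b * fg i))"
      using h that by (intro mult_left_mono) (auto simp: feasible_def)
    then show ?thesis by (simp add: algebra_simps)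
  qed
  then have "(\<Sum>i<r. h i * lam (((1 - t) * a + t * b) * fg i)) \<le> (\<Sum>i<r. (1 - t) * (h i * lam (a * fg i)) + t * (h i * lam (b * fg i)))"
    by (intro sum_mono) auto
  also have "\<dots> = (1 - t) * (\<Sum>i<r. h i * lam (a * fg i)) + t * (\<Sum>i<r. h i * lam (b * fg i))"
    by (simp add: sum.distrib sum_distrib_left)
  finally have "(1 / real r) * (\<Sum>i<r. h i * lam (((1 - t) * a + t * b) * fg i)) \<le> (1 / real r) * ((1 - t) * (\<Sum>i<r. h i * lam (a * fg i)) + t * (\<Sum>i<r. h i * lam (b * fg i)))"
    by (intro mult_left_mono) auto
  then show "mean_lam h ((1 - t) *\<^sub>R a + t *\<^sub>R b) \<le> (1 - t) * mean_lam h a + t * mean_lam h b"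
    unfolding mean_lam_def real_scaleR_def distrib_left[of "1 / real r"] mult.left_commute[of "1 / real r"] .
qed auto

lemma mean_lam_0: "mean_lam h 0 = 0" by (simp add: mean_lam_def lam_0)

lemma mean_lam_lower: "feasible h \<Longrightarrow> s \<le> 0 \<Longrightarrow> s * f 1 - \<bar>ln (2 * p01)\<bar> \<le> mean_lam h s"
proof -
  assume h: "feasible h" and s: "s \<le> 0"
  have "h i * lam (s * fg i) \<ge> s * f 1 - \<bar>ln (2 * p01)\<bar>" if i: "i < r" for i
  proof -
    have hi: "0 \<le> h i" "h i \<le> 1" using h i \<delta> by (auto simp: feasible_def)
    have "s * fg i \<le> 0" using s fg_pos[OF i] by (simp add: mult_nonpos_nonneg)
    then have "s * fg i + ln (2 * p01) \<le> lam (s * fg i)" by (rule lam_lower)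
    moreover have "s * f 1 \<le> s * fg i" using s fg_bounds(2)[OF i] by (rule mult_left_mono_neg[rotated])
    ultimately have 1: "s * f 1 - \<bar>ln (2 * p01)\<bar> \<le> lam (s * fg i)" by linarith
    have 2: "s * f 1 - \<bar>ln (2 * p01)\<bar> \<le> 0"
    proof -
      have "s * f 1 \<le> 0" using s f1_pos by (simp add: mult_nonpos_nonneg)
      then show ?thesis by linarith
    qed
    have "h i * (s * f 1 - \<bar>ln (2 * p01)\<bar>) \<ge> s * f 1 - \<bar>ln (2 * p01)\<bar>"
      using mult_right_mono_neg[OF hi(2) 2] by simp
    moreover have "h i * (s * f 1 - \<bar>ln (2 * p01)\<bar>) \<le> h i * lam (s * fg i)" using 1 hi by (intro mult_left_mono) auto
    ultimately show ?thesis by linarith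
  qed
  then have "(\<Sum>i<r. s * f 1 - \<bar>ln (2 * p01)\<bar>) \<le> (\<Sum>i<r. h i * lam (s * fg i))" by (intro sum_mono) auto
  then have "real r * (s * f 1 - \<bar>ln (2 * p01)\<bar>) \<le> (\<Sum>i<r. h i * lam (s * fg i))" by simp
  then show ?thesis using r by (simp add: mean_lam_def field_simps)
qed

lemma mean_lam_nonneg: "feasible h \<Longrightarrow> 0 \<le> s \<Longrightarrow> 0 \<le> mean_lam h s"
proof -
  assume h: "feasible h" and s: "0 \<le> s"
  have "0 \<le> lam (s * fg i)" if "i < r" for i
    using lam_mono[of 0 "s * fg i"] lam_0 s fg_pos[OF that] by simp
  then show ?thesis unfolding mean_lam_def
    using h by (intro mult_nonneg_nonneg sum_nonneg) (auto simp: feasible_def)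
qed

text \<open>The parameter minimises \<open>\<Psi>\<close>, the convex \<open>mean_lam h\<close> plus
  a quadratic; a nonpositive minimiser exists because \<open>\<Psi>\<close> is nonnegative on the
  positive axis and \<open>\<Psi> 0 = 0\<close>. The first-order condition says that
  \<open>- c1 f \<delta> * \<sigma>\<close> is a subgradient of \<open>mean_lam h\<close> at
  \<open>\<sigma>\<close>, which is the asserted maximality. Convexity takes the place of
  differentiating \<open>lam\<close>.\<close>

lemma saddle_exists:
  assumes h: "feasible h"
  shows "\<exists>\<sigma>\<in>{- saddle_radius..0}. \<forall>s. - c1 f \<delta> * \<sigma> * s - mean_lam h s \<le> - c1 f \<delta> * \<sigma> * \<sigma> - mean_lam h \<sigma>"
proof -
  define \<Psi> where "\<Psi> s = mean_lam h s + c1 f \<delta> * s\<^sup>2 / 2" for s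
  have "continuous_on UNIV (mean_lam h)" by (rule convex_on_continuous[OF _ mean_lam_convex[OF h]]) auto
  then have "continuous_on {- saddle_radius..0} \<Psi>" unfolding \<Psi>_def
    by (intro continuous_intros) (auto intro: continuous_on_subset)
  then obtain \<sigma> where \<sigma>: "\<sigma> \<in> {- saddle_radius..0}" "\<And>s. s \<in> {- saddle_radius..0} \<Longrightarrow> \<Psi> \<sigma> \<le> \<Psi> s"
    using continuous_attains_inf[of "{- saddle_radius..0}" \<Psi>] saddle_radius_ge_1 by auto
  have \<Psi>0: "\<Psi> \<sigma> \<le> 0" using \<sigma>(2)[of 0] saddle_radius_ge_1 by (simp add: \<Psi>_def mean_lam_0)
  have min: "\<Psi> \<sigma> \<le> \<Psi> s" for s
  proof -
    consider "s \<in> {- saddle_radius..0}" | "0 < s" | "s < - saddle_radius" by fastforce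
    then show ?thesis
    proof cases
      case 2
      then have "0 \<le> \<Psi> s" using mean_lam_nonneg[OF h, of s] c1_pos by (simp add: \<Psi>_def)
      then show ?thesis using \<Psi>0 by simp
    next
      case 3
      define k where "k = \<bar>ln (2 * p01)\<bar>"
      have s: "s < 0" "- s > 1" using 3 saddle_radius_ge_1 by auto
      have "2 * (f 1 + k) / c1 f \<delta> < - s" using 3 by (simp add: saddle_radius_def k_def)
      then have "2 * (f 1 + k) < - s * c1 f \<delta>" using c1_pos by (simp add: divide_less_eq)
      then have "(- s) * (2 * (f 1 + k)) < (- s) * (- s * c1 f \<delta>)" using s by (intro mult_strict_left_mono) auto
      then have "(- s) * (f 1 + k) < c1 f \<delta> * s\<^sup>2 / 2" by (simp add: power2_eq_square algebra_simps)
      moreover have "k \<le> (- s) * k" using s mult_right_mono[of 1 "- s" k] by (simp add: k_def)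
      moreover have "s * f 1 - k \<le> mean_lam h s" using mean_lam_lower[OF h, of s] s by (simp add: k_def)
      ultimately have "0 \<le> \<Psi> s" by (simp add: \<Psi>_def algebra_simps)
      then show ?thesis using \<Psi>0 by simp
    qed (rule \<sigma>)
  qed
  have "- c1 f \<delta> * \<sigma> * s - mean_lam h s \<le> - c1 f \<delta> * \<sigma> * \<sigma> - mean_lam h \<sigma>" for s
  proof -
    define q where "q = mean_lam h s - mean_lam h \<sigma> + c1 f \<delta> * \<sigma> * (s - \<sigma>)"
    \<comment> \<open>Minimality along the segment towards \<open>s\<close>, divided by
      \<open>t\<close>; letting \<open>t\<close> tend to \<open>0\<close> gives
      \<open>0 \<le> q\<close>.\<close>
    have key: "0 \<le> q + t * (c1 f \<delta> * (s - \<sigma>)\<^sup>2 / 2)" if t: "0 < t" "t < 1" for t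
    proof -
      have "mean_lam h ((1 - t) * \<sigma> + t * s) \<le> (1 - t) * mean_lam h \<sigma> + t * mean_lam h s"
        using convex_onD[OF mean_lam_convex[OF h], of t \<sigma> s] t by simp
      moreover have "\<Psi> \<sigma> \<le> \<Psi> ((1 - t) * \<sigma> + t * s)" by (rule min)
      ultimately have "0 \<le> t * (mean_lam h s - mean_lam h \<sigma>) + c1 f \<delta> * (((1 - t) * \<sigma> + t * s)\<^sup>2 - \<sigma>\<^sup>2) / 2"
        by (simp add: \<Psi>_def algebra_simps diff_divide_distrib)
      also have "((1 - t) * \<sigma> + t * s)\<^sup>2 - \<sigma>\<^sup>2 = 2 * t * \<sigma> * (s - \<sigma>) + t * t * (s - \<sigma>)\<^sup>2"
        by (simp add: power2_eq_square algebra_simps)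
      also have "t * (mean_lam h s - mean_lam h \<sigma>) + c1 f \<delta> * (2 * t * \<sigma> * (s - \<sigma>) + t * t * (s - \<sigma>)\<^sup>2) / 2 = t * (q + t * (c1 f \<delta> * (s - \<sigma>)\<^sup>2 / 2))"
        unfolding q_def by (simp only: distrib_left add_divide_distrib) simp
      finally have "0 \<le> t * (q + t * (c1 f \<delta> * (s - \<sigma>)\<^sup>2 / 2))" .
      then show ?thesis using t by (simp add: zero_le_mult_iff)
    qed
    have "0 \<le> q"
    proof (rule ccontr)
      assume q: "\<not> 0 \<le> q"
      define B where "B = c1 f \<delta> * (s - \<sigma>)\<^sup>2 / 2"
      have B: "B \<ge> 0" using c1_pos by (simp add: B_def)
      \<comment> \<open>Small enough for the quadratic term to use up less than half of
        \<open>- q\<close>.\<close>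
      define t where "t = min (1 / 2) (- q / (2 * (B + 1)))"
      have "0 < - q / (2 * (B + 1))" using q B by (intro divide_pos_pos) auto
      then have t: "0 < t" "t < 1" "t \<le> - q / (2 * (B + 1))" by (auto simp: t_def)
      have "t * (2 * (B + 1)) \<le> - q" using t(3) B pos_le_divide_eq[of "2 * (B + 1)" t "- q"] by simp
      moreover have "t * B \<le> t * (2 * (B + 1))" using t B by (intro mult_left_mono) auto
      moreover have "t * (2 * (B + 1)) = 2 * (t * B) + 2 * t" by (simp add: algebra_simps)
      ultimately have "q + t * B < 0" using t q B mult_nonneg_nonneg[of t B] by linarith
      then show False using key[OF t(1,2)] by (simp add: B_def)
    qed
    then show ?thesis by (simp add: q_def algebra_simps)
  qed
  then show ?thesis using \<sigma>(1) by blast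
qed

text \<open>At \<open>s = saddle h\<close> the supremum defining \<open>c0_conj f \<delta> r h y\<close> is attained for \<open>y = - c1 f \<delta> * s / c0bar f \<delta> r h\<close>,
  and \<open>psi_int f \<delta> r h y\<close> becomes the Chernoff exponent with parameter \<open>s\<close>.\<close>

definition saddle :: "(nat \<Rightarrow> real) \<Rightarrow> real" where
  "saddle h = (SOME \<sigma>. \<sigma> \<in> {- saddle_radius..0} \<and> (feasible h \<longrightarrow> (\<forall>s. - c1 f \<delta> * \<sigma> * s - mean_lam h s \<le> - c1 f \<delta> * \<sigma> * \<sigma> - mean_lam h \<sigma>)))"

lemma saddle: "saddle h \<in> {- saddle_radius..0}"
  "feasible h \<Longrightarrow> - c1 f \<delta> * saddle h * s - mean_lam h s \<le> - c1 f \<delta> * saddle h * saddle h - mean_lam h (saddle h)"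
proof -
  have "\<exists>\<sigma>. \<sigma> \<in> {- saddle_radius..0} \<and> (feasible h \<longrightarrow> (\<forall>s. - c1 f \<delta> * \<sigma> * s - mean_lam h s \<le> - c1 f \<delta> * \<sigma> * \<sigma> - mean_lam h \<sigma>))"
  proof (cases "feasible h")
    case True
    then show ?thesis using saddle_exists[OF True] by blast
  next
    case False
    then show ?thesis using saddle_radius_ge_1 by (intro exI[of _ 0]) auto
  qed
  from someI_ex[OF this] show "saddle h \<in> {- saddle_radius..0}"
    "feasible h \<Longrightarrow> - c1 f \<delta> * saddle h * s - mean_lam h s \<le> - c1 f \<delta> * saddle h * saddle h - mean_lam h (saddle h)"
    unfolding saddle_def by blast+
qed

lemma c0bar_pos: "feasible h \<Longrightarrow> 0 < c0bar f \<delta> r h"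
proof -
  assume h: "feasible h"
  have "f \<delta> * (\<Sum>i<r. h i) \<le> (\<Sum>i<r. fg i * h i)"
    unfolding sum_distrib_left using h fg_bounds(1) by (intro sum_mono mult_right_mono) (auto simp: feasible_def)
  then have "1 / real r * (f \<delta> * (\<Sum>i<r. h i)) \<le> c0bar f \<delta> r h"
    unfolding c0bar_def by (intro mult_left_mono) auto
  moreover have "0 < 1 / real r * (\<Sum>i<r. h i)" using h \<delta> unfolding feasible_def by linarith
  then have "0 < f \<delta> * (1 / real r * (\<Sum>i<r. h i))" using f\<delta>_pos by (rule mult_pos_pos[rotated])
  then have "0 < 1 / real r * (f \<delta> * (\<Sum>i<r. h i))" by (simp only: mult.left_commute)
  ultimately show ?thesis by linarith
qed

lemma psi_int_saddle:
  assumes h: "feasible h"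
  shows "\<exists>y. psi_int f \<delta> r h y = ereal (- (real r * (\<Sum>i<r. h i) - \<delta>) * ln 2 + ((saddle h)\<^sup>2 / 2 * c1 f \<delta> + mean_lam h (saddle h)))"
proof -
  define c0 where "c0 = c0bar f \<delta> r h"
  define \<sigma> where "\<sigma> = saddle h"
  have c0: "c0 > 0" unfolding c0_def by (rule c0bar_pos[OF h])
  define y where "y = - c1 f \<delta> * \<sigma> / c0"
  have cy: "c0 * s * y = - c1 f \<delta> * \<sigma> * s" for s using c0 by (simp add: y_def)
  have "c0_conj f \<delta> r h y = (SUP s\<in>UNIV. ereal (- c1 f \<delta> * \<sigma> * s - mean_lam h s))"
    unfolding c0_conj_def c0_def[symmetric] cy mean_lam_def ..
  also have "\<dots> = ereal (- c1 f \<delta> * \<sigma> * \<sigma> - mean_lam h \<sigma>)"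
  proof (rule antisym)
    show "(SUP s\<in>UNIV. ereal (- c1 f \<delta> * \<sigma> * s - mean_lam h s)) \<le> ereal (- c1 f \<delta> * \<sigma> * \<sigma> - mean_lam h \<sigma>)"
      unfolding \<sigma>_def by (rule SUP_least) (use saddle(2)[OF h] in simp)
    show "ereal (- c1 f \<delta> * \<sigma> * \<sigma> - mean_lam h \<sigma>) \<le> (SUP s\<in>UNIV. ereal (- c1 f \<delta> * \<sigma> * s - mean_lam h s))"
      by (rule SUP_upper2[of \<sigma>]) auto
  qed
  finally have conj: "c0_conj f \<delta> r h y = ereal (- c1 f \<delta> * \<sigma> * \<sigma> - mean_lam h \<sigma>)" .
  \<comment> \<open>Together with \<open>conj\<close> the two terms add up to minus the sum of
    \<open>c1 f \<delta> * \<sigma>\<^sup>2 / 2\<close> and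
    \<open>mean_lam h \<sigma>\<close>.\<close>
  have "c0\<^sup>2 / (2 * c1 f \<delta>) * y\<^sup>2 = c1 f \<delta> * \<sigma>\<^sup>2 / 2"
    using c0 c1_pos by (simp add: y_def power2_eq_square field_simps)
  then have "psi_int f \<delta> r h y = ereal (- (real r * (\<Sum>i<r. h i) - \<delta>) * ln 2 + (\<sigma>\<^sup>2 / 2 * c1 f \<delta> + mean_lam h \<sigma>))"
    unfolding psi_int_def conj c0_def[symmetric]
    by (simp add: power2_eq_square algebra_simps)
  then show ?thesis unfolding \<sigma>_def by blast
qed

definition com_part :: "(nat \<Rightarrow> real) \<Rightarrow> real" where
  "com_part h = (1 - \<delta>) / real r * (\<Sum>i<r. Hent (h i / (1 - \<delta>)))"

definition int_part :: "(nat \<Rightarrow> real) \<Rightarrow> real" where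
  "int_part h = (saddle h)\<^sup>2 / 2 * c1 f \<delta> + mean_lam h (saddle h)"

text \<open>The \<open>ln 2\<close> terms of \<open>psi_com\<close> and \<open>psi_int\<close>
  cancel, mirroring the cancellation of the signs in \<open>fail_bound\<close>.\<close>

lemma psi_tot_ge:
  assumes h: "feasible h" and x: "0 < x"
  shows "ereal (com_part h + int_part h + psi_ext f \<delta> r h x) \<le> psi_tot f \<delta> \<alpha> r"
proof -
  obtain y where y: "psi_int f \<delta> r h y = ereal (- (real r * (\<Sum>i<r. h i) - \<delta>) * ln 2 + int_part h)"
    using psi_int_saddle[OF h] unfolding int_part_def by blast
  have "ereal (psi_com \<delta> r h) + psi_int f \<delta> r h y + ereal (psi_ext f \<delta> r h x) \<le> psi_tot f \<delta> \<alpha> r"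
    unfolding psi_tot_def by (rule SUP_upper2[of "(h, x, y)"]) (use h x in \<open>auto simp: feasible_def\<close>)
  moreover have "ereal (psi_com \<delta> r h) + psi_int f \<delta> r h y + ereal (psi_ext f \<delta> r h x) = ereal (com_part h + int_part h + psi_ext f \<delta> r h x)"
    unfolding y psi_com_def com_part_def by (simp add: algebra_simps)
  ultimately show ?thesis by simp
qed

section \<open>Bounds for the external exponent\<close>

text \<open>Bounds the variation of \<open>ln (erf (x * v))\<close> for \<open>v\<close> in
  \<open>{f \<delta>..f 1}\<close>, uniformly in \<open>x > 0\<close>.\<close>

definition erf_spread :: real where "erf_spread = ln (f 1 / f \<delta>)"

text \<open>Minus this is a lower bound for \<open>psi_ext\<close> at \<open>x = 1\<close>, hence
  for its supremum over \<open>x\<close>.\<close>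

definition ext_floor :: real where "ext_floor = (f 1)\<^sup>2 - ln (erf (f \<delta>))"

lemma erf_spread_nonneg: "0 \<le> erf_spread" using f\<delta>1 f\<delta>_pos by (simp add: erf_spread_def)

lemma ext_floor_nonneg: "0 \<le> ext_floor" using ln_erf_nonpos[OF f\<delta>_pos] unfolding ext_floor_def by (smt (verit) zero_le_power2)

text \<open>For \<open>x\<^sup>2\<close> above this value, half of the decay
  \<open>c1 f \<delta> * x\<^sup>2\<close> in \<open>psi_ext_upper\<close> covers
  \<open>erf_spread + ext_floor\<close>.\<close>

definition sq_cutoff :: real where "sq_cutoff = 2 * (erf_spread + ext_floor) / c1 f \<delta>"

text \<open>The quadratic error of \<open>ext_exponent_bound\<close>, enlarged by the
  \<open>x\<^sup>2\<close> to be gained and evaluated at the cutoff, plus the constant error of that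
  bound.\<close>

definition ext_const :: real where "ext_const = (real r * (f 1)\<^sup>2 + 1) * sq_cutoff + (1 + real r) * erf_spread"

lemma ln_erf_window:
  assumes x: "0 < x" and v: "f \<delta> \<le> v" "v \<le> f 1"
  shows "ln (erf (x * f \<delta>)) \<le> ln (erf (x * v))" "ln (erf (x * v)) \<le> ln (erf (x * f \<delta>)) + erf_spread"
proof -
  have p: "0 < x * f \<delta>" "x * f \<delta> \<le> x * v" "x * v \<le> x * f 1" using x v f\<delta>_pos by auto
  show "ln (erf (x * f \<delta>)) \<le> ln (erf (x * v))" by (rule ln_erf_mono[OF p(1,2)])
  have "ln (erf (x * v)) \<le> ln (erf (x * f 1))" using p by (intro ln_erf_mono) auto
  also have "\<dots> \<le> ln (erf (x * f \<delta>)) + ln (x * f 1 / (x * f \<delta>))" using p by (intro ln_erf_ratio) auto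
  finally show "ln (erf (x * v)) \<le> ln (erf (x * f \<delta>)) + erf_spread" using x by (simp add: erf_spread_def)
qed

lemma f_window: "u \<in> {\<delta>..1} \<Longrightarrow> f \<delta> \<le> f u \<and> f u \<le> f 1"
  using \<delta> by (auto intro!: f_le)

lemma cont_ln_erf: "0 < x \<Longrightarrow> continuous_on {\<delta>..1} (\<lambda>u. ln (erf (x * f u)))"
proof -
  assume x: "0 < x"
  have "continuous_on {\<delta>..1} f" using \<delta> by (intro continuous_on_subset[OF f_cont]) auto
  then have "continuous_on {\<delta>..1} (\<lambda>u. erf (x * f u))"
    by (intro continuous_on_compose2[OF continuous_on_erf[of UNIV]] continuous_intros) auto
  moreover have "erf (x * f u) \<noteq> 0" if "u \<in> {\<delta>..1}" for u
  proof -
    have "0 < x * f u" using x f_window[OF that] f\<delta>_pos by (intro mult_pos_pos) auto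
    from erf_pos[OF this] show ?thesis by simp
  qed
  ultimately show ?thesis by (intro continuous_on_ln) auto
qed

text \<open>Both logarithmic parts are compared with \<open>e0\<close>: the integral contributes at
  most \<open>- (1 - \<delta>) * e0\<close> up to the spread, the sum at most
  \<open>(1 - \<delta>) * e0\<close> since \<open>h i \<le> 1 - \<delta>\<close>. They cancel, so
  the bound stays finite as \<open>x\<close> tends to \<open>0\<close>.\<close>

lemma psi_ext_upper:
  assumes h: "\<And>i. i < r \<Longrightarrow> 0 \<le> h i \<and> h i \<le> 1 - \<delta>" and x: "0 < x"
  shows "psi_ext f \<delta> r h x \<le> - c1 f \<delta> * x\<^sup>2 + erf_spread"
proof -
  define e0 where "e0 = - ln (erf (x * f \<delta>))"
  have e0: "0 \<le> e0" using ln_erf_nonpos[of "x * f \<delta>"] x f\<delta>_pos by (simp add: e0_def)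
  have "integral {\<delta>..1} (\<lambda>u. ln (erf (x * f u))) \<le> integral {\<delta>..1} (\<lambda>u. - e0 + erf_spread)"
    using ln_erf_window(2)[OF x] f_window
    by (intro integral_le integrable_continuous_interval cont_ln_erf x) (auto simp: e0_def)
  then have 1: "integral {\<delta>..1} (\<lambda>u. ln (erf (x * f u))) \<le> (1 - \<delta>) * (- e0 + erf_spread)"
    using \<delta>1 by simp
  have "h i * (- ln (erf (x * fg i))) \<le> (1 - \<delta>) * e0" if "i < r" for i
  proof -
    have "0 < x * fg i" using x fg_pos[OF that] by simp
    then have "0 \<le> - ln (erf (x * fg i))" using ln_erf_nonpos by simp
    moreover have "- ln (erf (x * fg i)) \<le> e0" using ln_erf_window(1)[OF x fg_bounds[OF that]] by (simp add: e0_def)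
    ultimately show ?thesis using h[OF that] by (intro mult_mono) auto
  qed
  then have "1 / real r * (\<Sum>i<r. h i * (- ln (erf (x * fg i)))) \<le> (1 - \<delta>) * e0" by (rule avg_le)
  then have 2: "- (1 / real r * (\<Sum>i<r. h i * ln (erf (x * fg i)))) \<le> (1 - \<delta>) * e0"
    by (simp add: sum_negf)
  have "(1 - \<delta>) * erf_spread \<le> 1 * erf_spread" using \<delta> erf_spread_nonneg by (intro mult_right_mono) auto
  then have 3: "G0bar f \<delta> r h x \<le> erf_spread" using 1 2 unfolding G0bar_def by (simp add: algebra_simps)
  have "0 \<le> 1 / real r * (\<Sum>i<r. (fg i)\<^sup>2 * h i)" using h by (intro mult_nonneg_nonneg sum_nonneg) auto
  then have "c1 f \<delta> \<le> c2bar f \<delta> r h" unfolding c2bar_def c1_def by linarith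
  then have "c1 f \<delta> * x\<^sup>2 \<le> c2bar f \<delta> r h * x\<^sup>2" by (intro mult_right_mono) auto
  then show ?thesis using 3 unfolding psi_ext_def by linarith
qed

lemma psi_ext_lower:
  assumes h: "\<And>i. i < r \<Longrightarrow> 0 \<le> h i \<and> h i \<le> 1 - \<delta>"
  shows "- ext_floor \<le> psi_ext f \<delta> r h 1"
proof -
  have "integral {\<delta>..1} (\<lambda>u. ln (erf (f \<delta>))) \<le> integral {\<delta>..1} (\<lambda>u. ln (erf (1 * f u)))"
    using ln_erf_window(1)[of 1] f_window
    by (intro integral_le integrable_continuous_interval cont_ln_erf) auto
  then have 1: "(1 - \<delta>) * ln (erf (f \<delta>)) \<le> integral {\<delta>..1} (\<lambda>u. ln (erf (1 * f u)))" using \<delta>1 by simp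
  have "1 * ln (erf (f \<delta>)) \<le> (1 - \<delta>) * ln (erf (f \<delta>))"
    using \<delta> ln_erf_nonpos[OF f\<delta>_pos] by (intro mult_right_mono_neg) auto
  moreover have "0 \<le> - (1 / real r * (\<Sum>i<r. h i * ln (erf (1 * fg i))))"
  proof -
    have "h i * ln (erf (1 * fg i)) \<le> 0" if "i < r" for i
      using ln_erf_nonpos[of "fg i"] fg_pos[OF that] h[OF that] by (simp add: mult_nonneg_nonpos)
    then have "1 / real r * (\<Sum>i<r. h i * ln (erf (1 * fg i))) \<le> 0" by (rule avg_le)
    then show ?thesis by simp
  qed
  ultimately have G: "ln (erf (f \<delta>)) \<le> G0bar f \<delta> r h 1" using 1 unfolding G0bar_def by linarith
  have "integral {0..\<delta>} (\<lambda>u. (f u)\<^sup>2) \<le> integral {0..\<delta>} (\<lambda>u. (f 1)\<^sup>2)"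
  proof (rule integral_le)
    show "(\<lambda>u. (f u)\<^sup>2) integrable_on {0..\<delta>}"
      using \<delta>1 by (intro integrable_continuous_interval continuous_intros continuous_on_subset[OF f_cont]) auto
    show "(f u)\<^sup>2 \<le> (f 1)\<^sup>2" if "u \<in> {0..\<delta>}" for u
      using that \<delta>1 f_nonneg by (intro power_mono f_le) auto
  qed auto
  then have a: "integral {0..\<delta>} (\<lambda>u. (f u)\<^sup>2) \<le> \<delta> * (f 1)\<^sup>2" using \<delta> by simp
  have b: "1 / real r * (\<Sum>i<r. (fg i)\<^sup>2 * h i) \<le> (f 1)\<^sup>2 * (1 - \<delta>)"
  proof (rule avg_le)
    fix i assume "i < r"
    then show "(fg i)\<^sup>2 * h i \<le> (f 1)\<^sup>2 * (1 - \<delta>)"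
      using h[of i] fg_bounds(2)[of i] fg_pos[of i] by (intro mult_mono power_mono) auto
  qed
  have "c2bar f \<delta> r h \<le> (f 1)\<^sup>2" using a b unfolding c2bar_def by (simp add: algebra_simps)
  then show ?thesis using G unfolding psi_ext_def ext_floor_def by simp
qed

text \<open>Collects the errors of the internal exponent, the external factor and the entropy that
  do not depend on \<open>n\<close>.\<close>

definition face_const :: real where
  "face_const = saddle_radius\<^sup>2 / 2 * (f 1)\<^sup>2 + real r * \<bar>lam (- saddle_radius * f 1)\<bar> + ext_const + 2 * real r"

text \<open>A bound for each face term up to its entropy factor; besides
  \<open>exp (real n * \<Psi>)\<close> it grows only like a polynomial times an exponential of
  \<open>sqrt (real n)\<close>.\<close>

definition face_bound :: "nat \<Rightarrow> real \<Rightarrow> real" where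
  "face_bound n \<Psi> = exp (saddle_radius * (f 1 * sqrt (real n)) + face_const + real n * \<Psi>) * (f 1 * sqrt (real n)) / p01"

lemma face_bound_nonneg: "0 \<le> face_bound n \<Psi>"
  using f1_pos p01_pos by (simp add: face_bound_def)

lemma psi_tot_gt_MInf: "psi_tot f \<delta> \<alpha> r \<noteq> - \<infinity>"
proof -
  have "feasible (\<lambda>_. 1 - \<delta>)" using \<delta>1 \<alpha> r by (simp add: feasible_def)
  from psi_tot_ge[OF this zero_less_one] show ?thesis by (cases "psi_tot f \<delta> \<alpha> r") auto
qed

end

section \<open>Discretisation into blocks\<close>

text \<open>The last assumption makes every block nonempty and \<open>1 / block_len\<close> at most
  one.\<close>

locale sized_setup = weight_setup +
  fixes n k m :: nat
  assumes n: "0 < n" and k: "real k = \<delta> * real n" and m: "real m = \<alpha> * real n"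
    and big: "2 \<le> real n * (1 - \<delta>) / real r"
begin

text \<open>The ideal number of coordinates per block, in general not an integer.\<close>

definition block_len :: real where "block_len = real n * (1 - \<delta>) / real r"

lemma block_len_ge: "2 \<le> block_len" and r_block_len: "real r * block_len = real n * (1 - \<delta>)" and block_len_alt: "block_len = real n / real r * (1 - \<delta>)"
  using big r by (auto simp: block_len_def)

lemma k_bounds: "0 < k" "k < n" "k < m" "m < n"
proof -
  have "0 < \<delta> * real n" using \<delta> n by simp
  then show "0 < k" using k by simp
  have "\<delta> * real n < 1 * real n" using \<delta>1 n by (intro mult_strict_right_mono) auto
  then show "k < n" using k by simp
  have "\<delta> * real n < \<alpha> * real n" using \<delta> n by (intro mult_strict_right_mono) auto
  then show "k < m" using k m by linarith
  have "\<alpha> * real n < 1 * real n" using \<alpha> n by (intro mult_strict_right_mono) auto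
  then show "m < n" using m by simp
qed

lemma k_div: "real k / real n = \<delta>" using k n by simp

abbreviation "w \<equiv> wts f n"

lemma w_pos: "j < n \<Longrightarrow> 0 < w j"
  using f_pos n by (auto simp: wts_def)

lemma w_le: "j < n \<Longrightarrow> w j \<le> f 1"
  using n by (auto simp: wts_def intro!: f_le)

text \<open>A coordinate belongs to block \<open>i\<close> if its point \<open>(j + 1) / n\<close>
  lies between grid points \<open>i\<close> and \<open>i + 1\<close>, the left one excluded and the
  right one included. The ceiling counts blocks from \<open>1\<close>, hence the
  subtraction.\<close>

definition blk :: "nat \<Rightarrow> nat" where
  "blk j = nat \<lceil>(real (Suc j) / real n - \<delta>) * real r / (1 - \<delta>)\<rceil> - 1"

definition block :: "nat \<Rightarrow> nat set" where
  "block i = {j \<in> {k..<n}. blk j = i}"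

lemma blk_iff:
  assumes j: "j \<in> {k..<n}"
  shows "blk j = i \<longleftrightarrow> real k + real i * block_len < real j + 1 \<and> real j + 1 \<le> real k + (real i + 1) * block_len"
    and "blk j < r"
proof -
  define y where "y = (real (Suc j) / real n - \<delta>) * real r / (1 - \<delta>)"
  have yL: "y * block_len = real j + 1 - real k"
  proof -
    have "y * (1 - \<delta>) = (real (Suc j) / real n - \<delta>) * real r" using \<delta>1 by (simp add: y_def)
    then have "y * (real n * (1 - \<delta>)) = (real (Suc j) / real n - \<delta>) * real r * real n" by (metis mult.assoc mult.commute)
    also have "\<dots> = (real j + 1 - real k) * real r" using n k by (simp add: field_simps)
    finally have "y * (real r * block_len) = (real j + 1 - real k) * real r" by (simp only: r_block_len)
    then have "(y * block_len) * real r = (real j + 1 - real k) * real r" by (simp add: mult_ac)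
    then show ?thesis using r by simp
  qed
  have Lp: "0 < block_len" using block_len_ge by simp
  have "0 < y * block_len" using yL j by auto
  then have y0: "0 < y" using Lp by (simp add: zero_less_mult_iff)
  have "real j + 1 \<le> real n" using j by auto
  then have "y * block_len \<le> real n - real k" using yL by simp
  also have "\<dots> = real r * block_len" using r_block_len k by (simp add: algebra_simps)
  finally have yr: "y \<le> real r" using Lp by simp
  have c: "1 \<le> \<lceil>y\<rceil>" using y0 by simp
  have "\<lceil>y\<rceil> \<le> int r" using yr by (simp add: ceiling_le_iff)
  then show "blk j < r" using c r unfolding blk_def y_def[symmetric] by linarith
  have "blk j = i \<longleftrightarrow> \<lceil>y\<rceil> = int i + 1" using c unfolding blk_def y_def[symmetric] by linarith
  also have "\<dots> \<longleftrightarrow> real i < y \<and> y \<le> real i + 1" by (simp add: ceiling_eq_iff)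
  also have "\<dots> \<longleftrightarrow> real i * block_len < y * block_len \<and> y * block_len \<le> (real i + 1) * block_len" using Lp by simp
  also have "\<dots> \<longleftrightarrow> real k + real i * block_len < real j + 1 \<and> real j + 1 \<le> real k + (real i + 1) * block_len" unfolding yL by linarith
  finally show "blk j = i \<longleftrightarrow> real k + real i * block_len < real j + 1 \<and> real j + 1 \<le> real k + (real i + 1) * block_len" .
qed

text \<open>The grid point is the left end of the block and \<open>f\<close> is non-decreasing. Both
  the internal and the external estimates of a face rest on this one-sided comparison.\<close>

lemma fg_le_w: "j \<in> {k..<n} \<Longrightarrow> fg (blk j) \<le> w j"
proof -
  assume j: "j \<in> {k..<n}"
  have b: "blk j < r" "real k + real (blk j) * block_len < real j + 1" using blk_iff[OF j] by auto
  have "\<delta> + real (blk j) * (1 - \<delta>) / real r = (real k + real (blk j) * block_len) / real n"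
    using n k by (simp add: block_len_def add_divide_distrib)
  also have "\<dots> \<le> real (Suc j) / real n" using b n by (intro divide_right_mono) auto
  finally show ?thesis unfolding fgrid_def wts_def using grid_pt[OF b(1)] \<delta> j n by (intro f_le) auto
qed

lemma card_block: "i < r \<Longrightarrow> block_len - 1 < real (card (block i))" "i < r \<Longrightarrow> real (card (block i)) < block_len + 1"
proof -
  assume i: "i < r"
  have "block i = {j::nat. real k + real i * block_len < real j + 1 \<and> real j + 1 \<le> real k + (real i + 1) * block_len}"
  proof (intro set_eqI iffI)
    fix j assume "j \<in> {j::nat. real k + real i * block_len < real j + 1 \<and> real j + 1 \<le> real k + (real i + 1) * block_len}"
    then have j: "real k + real i * block_len < real j + 1" "real j + 1 \<le> real k + (real i + 1) * block_len" by auto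
    have "0 \<le> real i * block_len" using block_len_ge by simp
    then have "k \<le> j" using j(1) by linarith
    have "(real i + 1) * block_len \<le> real r * block_len" using i block_len_ge by (intro mult_right_mono) auto
    then have "real j + 1 \<le> real n" using j(2) r_block_len k by (simp add: algebra_simps)
    then have "j \<in> {k..<n}" using \<open>k \<le> j\<close> by auto
    then show "j \<in> block i" using blk_iff(1)[of j i] j by (simp add: block_def)
  qed (use blk_iff in \<open>auto simp: block_def\<close>)
  then have e: "card (block i) = card {j::nat. real k + real i * block_len < real j + 1 \<and> real j + 1 \<le> real k + (real i + 1) * block_len}" by simp
  have "0 \<le> real k + real i * block_len" "real k + real i * block_len \<le> real k + (real i + 1) * block_len" using block_len_ge by (auto simp: algebra_simps)
  note card_nat_interval[OF this]
  moreover have "real k + (real i + 1) * block_len - (real k + real i * block_len) = block_len" by (simp add: algebra_simps)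
  ultimately show "block_len - 1 < real (card (block i))" "real (card (block i)) < block_len + 1" unfolding e by simp_all
qed

lemma finite_block: "finite (block i)" "block i \<subseteq> {k..<n}" by (auto simp: block_def)

lemma sum_blocks:
  assumes "T \<subseteq> {k..<n}"
  shows "(\<Sum>j\<in>T. g j) = (\<Sum>i<r. \<Sum>j\<in>T \<inter> block i. (g j :: real))"
proof -
  have "(\<Sum>j\<in>T. g j) = (\<Sum>i<r. \<Sum>j\<in>{j\<in>T. blk j = i}. g j)"
    using assms blk_iff(2) by (intro sum.group[symmetric]) (auto intro: finite_subset)
  moreover have "{j\<in>T. blk j = i} = T \<inter> block i" for i using assms by (auto simp: block_def)
  ultimately show ?thesis by simp
qed

definition block_count :: "nat set \<Rightarrow> nat \<Rightarrow> real" where "block_count T i = real (card (T \<inter> block i))"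

definition block_frac :: "nat set \<Rightarrow> nat \<Rightarrow> real" where "block_frac T i = block_count T i / real (card (block i))"

text \<open>The block fractions, pushed slightly towards the full block: this compensates the rounding of the
  block sizes, so that the total mass is at least \<open>card T / n\<close>.\<close>

definition block_mass :: "nat set \<Rightarrow> nat \<Rightarrow> real" where
  "block_mass T i = (1 - \<delta>) * ((1 - 1 / block_len) * block_frac T i + 1 / block_len)"

lemma sum_const_blocks: "T \<subseteq> {k..<n} \<Longrightarrow> (\<Sum>j\<in>T. g (blk j)) = (\<Sum>i<r. block_count T i * g i)"
proof -
  assume T: "T \<subseteq> {k..<n}"
  have "(\<Sum>j\<in>T \<inter> block i. g (blk j)) = block_count T i * g i" for i
    by (subst sum.cong[OF refl, of _ _ "\<lambda>_. g i"]) (auto simp: block_def block_count_def)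
  then show ?thesis using sum_blocks[OF T, of "\<lambda>j. g (blk j)"] by simp
qed

lemma block_frac_bounds: "0 \<le> block_frac T i" "block_frac T i \<le> 1"
proof -
  have "card (T \<inter> block i) \<le> card (block i)" using finite_block by (intro card_mono) auto
  then show "0 \<le> block_frac T i" "block_frac T i \<le> 1" by (auto simp: block_frac_def block_count_def divide_le_eq_1)
qed

lemma block_count_eq: "i < r \<Longrightarrow> block_count T i = block_frac T i * real (card (block i))"
  using card_block(1)[of i] block_len_ge by (simp add: block_frac_def)

lemma block_len_inv: "0 \<le> 1 / block_len" "1 / block_len \<le> 1" using block_len_ge by auto

lemma block_mass_bounds: "0 \<le> block_mass T i" "block_mass T i \<le> 1 - \<delta>"
proof -
  have "(1 - 1 / block_len) * block_frac T i + 1 / block_len \<le> (1 - 1 / block_len) * 1 + 1 / block_len"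
    using block_len_inv block_frac_bounds by (intro add_mono mult_left_mono) auto
  then have "(1 - \<delta>) * ((1 - 1 / block_len) * block_frac T i + 1 / block_len) \<le> (1 - \<delta>) * 1"
    using \<delta>1 by (intro mult_left_mono) auto
  then show "block_mass T i \<le> 1 - \<delta>" by (simp add: block_mass_def)
  show "0 \<le> block_mass T i" unfolding block_mass_def using \<delta>1 block_len_inv block_frac_bounds by (intro mult_nonneg_nonneg add_nonneg_nonneg) auto
qed

lemma block_mass_scaled: "real n / real r * block_mass T i = block_len - (block_len - 1) * (1 - block_frac T i)"
proof -
  have "real n / real r * block_mass T i = block_len * ((1 - 1 / block_len) * block_frac T i + 1 / block_len)"
    unfolding block_mass_def by (simp only: block_len_alt mult.assoc)
  also have "\<dots> = block_len - (block_len - 1) * (1 - block_frac T i)" using block_len_ge by (simp add: field_simps)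
  finally show ?thesis .
qed

text \<open>With \<open>x\<close> the deviation of the block size from \<open>block_len\<close> and
  \<open>t\<close> the block fraction, the difference is \<open>x * t - (1 - t)\<close>, where
  \<open>\<bar>x\<bar> < 1\<close>.\<close>

lemma block_count_approx: "i < r \<Longrightarrow> block_count T i - real n / real r * block_mass T i \<ge> - 1" "i < r \<Longrightarrow> block_count T i - real n / real r * block_mass T i \<le> 1"
  and cl_hh_eq: "i < r \<Longrightarrow> real n / real r * block_mass T i - block_count T i = (1 + (real (card (block i)) - block_len)) * (1 - block_frac T i) - (real (card (block i)) - block_len)"
proof -
  assume i: "i < r"
  define x where "x = real (card (block i)) - block_len"
  define t where "t = block_frac T i"
  have x: "- 1 < x" "x < 1" using card_block[OF i] by (auto simp: x_def)
  have t: "0 \<le> t" "t \<le> 1" using block_frac_bounds by (auto simp: t_def)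
  have "block_count T i = t * (block_len + x)" using block_count_eq[OF i] by (simp add: x_def t_def)
  moreover have h: "real n / real r * block_mass T i = block_len - (block_len - 1) * (1 - t)" unfolding t_def by (rule block_mass_scaled)
  ultimately have e: "block_count T i - real n / real r * block_mass T i = x * t - (1 - t)" by (simp add: algebra_simps)
  have "- 1 * t \<le> x * t" "x * t \<le> 1 * t" using x t by (intro mult_right_mono; simp)+
  then show "block_count T i - real n / real r * block_mass T i \<ge> - 1" "block_count T i - real n / real r * block_mass T i \<le> 1" unfolding e using t by auto
  show "real n / real r * block_mass T i - block_count T i = (1 + (real (card (block i)) - block_len)) * (1 - block_frac T i) - (real (card (block i)) - block_len)"
    unfolding x_def[symmetric] t_def[symmetric] using e by (simp add: algebra_simps)
qed

lemma sum_block_count: "T \<subseteq> {k..<n} \<Longrightarrow> (\<Sum>i<r. block_count T i) = real (card T)"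
  using sum_const_blocks[of T "\<lambda>_. 1"] by simp

text \<open>The deviations of the block sizes sum to zero, which leaves a sum of terms
  \<open>(1 + x) * (1 - t)\<close> with \<open>x > - 1\<close>. The push by
  \<open>1 / block_len\<close> in \<open>block_mass\<close> is the shift that supplies the
  \<open>1\<close> here.\<close>

lemma sum_block_count_le: "T \<subseteq> {k..<n} \<Longrightarrow> (\<Sum>i<r. block_count T i) \<le> (\<Sum>i<r. real n / real r * block_mass T i)"
proof -
  assume T: "T \<subseteq> {k..<n}"
  have "(\<Sum>i<r. real (card (block i)) - block_len) = (\<Sum>i<r. block_count {k..<n} i) - real r * block_len"
    using finite_block by (simp add: sum_subtractf block_count_def Int_absorb1)
  also have "\<dots> = 0" using sum_block_count[of "{k..<n}"] k_bounds k r_block_len by (simp add: of_nat_diff algebra_simps)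
  finally have z: "(\<Sum>i<r. real (card (block i)) - block_len) = 0" .
  have "(\<Sum>i<r. real n / real r * block_mass T i) - (\<Sum>i<r. block_count T i) = (\<Sum>i<r. (1 + (real (card (block i)) - block_len)) * (1 - block_frac T i) - (real (card (block i)) - block_len))"
    unfolding sum_subtractf[symmetric] using cl_hh_eq by (intro sum.cong) auto
  also have "\<dots> = (\<Sum>i<r. (1 + (real (card (block i)) - block_len)) * (1 - block_frac T i))" using z by (simp add: sum_subtractf)
  also have "\<dots> \<ge> 0"
  proof (rule sum_nonneg)
    fix i assume "i \<in> {..<r}"
    then have "0 \<le> 1 + (real (card (block i)) - block_len)" using card_block(1)[of i] by simp
    then show "0 \<le> (1 + (real (card (block i)) - block_len)) * (1 - block_frac T i)"
      using block_frac_bounds(2)[of T i] by (intro mult_nonneg_nonneg) auto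
  qed
  finally show ?thesis by simp
qed

text \<open>The condition \<open>m < k + card T\<close> on the faces turns into the constraint of
  the supremum.\<close>

lemma feasible_block_mass: "T \<in> big_faces k m n \<Longrightarrow> feasible (block_mass T)"
proof -
  assume T: "T \<in> big_faces k m n"
  then have T': "T \<subseteq> {k..<n}" "m < k + card T" by (auto simp: big_faces_def)
  have "real m - real k \<le> real (card T)" using T'(2) by linarith
  also have "\<dots> \<le> real n / real r * (\<Sum>i<r. block_mass T i)"
    using sum_block_count_le[OF T'(1)] sum_block_count[OF T'(1)] by (simp add: sum_distrib_left)
  finally have "real n * (\<alpha> - \<delta>) \<le> real n * ((1 / real r) * (\<Sum>i<r. block_mass T i))"
    using k m by (simp add: algebra_simps)
  then have "\<alpha> - \<delta> \<le> (1 / real r) * (\<Sum>i<r. block_mass T i)" using n by (subst (asm) mult_le_cancel_left_pos) auto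
  then show ?thesis using block_mass_bounds by (simp add: feasible_def)
qed

text \<open>\<open>Hent_mix\<close> accounts for the push, and replacing the block size by
  \<open>block_len - 1\<close> costs at most \<open>2\<close> per block because the entropy is at
  most \<open>1\<close>.\<close>

lemma entropy_bound:
  "(\<Sum>i<r. real (card (block i)) * Hent (block_frac T i)) \<le> real n * com_part (block_mass T) + 2 * real r"
proof -
  have "real (card (block i)) * Hent (block_frac T i) \<le> block_len * Hent (block_mass T i / (1 - \<delta>)) + 2" if i: "i < r" for i
  proof -
    have H: "0 \<le> Hent (block_frac T i)" "Hent (block_frac T i) \<le> 1" using block_frac_bounds by (auto intro: Hent_nonneg Hent_le_1)
    have "block_mass T i / (1 - \<delta>) = (1 - 1 / block_len) * block_frac T i + 1 / block_len" using \<delta>1 by (simp add: block_mass_def)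
    then have "(1 - 1 / block_len) * Hent (block_frac T i) \<le> Hent (block_mass T i / (1 - \<delta>))"
      using Hent_mix[OF block_frac_bounds block_len_inv] by simp
    then have "block_len * ((1 - 1 / block_len) * Hent (block_frac T i)) \<le> block_len * Hent (block_mass T i / (1 - \<delta>))" using block_len_ge by (intro mult_left_mono) auto
    moreover have "block_len * (1 - 1 / block_len) = block_len - 1" using block_len_ge by (simp add: right_diff_distrib)
    ultimately have "(block_len - 1) * Hent (block_frac T i) \<le> block_len * Hent (block_mass T i / (1 - \<delta>))" by (simp only: mult.assoc[symmetric])
    moreover have "(real (card (block i)) - (block_len - 1)) * Hent (block_frac T i) \<le> 2 * 1"
      using card_block[OF i] H by (intro mult_mono) auto
    ultimately show ?thesis by (simp add: algebra_simps)
  qed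
  then have "(\<Sum>i<r. real (card (block i)) * Hent (block_frac T i)) \<le> (\<Sum>i<r. block_len * Hent (block_mass T i / (1 - \<delta>)) + 2)"
    by (intro sum_mono) auto
  also have "\<dots> = real n * com_part (block_mass T) + 2 * real r"
    by (simp add: sum.distrib sum_distrib_left[symmetric] com_part_def) (simp add: block_len_def)
  finally show ?thesis .
qed

section \<open>A single face against the exponent functional\<close>

lemma sum_sq_F:
  "real n * c1 f \<delta> \<le> (\<Sum>j<k. (w j)\<^sup>2)" "(\<Sum>j<k. (w j)\<^sup>2) \<le> real n * c1 f \<delta> + (f 1)\<^sup>2"
proof -
  have c: "continuous_on {real 0 / real n..real k / real n} (\<lambda>u. (f u)\<^sup>2)"
    using k_div \<delta>1 by (auto intro!: continuous_intros continuous_on_subset[OF f_cont])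
  have mo: "mono_on {real 0 / real n..real k / real n} (\<lambda>u. (f u)\<^sup>2)"
    using k_div \<delta>1 f_nonneg by (auto intro!: mono_onI power_mono f_le)
  note R = riemann_mono_bounds[OF n _ c mo]
  have i: "integral {real 0 / real n..real k / real n} (\<lambda>u. (f u)\<^sup>2) = c1 f \<delta>" by (simp add: c1_def k_div)
  have s: "(\<Sum>j=0..<k. (f (real (Suc j) / real n))\<^sup>2) = (\<Sum>j<k. (w j)\<^sup>2)" by (simp add: wts_def lessThan_atLeast0)
  have "c1 f \<delta> \<le> (\<Sum>j<k. (w j)\<^sup>2) / n" using R(1) unfolding i s by simp
  then show "real n * c1 f \<delta> \<le> (\<Sum>j<k. (w j)\<^sup>2)" using n by (simp add: field_simps)
  have "(\<Sum>j<k. (w j)\<^sup>2) / n \<le> c1 f \<delta> + ((f \<delta>)\<^sup>2 - (f 0)\<^sup>2) / n"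
    using R(2) unfolding i s k_div by (simp add: c1_def)
  then have "(\<Sum>j<k. (w j)\<^sup>2) \<le> real n * c1 f \<delta> + ((f \<delta>)\<^sup>2 - (f 0)\<^sup>2)" using n by (simp add: field_simps)
  moreover have "(f \<delta>)\<^sup>2 \<le> (f 1)\<^sup>2" using f\<delta>1 f\<delta>_pos by (intro power_mono) auto
  ultimately show "(\<Sum>j<k. (w j)\<^sup>2) \<le> real n * c1 f \<delta> + (f 1)\<^sup>2" by (smt (verit) zero_le_power2)
qed

text \<open>As the parameter is nonpositive and \<open>lam\<close> is increasing, lowering the
  weights to their grid values only increases the exponent. Each block count is off by at most one,
  which costs a value of \<open>lam\<close> that is bounded on the compact range of the
  parameter.\<close>

lemma int_exp_bound:
  assumes T: "T \<subseteq> {k..<n}"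
  shows "int_exp w k T (saddle (block_mass T)) \<le> real n * int_part (block_mass T) + (saddle_radius\<^sup>2 / 2 * (f 1)\<^sup>2 + real r * \<bar>lam (- saddle_radius * f 1)\<bar>)"
proof -
  define \<sigma> where "\<sigma> = saddle (block_mass T)"
  have \<sigma>: "- saddle_radius \<le> \<sigma>" "\<sigma> \<le> 0" using saddle(1)[of "block_mass T"] by (auto simp: \<sigma>_def)
  have "(\<Sum>j\<in>T. lam (\<sigma> * w j)) \<le> (\<Sum>j\<in>T. lam (\<sigma> * fg (blk j)))"
    using fg_le_w T \<sigma> by (intro sum_mono lam_mono mult_left_mono_neg) auto
  also have "\<dots> = (\<Sum>i<r. block_count T i * lam (\<sigma> * fg i))" by (rule sum_const_blocks[OF T])
  also have "\<dots> \<le> (\<Sum>i<r. real n / real r * block_mass T i * lam (\<sigma> * fg i) + \<bar>lam (- saddle_radius * f 1)\<bar>)"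
  proof (rule sum_mono)
    fix i assume "i \<in> {..<r}"
    then have i: "i < r" by simp
    have "\<sigma> * fg i \<le> 0" using \<sigma> fg_pos[OF i] by (simp add: mult_nonpos_nonneg)
    then have l0: "lam (\<sigma> * fg i) \<le> 0" using lam_mono[of "\<sigma> * fg i" 0] lam_0 by simp
    have "- saddle_radius * f 1 \<le> \<sigma> * f 1" using \<sigma> f1_pos by (intro mult_right_mono) auto
    also have "\<dots> \<le> \<sigma> * fg i" using \<sigma> fg_bounds(2)[OF i] by (intro mult_left_mono_neg)
    finally have "lam (- saddle_radius * f 1) \<le> lam (\<sigma> * fg i)" by (rule lam_mono)
    then have l1: "- lam (\<sigma> * fg i) \<le> \<bar>lam (- saddle_radius * f 1)\<bar>" by simp
    have "block_count T i * lam (\<sigma> * fg i) \<le> (real n / real r * block_mass T i - 1) * lam (\<sigma> * fg i)"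
      using block_count_approx(1)[OF i, of T] l0 by (intro mult_right_mono_neg) auto
    then show "block_count T i * lam (\<sigma> * fg i) \<le> real n / real r * block_mass T i * lam (\<sigma> * fg i) + \<bar>lam (- saddle_radius * f 1)\<bar>"
      using l1 by (simp add: left_diff_distrib)
  qed
  also have "\<dots> = real n * mean_lam (block_mass T) \<sigma> + real r * \<bar>lam (- saddle_radius * f 1)\<bar>"
    by (simp add: sum.distrib mean_lam_def sum_distrib_left mult.assoc)
  finally have 1: "(\<Sum>j\<in>T. lam (\<sigma> * w j)) \<le> real n * mean_lam (block_mass T) \<sigma> + real r * \<bar>lam (- saddle_radius * f 1)\<bar>" .
  have "\<sigma>\<^sup>2 \<le> saddle_radius\<^sup>2" using \<sigma> saddle_radius_ge_1 by (intro abs_le_square_iff[THEN iffD1]) auto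
  then have "\<sigma>\<^sup>2 / 2 * (f 1)\<^sup>2 \<le> saddle_radius\<^sup>2 / 2 * (f 1)\<^sup>2" by (intro mult_right_mono) auto
  moreover have "\<sigma>\<^sup>2 / 2 * (\<Sum>j<k. (w j)\<^sup>2) \<le> \<sigma>\<^sup>2 / 2 * (real n * c1 f \<delta> + (f 1)\<^sup>2)"
    by (intro mult_left_mono sum_sq_F) auto
  ultimately have 2: "\<sigma>\<^sup>2 / 2 * (\<Sum>j<k. (w j)\<^sup>2) \<le> real n * (\<sigma>\<^sup>2 / 2 * c1 f \<delta>) + saddle_radius\<^sup>2 / 2 * (f 1)\<^sup>2"
    by (simp add: algebra_simps)
  show ?thesis using 1 2 unfolding int_exp_def int_part_def \<sigma>_def[symmetric] by (simp add: distrib_left)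
qed

lemma fnrm_le: "T \<subseteq> {k..<n} \<Longrightarrow> fnrm w k T \<le> f 1 * sqrt (real n)"
proof -
  assume T: "T \<subseteq> {k..<n}"
  have fT: "finite T" using T finite_subset by blast
  have "(\<Sum>j<k. (w j)\<^sup>2) + (\<Sum>j\<in>T. (w j)\<^sup>2) = (\<Sum>j\<in>{..<k} \<union> T. (w j)\<^sup>2)"
    using T fT by (intro sum.union_disjoint[symmetric]) auto
  also have "\<dots> \<le> (\<Sum>j<n. (w j)\<^sup>2)" using T k_bounds by (intro sum_mono2) auto
  also have "\<dots> \<le> (\<Sum>j<n. (f 1)\<^sup>2)" using w_pos w_le by (intro sum_mono power_mono) (auto intro: less_imp_le)
  also have "\<dots> = (f 1)\<^sup>2 * real n" by simp
  finally have "sqrt ((\<Sum>j<k. (w j)\<^sup>2) + (\<Sum>j\<in>T. (w j)\<^sup>2)) \<le> sqrt ((f 1)\<^sup>2 * real n)" by (rule real_sqrt_le_mono)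
  then show ?thesis using f1_pos by (simp add: fnrm_def real_sqrt_mult)
qed

lemma fnrm_sq: "T \<subseteq> {k..<n} \<Longrightarrow> (fnrm w k T)\<^sup>2 = (\<Sum>j<k. (w j)\<^sup>2) + (\<Sum>j\<in>T. (w j)\<^sup>2)"
  by (simp add: fnrm_def sum_nonneg)

text \<open>The delicate term is the sum over \<open>T\<close>, whose summands are unbounded as
  \<open>x\<close> tends to \<open>0\<close>. Subtracting \<open>e0\<close> from them leaves
  differences bounded by \<open>erf_spread\<close>, and the remainder, \<open>e0\<close> times the
  excess of the counts over the scaled masses, is nonpositive by
  \<open>sum_block_count_le\<close>.\<close>

lemma ext_exponent_bound:
  assumes T: "T \<subseteq> {k..<n}" and x: "0 < x"
  shows "- x\<^sup>2 * (fnrm w k T)\<^sup>2 + (\<Sum>j\<in>{k..<n} - T. ln (erf (x * w j)))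
     \<le> real n * psi_ext f \<delta> r (block_mass T) x + real r * (f 1)\<^sup>2 * x\<^sup>2 + (1 + real r) * erf_spread"
proof -
  have sq: "real n * c2bar f \<delta> r (block_mass T) - real r * (f 1)\<^sup>2 \<le> (fnrm w k T)\<^sup>2"
  proof -
    have "(\<Sum>i<r. real n / real r * ((fg i)\<^sup>2 * block_mass T i) - (f 1)\<^sup>2) \<le> (\<Sum>i<r. block_count T i * (fg i)\<^sup>2)"
    proof (rule sum_mono)
      fix i assume "i \<in> {..<r}"
      then have i: "i < r" by simp
      have "(real n / real r * block_mass T i - 1) * (fg i)\<^sup>2 \<le> block_count T i * (fg i)\<^sup>2"
        using block_count_approx(1)[OF i, of T] by (intro mult_right_mono) auto
      moreover have "(fg i)\<^sup>2 \<le> (f 1)\<^sup>2" using fg_bounds(2)[OF i] fg_pos[OF i] by (intro power_mono) auto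
      moreover have "(real n / real r * block_mass T i - 1) * (fg i)\<^sup>2 = real n / real r * ((fg i)\<^sup>2 * block_mass T i) - (fg i)\<^sup>2"
        by (simp add: left_diff_distrib)
      ultimately show "real n / real r * ((fg i)\<^sup>2 * block_mass T i) - (f 1)\<^sup>2 \<le> block_count T i * (fg i)\<^sup>2" by linarith
    qed
    also have "(\<Sum>i<r. block_count T i * (fg i)\<^sup>2) = (\<Sum>j\<in>T. (fg (blk j))\<^sup>2)" by (rule sum_const_blocks[OF T, symmetric])
    also have "\<dots> \<le> (\<Sum>j\<in>T. (w j)\<^sup>2)"
    proof (rule sum_mono)
      fix j assume "j \<in> T"
      then have j: "j \<in> {k..<n}" using T by auto
      show "(fg (blk j))\<^sup>2 \<le> (w j)\<^sup>2"
        by (rule power_mono[OF fg_le_w[OF j] less_imp_le[OF fg_pos[OF blk_iff(2)[OF j]]]])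
    qed
    finally have "real n / real r * (\<Sum>i<r. (fg i)\<^sup>2 * block_mass T i) - real r * (f 1)\<^sup>2 \<le> (\<Sum>j\<in>T. (w j)\<^sup>2)"
      by (simp add: sum_subtractf sum_distrib_left)
    then show ?thesis using sum_sq_F(1) unfolding fnrm_sq[OF T] c2bar_def c1_def by (simp add: distrib_left)
  qed
  have 1: "- x\<^sup>2 * (fnrm w k T)\<^sup>2 \<le> - (real n * c2bar f \<delta> r (block_mass T)) * x\<^sup>2 + real r * (f 1)\<^sup>2 * x\<^sup>2"
    using mult_right_mono[OF sq, of "x\<^sup>2"] by (simp add: algebra_simps)
  define g where "g = (\<lambda>u. ln (erf (x * f u)))"
  have nn: "real n / real n = 1" using n by simp
  have c: "continuous_on {real k / real n..real n / real n} g"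
    unfolding k_div nn g_def by (rule cont_ln_erf[OF x])
  have mo: "mono_on {real k / real n..real n / real n} g"
    unfolding k_div nn
  proof (rule mono_onI)
    fix u v assume uv: "u \<in> {\<delta>..1}" "v \<in> {\<delta>..1}" "u \<le> v"
    have "f u \<le> f v" using uv \<delta> by (intro f_le) auto
    moreover have "0 < f u" using f_window[OF uv(1)] f\<delta>_pos by linarith
    ultimately show "g u \<le> g v" unfolding g_def using x by (intro ln_erf_mono) auto
  qed
  have "(\<Sum>j=k..<n. g (real (Suc j) / real n)) / real n \<le> integral {\<delta>..1} g + (g 1 - g \<delta>) / real n"
    using riemann_mono_bounds(2)[OF n _ c mo] k_bounds unfolding k_div nn by simp
  moreover have "g 1 - g \<delta> \<le> erf_spread" using ln_erf_window(2)[OF x, of "f 1"] f\<delta>1 by (simp add: g_def)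
  ultimately have 2: "(\<Sum>j=k..<n. ln (erf (x * w j))) \<le> real n * integral {\<delta>..1} (\<lambda>u. ln (erf (x * f u))) + erf_spread"
    using n by (simp add: g_def wts_def field_simps)
  define ee where "ee = (\<lambda>i. - ln (erf (x * fg i)))"
  define e0 where "e0 = - ln (erf (x * f \<delta>))"
  have e0: "0 \<le> e0" using ln_erf_nonpos[of "x * f \<delta>"] x f\<delta>_pos by (simp add: e0_def)
  have "(\<Sum>j\<in>T. - ln (erf (x * w j))) \<le> (\<Sum>j\<in>T. ee (blk j))"
  proof (rule sum_mono)
    fix j assume "j \<in> T"
    then have j: "j \<in> {k..<n}" using T by auto
    have "0 < x * fg (blk j)" "x * fg (blk j) \<le> x * w j"
      using fg_le_w[OF j] fg_pos[OF blk_iff(2)[OF j]] x by auto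
    from ln_erf_mono[OF this] show "- ln (erf (x * w j)) \<le> ee (blk j)" by (simp add: ee_def)
  qed
  also have "\<dots> = (\<Sum>i<r. block_count T i * ee i)" by (rule sum_const_blocks[OF T])
  also have "\<dots> \<le> real n / real r * (\<Sum>i<r. block_mass T i * ee i) + real r * erf_spread"
  proof -
    have id: "c * e - b * e = (c - b) * (e - e0) + (e0 * c - e0 * b)" for b c e :: real by (simp add: algebra_simps)
    have "(\<Sum>i<r. block_count T i * ee i) - (\<Sum>i<r. real n / real r * block_mass T i * ee i)
        = (\<Sum>i<r. (block_count T i - real n / real r * block_mass T i) * (ee i - e0)) + e0 * ((\<Sum>i<r. block_count T i) - (\<Sum>i<r. real n / real r * block_mass T i))"
      unfolding right_diff_distrib[of e0] sum_distrib_left sum_subtractf[symmetric] sum.distrib[symmetric]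
      by (intro sum.cong refl id)
    also have "\<dots> \<le> (\<Sum>i<r. erf_spread) + 0"
    proof (rule add_mono)
      show "(\<Sum>i<r. (block_count T i - real n / real r * block_mass T i) * (ee i - e0)) \<le> (\<Sum>i<r. erf_spread)"
      proof (rule sum_mono)
        fix i assume "i \<in> {..<r}"
        then have i: "i < r" by simp
        have "\<bar>block_count T i - real n / real r * block_mass T i\<bar> \<le> 1" using block_count_approx(1,2)[OF i, of T] by (intro abs_leI) linarith+
        moreover have "\<bar>ee i - e0\<bar> \<le> erf_spread" using ln_erf_window[OF x fg_bounds[OF i]] by (simp add: ee_def e0_def)
        ultimately have "\<bar>block_count T i - real n / real r * block_mass T i\<bar> * \<bar>ee i - e0\<bar> \<le> 1 * erf_spread" by (intro mult_mono) auto
        then show "(block_count T i - real n / real r * block_mass T i) * (ee i - e0) \<le> erf_spread"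
          unfolding abs_mult[symmetric] mult_1 by (rule order_trans[OF abs_ge_self])
      qed
      show "e0 * ((\<Sum>i<r. block_count T i) - (\<Sum>i<r. real n / real r * block_mass T i)) \<le> 0"
        using sum_block_count_le[OF T] e0 by (intro mult_nonneg_nonpos) auto
    qed
    finally show ?thesis by (simp add: sum_distrib_left mult.assoc)
  qed
  finally have 3: "(\<Sum>j\<in>T. - ln (erf (x * w j))) \<le> real n / real r * (\<Sum>i<r. block_mass T i * ee i) + real r * erf_spread" .
  have "(\<Sum>j\<in>{k..<n} - T. ln (erf (x * w j))) = (\<Sum>j=k..<n. ln (erf (x * w j))) + (\<Sum>j\<in>T. - ln (erf (x * w j)))"
    using T by (simp add: sum_diff sum_negf)
  moreover have "real n * psi_ext f \<delta> r (block_mass T) x = - (real n * c2bar f \<delta> r (block_mass T)) * x\<^sup>2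
      + real n * integral {\<delta>..1} (\<lambda>u. ln (erf (x * f u))) + real n / real r * (\<Sum>i<r. block_mass T i * ee i)"
    unfolding psi_ext_def G0bar_def ee_def by (simp add: sum_negf algebra_simps)
  ultimately show ?thesis using 1 2 3 by (simp add: distrib_right)
qed

text \<open>The error of \<open>ext_exponent_bound\<close> grows like \<open>x\<^sup>2\<close>, and
  a further \<open>- x\<^sup>2\<close> is to be gained for integrability. Up to
  \<open>sq_cutoff\<close> this costs a constant. Beyond it, half of the decay in
  \<open>psi_ext_upper\<close>, which carries the factor \<open>n\<close>, pays for it; the other
  half keeps the exponent below \<open>real n * S\<close> because
  \<open>S \<ge> - ext_floor\<close>.\<close>

lemma ext_exponent_decay:
  assumes T: "T \<subseteq> {k..<n}" and x: "0 < x" and S: "\<And>x. 0 < x \<Longrightarrow> psi_ext f \<delta> r (block_mass T) x \<le> S"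
    and big2: "2 * (real r * (f 1)\<^sup>2 + 1) \<le> real n * c1 f \<delta>"
  shows "- x\<^sup>2 * (fnrm w k T)\<^sup>2 + (\<Sum>j\<in>{k..<n} - T. ln (erf (x * w j))) \<le> real n * S + ext_const - x\<^sup>2"
proof -
  define K where "K = real r * (f 1)\<^sup>2 + 1"
  have K: "K \<ge> 0" by (simp add: K_def)
  define Q where "Q = - x\<^sup>2 * (fnrm w k T)\<^sup>2 + (\<Sum>j\<in>{k..<n} - T. ln (erf (x * w j)))"
  have Q: "Q \<le> real n * psi_ext f \<delta> r (block_mass T) x + K * x\<^sup>2 - x\<^sup>2 + (1 + real r) * erf_spread"
    using ext_exponent_bound[OF T x] by (simp add: Q_def K_def algebra_simps)
  have h: "0 \<le> block_mass T i \<and> block_mass T i \<le> 1 - \<delta>" for i using block_mass_bounds by simp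
  have "Q \<le> real n * S + ext_const - x\<^sup>2"
  proof (cases "x\<^sup>2 \<le> sq_cutoff")
    case True
    have "real n * psi_ext f \<delta> r (block_mass T) x \<le> real n * S" using S[OF x] by (intro mult_left_mono) auto
    moreover have "K * x\<^sup>2 \<le> K * sq_cutoff" using True K by (intro mult_left_mono) auto
    ultimately show ?thesis using Q unfolding ext_const_def K_def[symmetric] by linarith
  next
    case False
    have S1: "- ext_floor \<le> S" using psi_ext_lower[of "block_mass T"] h S[of 1] by (meson order_trans zero_less_one)
    have "real n * psi_ext f \<delta> r (block_mass T) x \<le> real n * (- c1 f \<delta> * x\<^sup>2 + erf_spread)"
      using psi_ext_upper[of "block_mass T" x] h x by (intro mult_left_mono) auto
    moreover have "K * x\<^sup>2 \<le> real n * c1 f \<delta> / 2 * x\<^sup>2" using big2 by (intro mult_right_mono) (auto simp: K_def)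
    moreover have "2 * (erf_spread + ext_floor) / c1 f \<delta> < x\<^sup>2" using False by (simp add: sq_cutoff_def)
    then have "2 * (erf_spread + ext_floor) < x\<^sup>2 * c1 f \<delta>" by (simp only: pos_divide_less_eq[OF c1_pos])
    then have "real n * (2 * (erf_spread + ext_floor)) \<le> real n * (x\<^sup>2 * c1 f \<delta>)" by (intro mult_left_mono) auto
    moreover have "real n * (- ext_floor) \<le> real n * S" using S1 by (intro mult_left_mono) auto
    moreover have "0 \<le> sq_cutoff" using erf_spread_nonneg ext_floor_nonneg c1_pos by (simp add: sq_cutoff_def)
    then have "(1 + real r) * erf_spread \<le> ext_const" using K by (simp add: ext_const_def K_def)
    moreover have "real n * (- c1 f \<delta> * x\<^sup>2 + erf_spread) + real n * c1 f \<delta> / 2 * x\<^sup>2 = real n * erf_spread - real n * (x\<^sup>2 * c1 f \<delta>) / 2"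
      by (simp add: algebra_simps)
    moreover have "real n * (2 * (erf_spread + ext_floor)) = 2 * (real n * erf_spread) + 2 * (real n * ext_floor)" by (simp add: algebra_simps)
    ultimately show ?thesis using Q by simp
  qed
  then show ?thesis by (simp add: Q_def)
qed

text \<open>With \<open>z = x * R * sqrt 2\<close> the Gaussian weight is
  \<open>exp (- x\<^sup>2 * R\<^sup>2)\<close>, so the integrand has the exponent treated in
  \<open>ext_exponent_decay\<close>. The gained factor \<open>exp (- x\<^sup>2)\<close>, with the
  normalisation of the Gaussian density, is \<open>R\<close> times the density of a normal law with
  standard deviation \<open>R\<close>, whose integral is one.\<close>

lemma ext_int_bound:
  assumes T: "T \<subseteq> {k..<n}" and S: "\<And>x. 0 < x \<Longrightarrow> psi_ext f \<delta> r (block_mass T) x \<le> S"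
    and big2: "2 * (real r * (f 1)\<^sup>2 + 1) \<le> real n * c1 f \<delta>"
  shows "ext_int w n k T \<le> ennreal (exp (real n * S + ext_const) * fnrm w k T)"
proof -
  define R where "R = fnrm w k T"
  have R: "0 < R" unfolding R_def using k_bounds w_pos T finite_subset by (intro fnrm_pos) auto
  have pt: "ennreal (std_normal_density z) * (of_bool (0 < z) * (\<Prod>j\<in>{k..<n} - T. ennreal (erf (z / R * w j / sqrt 2))))
     \<le> ennreal (exp (real n * S + ext_const) * R) * ennreal (normal_density 0 R z)" for z
  proof (cases "0 < z")
    case True
    define x where "x = z / (R * sqrt 2)"
    have x: "0 < x" using True R by (simp add: x_def)
    have xw: "z / R * w j / sqrt 2 = x * w j" for j by (simp add: x_def)
    have ep: "0 < erf (x * w j)" if "j \<in> {k..<n} - T" for j using that x w_pos by (intro erf_pos mult_pos_pos) auto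
    have z2: "x\<^sup>2 * R\<^sup>2 = z\<^sup>2 / 2" "x\<^sup>2 = z\<^sup>2 / (2 * R\<^sup>2)" using R by (auto simp: x_def power_mult_distrib power_divide)
    have "(\<Prod>j\<in>{k..<n} - T. erf (x * w j)) = exp (\<Sum>j\<in>{k..<n} - T. ln (erf (x * w j)))"
      using ep by (simp add: exp_sum)
    then have "std_normal_density z * (\<Prod>j\<in>{k..<n} - T. erf (x * w j)) = 1 / sqrt (2 * pi) * exp (- (x\<^sup>2 * R\<^sup>2) + (\<Sum>j\<in>{k..<n} - T. ln (erf (x * w j))))"
      unfolding z2(1) exp_add by (simp add: std_normal_density_def)
    also have "\<dots> \<le> 1 / sqrt (2 * pi) * exp (real n * S + ext_const - x\<^sup>2)"
      using ext_exponent_decay[OF T x S big2] by (intro mult_left_mono) (auto simp: R_def)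
    also have "\<dots> = exp (real n * S + ext_const) * R * normal_density 0 R z"
    proof -
      have "exp (real n * S + ext_const - z\<^sup>2 / (2 * R\<^sup>2)) = exp (real n * S + ext_const) * exp (- (z\<^sup>2 / (2 * R\<^sup>2)))"
        by (simp add: mult_exp_exp)
      then show ?thesis unfolding z2(2) normal_density_def using R by (simp add: real_sqrt_mult)
    qed
    finally have "std_normal_density z * (\<Prod>j\<in>{k..<n} - T. erf (x * w j)) \<le> exp (real n * S + ext_const) * R * normal_density 0 R z" .
    moreover have "(\<Prod>j\<in>{k..<n} - T. ennreal (erf (x * w j))) = ennreal (\<Prod>j\<in>{k..<n} - T. erf (x * w j))"
      using ep by (intro prod_ennreal) (auto intro: less_imp_le)
    moreover have "0 \<le> (\<Prod>j\<in>{k..<n} - T. erf (x * w j))" using ep by (intro prod_nonneg) (auto intro: less_imp_le)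
    ultimately show ?thesis unfolding xw using True R
      by (simp add: ennreal_mult[symmetric] ennreal_leI)
  qed simp
  have "ext_int w n k T = (\<integral>\<^sup>+z. ennreal (std_normal_density z) * (of_bool (0 < z) * (\<Prod>j\<in>{k..<n} - T. ennreal (erf (z / R * w j / sqrt 2)))) \<partial>lborel)"
    unfolding ext_int_def R_def[symmetric]
  proof (rule nn_integral_std_normal)
    have "(\<lambda>z::real. of_bool (0 < z) :: ennreal) = indicator {0<..}" by (auto simp: indicator_def)
    then have m1: "(\<lambda>z::real. of_bool (0 < z) :: ennreal) \<in> borel_measurable borel" by simp
    have "continuous_on UNIV (\<lambda>z. erf (z / R * w j / sqrt 2))" for j
      using R by (intro continuous_on_compose2[OF continuous_on_erf[of UNIV]] continuous_intros) auto
    then have m2: "(\<lambda>z. ennreal (erf (z / R * w j / sqrt 2))) \<in> borel_measurable borel" for j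
      by (intro measurable_compose[OF borel_measurable_continuous_onI measurable_ennreal])
    show "(\<lambda>z. of_bool (0 < z) * (\<Prod>j\<in>{k..<n} - T. ennreal (erf (z / R * w j / sqrt 2)))) \<in> borel_measurable borel"
      by (intro borel_measurable_times_ennreal borel_measurable_prod_ennreal m1 m2)
  qed
  also have "\<dots> \<le> (\<integral>\<^sup>+z. ennreal (exp (real n * S + ext_const) * R) * ennreal (normal_density 0 R z) \<partial>lborel)"
    by (intro nn_integral_mono pt)
  also have "\<dots> = ennreal (exp (real n * S + ext_const) * R) * (\<integral>\<^sup>+z. ennreal (normal_density 0 R z) \<partial>lborel)"
    by (rule nn_integral_cmult) simp
  also have "(\<integral>\<^sup>+z. ennreal (normal_density 0 R z) \<partial>lborel) = ennreal (\<integral>z. normal_density 0 R z \<partial>lborel)"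
    using R by (intro nn_integral_eq_integral) auto
  also have "(\<integral>z. normal_density 0 R z \<partial>lborel) = 1" using R by simp
  finally show ?thesis by (simp add: R_def)
qed

text \<open>The three parts of the exponent add up to at most \<open>\<Psi>\<close>. The entropy
  bound is used backwards: \<open>com_part\<close> is traded for the entropy of the face itself,
  which leaves the factor \<open>exp (- H)\<close> that \<open>sum_exp_entropy_le\<close> can
  sum.\<close>

lemma face_term_bound:
  assumes T: "T \<in> big_faces k m n" and \<Psi>: "psi_tot f \<delta> \<alpha> r = ereal \<Psi>"
    and big2: "2 * (real r * (f 1)\<^sup>2 + 1) \<le> real n * c1 f \<delta>"
  shows "ennreal (exp (- saddle (block_mass T) * fnrm w k T) / p01 * exp (int_exp w k T (saddle (block_mass T)))) * ext_int w n k T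
    \<le> ennreal (face_bound n \<Psi> * exp (- (\<Sum>i<r. real (card (block i)) * Hent (block_frac T i))))"
proof -
  have T': "T \<subseteq> {k..<n}" using T by (simp add: big_faces_def)
  \<comment> \<open>What the supremum leaves for the external exponent once
    \<open>h = block_mass T\<close> is fixed.\<close>
  define S where "S = \<Psi> - com_part (block_mass T) - int_part (block_mass T)"
  define H where "H = (\<Sum>i<r. real (card (block i)) * Hent (block_frac T i))"
  have R: "0 < fnrm w k T" using k_bounds w_pos T' finite_subset by (intro fnrm_pos) auto
  have S: "psi_ext f \<delta> r (block_mass T) x \<le> S" if "0 < x" for x
    using psi_tot_ge[OF feasible_block_mass[OF T] that] unfolding \<Psi> S_def by simp
  have "- saddle (block_mass T) * fnrm w k T \<le> saddle_radius * (f 1 * sqrt (real n))"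
    using saddle(1)[of "block_mass T"] fnrm_le[OF T'] R saddle_radius_ge_1 by (intro mult_mono) auto
  moreover have "int_exp w k T (saddle (block_mass T)) \<le> real n * int_part (block_mass T) + (saddle_radius\<^sup>2 / 2 * (f 1)\<^sup>2 + real r * \<bar>lam (- saddle_radius * f 1)\<bar>)"
    by (rule int_exp_bound[OF T'])
  moreover have "H \<le> real n * com_part (block_mass T) + 2 * real r" unfolding H_def by (rule entropy_bound)
  moreover have "real n * S = real n * \<Psi> - real n * com_part (block_mass T) - real n * int_part (block_mass T)"
    by (simp add: S_def right_diff_distrib)
  ultimately have e: "- saddle (block_mass T) * fnrm w k T + int_exp w k T (saddle (block_mass T)) + (real n * S + ext_const)
      \<le> saddle_radius * (f 1 * sqrt (real n)) + face_const + real n * \<Psi> + - H" unfolding face_const_def by linarith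
  have "exp (- saddle (block_mass T) * fnrm w k T) / p01 * exp (int_exp w k T (saddle (block_mass T))) * (exp (real n * S + ext_const) * fnrm w k T)
      = exp (- saddle (block_mass T) * fnrm w k T + int_exp w k T (saddle (block_mass T)) + (real n * S + ext_const)) * fnrm w k T / p01"
    unfolding exp_add[of _ "real n * S + ext_const"] exp_add[of "- saddle (block_mass T) * fnrm w k T"] by simp
  also have "\<dots> \<le> exp (saddle_radius * (f 1 * sqrt (real n)) + face_const + real n * \<Psi> + - H) * (f 1 * sqrt (real n)) / p01"
    using e fnrm_le[OF T'] R p01_pos by (intro divide_right_mono mult_mono) auto
  also have "\<dots> = face_bound n \<Psi> * exp (- H)" unfolding face_bound_def exp_add[of _ "- H"] by simp
  finally have le: "exp (- saddle (block_mass T) * fnrm w k T) / p01 * exp (int_exp w k T (saddle (block_mass T))) * (exp (real n * S + ext_const) * fnrm w k T)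
      \<le> face_bound n \<Psi> * exp (- H)" .
  have "ennreal (exp (- saddle (block_mass T) * fnrm w k T) / p01 * exp (int_exp w k T (saddle (block_mass T)))) * ext_int w n k T
     \<le> ennreal (exp (- saddle (block_mass T) * fnrm w k T) / p01 * exp (int_exp w k T (saddle (block_mass T)))) * ennreal (exp (real n * S + ext_const) * fnrm w k T)"
    by (intro mult_left_mono ext_int_bound[OF T' S big2]) auto
  also have "\<dots> = ennreal (exp (- saddle (block_mass T) * fnrm w k T) / p01 * exp (int_exp w k T (saddle (block_mass T))) * (exp (real n * S + ext_const) * fnrm w k T))"
    using p01_pos R by (intro ennreal_mult[symmetric]) auto
  also have "\<dots> \<le> ennreal (face_bound n \<Psi> * exp (- H))" by (rule ennreal_leI[OF le])
  finally show ?thesis by (simp add: H_def)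
qed

text \<open>The factor \<open>emeasure stdn {0<..}\<close> occurs twice: once for the auxiliary row
  in \<open>fail_prob_bound\<close>, and once as the external factor of the full face, computed in
  \<open>ext_int_full\<close>.\<close>

lemma fail_prob_le:
  assumes \<Psi>: "psi_tot f \<delta> \<alpha> r = ereal \<Psi>"
    and big2: "2 * (real r * (f 1)\<^sup>2 + 1) \<le> real n * c1 f \<delta>"
    and F: "F \<in> sets (gauss ({..<m} \<times> {..<n}))"
    and bad: "\<And>A. A \<in> F \<Longrightarrow> \<exists>d\<in>descent_cone w k n. 0 < nrm n d \<and> (\<forall>i<m. rowdot A n i d = 0)"
  shows "emeasure (gauss ({..<m} \<times> {..<n})) F * (emeasure stdn {0<..} * emeasure stdn {0<..})
    \<le> ennreal (2 * (face_bound n \<Psi> * (real n + 1) ^ r))"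
proof -
  define ph where "ph = emeasure stdn {0<..}"
  define E where "E = emeasure (gauss ({..<m} \<times> {..<n})) F"
  define t where "t = (\<lambda>T. ennreal (exp (- saddle (block_mass T) * fnrm w k T) / p01 * exp (int_exp w k T (saddle (block_mass T)))) * ext_int w n k T)"
  define C where "C = ennreal (exp (int_exp w k {k..<n} (saddle (block_mass {k..<n}))))"
  have sg: "saddle h \<le> 0" for h using saddle(1)[of h] by simp
  have ph1: "ph \<le> 1" unfolding ph_def by (rule stdn.emeasure_le_1)
  have "E * ph \<le> sum t (big_faces k m n) + C"
    using fail_prob_bound[of n w k "\<lambda>T. saddle (block_mass T)" F m, OF w_pos k_bounds(1) less_imp_le[OF k_bounds(2)] sg F bad]
    unfolding fail_bound_def t_def C_def E_def ph_def by simp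
  then have "E * ph * ph \<le> (sum t (big_faces k m n) + C) * ph" by (intro mult_right_mono) auto
  also have "\<dots> = sum t (big_faces k m n) * ph + C * ph" by (simp add: distrib_right)
  also have "\<dots> \<le> sum t (big_faces k m n) + sum t (big_faces k m n)"
  proof (rule add_mono)
    show "sum t (big_faces k m n) * ph \<le> sum t (big_faces k m n)"
      using mult_left_mono[OF ph1, of "sum t (big_faces k m n)"] by simp
    \<comment> \<open>the pattern with vanishing multiplier is dominated by the term of the full face\<close>
    have T0: "{k..<n} \<in> big_faces k m n" using k_bounds by (simp add: big_faces_def)
    have "0 \<le> - saddle (block_mass {k..<n}) * fnrm w k {k..<n}"
      using sg by (intro mult_nonneg_nonneg) (auto simp: fnrm_def intro!: add_nonneg_nonneg sum_nonneg)
    then have "p01 \<le> exp (- saddle (block_mass {k..<n}) * fnrm w k {k..<n})" using p01_le_1 by (metis one_le_exp_iff order_trans)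
    then have "1 \<le> exp (- saddle (block_mass {k..<n}) * fnrm w k {k..<n}) / p01" using p01_pos by simp
    then have "1 * exp (int_exp w k {k..<n} (saddle (block_mass {k..<n})))
        \<le> exp (- saddle (block_mass {k..<n}) * fnrm w k {k..<n}) / p01 * exp (int_exp w k {k..<n} (saddle (block_mass {k..<n})))"
      by (intro mult_right_mono) auto
    then have "C * ph \<le> t {k..<n}"
      unfolding t_def C_def ext_int_full ph_def by (intro mult_right_mono ennreal_leI) auto
    also have "\<dots> \<le> sum t (big_faces k m n)" by (rule member_le_sum[OF T0 _ finite_big_faces]) simp
    finally show "C * ph \<le> sum t (big_faces k m n)" .
  qed
  also have "\<dots> = 2 * sum t (big_faces k m n)" by (simp add: mult_2)
  also have "sum t (big_faces k m n) \<le> ennreal (face_bound n \<Psi> * (real n + 1) ^ r)"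
  proof -
    let ?H = "\<lambda>T. \<Sum>i<r. real (card (block i)) * Hent (block_frac T i)"
    have "sum t (big_faces k m n) \<le> (\<Sum>T\<in>big_faces k m n. ennreal (face_bound n \<Psi> * exp (- ?H T)))"
      unfolding t_def by (intro sum_mono face_term_bound \<Psi> big2)
    also have "\<dots> \<le> (\<Sum>T\<in>Pow {k..<n}. ennreal (face_bound n \<Psi> * exp (- ?H T)))"
      by (intro sum_mono2) (auto simp: big_faces_def)
    also have "\<dots> = ennreal (face_bound n \<Psi> * (\<Sum>T\<in>Pow {k..<n}. exp (- ?H T)))"
      using face_bound_nonneg by (subst sum_ennreal) (auto simp: sum_distrib_left)
    also have "\<dots> \<le> ennreal (face_bound n \<Psi> * (real n + 1) ^ r)"
      using sum_exp_entropy_le[of "{k..<n}" n blk r] blk_iff(2) unfolding block_def[symmetric] block_count_def[symmetric] block_frac_def[symmetric]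
      by (intro ennreal_leI mult_left_mono face_bound_nonneg) auto
    finally show ?thesis .
  qed
  finally have "E * ph * ph \<le> 2 * ennreal (face_bound n \<Psi> * (real n + 1) ^ r)" by (simp add: mult_left_mono)
  then show ?thesis unfolding E_def ph_def by (simp add: mult.assoc ennreal_mult face_bound_nonneg)
qed

section \<open>From the failure event to the asymptotics\<close>

text \<open>Since \<open>x\<close> is positive in the first \<open>k\<close> coordinates and zero in
  the others, \<open>qf\<close> of the difference is at most the difference of the norms, by
  \<open>z j \<le> \<bar>z j\<bar>\<close>.\<close>

lemma fail_descent:
  assumes x: "\<And>j. j < k \<Longrightarrow> 0 < x j" "\<And>j. k \<le> j \<Longrightarrow> x j = 0" and A: "A \<in> fail_event f m n x"
  shows "\<exists>d\<in>descent_cone w k n. 0 < nrm n d \<and> (\<forall>i<m. rowdot A n i d = 0)"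
proof -
  obtain z where z: "\<forall>j\<ge>n. z j = 0" "z \<noteq> x" "\<forall>i<m. (\<Sum>j<n. A (i, j) * z j) = (\<Sum>j<n. A (i, j) * x j)"
    "wl1 w n z \<le> wl1 w n x"
    using A by (auto simp: fail_event_def)
  define d where "d = (\<lambda>j. z j - x j)"
  have d0: "\<forall>j\<ge>n. d j = 0" using z(1) x(2) k_bounds by (auto simp: d_def)
  have split: "sum g {..<n} = sum g {..<k} + sum g {k..<n}" for g :: "nat \<Rightarrow> real"
    using k_bounds by (simp add: lessThan_atLeast0 sum.atLeastLessThan_concat)
  have "(\<Sum>j<k. w j * (x j + d j)) \<le> (\<Sum>j<k. w j * \<bar>z j\<bar>)"
    using w_pos k_bounds by (intro sum_mono mult_left_mono) (auto simp: d_def intro: less_imp_le)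
  moreover have "(\<Sum>j<k. w j * \<bar>x j\<bar>) = (\<Sum>j<k. w j * x j)" using x(1) by (intro sum.cong) (auto simp: less_imp_le)
  moreover have "(\<Sum>j=k..<n. w j * \<bar>d j\<bar>) = (\<Sum>j=k..<n. w j * \<bar>z j\<bar>)" "(\<Sum>j=k..<n. w j * \<bar>x j\<bar>) = 0"
    using x(2) by (auto simp: d_def)
  ultimately have "qf w k n d \<le> 0"
    using z(4) unfolding wl1_def qf_def split by (simp add: distrib_left sum.distrib)
  then have "d \<in> descent_cone w k n" using d0 by (simp add: descent_cone_def)
  moreover have "0 < nrm n d"
  proof -
    obtain j where j: "z j \<noteq> x j" using z(2) by auto
    then have "d j \<noteq> 0" by (simp add: d_def)
    moreover from this have "j < n" using d0 by (meson not_le)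
    ultimately show ?thesis by (auto simp: nrm_pos_iff)
  qed
  moreover have "\<forall>i<m. rowdot A n i d = 0"
    using z(3) by (simp add: rowdot_def d_def right_diff_distrib sum_subtractf)
  ultimately show ?thesis by blast
qed

lemma ln_fail_prob_le:
  assumes \<Psi>: "psi_tot f \<delta> \<alpha> r = ereal \<Psi>"
    and big2: "2 * (real r * (f 1)\<^sup>2 + 1) \<le> real n * c1 f \<delta>"
    and x: "\<And>j. j < k \<Longrightarrow> 0 < x j" "\<And>j. k \<le> j \<Longrightarrow> x j = 0"
    and P: "measure (gauss_matrix m n) (fail_event f m n x) \<noteq> 0"
  shows "ln (measure (gauss_matrix m n) (fail_event f m n x)) / real n
    \<le> \<Psi> + ((ln 2 - 2 * ln (measure stdn {0<..}) - ln p01 + ln (f 1) + face_const)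
        + (saddle_radius * f 1) * sqrt (real n) + ln (real n) / 2 + real r * ln (real n + 1)) / real n"
proof -
  let ?G = "gauss ({..<m} \<times> {..<n})"
  define P where "P = measure ?G (fail_event f m n x)"
  define q where "q = measure stdn {0<..}"
  interpret P: prob_space ?G by (rule prob_space_gauss)
  have GM: "gauss_matrix m n = ?G" by (simp add: gauss_matrix_def gauss_def)
  \<comment> \<open>A set that is not measurable has \<open>measure\<close> zero by convention, so
    the assumption \<open>P\<close> settles measurability.\<close>
  have F: "fail_event f m n x \<in> sets ?G"
    using P unfolding GM by (meson measure_notin_sets)
  have P0: "0 < P" using P unfolding GM P_def by (simp add: zero_less_measure_iff)
  have "{0<..<1::real} \<subseteq> {0<..}" by auto
  then have "emeasure stdn {0<..<1} \<le> emeasure stdn {0<..}" by (intro emeasure_mono) (auto simp: std_normal_measure_def)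
  then have "0 < emeasure stdn {0<..}" using emeasure_std_normal_interval_pos[of 0 1] by simp
  then have q0: "0 < q" unfolding q_def stdn.emeasure_eq_measure by simp
  have "ennreal (P * (q * q)) \<le> ennreal (2 * (face_bound n \<Psi> * (real n + 1) ^ r))"
    using fail_prob_le[OF \<Psi> big2 F fail_descent[OF x]] P0 q0
    unfolding stdn.emeasure_eq_measure P.emeasure_eq_measure P_def[symmetric] q_def[symmetric]
    by (simp add: ennreal_mult[symmetric])
  then have le: "P * (q * q) \<le> 2 * (face_bound n \<Psi> * (real n + 1) ^ r)"
    using face_bound_nonneg by (subst (asm) ennreal_le_iff) auto
  have n1: "0 < real n" using n by simp
  have "ln (P * (q * q)) \<le> ln (2 * (face_bound n \<Psi> * (real n + 1) ^ r))"
    using le P0 q0 by (intro ln_mono) auto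
  moreover have "ln (P * (q * q)) = ln P + 2 * ln q" using P0 q0 by (simp add: ln_mult)
  moreover have "ln (2 * (face_bound n \<Psi> * (real n + 1) ^ r)) = ln 2 + (ln (face_bound n \<Psi>) + real r * ln (real n + 1))"
    using n1 f1_pos p01_pos by (simp add: face_bound_def ln_mult ln_div ln_realpow)
  moreover have "ln (face_bound n \<Psi>) = saddle_radius * (f 1 * sqrt (real n)) + face_const + real n * \<Psi> + (ln (f 1) + ln (real n) / 2) - ln p01"
    using n1 f1_pos p01_pos by (simp add: face_bound_def ln_mult ln_div ln_sqrt)
  ultimately have "ln P \<le> real n * \<Psi> + ((ln 2 - 2 * ln q - ln p01 + ln (f 1) + face_const)
        + (saddle_radius * f 1) * sqrt (real n) + ln (real n) / 2 + real r * ln (real n + 1))" by simp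
  then have "ln P / real n \<le> (real n * \<Psi> + ((ln 2 - 2 * ln q - ln p01 + ln (f 1) + face_const)
        + (saddle_radius * f 1) * sqrt (real n) + ln (real n) / 2 + real r * ln (real n + 1))) / real n"
    using n1 by (intro divide_right_mono) auto
  then show ?thesis using n1 unfolding GM P_def[symmetric] q_def[symmetric] add_divide_distrib[of "real n * \<Psi>"] by simp
qed

end

context weight_setup begin

lemma fail_prob_asymptotics:
  assumes \<epsilon>: "0 < \<epsilon>"
  shows "\<exists>N::nat. \<forall>n k m. n > N \<longrightarrow> real k = \<delta> * real n \<longrightarrow> real m = \<alpha> * real n \<longrightarrow>
     (\<forall>x :: nat \<Rightarrow> real. (\<forall>j<k. 0 < x j) \<longrightarrow> (\<forall>j\<ge>k. x j = 0) \<longrightarrow>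
        (let P = measure (gauss_matrix m n) (fail_event f m n x) in
          P = 0 \<or> ereal (ln P / real n) < psi_tot f \<delta> \<alpha> r + ereal \<epsilon>))"
proof (cases "psi_tot f \<delta> \<alpha> r")
  case (real \<Psi>)
  define err where "err = (\<lambda>n. ((ln 2 - 2 * ln (measure stdn {0<..}) - ln p01 + ln (f 1) + face_const)
        + (saddle_radius * f 1) * sqrt (real n) + ln (real n) / 2 + real r * ln (real n + 1)) / real n)"
  have "\<forall>\<^sub>F n in sequentially. err n < \<epsilon>"
    unfolding err_def using error_tendsto \<epsilon> by (rule order_tendstoD(2))
  moreover have "\<forall>\<^sub>F n in sequentially. 2 \<le> real n * ((1 - \<delta>) / real r)"
    using \<delta>1 r by (intro ev_le_real_mult) auto
  moreover have "\<forall>\<^sub>F n in sequentially. 2 * (real r * (f 1)\<^sup>2 + 1) \<le> real n * c1 f \<delta>"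
    by (intro ev_le_real_mult c1_pos)
  ultimately have "\<forall>\<^sub>F n in sequentially. err n < \<epsilon> \<and> 2 \<le> real n * ((1 - \<delta>) / real r)
      \<and> 2 * (real r * (f 1)\<^sup>2 + 1) \<le> real n * c1 f \<delta>"
    by (auto intro: eventually_conj)
  then obtain N where N: "\<And>n. n \<ge> N \<Longrightarrow> err n < \<epsilon> \<and> 2 \<le> real n * ((1 - \<delta>) / real r)
      \<and> 2 * (real r * (f 1)\<^sup>2 + 1) \<le> real n * c1 f \<delta>"
    unfolding eventually_sequentially by blast
  have main: "P = 0 \<or> ereal (ln P / real n) < psi_tot f \<delta> \<alpha> r + ereal \<epsilon>"
    if n: "n > N" and km: "real k = \<delta> * real n" "real m = \<alpha> * real n"
      and x: "\<forall>j<k. 0 < x j" "\<forall>j\<ge>k. x j = 0" and P: "P = measure (gauss_matrix m n) (fail_event f m n x)"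
    for n k m and x :: "nat \<Rightarrow> real" and P
  proof (cases "P = 0")
    case False
    have Nn: "err n < \<epsilon>" "2 \<le> real n * (1 - \<delta>) / real r" "2 * (real r * (f 1)\<^sup>2 + 1) \<le> real n * c1 f \<delta>"
      using N[of n] n by auto
    interpret sized_setup f \<delta> \<alpha> r n k m by unfold_locales (use n km Nn in auto)
    have "ln P / real n \<le> \<Psi> + err n"
      using ln_fail_prob_le[OF real Nn(3), of x] x False unfolding P err_def by simp
    then show ?thesis using Nn(1) by (simp add: real)
  qed simp
  show ?thesis unfolding Let_def
    by (intro exI[of _ N] allI impI) (rule main, (assumption | rule refl)+)
\<comment> \<open>The infinite values are left: for \<open>\<infinity>\<close> the strict inequality
  is immediate, and \<open>- \<infinity>\<close> is excluded.\<close>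
qed (use psi_tot_gt_MInf in auto)

end

theorem theorem3:
  fixes f :: "real \<Rightarrow> real" and \<delta> \<alpha> :: real and r :: nat
  assumes "continuous_on {0..1} f"
    and "mono_on {0..1} f"
    and "\<forall>u\<in>{0..1}. 0 \<le> f u"
    and "\<forall>u\<in>{0<..1}. 0 < f u"
    and "0 < \<delta>" and "\<delta> < \<alpha>" and "\<alpha> < 1"
    and "0 < r"
  shows "\<forall>\<epsilon>>0. \<exists>N::nat. \<forall>n k m. n > N \<longrightarrow> real k = \<delta> * real n \<longrightarrow> real m = \<alpha> * real n \<longrightarrow>
     (\<forall>x :: nat \<Rightarrow> real. (\<forall>j<k. 0 < x j) \<longrightarrow> (\<forall>j\<ge>k. x j = 0) \<longrightarrow>
        (let P = measure (gauss_matrix m n) (fail_event f m n x) in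
          P = 0 \<or> ereal (ln P / real n) < psi_tot f \<delta> \<alpha> r + ereal \<epsilon>))"
proof -
  interpret weight_setup f \<delta> \<alpha> r using assms by unfold_locales
  show ?thesis using fail_prob_asymptotics by blast
qed

end
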